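(* Let $\mathcal C=\mathcal A\circ\mathcal B$ be an admissible composition scheme of singular exponent $s$, such that $A(y)$ has a complete asymptotic expansion. Let $\mu,\sigma$ be the expectation and standard deviation of the size of an object of $\mathcal B$ under the Boltzmann distribution at $\rho$, the radius of convergence of $C(z)$, and let $p_\infty^1(t),p_\infty^2(t),\dots$ be the polynomials in the expansion of the distortion factor $d_{n,k}$ (see context). Let $a\in(0,1)$ and $r\in\mathbb N$, and let $y_n^{(r)}(t)=1+\sum_{i=1}^rp_\infty^i(t)\,n^{-i/2}$. For $0\le k\le n$, with $t:=\frac{k-n/\mu}{\sigma\sqrt{n/\mu^3}}$, define a rejection sequence by $$w_{n,k}:=\frac{a}{y_n^{(r)}(t)}\ \text{ if } y_n^{(r)}(t)\ge a,\qquad w_{n,k}:=1\ \text{ otherwise}.$$ Let $\pi_n$ be the uniform distribution on $\mathcal C_n$ and $\pi_n^{\mathrm{rej}}$ the distribution on $\mathcal C_n$ of the output of the rejection leap generator with this rejection sequence. Then, as $n\to\infty$, $$d_{\mathrm{TV}}(\pi_n,\pi_n^{\mathrm{rej}})=\Big(\frac c2+o(1)\Big)n^{-\frac{r+1}2}$$ (that is, $d_{\mathrm{TV}}(\pi_n,\pi_n^{\mathrm{rej}})\sim\frac{c}{2\,n^{(r+1)/2}}$ when $c\neq0$), where $$c=\frac1{\sqrt{2\pi}}\int_{\mathbb R}e^{-t^2/2}\,\bigl|p_\infty^{r+1}(t)-I\bigr|\,\mathrm dt,\qquad I:=\frac1{\sqrt{2\pi}}\int_{\mathbb R}e^{-t^2/2}\,p_\infty^{r+1}(t)\,\mathrm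 dt.$$ The probability of success of each trial of the rejection leap generator tends to $a$ as $n\to\infty$, so that (if the uniform generator for $\mathcal A_k$ has time complexity $O(k)$ and the Boltzmann sampler for $\mathcal B$ has time complexity linear in the size of the output) the expected complexity of the rejection leap generator is $O(n)$.
   Context: $\mathbb N=\{0,1,2,\dots\}$ and $\mathbb N^*=\mathbb N\setminus\{0\}$. For probability distributions $\pi,\pi'$ on a finite set $E$, $d_{\mathrm{TV}}(\pi,\pi')=\frac12\sum_{x\in E}|\pi(x)-\pi'(x)|$. A combinatorial class $\mathcal C$ is a set with a size function $\gamma\mapsto|\gamma|\in\mathbb N$ such that every $\mathcal C_n=\{\gamma\in\mathcal C:|\gamma|=n\}$ is finite; an object of size $n$ is made of $n$ atoms. Classes are either all unlabeled (set $\delta_n=1$) or all labeled (the atoms of an object of size $n$ carry distinct labels in $\{1,\dots,n\}$, and $\mathcal C_n$ is closed under relabeling; set $\delta_n=1/n!$). The generating function is $C(z)=\sum_n\delta_n|\mathcal C_n|z^n$, and similarly $A(y),B(z)$ for $\mathcal A,\mathcal B$. Composition: if $\mathcal B$ has no object of size $0$, $\mathcal C=\mathcal A\circ\mathcal B$ is the class of objects $\gamma$ obtained from some $\alpha\in\mathcal A$, of size $k$ say, by substituting its atoms by objects $\beta_1,\dots,\beta_k\in\mathcal B$; the size is $|\beta_1|+\cdots+|\beta_k|$ and $k$ is the core-size of $\gamma$. In the labeled case this is the usual labeled substitution (a partition of the label set into $k$ blocks, a $\mathcal B$-structure on each block and an $\mathcal A$-structure on the set of blocks). In the unlabeled case the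 atoms of each object of $\mathcal A$ are assumed to be unambiguously ranked, so $\gamma$ is a pair $(\alpha,(\beta_1,\dots,\beta_{|\alpha|}))$. In both cases $C(z)=A(B(z))$. Let $\rho_A,\rho_B,\rho_C>0$ be the radii of convergence of $A,B,C$ ($\rho_A,\rho_C$ finite), $\rho=\rho_C$. The scheme is supercritical if $\rho_B>\rho_C$ (in which case $B(\rho_C)=\rho_A$). The support of a series is the set of indices of its nonzero coefficients; a series is periodic if its support is contained in $c+d\,\mathbb N$ for some $d\ge2$, $c\ge0$, and aperiodic otherwise. The scheme is admissible if it is supercritical, $A(y),B(z),C(z)$ are aperiodic, and the support of $A(y)$ contains $\mathbb N^*$. For $s\in\mathbb R$ with $-s\notin\mathbb N$, a generating function $F(z)$ with radius of convergence $\rho_F\in(0,\infty)$ has singular exponent $s$ if $\rho_F$ is its unique dominant singularity and there are a nonzero constant $\kappa_F$ and a polynomial $P(z)$ such that $F(z)=P(z)+\kappa_F(1-z/\rho_F)^{-s}+O((1-z/\rho_F)^{-s+1})$ in a $\Delta$-neighborhood of $\rho_F$ (a domain $\{|z|<\rho_F(1+\eta),\ z\ne\rho_F,\ |\arg(z/\rho_F-1)|>\theta\}$ with $\eta>0$, $0<\theta<\pi/2$, as usual in singularity analysis). An admissible scheme has singular exponent $s$ if $A(y)$ has singular exponent $s$ (then so does $C(z)$). Such an $F$ has a complete asymptotic expansion if there exist coefficients $f_\infty^1,f_\infty^2,\dots$ such that for every $r\ge0$, $[z^n]F(z)=\frac{\kappa_F}{\Gamma(s)}\rho_F^{-n}n^{s-1}\big(1+\sum_{i=1}^rf_\infty^in^{-i}+O(n^{-r-1})\big)$.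 If $A(y)$ has a complete asymptotic expansion (coefficients $a_\infty^i$), then so does $C(z)$ (coefficients $c_\infty^i$). The Boltzmann distribution on $\mathcal B$ at $\rho$ gives $\beta$ probability $\delta_{|\beta|}\rho^{|\beta|}/B(\rho)$; thus $\mu=\mu(\rho)$ and $\sigma=\sqrt{\rho\mu'(\rho)}$ with $\mu(x)=xB'(x)/B(x)$. Leap generator for $\mathcal C$ at size $n$ (for $n\ge1$ such that $\mathcal C_n\neq\emptyset$): at each attempt, generate independent objects $\beta_1,\beta_2,\dots\in\mathcal B$, each under the Boltzmann distribution at $\rho$ (by a Boltzmann sampler), and stop at the largest $k$ such that $S:=|\beta_1|+\cdots+|\beta_k|\le n$. If $S<n$, the attempt fails and one restarts with a new independent attempt. If $S=n$, draw $\alpha$ uniformly at random in $\mathcal A_k$, substitute the $i$th atom of $\alpha$ by $\beta_i$ for each $i$ (in the labeled setting, moreover assign to the atoms uniformly randomly permuted labels in $\{1,\dots,n\}$), and return the resulting object of $\mathcal C_n$. Assembly and relabeling have cost linear in $n$. Rejection leap generator associated with $(w_{n,k})$, $w_{n,k}\in[0,1]$: repeat independent trials, where a trial draws $\gamma\in\mathcal C_n$ by a (complete) call to the leap generator, lets $k$ be its core-size, and succeeds with probability $w_{n,k}$; return the first $\gamma$ whose trial succeeds. Distortion factor: with $a_k=[y^k]A(y)$, $c_n=[z^n]C(z)$, $q_n=[z^n]\frac1{1-B(\rho z)/B(\rho)}$, let $d_{n,k}=\frac1{q_n}\frac{c_n\rho^n}{a_kB(\rho)^k}$. The polynomials $p_\infty^i(t)$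 ($i\ge1$) are the ones (of degree at most $i$, with the parity of $i$) such that for any $\epsilon_n=o(\sqrt n)$ and any fixed $r\ge0$, $d_{n,k}=1+\sum_{i=1}^rp_\infty^i(t)n^{-i/2}+O\big(((1+t^2)/n)^{(r+1)/2}\big)$ for $k=\frac n\mu\big(1+t\frac\sigma{\sqrt{\mu n}}\big)$ with $|t|\le\epsilon_n$. Explicitly, they are obtained by expanding in powers of $n^{-1/2}$ (with $t$ fixed) the expression $(1+x)^{1-s}\big(1+\sum_{i\ge1}c_\infty^in^{-i}\big)\big(1+\sum_{i\ge1}a_\infty^i\mu^in^{-i}(1+x)^{-i}\big)^{-1}$ with $x=t\sigma/\sqrt{\mu n}$; e.g. $p_\infty^1(t)=-\frac{\sigma}{\sqrt\mu}(s-1)t$ and $p_\infty^2(t)=\frac{(s-1)s\sigma^2}{2\mu}t^2+c_\infty^1-a_\infty^1\mu$. *)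

theory Defs
  imports
    "HOL-Probability.Probability"
    "HOL-Probability.SPMF"
    "HOL-Combinatorics.Permutations"
    "HOL-Library.Landau_Symbols"
begin

section \<open>Combinatorial classes\<close>

datatype setting = Unlabeled | Labeled

text \<open>
  In the labeled setting, \<open>relabel C \<sigma> \<gamma>\<close> is the object obtained from \<open>\<gamma>\<close> by replacing every
  label \<open>i\<close> by \<open>\<sigma> i\<close>.  The field is not used in the unlabeled setting.
\<close>

record 'c comb_class =
  objs :: "'c set"
  osize :: "'c \<Rightarrow> nat"
  relabel :: "(nat \<Rightarrow> nat) \<Rightarrow> 'c \<Rightarrow> 'c"

definition objs_of_size :: "'c comb_class \<Rightarrow> nat \<Rightarrow> 'c set" where
  "objs_of_size C n = {\<gamma> \<in> objs C. osize C \<gamma> = n}"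

definition is_comb_class :: "setting \<Rightarrow> 'c comb_class \<Rightarrow> bool" where
  "is_comb_class S C \<longleftrightarrow>
     (\<forall>n. finite (objs_of_size C n)) \<and>
     (S = Labeled \<longrightarrow> (\<forall>n. \<forall>\<gamma>\<in>objs_of_size C n.
        relabel C id \<gamma> = \<gamma> \<and>
        (\<forall>\<sigma>. \<sigma> permutes {1..n} \<longrightarrow> relabel C \<sigma> \<gamma> \<in> objs_of_size C n) \<and>
        (\<forall>\<sigma> \<tau>. \<sigma> permutes {1..n} \<longrightarrow> \<tau> permutes {1..n} \<longrightarrow>
           relabel C (\<sigma> \<circ> \<tau>) \<gamma> = relabel C \<sigma> (relabel C \<tau> \<gamma>))))"

definition delta :: "setting \<Rightarrow> nat \<Rightarrow> real" where
  "delta S n = (case S of Unlabeled \<Rightarrow> 1 | Labeled \<Rightarrow> 1 / fact n)"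

definition gen_fun :: "setting \<Rightarrow> 'c comb_class \<Rightarrow> real fps" where
  "gen_fun S C = Abs_fps (\<lambda>n. delta S n * real (card (objs_of_size C n)))"


section \<open>Composition\<close>

text \<open>
  An object of the composition is a triple \<open>(\<alpha>, \<beta>s, Us)\<close>: the core \<open>\<alpha>\<close>, the list \<open>\<beta>s\<close> of the
  objects substituted for its atoms, and, in the labeled setting, the list \<open>Us\<close> of their label
  sets (\<open>Us = []\<close> in the unlabeled setting).

  Labeled setting: the blocks in \<open>Us\<close> are listed by increasing minimum, and the atom of \<open>\<alpha>\<close>
  with label \<open>i\<close> stands for the \<open>i\<close>th block.  The structure on a block \<open>U\<close> is recorded as an
  object with labels \<open>{1..card U}\<close>, which are to be read through the increasing bijection
  \<open>{1..card U} \<rightarrow> U\<close>.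
\<close>

type_synonym ('a, 'b) composite = "'a \<times> 'b list \<times> nat set list"

definition core_size :: "('a, 'b) composite \<Rightarrow> nat" where
  "core_size = (\<lambda>(\<alpha>, \<beta>s, Us). length \<beta>s)"

definition total_size :: "'b comb_class \<Rightarrow> 'b list \<Rightarrow> nat" where
  "total_size B \<beta>s = (\<Sum>\<beta>\<leftarrow>\<beta>s. osize B \<beta>)"

definition unlabeled_composites :: "'a comb_class \<Rightarrow> 'b comb_class \<Rightarrow> ('a, 'b) composite set" where
  "unlabeled_composites A B =
     {(\<alpha>, \<beta>s, []) | \<alpha> \<beta>s. \<alpha> \<in> objs A \<and> set \<beta>s \<subseteq> objs B \<and> length \<beta>s = osize A \<alpha>}"

definition labeled_composites :: "'a comb_class \<Rightarrow> 'b comb_class \<Rightarrow> ('a, 'b) composite set" where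
  "labeled_composites A B =
     {(\<alpha>, \<beta>s, Us) | \<alpha> \<beta>s Us.
        \<alpha> \<in> objs A \<and> set \<beta>s \<subseteq> objs B \<and> length \<beta>s = osize A \<alpha> \<and> length Us = osize A \<alpha> \<and>
        (\<forall>i<length Us. finite (Us ! i) \<and> card (Us ! i) = osize B (\<beta>s ! i)) \<and>
        (\<forall>j<length Us. \<forall>i<j. Us ! i \<inter> Us ! j = {} \<and> Min (Us ! i) < Min (Us ! j)) \<and>
        \<Union> (set Us) = {1..total_size B \<beta>s}}"

text \<open>
  Relabeling a composite by \<open>\<sigma>\<close> turns a block \<open>U\<close> into \<open>\<sigma> ` U\<close>.  The relative order of the labels
  within a block and the order of the blocks by minimum may both change; the first change is
  compensated by \<open>block_perm\<close>, which relabels the object on the block, and the second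
  one by \<open>core_perm\<close>, which relabels the core.
\<close>

definition rank_in :: "nat set \<Rightarrow> nat \<Rightarrow> nat" where
  "rank_in U x = card {y \<in> U. y \<le> x}"

definition block_perm :: "(nat \<Rightarrow> nat) \<Rightarrow> nat set \<Rightarrow> nat \<Rightarrow> nat" where
  "block_perm \<sigma> U i =
     (if i \<in> {1..card U} then rank_in (\<sigma> ` U) (\<sigma> (sorted_list_of_set U ! (i - 1))) else i)"

definition core_perm :: "nat set list \<Rightarrow> nat \<Rightarrow> nat" where
  "core_perm Us i =
     (if i \<in> {1..length Us} then rank_in (Min ` set Us) (Min (Us ! (i - 1))) else i)"

definition composite_relabel ::
  "'a comb_class \<Rightarrow> 'b comb_class \<Rightarrow> (nat \<Rightarrow> nat) \<Rightarrow> ('a, 'b) composite \<Rightarrow> ('a, 'b) composite" where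
  "composite_relabel A B \<sigma> = (\<lambda>(\<alpha>, \<beta>s, Us).
     let Vs = map ((`) \<sigma>) Us;
         ps = sort_key (\<lambda>(\<beta>, V). Min V) (zip (map2 (\<lambda>U. relabel B (block_perm \<sigma> U)) Us \<beta>s) Vs)
     in (relabel A (core_perm Vs) \<alpha>, map fst ps, map snd ps))"

definition composition ::
  "setting \<Rightarrow> 'a comb_class \<Rightarrow> 'b comb_class \<Rightarrow> ('a, 'b) composite comb_class" where
  "composition S A B =
     \<lparr>objs = (case S of Unlabeled \<Rightarrow> unlabeled_composites A B | Labeled \<Rightarrow> labeled_composites A B),
      osize = (\<lambda>(\<alpha>, \<beta>s, Us). total_size B \<beta>s),
      relabel = composite_relabel A B\<rparr>"


section \<open>Admissible schemes, singular exponents, asymptotic expansions\<close>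

definition periodic :: "real fps \<Rightarrow> bool" where
  "periodic F \<longleftrightarrow> (\<exists>c d::nat. d \<ge> 2 \<and> {n. fps_nth F n \<noteq> 0} \<subseteq> {c + d * j | j. True})"

definition composition_scheme :: "setting \<Rightarrow> 'a comb_class \<Rightarrow> 'b comb_class \<Rightarrow> bool" where
  "composition_scheme S A B \<longleftrightarrow>
     is_comb_class S A \<and> is_comb_class S B \<and> objs_of_size B 0 = {} \<and>
     0 < fps_conv_radius (gen_fun S A) \<and> fps_conv_radius (gen_fun S A) < \<infinity> \<and>
     0 < fps_conv_radius (gen_fun S B) \<and>
     0 < fps_conv_radius (gen_fun S (composition S A B)) \<and>
     fps_conv_radius (gen_fun S (composition S A B)) < \<infinity>"

definition admissible :: "setting \<Rightarrow> 'a comb_class \<Rightarrow> 'b comb_class \<Rightarrow> bool" where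
  "admissible S A B \<longleftrightarrow>
     composition_scheme S A B \<and>
     fps_conv_radius (gen_fun S B) > fps_conv_radius (gen_fun S (composition S A B)) \<and>
     \<not> periodic (gen_fun S A) \<and> \<not> periodic (gen_fun S B) \<and>
     \<not> periodic (gen_fun S (composition S A B)) \<and>
     (\<forall>k\<ge>1. fps_nth (gen_fun S A) k \<noteq> 0)"

definition delta_domain :: "real \<Rightarrow> real \<Rightarrow> real \<Rightarrow> complex set" where
  "delta_domain \<rho> \<eta> \<theta> =
     {z. cmod z < \<rho> * (1 + \<eta>) \<and> z \<noteq> of_real \<rho> \<and> \<bar>Arg (z / of_real \<rho> - 1)\<bar> > \<theta>}"

text \<open>
  The continuation \<open>f\<close> of \<open>F\<close> is holomorphic on the domain, which contains all points of the circle
  of convergence but \<open>\<rho>\<close>; hence \<open>\<rho>\<close> is the unique dominant singularity of \<open>F\<close>.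
\<close>

definition singular_expansion :: "real fps \<Rightarrow> real \<Rightarrow> real \<Rightarrow> bool" where
  "singular_expansion F s \<kappa> \<longleftrightarrow>
     - s \<notin> \<nat> \<and> \<kappa> \<noteq> 0 \<and> 0 < fps_conv_radius F \<and> fps_conv_radius F < \<infinity> \<and>
     (let \<rho> = real_of_ereal (fps_conv_radius F) in
      \<exists>\<eta> \<theta> f P. \<eta> > 0 \<and> 0 < \<theta> \<and> \<theta> < pi / 2 \<and>
        f holomorphic_on delta_domain \<rho> \<eta> \<theta> \<and>
        (\<forall>z. cmod z < \<rho> \<longrightarrow> (\<lambda>n. of_real (fps_nth F n) * z ^ n) sums f z) \<and>
        (\<lambda>z. f z - poly P z - of_real \<kappa> * (1 - z / of_real \<rho>) powr of_real (- s))
          \<in> O[at (of_real \<rho>) within delta_domain \<rho> \<eta> \<theta>](\<lambda>z. (1 - z / of_real \<rho>) powr of_real (- s + 1)))"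

definition has_singular_exponent :: "real fps \<Rightarrow> real \<Rightarrow> bool" where
  "has_singular_exponent F s \<longleftrightarrow> (\<exists>\<kappa>. singular_expansion F s \<kappa>)"

definition has_complete_expansion :: "real fps \<Rightarrow> real \<Rightarrow> bool" where
  "has_complete_expansion F s \<longleftrightarrow>
     (\<exists>\<kappa> (f :: nat \<Rightarrow> real). singular_expansion F s \<kappa> \<and>
        (\<forall>r. (\<lambda>n. fps_nth F n / (\<kappa> / Gamma s * real_of_ereal (fps_conv_radius F) powr (- real n)
                                   * real n powr (s - 1))
                  - (1 + (\<Sum>i=1..r. f i * real n powr (- real i))))
              \<in> O(\<lambda>n. real n powr (- real r - 1))))"


section \<open>Boltzmann distribution and distortion factor\<close>

definition boltzmann :: "setting \<Rightarrow> 'b comb_class \<Rightarrow> real \<Rightarrow> 'b pmf" where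
  "boltzmann S B x = embed_pmf (\<lambda>\<beta>. if \<beta> \<in> objs B
     then delta S (osize B \<beta>) * x ^ osize B \<beta> / eval_fps (gen_fun S B) x else 0)"

definition rho :: "setting \<Rightarrow> 'a comb_class \<Rightarrow> 'b comb_class \<Rightarrow> real" where
  "rho S A B = real_of_ereal (fps_conv_radius (gen_fun S (composition S A B)))"

definition mu :: "setting \<Rightarrow> 'a comb_class \<Rightarrow> 'b comb_class \<Rightarrow> real" where
  "mu S A B = measure_pmf.expectation (boltzmann S B (rho S A B)) (\<lambda>\<beta>. real (osize B \<beta>))"

definition sigma :: "setting \<Rightarrow> 'a comb_class \<Rightarrow> 'b comb_class \<Rightarrow> real" where
  "sigma S A B =
     sqrt (measure_pmf.variance (boltzmann S B (rho S A B)) (\<lambda>\<beta>. real (osize B \<beta>)))"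

definition renewal_coeff :: "setting \<Rightarrow> 'a comb_class \<Rightarrow> 'b comb_class \<Rightarrow> nat \<Rightarrow> real" where
  "renewal_coeff S A B n =
     (let \<rho> = rho S A B; b = gen_fun S B
      in fps_nth (inverse (1 - fps_const (1 / eval_fps b \<rho>) * (b oo (fps_const \<rho> * fps_X)))) n)"

definition distortion :: "setting \<Rightarrow> 'a comb_class \<Rightarrow> 'b comb_class \<Rightarrow> nat \<Rightarrow> nat \<Rightarrow> real" where
  "distortion S A B n k =
     1 / renewal_coeff S A B n *
     (fps_nth (gen_fun S (composition S A B)) n * rho S A B ^ n
        / (fps_nth (gen_fun S A) k * eval_fps (gen_fun S B) (rho S A B) ^ k))"

definition scaled :: "setting \<Rightarrow> 'a comb_class \<Rightarrow> 'b comb_class \<Rightarrow> nat \<Rightarrow> nat \<Rightarrow> real" where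
  "scaled S A B n k =
     (real k - real n / mu S A B) / (sigma S A B * sqrt (real n / mu S A B ^ 3))"

definition distortion_expansion ::
  "setting \<Rightarrow> 'a comb_class \<Rightarrow> 'b comb_class \<Rightarrow> (nat \<Rightarrow> real poly) \<Rightarrow> bool" where
  "distortion_expansion S A B p \<longleftrightarrow>
     (\<forall>i\<ge>1. degree (p i) \<le> i \<and> (\<forall>x. poly (p i) (- x) = (- 1) ^ i * poly (p i) x)) \<and>
     (\<forall>\<epsilon> r. \<epsilon> \<in> o(\<lambda>n. sqrt (real n)) \<longrightarrow>
        (\<exists>K. \<forall>\<^sub>F n in sequentially. \<forall>k. let t = scaled S A B n k in \<bar>t\<bar> \<le> \<epsilon> n \<longrightarrow>
           \<bar>distortion S A B n k - (1 + (\<Sum>i=1..r. poly (p i) t * real n powr (- real i / 2)))\<bar>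
             \<le> K * ((1 + t\<^sup>2) / real n) powr ((real r + 1) / 2)))"

text \<open>The expansion determines the polynomials of index at least 1; the one of index 0 is not used.\<close>

definition distortion_poly :: "setting \<Rightarrow> 'a comb_class \<Rightarrow> 'b comb_class \<Rightarrow> nat \<Rightarrow> real poly" where
  "distortion_poly S A B = (SOME p. distortion_expansion S A B p)"


section \<open>Leap generators\<close>

text \<open>
  A randomized algorithm is a subprobability distribution on pairs of an output and
  a running time; the missing mass is the probability of non-termination.
  Running times of the given samplers are random: \<open>tA \<alpha>\<close> and \<open>tB \<beta>\<close> are the distributions of the
  running time of the sampler given that its output is \<open>\<alpha>\<close>, resp. \<open>\<beta>\<close>, and \<open>tasm n\<close> is the
  time for assembling and relabeling an object of size \<open>n\<close>.
\<close>

partial_function (spmf) retry :: "('x option \<times> nat) spmf \<Rightarrow> nat \<Rightarrow> ('x \<times> nat) spmf" where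
  "retry trial t = bind_spmf trial (\<lambda>(x, u).
     case x of None \<Rightarrow> retry trial (t + u) | Some y \<Rightarrow> return_spmf (y, t + u))"

text \<open>
  \<open>fill\<close> returns the longest prefix of total size at most \<open>n\<close> of the sequence of samples; the time
  includes the first sample that does not fit.
\<close>

partial_function (spmf) fill ::
  "('b \<times> nat) pmf \<Rightarrow> 'b comb_class \<Rightarrow> nat \<Rightarrow> 'b list \<Rightarrow> nat \<Rightarrow> ('b list \<times> nat) spmf" where
  "fill smp B n \<beta>s t = bind_spmf (spmf_of_pmf smp) (\<lambda>(\<beta>, u).
     if total_size B (\<beta>s @ [\<beta>]) \<le> n then fill smp B n (\<beta>s @ [\<beta>]) (t + u)
     else return_spmf (\<beta>s, t + u))"

definition timed :: "'x pmf \<Rightarrow> ('x \<Rightarrow> nat pmf) \<Rightarrow> ('x \<times> nat) pmf" where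
  "timed p T = bind_pmf p (\<lambda>x. map_pmf (\<lambda>u. (x, u)) (T x))"

fun interval_blocks :: "nat \<Rightarrow> nat list \<Rightarrow> nat set list" where
  "interval_blocks m [] = []"
| "interval_blocks m (l # ls) = {m + 1..m + l} # interval_blocks (m + l) ls"

definition assemble ::
  "setting \<Rightarrow> 'a comb_class \<Rightarrow> 'b comb_class \<Rightarrow> 'a \<Rightarrow> 'b list \<Rightarrow> ('a, 'b) composite pmf" where
  "assemble S A B \<alpha> \<beta>s =
     (case S of
        Unlabeled \<Rightarrow> return_pmf (\<alpha>, \<beta>s, [])
      | Labeled \<Rightarrow> map_pmf
          (\<lambda>\<sigma>. composite_relabel A B \<sigma> (\<alpha>, \<beta>s, interval_blocks 0 (map (osize B) \<beta>s)))
          (pmf_of_set {\<sigma>. \<sigma> permutes {1..total_size B \<beta>s}}))"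

definition leap_attempt ::
  "setting \<Rightarrow> 'a comb_class \<Rightarrow> 'b comb_class \<Rightarrow> ('a \<Rightarrow> nat pmf) \<Rightarrow> ('b \<Rightarrow> nat pmf) \<Rightarrow> (nat \<Rightarrow> nat)
    \<Rightarrow> nat \<Rightarrow> (('a, 'b) composite option \<times> nat) spmf" where
  "leap_attempt S A B tA tB tasm n =
     bind_spmf (fill (timed (boltzmann S B (rho S A B)) tB) B n [] 0) (\<lambda>(\<beta>s, u).
       if total_size B \<beta>s < n then return_spmf (None, u)
       else spmf_of_pmf (
         bind_pmf (timed (pmf_of_set (objs_of_size A (length \<beta>s))) tA) (\<lambda>(\<alpha>, v).
           map_pmf (\<lambda>\<gamma>. (Some \<gamma>, u + v + tasm n)) (assemble S A B \<alpha> \<beta>s))))"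

definition leap_generator ::
  "setting \<Rightarrow> 'a comb_class \<Rightarrow> 'b comb_class \<Rightarrow> ('a \<Rightarrow> nat pmf) \<Rightarrow> ('b \<Rightarrow> nat pmf) \<Rightarrow> (nat \<Rightarrow> nat)
    \<Rightarrow> nat \<Rightarrow> (('a, 'b) composite \<times> nat) spmf" where
  "leap_generator S A B tA tB tasm n = retry (leap_attempt S A B tA tB tasm n) 0"

definition rejection_trial ::
  "(nat \<Rightarrow> nat \<Rightarrow> real) \<Rightarrow> setting \<Rightarrow> 'a comb_class \<Rightarrow> 'b comb_class
    \<Rightarrow> ('a \<Rightarrow> nat pmf) \<Rightarrow> ('b \<Rightarrow> nat pmf) \<Rightarrow> (nat \<Rightarrow> nat)
    \<Rightarrow> nat \<Rightarrow> (('a, 'b) composite option \<times> nat) spmf" where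
  "rejection_trial w S A B tA tB tasm n =
     bind_spmf (leap_generator S A B tA tB tasm n) (\<lambda>(\<gamma>, u).
       map_spmf (\<lambda>success. (if success then Some \<gamma> else None, u))
         (spmf_of_pmf (bernoulli_pmf (w n (core_size \<gamma>)))))"

definition rejection_generator ::
  "(nat \<Rightarrow> nat \<Rightarrow> real) \<Rightarrow> setting \<Rightarrow> 'a comb_class \<Rightarrow> 'b comb_class
    \<Rightarrow> ('a \<Rightarrow> nat pmf) \<Rightarrow> ('b \<Rightarrow> nat pmf) \<Rightarrow> (nat \<Rightarrow> nat)
    \<Rightarrow> nat \<Rightarrow> (('a, 'b) composite \<times> nat) spmf" where
  "rejection_generator w S A B tA tB tasm n = retry (rejection_trial w S A B tA tB tasm n) 0"

definition success_prob :: "('x option \<times> nat) spmf \<Rightarrow> real" where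
  "success_prob trial = measure (measure_spmf trial) {(x, u). x \<noteq> None}"

definition expected_time :: "('x \<times> nat) spmf \<Rightarrow> ennreal" where
  "expected_time p =
     (\<integral>\<^sup>+ z. (case z of None \<Rightarrow> \<infinity> | Some (x, u) \<Rightarrow> of_nat u) \<partial>measure_pmf p)"

definition tv_dist :: "'x set \<Rightarrow> ('x \<Rightarrow> real) \<Rightarrow> ('x \<Rightarrow> real) \<Rightarrow> real" where
  "tv_dist E p q = (1 / 2) * (\<Sum>x\<in>E. \<bar>p x - q x\<bar>)"

end

theory Submission
  imports
    Defs
    "HOL-Complex_Analysis.Cauchy_Integral_Formula"
    "HOL-Combinatorics.Multiset_Permutations"
    "HOL-Real_Asymp.Real_Asymp"
begin

text \<open>
  The sizes of the components drawn by the leap generator are independent, so a run hits size \<open>n\<close> with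
  exactly \<open>k\<close> components with probability \<open>hit k n\<close>, the \<open>n\<close>th coefficient of the \<open>k\<close>th power of their
  probability generating function, and \<open>q n\<close> is the probability of success of an attempt.  Counting
  assemblies shows that the probability that an attempt outputs \<open>\<gamma>\<close> depends only on the core-size of \<open>\<gamma>\<close>.
  Hence the total variation distance is half the expectation of \<open>\<bar>1 / D - w / Z\<bar>\<close>, where \<open>D\<close> is the distortion
  factor, \<open>Z\<close> is the probability of success of a rejection trial, and \<open>k\<close> is distributed as the number of
  components given a hit at \<open>n\<close>.

  Under this conditional law the scaled core-size converges to a standard Gaussian variable, with
  exponential tilting controlling all moments; \<open>1 / D - w / Z\<close> is to first order
  \<open>n powr (- (r + 1) / 2)\<close> times \<open>I - p (r + 1)\<close>, because \<open>1 / D\<close> and \<open>w / Z\<close> both have expectation 1.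
  The distortion factor is expanded by means of the conditional moments of the core-size, which are polynomials
  in \<open>n\<close> up to exponentially small errors since \<open>1 / (1 - B(\<rho> z) / B(\<rho>))\<close> has no other pole than 1 in
  some disk of radius larger than 1.
\<close>

section \<open>Renewal sequences\<close>

text \<open>The expansion of the coefficients of \<open>C\<close> is drawn from that of
  \<open>A\<close>: by \<open>card_Cn\<close>, \<open>c_n \<rho>^n / q_n\<close> is the conditional
  mean of \<open>a_k B(\<rho>)^k\<close>, so the numerator of the distortion factor is the mean of
  its denominator. Uniform expansions live on the scale \<open>n^(-1/2)\<close>, yet this mean must
  expand in integer powers of \<open>1/n\<close>; the parity of the polynomials in the scaled
  core-size secures it. The Gaussian limit comes from weighting runs of k components by
  \<open>x^n / c^k\<close>. With c the tilted mass at x, the tilted sizes still sum to 1, so the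
  pole stays at 1 and the rest of the generating function moves little in an l1 norm. As the final
  constant is the expectation of a continuous function of polynomial growth, convergence in law and
  moment bounds together yield it. Expansions hold uniformly only for k in a window around
  \<open>n/\<mu>\<close> of width proportional to n. Elsewhere merely polynomial bounds are
  available; there n is at most a power of the scaled core-size, whose moments are bounded, so those
  k contribute less than any power of \<open>1/n\<close>.\<close>

lemma power_le_fact_exp:
  fixes x :: real
  assumes "x \<ge> 0"
  shows "x ^ j \<le> fact j * exp x"
proof -
  have s: "(\<lambda>n. x ^ n / fact n) sums exp x"
    using exp_converges[of x] by (simp add: field_simps scaleR_conv_of_real)
  have "(\<Sum>n\<in>{j}. x ^ n / fact n) \<le> (\<Sum>n. x ^ n / fact n)"
    using s assms by (intro sum_le_suminf) (auto simp: sums_iff)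
  also have "\<dots> = exp x" using s by (simp add: sums_iff)
  finally show ?thesis by (simp add: field_simps)
qed

text \<open>On the tail from index \<open>m\<close> the weight \<open>r ^ j\<close> is at least
  \<open>r ^ m\<close>, which gains the factor \<open>1 / r ^ m\<close>. It serves for the tails of
  \<open>b\<close>, for the perturbation caused by a tilt and for the remainder of the binomial
  series.\<close>

lemma tail_norm_le:
  fixes f :: "nat \<Rightarrow> 'a::banach" and g :: "nat \<Rightarrow> real"
  assumes fg: "\<And>j. norm (f j) \<le> g j" and r: "r \<ge> 1" and sg: "summable (\<lambda>j. g j * r ^ j)"
  shows "summable f" and "norm (\<Sum>j. f (j + m)) \<le> (\<Sum>j. g j * r ^ j) / r ^ m"
proof -
  have g0: "g j \<ge> 0" for j using fg[of j] norm_ge_zero[of "f j"] by linarith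
  have gr: "g j \<le> g j * r ^ j" for j
    using mult_left_mono[OF one_le_power[OF r, of j] g0[of j]] by simp
  have "norm (f j) \<le> g j * r ^ j" for j using fg[of j] gr[of j] by linarith
  then have sn: "summable (\<lambda>j. norm (f j))"
    by (intro summable_comparison_test[OF _ sg]) auto
  then show "summable f" by (rule summable_norm_cancel)
  have sm: "summable (\<lambda>j. g (j + m) * r ^ (j + m))"
    using summable_ignore_initial_segment[OF sg] .
  have snm: "summable (\<lambda>j. norm (f (j + m)))"
    using summable_ignore_initial_segment[OF sn] .
  have "norm (\<Sum>j. f (j + m)) * r ^ m \<le> (\<Sum>j. norm (f (j + m))) * r ^ m"
    using r by (intro mult_right_mono summable_norm snm) auto
  also have "\<dots> = (\<Sum>j. norm (f (j + m)) * r ^ m)"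
    by (rule suminf_mult2[OF snm])
  also have "\<dots> \<le> (\<Sum>j. g (j + m) * r ^ (j + m))"
  proof (intro suminf_le summable_mult2 snm sm)
    fix j
    have "r ^ m \<le> r ^ (j + m)" using r by (intro power_increasing) auto
    then show "norm (f (j + m)) * r ^ m \<le> g (j + m) * r ^ (j + m)"
      using fg g0 r by (intro mult_mono) auto
  qed
  also have "\<dots> \<le> (\<Sum>j. g j * r ^ j)"
    using suminf_split_initial_segment[OF sg, of m] g0 r
    by (simp add: sum_nonneg)
  finally show "norm (\<Sum>j. f (j + m)) \<le> (\<Sum>j. g j * r ^ j) / r ^ m"
    using r by (simp add: field_simps)
qed

lemma fps_compose_nth_atMost: "fps_nth (a oo F) n = (\<Sum>k\<le>n. fps_nth a k * fps_nth (F ^ k) n)"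
  by (simp add: fps_compose_nth atLeast0AtMost)

text \<open>Substitution of \<open>F\<close> into the negative binomial series. The case
  \<open>j = 0\<close> is the renewal sequence; larger \<open>j\<close> turns binomial moments of
  the number of components into coefficients of powers of the renewal series.\<close>

lemma fps_inverse_one_minus_nth:
  fixes F :: "'a::{field_char_0} fps"
  assumes "fps_nth F 0 = 0"
  shows "fps_nth (inverse (1 - F) ^ Suc j) n = (\<Sum>k\<le>n. of_nat ((k + j) choose j) * fps_nth (F ^ k) n)"
proof -
  have "inverse ((1 - fps_const (1::'a) * fps_X) ^ Suc j) = Abs_fps (\<lambda>k. of_nat ((Suc j + k - 1) choose k) * 1 ^ k)"
    by (rule one_minus_const_fps_X_neg_power') simp
  moreover have "(j + k) choose k = (k + j) choose j" for k
    using binomial_symmetric[of k "j + k"] by (simp add: add.commute)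
  ultimately have 1: "inverse (1 - fps_X :: 'a fps) ^ Suc j = Abs_fps (\<lambda>k. of_nat ((k + j) choose j))"
    by (simp add: fps_inverse_power del: power_Suc)
  have "inverse (1 - F) ^ Suc j = (inverse (1 - fps_X) ^ Suc j) oo F"
    using assms by (simp add: fps_compose_power[symmetric] fps_inverse_compose fps_compose_sub_distrib del: power_Suc)
  also have "fps_nth \<dots> n = (\<Sum>k\<le>n. of_nat ((k + j) choose j) * fps_nth (F ^ k) n)"
    unfolding 1 fps_compose_nth_atMost by simp
  finally show ?thesis .
qed

lemma fps_renewal_nth:
  fixes F :: "'a::{field_char_0} fps"
  assumes "fps_nth F 0 = 0"
  shows "fps_nth (inverse (1 - F)) n = (\<Sum>k\<le>n. fps_nth (F ^ k) n)"
  using fps_inverse_one_minus_nth[OF assms, of 0 n] by simp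

text \<open>By \<open>U = 1 + F * U\<close> and the vanishing constant term of \<open>F\<close>,
  each later coefficient of \<open>U\<close> combines earlier ones with nonnegative weights of sum
  at most 1; strong induction keeps all of them between 0 and 1.\<close>

lemma renewal_le_1:
  fixes F :: "real fps"
  assumes "fps_nth F 0 = 0" "\<And>m. fps_nth F m \<ge> 0" "\<And>n. (\<Sum>m\<le>n. fps_nth F m) \<le> 1"
  shows "(\<Sum>k\<le>n. fps_nth (F ^ k) n) \<le> 1"
proof -
  define U where "U = inverse (1 - F)"
  have nz: "fps_nth (1 - F) 0 \<noteq> 0" using assms(1) by simp
  have "U * (1 - F) = 1" unfolding U_def by (rule inverse_mult_eq_1[OF nz])
  then have U: "U = 1 + F * U" by (simp add: algebra_simps)
  have "0 \<le> fps_nth U n \<and> fps_nth U n \<le> 1" for n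
  proof (induction n rule: less_induct)
    case (less n)
    show ?case
    proof (cases "n = 0")
      case True
      then show ?thesis using assms(1) by (subst (1 2) U) simp
    next
      case False
      have eq: "fps_nth U n = (\<Sum>i\<le>n. fps_nth F i * fps_nth U (n - i))"
        using False by (subst U) (simp add: fps_mult_nth atLeast0AtMost)
      have t: "0 \<le> fps_nth F i * fps_nth U (n - i) \<and> fps_nth F i * fps_nth U (n - i) \<le> fps_nth F i" if "i \<le> n" for i
      proof (cases "i = 0")
        case True
        then show ?thesis using assms(1) by simp
      next
        case False
        then have "0 \<le> fps_nth U (n - i) \<and> fps_nth U (n - i) \<le> 1" using less \<open>n \<noteq> 0\<close> by simp
        then show ?thesis using assms(2)[of i] by (simp add: mult_left_le)
      qed
      have "(\<Sum>i\<le>n. fps_nth F i * fps_nth U (n - i)) \<le> (\<Sum>i\<le>n. fps_nth F i)"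
        using t by (intro sum_mono) auto
      moreover have "0 \<le> (\<Sum>i\<le>n. fps_nth F i * fps_nth U (n - i))"
        using t by (intro sum_nonneg) auto
      ultimately show ?thesis using assms(3)[of n] eq by linarith
    qed
  qed
  then show ?thesis using fps_renewal_nth[OF assms(1), of n] unfolding U_def by metis
qed

section \<open>Perturbation of inverse power series in a truncated l1 norm\<close>

definition l1 :: "nat \<Rightarrow> 'a::real_normed_vector fps \<Rightarrow> real" where
  "l1 n f = (\<Sum>j\<le>n. norm (fps_nth f j))"

lemma l1_nonneg: "l1 n f \<ge> 0" by (simp add: l1_def sum_nonneg)

lemma l1_add: "l1 n (f + g) \<le> l1 n f + l1 n g"
  by (simp add: l1_def sum.distrib[symmetric] sum_mono norm_triangle_ineq)

lemma l1_mult: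
  fixes f g :: "'a::real_normed_algebra_1 fps"
  shows "l1 n (f * g) \<le> l1 n f * l1 n g"
proof -
  have "l1 n (f * g) \<le> (\<Sum>k\<le>n. \<Sum>i\<le>k. norm (fps_nth f i) * norm (fps_nth g (k - i)))"
    unfolding l1_def fps_mult_nth atLeast0AtMost
    by (intro sum_mono sum_norm_le norm_mult_ineq)
  also have "\<dots> = (\<Sum>(i,j)\<in>{(i,j). i + j \<le> n}. norm (fps_nth f i) * norm (fps_nth g j))"
    by (rule sum.triangle_reindex_eq[symmetric])
  also have "\<dots> \<le> (\<Sum>(i,j)\<in>{..n}\<times>{..n}. norm (fps_nth f i) * norm (fps_nth g j))"
    by (intro sum_mono2) auto
  also have "\<dots> = l1 n f * l1 n g"
    by (simp add: l1_def sum_product sum.cartesian_product)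
  finally show ?thesis .
qed

text \<open>Resolvent identity \<open>W' - W = W' * W * (H - H')\<close>. The norm of
  \<open>W'\<close> is first bounded by \<open>2 * w\<close> by absorbing half of it into itself;
  this is legitimate because \<open>l1 n\<close> sums finitely many coefficients and is finite
  without any convergence, which is why the norm is truncated.\<close>

lemma l1_inverse_perturb:
  fixes H H' :: "'a::{real_normed_algebra_1,field} fps"
  assumes H0: "fps_nth H 0 \<noteq> 0" "fps_nth H' 0 \<noteq> 0"
    and w: "l1 n (inverse H) \<le> w" and e: "l1 n (H - H') \<le> e" and we: "w * e \<le> 1 / 2"
  shows "l1 n (inverse H' - inverse H) \<le> 2 * w * w * e"
proof -
  let ?W = "inverse H" and ?W' = "inverse H'"
  have 1: "?W * H = 1" "?W' * H' = 1" using H0 by (simp_all add: inverse_mult_eq_1)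
  have "?W' - ?W = ?W' * (?W * H) - ?W * (?W' * H')" by (simp only: 1 mult_1_right)
  also have "\<dots> = ?W' * ?W * (H - H')" by (simp add: algebra_simps)
  finally have eq: "?W' - ?W = ?W' * ?W * (H - H')" .
  have w0: "w \<ge> 0" "e \<ge> 0" using w e l1_nonneg[of n ?W] l1_nonneg[of n "H - H'"] by linarith+
  have b: "l1 n (?W' - ?W) \<le> l1 n ?W' * (w * e)"
  proof -
    have "l1 n (?W' - ?W) \<le> l1 n (?W' * ?W) * l1 n (H - H')" unfolding eq by (rule l1_mult)
    also have "\<dots> \<le> (l1 n ?W' * l1 n ?W) * l1 n (H - H')"
      by (intro mult_right_mono l1_mult l1_nonneg)
    also have "\<dots> \<le> (l1 n ?W' * w) * e"
      using w e w0 by (intro mult_mono mult_nonneg_nonneg l1_nonneg) (auto simp: l1_nonneg)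
    finally show ?thesis by (simp add: mult_ac)
  qed
  have "l1 n ?W' \<le> l1 n ?W + l1 n (?W' - ?W)"
    using l1_add[of n ?W "?W' - ?W"] by simp
  also have "\<dots> \<le> w + l1 n ?W' * (1/2)"
    using b w mult_left_mono[OF we l1_nonneg[of n ?W']] by linarith
  finally have "l1 n ?W' \<le> 2 * w" by simp
  then have "l1 n ?W' * (w * e) \<le> 2 * w * (w * e)"
    using w0 by (intro mult_right_mono) auto
  then show ?thesis using b by (simp add: mult_ac)
qed

text \<open>\<open>b\<close> is the law of the size of one component. The radius
  \<open>R > 1\<close> renders supercriticality as exponential tails, \<open>b_gcd\<close> leaves 1
  as the only pole of the renewal series on the unit circle, and \<open>b_nondeg\<close> makes the
  variance positive.\<close>

locale renewal =
  fixes b :: "nat \<Rightarrow> real" and R :: real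
  assumes b_nonneg: "b m \<ge> 0" and b_0: "b 0 = 0" and R_gt_1: "R > 1"
    and b_radius: "summable (\<lambda>m. b m * R ^ m)" and b_sums: "b sums 1"
    and b_gcd: "d \<ge> 2 \<Longrightarrow> \<exists>m. b m \<noteq> 0 \<and> \<not> d dvd m"
    and b_nondeg: "\<exists>m m'. b m \<noteq> 0 \<and> b m' \<noteq> 0 \<and> m \<noteq> m'"
begin

definition mean :: real where "mean = (\<Sum>m. real m * b m)"

definition var :: real where "var = (\<Sum>m. (real m - mean)\<^sup>2 * b m)"

definition hit :: "nat \<Rightarrow> nat \<Rightarrow> real" where "hit k n = fps_nth (Abs_fps b ^ k) n"

definition q :: "nat \<Rightarrow> real" where "q n = (\<Sum>k\<le>n. hit k n)"

lemma summable_b_pow: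
  assumes "0 \<le> r" "r < R"
  shows "summable (\<lambda>m. real m ^ j * b m * r ^ m)"
proof (cases "r = 0")
  case True
  then show ?thesis by (intro summable_finite[of "{0}"]) auto
next
  case False
  then have r: "0 < r" using assms by simp
  \<comment> \<open>With this rate \<open>exp (c * m) = (R / r) ^ m\<close>, so the gap between
    \<open>r\<close> and \<open>R\<close> absorbs the power \<open>m ^ j\<close>.\<close>
  define c where "c = ln (R / r)"
  have c: "c > 0" using assms r by (simp add: c_def)
  show ?thesis
  proof (rule summable_comparison_test[OF _ summable_mult[OF b_radius, of "fact j / c ^ j"]], intro exI[of _ 0] allI impI)
    fix m
    have "(c * real m) ^ j \<le> fact j * exp (c * real m)"
      using c by (intro power_le_fact_exp) auto
    also have "exp (c * real m) = (R / r) ^ m"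
      using R_gt_1 r by (simp add: c_def exp_of_nat2_mult)
    finally have "real m ^ j * r ^ m \<le> fact j / c ^ j * R ^ m"
      using c r by (simp add: power_mult_distrib field_simps)
    then have "b m * (real m ^ j * r ^ m) \<le> b m * (fact j / c ^ j * R ^ m)"
      by (rule mult_left_mono[OF _ b_nonneg])
    then show "norm (real m ^ j * b m * r ^ m) \<le> fact j / c ^ j * (b m * R ^ m)"
      using b_nonneg r by (simp add: mult_ac abs_mult)
  qed
qed

lemma summable_b_mom: "summable (\<lambda>m. real m ^ j * b m)"
  using summable_b_pow[of 1 j] R_gt_1 by simp

lemma summable_b: "summable b" and suminf_b: "(\<Sum>m. b m) = 1"
  using b_sums by (auto simp: sums_iff)

lemma b_pos_ex: "\<exists>m\<ge>1. b m > 0"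
proof -
  obtain m where "b m \<noteq> 0" using b_nondeg by blast
  then show ?thesis using b_0 b_nonneg[of m] by (intro exI[of _ m]) (cases m; auto)
qed

lemma mean_ge_1: "mean \<ge> 1"
proof -
  have "(\<Sum>m. b m) \<le> (\<Sum>m. real m * b m)"
  proof (intro suminf_le summable_b)
    show "b m \<le> real m * b m" for m
      using b_nonneg[of m] b_0 by (cases m) (auto simp: algebra_simps)
    show "summable (\<lambda>m. real m * b m)" using summable_b_mom[of 1] by simp
  qed
  then show ?thesis by (simp add: mean_def suminf_b)
qed

lemma summable_var: "summable (\<lambda>m. (real m - mean)\<^sup>2 * b m)"
proof -
  have "summable (\<lambda>m. real m ^ 2 * b m - 2 * mean * (real m ^ 1 * b m) + mean\<^sup>2 * b m)"
    by (intro summable_add summable_diff summable_mult summable_b_mom summable_b)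
  then show ?thesis by (simp add: power2_diff algebra_simps)
qed

lemma var_pos: "var > 0"
proof -
  obtain m m' where m: "b m \<noteq> 0" "b m' \<noteq> 0" "m \<noteq> m'" using b_nondeg by blast
  then obtain i where i: "b i \<noteq> 0" "real i \<noteq> mean" by (metis of_nat_eq_iff)
  have "0 < (real i - mean)\<^sup>2 * b i" using i b_nonneg[of i] by auto
  also have "\<dots> = (\<Sum>m\<in>{i}. (real m - mean)\<^sup>2 * b m)" by simp
  also have "\<dots> \<le> var" unfolding var_def
    by (intro sum_le_suminf summable_var) (auto simp: b_nonneg)
  finally show ?thesis .
qed

lemma hit_nonneg: "hit k n \<ge> 0"
proof -
  have "\<forall>n. fps_nth (Abs_fps b ^ k) n \<ge> 0"
    by (induction k) (auto simp: fps_mult_nth b_nonneg intro!: sum_nonneg)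
  then show ?thesis by (simp add: hit_def)
qed

lemma q_nonneg: "q n \<ge> 0" by (simp add: q_def sum_nonneg hit_nonneg)

lemma q_eq: "q n = fps_nth (inverse (1 - Abs_fps b)) n"
  using fps_renewal_nth[of "Abs_fps b" n] by (simp add: q_def hit_def b_0)

text \<open>Tilting the size law by \<open>z ^ m / c\<close> multiplies the weight of every run of
  \<open>k\<close> components of total size \<open>n\<close> by the same factor. Real
  \<open>z\<close> will give moment bounds, complex \<open>z\<close> characteristic
  functions.\<close>

lemma tilted_power:
  fixes z c :: "'a::{real_normed_field}"
  shows "fps_nth (Abs_fps (\<lambda>m. of_real (b m) * z ^ m / c) ^ k) n = of_real (hit k n) * z ^ n / c ^ k"
  unfolding hit_def
proof (induction k arbitrary: n)
  case (Suc k)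
  have "fps_nth (Abs_fps (\<lambda>m. of_real (b m) * z ^ m / c) ^ Suc k) n =
      (\<Sum>i=0..n. of_real (b i) * z ^ i / c * (of_real (fps_nth (Abs_fps b ^ k) (n - i)) * z ^ (n - i) / c ^ k))"
    by (simp add: fps_mult_nth Suc.IH)
  also have "\<dots> = (\<Sum>i=0..n. of_real (b i * fps_nth (Abs_fps b ^ k) (n - i)) * z ^ n / c ^ Suc k)"
  proof (intro sum.cong refl)
    fix i assume "i \<in> {0..n}"
    then have "z ^ n = z ^ i * z ^ (n - i)" by (simp flip: power_add)
    then show "of_real (b i) * z ^ i / c * (of_real (fps_nth (Abs_fps b ^ k) (n - i)) * z ^ (n - i) / c ^ k) =
      of_real (b i * fps_nth (Abs_fps b ^ k) (n - i)) * z ^ n / c ^ Suc k" by (simp add: mult_ac)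
  qed
  also have "\<dots> = of_real (fps_nth (Abs_fps b ^ Suc k) n) * z ^ n / c ^ Suc k"
    by (simp add: fps_mult_nth sum_distrib_right sum_divide_distrib)
  finally show ?case .
qed (simp add: fps_one_nth)

section \<open>Real tilts and exponential moments\<close>

definition beta :: "real \<Rightarrow> real" where "beta x = (\<Sum>m. b m * x ^ m)"

lemma summable_beta: "0 \<le> x \<Longrightarrow> x < R \<Longrightarrow> summable (\<lambda>m. b m * x ^ m)"
  using summable_b_pow[of x 0] by simp

lemma beta_pos:
  assumes "0 < x" "x < R" shows "beta x > 0"
proof -
  obtain m where m: "b m > 0" using b_pos_ex by blast
  have "0 < (\<Sum>m\<in>{m}. b m * x ^ m)" using m assms by simp
  also have "\<dots> \<le> beta x" unfolding beta_def using assms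
    by (intro sum_le_suminf summable_beta) (auto simp: b_nonneg)
  finally show ?thesis .
qed

text \<open>Normalised by \<open>beta x\<close>, the tilted sizes form a probability law again, and
  its renewal probability at \<open>n\<close> is at most 1. All control of large deviations comes
  from here.\<close>

lemma tilted_hit_sum_le:
  assumes "0 < x" "x < R"
  shows "(\<Sum>k\<le>n. hit k n * x ^ n / beta x ^ k) \<le> 1"
proof -
  let ?F = "Abs_fps (\<lambda>m. b m * x ^ m / beta x)"
  have "(\<Sum>k\<le>n. fps_nth (?F ^ k) n) \<le> 1"
  proof (rule renewal_le_1)
    fix n
    have "(\<Sum>m\<le>n. b m * x ^ m) \<le> beta x"
      unfolding beta_def using assms by (intro sum_le_suminf summable_beta) (auto simp: b_nonneg)
    then show "(\<Sum>m\<le>n. fps_nth ?F m) \<le> 1"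
      using beta_pos[OF assms] by (simp flip: sum_divide_distrib)
  qed (use assms beta_pos[OF assms] in \<open>auto simp: b_0 b_nonneg\<close>)
  then show ?thesis using tilted_power[of x "beta x"] by simp
qed

lemma exp_abs_le: "exp \<bar>y\<bar> \<le> exp (- (1 * y)) + exp (- (-1 * y))" for y :: real
  by (cases "y \<ge> 0") auto

lemma exp_le_quad: "exp y \<le> 1 + y + y\<^sup>2 / 2 * exp \<bar>y\<bar>" for y :: real
proof -
  obtain t where t: "\<bar>t\<bar> \<le> \<bar>y\<bar>" "exp y = (\<Sum>m<2. y ^ m / fact m) + exp t / fact 2 * y ^ 2"
    using Maclaurin_exp_le[of y 2] by blast
  have "exp t / 2 * y ^ 2 \<le> exp \<bar>y\<bar> / 2 * y ^ 2"
    using t(1) by (intro mult_right_mono) auto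
  then show ?thesis using t(2) by (simp add: eval_nat_numeral mult_ac)
qed

text \<open>A quadratic bound on the logarithm of the moment generating function. Its linear term is
  exactly \<open>mean\<close>, which centres the deviations in the next lemma.\<close>

lemma beta_exp_le:
  obtains h0 C where "h0 > 0" "exp h0 < R" "C \<ge> 0" "\<And>h. \<bar>h\<bar> \<le> h0 \<Longrightarrow> beta (exp h) \<le> exp (mean * h + C * h\<^sup>2)"
proof
  \<comment> \<open>Then \<open>exp h0\<close> is the square root of \<open>R\<close>, hence below
    \<open>R\<close>, and half the second moment tilted by \<open>exp h0\<close> bounds the Taylor
    remainder for all \<open>\<bar>h\<bar> \<le> h0\<close>.\<close>
  define h0 where "h0 = ln R / 2"
  define C where "C = (\<Sum>m. real m ^ 2 * b m * exp h0 ^ m) / 2"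
  show h0: "h0 > 0" using R_gt_1 by (simp add: h0_def)
  show e: "exp h0 < R" using R_gt_1 h0 exp_less_mono[of h0 "ln R"] by (simp add: h0_def)
  note s = summable_b_pow[of "exp h0" 2, OF _ e]
  show "C \<ge> 0" unfolding C_def using s by (intro divide_nonneg_nonneg suminf_nonneg) (auto simp: b_nonneg)
  fix h :: real assume h: "\<bar>h\<bar> \<le> h0"
  have eh: "exp h < R" using h e by (meson abs_le_D1 exp_le_cancel_iff le_less_trans)
  have s1: "summable (\<lambda>m. b m + h * (real m ^ 1 * b m) + h\<^sup>2 / 2 * (real m ^ 2 * b m * exp h0 ^ m))"
    using s by (intro summable_add summable_mult summable_b summable_b_mom) auto
  have "beta (exp h) \<le> (\<Sum>m. b m + h * (real m ^ 1 * b m) + h\<^sup>2 / 2 * (real m ^ 2 * b m * exp h0 ^ m))"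
    unfolding beta_def
  proof (intro suminf_le s1 summable_beta)
    fix m
    have "exp h ^ m = exp (real m * h)" by (simp add: exp_of_nat_mult)
    also have "\<dots> \<le> 1 + real m * h + (real m * h)\<^sup>2 / 2 * exp \<bar>real m * h\<bar>" by (rule exp_le_quad)
    also have "exp \<bar>real m * h\<bar> \<le> exp (real m * h0)" using h by (simp add: abs_mult mult_left_mono)
    also have "exp (real m * h0) = exp h0 ^ m" by (simp add: exp_of_nat_mult)
    finally have "b m * exp h ^ m \<le> b m * (1 + real m * h + (real m * h)\<^sup>2 / 2 * exp h0 ^ m)"
      using mult_left_mono[of _ _ "(real m * h)\<^sup>2 / 2"] by (intro mult_left_mono b_nonneg) force
    then show "b m * exp h ^ m \<le> b m + h * (real m ^ 1 * b m) + h\<^sup>2 / 2 * (real m ^ 2 * b m * exp h0 ^ m)"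
      by (simp add: algebra_simps power_mult_distrib)
  qed (use eh in auto)
  also have "\<dots> = 1 + h * mean + h\<^sup>2 / 2 * (2 * C)"
  proof -
    have "(\<lambda>m. b m + h * (real m ^ 1 * b m) + h\<^sup>2 / 2 * (real m ^ 2 * b m * exp h0 ^ m)) sums
      (1 + h * mean + h\<^sup>2 / 2 * (2 * C))"
      using s summable_b_mom[of 1] unfolding C_def mean_def
      by (intro sums_add sums_mult b_sums) (auto simp: sums_iff)
    then show ?thesis by (simp add: sums_iff)
  qed
  also have "\<dots> \<le> exp (mean * h + C * h\<^sup>2)"
    using exp_ge_add_one_self[of "mean * h + C * h\<^sup>2"] by (simp add: algebra_simps)
  finally show "beta (exp h) \<le> exp (mean * h + C * h\<^sup>2)" .
qed

text \<open>A Chernoff bound with tilts \<open>exp h\<close>, where \<open>h\<close> is plus or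
  minus \<open>1 / sqrt n\<close>. Since \<open>k \<le> n\<close>, the quadratic term contributes
  \<open>k * C * h^2 \<le> C\<close> uniformly in \<open>k\<close>; the two signs together dominate
  the absolute value in the exponent.\<close>

lemma exp_moment_bound:
  obtains K where "K > 0" "\<forall>\<^sub>F n in sequentially. (\<Sum>k\<le>n. hit k n * exp \<bar>(real k * mean - real n) / sqrt (real n)\<bar>) \<le> K"
proof -
  obtain h0 C where h0: "h0 > 0" "exp h0 < R" and C: "C \<ge> 0"
    and bd: "\<And>h. \<bar>h\<bar> \<le> h0 \<Longrightarrow> beta (exp h) \<le> exp (mean * h + C * h\<^sup>2)"
    using beta_exp_le by metis
  have one: "(\<Sum>k\<le>n. hit k n * exp (- (c * ((real k * mean - real n) / sqrt (real n))))) \<le> exp C"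
    if n: "n > 0" "1 / sqrt (real n) \<le> h0" and c: "\<bar>c\<bar> = 1" for n :: nat and c :: real
  proof -
    define h where "h = c / sqrt (real n)"
    have hh: "\<bar>h\<bar> \<le> h0" using n c by (simp add: h_def)
    have h2: "h\<^sup>2 = 1 / real n" using c n(1) by (auto simp: h_def power_divide abs_if split: if_splits)
    have x: "0 < exp h" "exp h < R" using hh h0 by (auto intro: le_less_trans[of _ "exp h0"])
    have t: "hit k n * exp (- (c * ((real k * mean - real n) / sqrt (real n)))) \<le> exp C * (hit k n * exp h ^ n / beta (exp h) ^ k)"
      if k: "k \<le> n" for k
    proof -
      have "beta (exp h) ^ k \<le> exp (mean * h + C * h\<^sup>2) ^ k"
        using beta_pos[OF x] bd[OF hh] by (intro power_mono) auto
      also have "\<dots> = exp (real k * (mean * h + C * h\<^sup>2))" by (simp add: exp_of_nat_mult)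
      also have "\<dots> \<le> exp (real k * mean * h + C)"
      proof -
        have "real k * (C * h\<^sup>2) \<le> C * 1"
          using k n C by (simp add: h2 field_simps mult_left_mono)
        then show ?thesis by (simp add: algebra_simps)
      qed
      finally have bk: "beta (exp h) ^ k \<le> exp (real k * mean * h + C)" .
      have "- (c * ((real k * mean - real n) / sqrt (real n))) = real n * h - real k * mean * h"
        by (simp add: h_def algebra_simps diff_divide_distrib)
      then have "exp (- (c * ((real k * mean - real n) / sqrt (real n)))) = exp C * (exp h ^ n / exp (real k * mean * h + C))"
        by (simp add: exp_diff exp_add exp_of_nat_mult)
      also have "\<dots> \<le> exp C * (exp h ^ n / beta (exp h) ^ k)"
        using bk beta_pos[OF x] by (intro mult_left_mono divide_left_mono) auto
      finally have "exp (- (c * ((real k * mean - real n) / sqrt (real n)))) \<le> exp C * (exp h ^ n / beta (exp h) ^ k)" .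
      from mult_left_mono[OF this hit_nonneg[of k n]] show ?thesis by (simp add: mult_ac)
    qed
    have "(\<Sum>k\<le>n. hit k n * exp (- (c * ((real k * mean - real n) / sqrt (real n))))) \<le>
        (\<Sum>k\<le>n. exp C * (hit k n * exp h ^ n / beta (exp h) ^ k))"
      using t by (intro sum_mono) auto
    also have "\<dots> = exp C * (\<Sum>k\<le>n. hit k n * exp h ^ n / beta (exp h) ^ k)" by (simp add: sum_distrib_left)
    also have "\<dots> \<le> exp C * 1" using tilted_hit_sum_le[OF x] by (intro mult_left_mono) auto
    finally show ?thesis by simp
  qed
  have "\<forall>\<^sub>F n in sequentially. (\<Sum>k\<le>n. hit k n * exp \<bar>(real k * mean - real n) / sqrt (real n)\<bar>) \<le> 2 * exp C"
  proof -
    have "(\<lambda>n. 1 / sqrt (real n)) \<longlonglongrightarrow> 0" by real_asymp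
    then have "\<forall>\<^sub>F n in sequentially. 1 / sqrt (real n) < h0" using h0(1) by (rule order_tendstoD)
    then show ?thesis using eventually_gt_at_top[of 0]
    proof eventually_elim
      case (elim n)
      let ?y = "\<lambda>k. (real k * mean - real n) / sqrt (real n)"
      have "(\<Sum>k\<le>n. hit k n * exp \<bar>?y k\<bar>) \<le> (\<Sum>k\<le>n. hit k n * exp (- (1 * ?y k)) + hit k n * exp (- (-1 * ?y k)))"
      proof (intro sum_mono)
        fix k
        have "exp \<bar>?y k\<bar> \<le> exp (- (1 * ?y k)) + exp (- (-1 * ?y k))" by (rule exp_abs_le)
        from mult_left_mono[OF this hit_nonneg[of k n]]
        show "hit k n * exp \<bar>?y k\<bar> \<le> hit k n * exp (- (1 * ?y k)) + hit k n * exp (- (-1 * ?y k))"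
          by (simp only: distrib_left)
      qed
      then show ?case using one[of n 1] one[of n "-1"] elim by (simp add: sum.distrib)
    qed
  qed
  then show ?thesis using that[of "2 * exp C"] by simp
qed

end

lemma geometric_partial_sums:
  fixes f :: "nat \<Rightarrow> 'a::banach"
  assumes f: "\<And>n. norm (f n) \<le> K * l ^ n" and l: "0 < l" "l < (1::real)"
  shows "summable f" and "norm ((\<Sum>j\<le>n. f j) - suminf f) \<le> K * l / (1 - l) * l ^ n"
proof -
  have sg: "summable (\<lambda>n. K * l ^ n)" using l by (intro summable_mult summable_geometric) auto
  show sf: "summable f" by (rule summable_comparison_test[OF _ sg]) (use f in auto)
  have "suminf f = (\<Sum>j. f (j + Suc n)) + (\<Sum>j<Suc n. f j)"
    by (rule suminf_split_initial_segment[OF sf])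
  then have "norm ((\<Sum>j\<le>n. f j) - suminf f) = norm (\<Sum>j. f (j + Suc n))"
    by (simp add: lessThan_Suc_atMost)
  also have "\<dots> \<le> (\<Sum>j. K * l ^ Suc n * l ^ j)"
  proof (rule norm_suminf_le)
    show "norm (f (j + Suc n)) \<le> K * l ^ Suc n * l ^ j" for j
      using f[of "j + Suc n"] by (simp add: power_add mult_ac)
    show "summable (\<lambda>j. K * l ^ Suc n * l ^ j)" using l by (intro summable_mult summable_geometric) auto
  qed
  also have "\<dots> = K * l / (1 - l) * l ^ n"
    using l by (subst suminf_mult) (auto simp: suminf_geometric summable_geometric)
  finally show "norm ((\<Sum>j\<le>n. f j) - suminf f) \<le> K * l / (1 - l) * l ^ n" .
qed

section \<open>The renewal theorem with an exponentially small error\<close>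

context renewal
begin

definition cb :: "complex fps" where "cb = Abs_fps (\<lambda>m. of_real (b m))"

definition cbeta :: "complex \<Rightarrow> complex" where "cbeta z = (\<Sum>m. of_real (b m) * z ^ m)"

text \<open>The quotient of \<open>1 - \<Sum> b m z^m X^m / c\<close> by \<open>1 - X\<close>, with
  which the factor responsible for a pole at 1 is removed. For \<open>z = c = 1\<close> its
  coefficients are the tails of \<open>b\<close>.\<close>

definition gH :: "complex \<Rightarrow> complex \<Rightarrow> complex fps" where
  "gH z c = Abs_fps (\<lambda>m. 1 - (\<Sum>j\<le>m. of_real (b j) * z ^ j / c))"

lemma gH_eq: "(1 - fps_X) * gH z c = 1 - Abs_fps (\<lambda>m. of_real (b m) * z ^ m / c)"
proof (rule fps_ext)
  show "fps_nth ((1 - fps_X) * gH z c) n = fps_nth (1 - Abs_fps (\<lambda>m. of_real (b m) * z ^ m / c)) n" for n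
    by (cases n) (simp_all add: gH_def left_diff_distrib b_0 atMost_Suc)
qed

lemma gH_nth_0 [simp]: "fps_nth (gH z c) 0 = 1"
  by (simp add: gH_def b_0)

text \<open>Dividing by \<open>1 - X\<close> is taking partial sums, so the tilted renewal sequence
  consists of the partial sums of the coefficients of \<open>1 / gH z c\<close>. Convergence of the
  former becomes summability of the latter.\<close>

lemma gH_renewal:
  "(\<Sum>k\<le>n. of_real (hit k n) * z ^ n / c ^ k) = (\<Sum>j\<le>n. fps_nth (inverse (gH z c)) j)"
proof -
  let ?B = "Abs_fps (\<lambda>m. of_real (b m) * z ^ m / c)"
  define F where "F = Abs_fps (\<lambda>n. \<Sum>j\<le>n. fps_nth (inverse (gH z c)) j)"
  have "(1 - fps_X) * F = inverse (gH z c)"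
  proof (rule fps_ext)
    show "fps_nth ((1 - fps_X) * F) n = fps_nth (inverse (gH z c)) n" for n
      by (cases n) (simp_all add: F_def left_diff_distrib atMost_Suc)
  qed
  moreover have "gH z c * inverse (gH z c) = 1" by (simp add: inverse_mult_eq_1')
  ultimately have "(1 - ?B) * F = 1"
    by (metis gH_eq mult.assoc mult.commute)
  then have "inverse (1 - ?B) = F" by (rule fps_inverse_unique)
  moreover have "(\<Sum>k\<le>n. of_real (hit k n) * z ^ n / c ^ k) = fps_nth (inverse (1 - ?B)) n"
    by (subst fps_renewal_nth) (simp_all add: b_0 tilted_power)
  ultimately show ?thesis by (simp add: F_def)
qed

text \<open>This radius and \<open>R2\<close> below satisfy \<open>1 < R2 < R' < R\<close>. The loss
  from \<open>R'\<close> to \<open>R2\<close> makes the series formed by the tails of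
  \<open>b\<close> converge at \<open>R2\<close>.\<close>

definition R' :: real where "R' = (1 + R) / 2"

lemma R': "1 < R'" "R' < R" "0 < R'" using R_gt_1 by (auto simp: R'_def)

lemma summable_b_R': "summable (\<lambda>m. b m * R' ^ m)"
  using summable_b_pow[of R' 0] R' by simp

lemma summable_cbeta: "norm z \<le> R' \<Longrightarrow> summable (\<lambda>m. of_real (b m) * z ^ m :: complex)"
proof (rule summable_comparison_test[OF _ summable_b_R'], intro exI[of _ 0] allI impI)
  fix m assume "norm z \<le> R'"
  then show "norm (of_real (b m) * z ^ m :: complex) \<le> b m * R' ^ m"
    by (auto simp: norm_mult norm_power b_nonneg intro!: mult_left_mono power_mono)
qed

lemma conv_radius_cb: "fps_conv_radius cb \<ge> R'"
  using conv_radius_geI[of "fps_nth cb" "of_real R'"] summable_cbeta[of "of_real R'"] R'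
  by (simp add: fps_conv_radius_def cb_def)

lemma eval_cb: "eval_fps cb z = cbeta z"
  by (simp add: eval_fps_def cb_def cbeta_def)

abbreviation cH :: "complex fps" where "cH \<equiv> gH 1 1"

lemma cH_nth: "fps_nth cH m = of_real (\<Sum>j. b (j + Suc m))"
proof -
  have "(\<Sum>j. b (j + Suc m)) + (\<Sum>j<Suc m. b j) = 1"
    using suminf_split_initial_segment[OF summable_b, of "Suc m"] unfolding suminf_b by (rule sym)
  then have "(\<Sum>j. b (j + Suc m)) = 1 - (\<Sum>j\<le>m. b j)" by (simp add: lessThan_Suc_atMost)
  then show ?thesis by (simp add: gH_def)
qed

definition R2 :: real where "R2 = (1 + R') / 2"

lemma R2: "1 < R2" "R2 < R'" "0 < R2" using R' by (auto simp: R2_def)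

lemma conv_radius_cH: "fps_conv_radius cH \<ge> R2"
proof -
  have "summable (\<lambda>n. fps_nth cH n * of_real R2 ^ n)"
  proof (rule summable_comparison_test)
    define A where "A = (\<Sum>j. b j * R' ^ j)"
    have A: "A \<ge> 0" unfolding A_def using summable_b_R' R' by (intro suminf_nonneg) (auto simp: b_nonneg)
    show "summable (\<lambda>n. A * (R2 / R') ^ n)"
      using R2 R' by (intro summable_mult summable_geometric) auto
    have "norm (fps_nth cH n * of_real R2 ^ n) \<le> A * (R2 / R') ^ n" for n
    proof -
      have "norm (fps_nth cH n) \<le> A / R' ^ Suc n"
      proof -
        have "norm (\<Sum>j. b (j + Suc n)) \<le> A / R' ^ Suc n"
          unfolding A_def by (rule tail_norm_le(2)) (use R' b_nonneg summable_b_R' in auto)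
        then show ?thesis unfolding cH_nth norm_of_real by simp
      qed
      also have "\<dots> \<le> A / R' ^ n" using A R' by (intro divide_left_mono) auto
      finally have "norm (fps_nth cH n) * R2 ^ n \<le> A / R' ^ n * R2 ^ n" using R2 by (intro mult_right_mono) auto
      then show ?thesis using R2 by (simp add: norm_mult norm_power power_divide)
    qed
    then show "\<exists>N. \<forall>n\<ge>N. norm (fps_nth cH n * of_real R2 ^ n) \<le> A * (R2 / R') ^ n" by blast
  qed
  then show ?thesis
    using conv_radius_geI[of "fps_nth cH" "of_real R2"] R2 by (simp add: fps_conv_radius_def)
qed

lemma cH_cb: "(1 - fps_X) * cH = 1 - cb"
  using gH_eq[of 1 1] by (simp add: cb_def)

lemma eval_cH:
  assumes "norm z < R2"
  shows "(1 - z) * eval_fps cH z = 1 - cbeta z"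
proof -
  have r: "ereal (norm z) < fps_conv_radius cH" "ereal (norm z) < fps_conv_radius cb"
    using assms conv_radius_cH conv_radius_cb R2
    by (auto intro: less_le_trans[of _ "ereal R2"] less_le_trans[of _ "ereal R'"])
  have "fps_conv_radius (1 - fps_X :: complex fps) = \<infinity>"
    using fps_conv_radius_diff[of "1::complex fps" fps_X] by simp
  then have "eval_fps ((1 - fps_X) * cH) z = (1 - z) * eval_fps cH z"
    using r by (subst eval_fps_mult) (auto simp: eval_fps_diff)
  moreover have "eval_fps (1 - cb) z = 1 - cbeta z"
    using r by (subst eval_fps_diff) (auto simp: eval_cb)
  ultimately show ?thesis using cH_cb by simp
qed

text \<open>The derivative of \<open>(1 - X) * cH = 1 - cb\<close>, taken at 1, equates
  \<open>cH\<close> at 1 with the derivative of \<open>cb\<close> at 1, which is the mean.\<close>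

lemma eval_cH_1: "eval_fps cH 1 = of_real mean"
proof -
  have r: "ereal (norm (1::complex)) < fps_conv_radius cH" "ereal (norm (1::complex)) < fps_conv_radius cb"
    using less_le_trans[OF _ conv_radius_cH, of 1] less_le_trans[OF _ conv_radius_cb, of 1] R2 R'
    by (simp_all add: one_ereal_def)
  have r': "ereal (norm (1::complex)) < fps_conv_radius (fps_deriv cH)"
    "ereal (norm (1::complex)) < fps_conv_radius (fps_deriv cb)"
    using less_le_trans[OF r(1) fps_conv_radius_deriv] less_le_trans[OF r(2) fps_conv_radius_deriv] by simp_all
  have i: "fps_conv_radius (1 - fps_X :: complex fps) = \<infinity>"
    using fps_conv_radius_diff[of "1::complex fps" fps_X] by simp
  have "fps_deriv ((1 - fps_X) * cH) = fps_deriv (1 - cb)" by (simp only: cH_cb)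
  then have "- cH + (1 - fps_X) * fps_deriv cH = - fps_deriv cb" by simp
  moreover have "x = y + w" if "- x + w = - y" for x y w :: "complex fps"
    using that by (metis add.inverse_inverse add_diff_cancel_right' diff_minus_eq_add minus_add_distrib)
  ultimately have "cH = fps_deriv cb + (1 - fps_X) * fps_deriv cH" by blast
  then have "eval_fps cH 1 = eval_fps (fps_deriv cb + (1 - fps_X) * fps_deriv cH) 1" by (rule arg_cong)
  also have "\<dots> = eval_fps (fps_deriv cb) 1 + eval_fps ((1 - fps_X) * fps_deriv cH) 1"
    using r' i by (intro eval_fps_add less_le_trans[OF _ fps_conv_radius_mult]) auto
  also have "eval_fps ((1 - fps_X) * fps_deriv cH) 1 = 0"
    using r' i by (subst eval_fps_mult) (auto simp: eval_fps_diff)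
  also have "eval_fps (fps_deriv cb) 1 = (\<Sum>m. of_real (real (Suc m) * b (Suc m)))"
    by (simp add: eval_fps_def cb_def)
  also have "\<dots> = of_real (\<Sum>m. real (Suc m) * b (Suc m))"
    using summable_b_mom[of 1] summable_Suc_iff[of "\<lambda>m. real m * b m"] by (intro suminf_of_real[symmetric]) simp
  also have "(\<Sum>m. real (Suc m) * b (Suc m)) = mean"
    using suminf_split_head[of "\<lambda>m. real m * b m"] summable_b_mom[of 1] by (simp add: mean_def)
  finally show ?thesis by simp
qed

text \<open>Equality case of the triangle inequality: the terms \<open>b m * (1 - Re (z^m))\<close>
  are nonnegative with sum 0, so \<open>z^m = 1\<close> on the support of \<open>b\<close>. The
  order of \<open>z\<close> then divides the whole support, and \<open>b_gcd\<close> makes it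
  1.\<close>

lemma cbeta_eq_1_imp:
  assumes z: "norm z \<le> 1" and e: "cbeta z = 1"
  shows "z = 1"
proof -
  have sz: "summable (\<lambda>m. of_real (b m) * z ^ m)" by (rule summable_cbeta) (use z R'(1) in linarith)
  have le: "Re (z ^ m) \<le> 1" for m
    using complex_Re_le_cmod[of "z ^ m"] power_le_one[OF norm_ge_zero z, of m] by (simp add: norm_power)
  have sr: "summable (\<lambda>m. b m * Re (z ^ m))"
    using summable_Re[OF sz] by simp
  have "(\<Sum>m. b m * Re (z ^ m)) = Re (cbeta z)"
    unfolding cbeta_def using Re_suminf[OF sz] by simp
  then have "(\<Sum>m. b m - b m * Re (z ^ m)) = 0"
    using suminf_diff[OF summable_b sr] e suminf_b by simp
  moreover have nn: "b m - b m * Re (z ^ m) \<ge> 0" for m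
    using mult_left_mono[OF le[of m] b_nonneg[of m]] by simp
  ultimately have "b m - b m * Re (z ^ m) = 0" for m
    using suminf_eq_zero_iff[OF summable_diff[OF summable_b sr] nn] by simp
  then have re: "Re (z ^ m) = 1" if "b m \<noteq> 0" for m using that by (metis mult_cancel_left2 right_minus_eq)
  have pm: "z ^ m = 1" if "b m \<noteq> 0" for m
  proof -
    have "norm (z ^ m) \<le> 1" using z by (simp add: norm_power power_le_one)
    then have "(Re (z ^ m))\<^sup>2 + (Im (z ^ m))\<^sup>2 \<le> 1"
      by (metis cmod_power2 norm_ge_zero power_le_one)
    then show ?thesis using re[OF that] by (simp add: complex_eq_iff)
  qed
  obtain m0 where m0: "m0 \<ge> 1" "b m0 > 0" using b_pos_ex by blast
  \<comment> \<open>The order of \<open>z\<close> as a root of unity, which exists because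
    \<open>z ^ m0 = 1\<close>.\<close>
  define d where "d = (LEAST d. d \<ge> 1 \<and> z ^ d = 1)"
  have d: "d \<ge> 1 \<and> z ^ d = 1" unfolding d_def
    by (rule LeastI) (use m0 pm[of m0] in auto)
  have dle: "d \<le> d'" if "d' \<ge> 1" "z ^ d' = 1" for d'
    unfolding d_def using that by (intro Least_le) simp
  have dvd: "d dvd m" if "b m \<noteq> 0" for m
  proof (rule ccontr)
    assume "\<not> d dvd m"
    then have "m mod d \<ge> 1" by (simp add: dvd_eq_mod_eq_0)
    have "z ^ m = z ^ (m mod d + d * (m div d))" by simp
    also have "\<dots> = z ^ (m mod d) * (z ^ d) ^ (m div d)" by (simp only: power_add power_mult)
    finally have "z ^ m = z ^ (m mod d) * (z ^ d) ^ (m div d)" .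
    moreover have "z ^ m = 1" "z ^ d = 1" using pm[OF that] d by blast+
    ultimately have "z ^ (m mod d) = 1" by simp
    from dle[OF \<open>m mod d \<ge> 1\<close> this] have "d \<le> m mod d" .
    then show False using d mod_less_divisor[of d m] by linarith
  qed
  then have "\<not> d \<ge> 2" using b_gcd[of d] by blast
  then have "d = 1" using d by linarith
  then show ?thesis using d by simp
qed

lemma eval_cH_nz:
  assumes "norm z \<le> 1"
  shows "eval_fps cH z \<noteq> 0"
proof
  assume 0: "eval_fps cH z = 0"
  have "norm z < R2" using assms R2(1) by linarith
  from eval_cH[OF this] have "cbeta z = 1" unfolding 0 by simp
  from cbeta_eq_1_imp[OF assms this] have "of_real mean = (0::complex)" using eval_cH_1 0 by simp
  then show False using mean_ge_1 by simp
qed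

text \<open>Without zeros in the closed unit disk, \<open>cH\<close> has by compactness none in a
  slightly larger one; \<open>1 / cH\<close> is analytic there, so its coefficients decay
  geometrically, and their sum is its value at 1.\<close>

lemma inverse_cH_decay_aux:
  "(\<exists>K l. 0 < K \<and> 0 < l \<and> l < 1 \<and> (\<forall>n. norm (fps_nth (inverse cH) n) \<le> K * l ^ n)) \<and>
    (fps_nth (inverse cH)) sums of_real (1 / mean)"
proof -
  let ?U = "ball 0 R2 \<inter> eval_fps cH -` (- {0})"
  have "ball (0::complex) R2 \<subseteq> eball 0 (fps_conv_radius cH)"
  proof
    fix x :: complex assume "x \<in> ball 0 R2"
    then have "ereal (dist 0 x) < ereal R2" unfolding mem_ball less_ereal.simps .
    from less_le_trans[OF this conv_radius_cH] show "x \<in> eball 0 (fps_conv_radius cH)"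
      unfolding in_eball_iff .
  qed
  then have "continuous_on (ball 0 R2) (eval_fps cH)"
    by (rule continuous_on_eval_fps[THEN continuous_on_subset])
  then have "open ?U"
    by (rule continuous_open_preimage) (rule open_ball, rule open_Compl, simp)
  moreover have "cball 0 1 \<subseteq> ?U"
  proof
    fix x :: complex assume "x \<in> cball 0 1"
    then have "norm x \<le> 1" by simp
    moreover from this R2(1) have "norm x < R2" by linarith
    ultimately show "x \<in> ?U" using eval_cH_nz[of x] by simp
  qed
  ultimately obtain e where e: "e > 0" "(\<Union>x\<in>cball 0 1. ball x e) \<subseteq> ?U"
    using compact_subset_open_imp_ball_epsilon_subset[OF compact_cball] by metis
  \<comment> \<open>A point outside the unit disk is compared with its radial projection to the unit
    circle, from which it has distance \<open>norm z - 1 < e\<close>.\<close>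
  have nz: "eval_fps cH z \<noteq> 0" if "ereal (norm z) < ereal (1 + e)" for z
  proof (cases "norm z \<le> 1")
    case False
    then have "dist (z / of_real (norm z)) z = norm z - 1"
    proof -
      have "z / of_real (norm z) - z = (of_real (1 / norm z - 1)) * z" by (simp add: left_diff_distrib)
      then have "dist (z / of_real (norm z)) z = \<bar>1 / norm z - 1\<bar> * norm z" by (simp only: dist_norm norm_mult norm_of_real)
      moreover have "\<bar>1 / x - 1\<bar> * x = x - 1" if "x > 1" for x :: real
        using that by (simp add: abs_if field_simps)
      ultimately show ?thesis using False by simp
    qed
    then have "z \<in> ball (z / of_real (norm z)) e" "z / of_real (norm z) \<in> cball 0 1" using that False
      by (auto simp: norm_divide)
    then show ?thesis using e(2) by blast
  qed (use eval_cH_nz in auto)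
  have cr: "fps_conv_radius (inverse cH) \<ge> min (ereal (1 + e)) (fps_conv_radius cH)"
    using nz by (intro fps_conv_radius_inverse)
  \<comment> \<open>Strictly between 1 and both \<open>1 + e\<close> and \<open>R2\<close>, so that
    \<open>1 / cH\<close> converges absolutely on the circle of radius \<open>r\<close>.\<close>
  define r where "r = min (1 + e / 2) ((1 + R2) / 2)"
  have r: "1 < r" using e R2 by (auto simp: r_def)
  have r2: "ereal r < fps_conv_radius (inverse cH)"
  proof -
    have "ereal r < min (ereal (1 + e)) (ereal R2)" using e R2 by (auto simp: r_def min_def field_simps)
    also have "\<dots> \<le> min (ereal (1 + e)) (fps_conv_radius cH)"
      by (rule min.mono[OF order_refl conv_radius_cH])
    also have "\<dots> \<le> fps_conv_radius (inverse cH)" by (rule cr)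
    finally show ?thesis .
  qed
  have s: "summable (\<lambda>n. norm (fps_nth (inverse cH) n * of_real r ^ n))"
    using r2 r by (intro norm_summable_fps) simp
  define K where "K = (\<Sum>n. norm (fps_nth (inverse cH) n * of_real r ^ n)) + 1"
  have K: "norm (fps_nth (inverse cH) n) \<le> K * (1 / r) ^ n" for n
  proof -
    have "norm (fps_nth (inverse cH) n * of_real r ^ n) \<le> K"
      using sum_le_suminf[OF s, of "{n}"] unfolding K_def by simp
    then show ?thesis using r by (simp add: norm_mult norm_power power_divide field_simps)
  qed
  have K0: "K > 0" unfolding K_def by (intro add_nonneg_pos suminf_nonneg s) simp_all
  have ev: "eval_fps (inverse cH) 1 = of_real (1 / mean)"
  proof -
    have "ereal (norm (1::complex)) < fps_conv_radius cH"
      using less_le_trans[OF _ conv_radius_cH, of 1] R2(1) by (simp add: one_ereal_def)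
    moreover have "ereal (norm (1::complex)) < ereal (1 + e)" using e(1) by simp
    ultimately have "eval_fps (inverse cH) 1 = inverse (eval_fps cH 1)"
      using eval_fps_inverse[of "ereal (1 + e)" cH, OF nz] by blast
    also have "\<dots> = of_real (1 / mean)" unfolding eval_cH_1 by (simp add: divide_inverse)
    finally show ?thesis .
  qed
  have "summable (\<lambda>n. fps_nth (inverse cH) n)"
    using geometric_partial_sums(1)[OF K, of] r by simp
  moreover have "(\<Sum>n. fps_nth (inverse cH) n) = of_real (1 / mean)" using ev by (simp add: eval_fps_def)
  ultimately have "(\<lambda>n. fps_nth (inverse cH) n) sums of_real (1 / mean)" by (simp add: sums_iff)
  moreover have "0 < 1 / r \<and> 1 / r < 1" using r by simp
  ultimately show ?thesis using K K0 by blast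
qed

lemmas inverse_cH_decay = inverse_cH_decay_aux[THEN conjunct1]
lemmas inverse_cH_sums = inverse_cH_decay_aux[THEN conjunct2]

lemma q_complex: "of_real (q n) = (\<Sum>j\<le>n. fps_nth (inverse cH) j)"
proof -
  have "(of_real (q n) :: complex) = (\<Sum>k\<le>n. of_real (hit k n) * 1 ^ n / 1 ^ k)"
    unfolding q_def by simp
  also have "\<dots> = (\<Sum>j\<le>n. fps_nth (inverse cH) j)" by (rule gH_renewal)
  finally show ?thesis .
qed

text \<open>Partial sums of a series with geometrically decaying terms approach its sum at the same
  rate. The exponential error is what later makes moments polynomial to every order.\<close>

lemma q_limit: "\<exists>K l. 0 < K \<and> 0 < l \<and> l < 1 \<and> (\<forall>n. \<bar>q n - 1 / mean\<bar> \<le> K * l ^ n)"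
proof -
  obtain K l where K: "0 < K" "0 < l" "l < 1" "\<And>n. norm (fps_nth (inverse cH) n) \<le> K * l ^ n"
    using inverse_cH_decay by blast
  have su: "suminf (fps_nth (inverse cH)) = of_real (1 / mean)" using inverse_cH_sums by (rule sums_unique[symmetric])
  have "\<bar>q n - 1 / mean\<bar> \<le> K * l / (1 - l) * l ^ n" for n
  proof -
    have "\<bar>q n - 1 / mean\<bar> = norm (of_real (q n) - of_real (1 / mean) :: complex)"
      unfolding of_real_diff[symmetric] norm_of_real ..
    also have "\<dots> \<le> K * l / (1 - l) * l ^ n"
      unfolding q_complex su[symmetric] by (rule geometric_partial_sums(2)[OF K(4) K(2,3), of n])
    finally show ?thesis .
  qed
  moreover have "0 < K * l / (1 - l)" using K by simp
  ultimately show ?thesis using K(2,3) by blast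
qed

lemma q_tendsto: "q \<longlonglongrightarrow> 1 / mean"
proof -
  obtain K l where K: "0 < K" "0 < l" "l < 1" "\<And>n. \<bar>q n - 1 / mean\<bar> \<le> K * l ^ n" using q_limit by blast
  have "(\<lambda>n. K * l ^ n) \<longlonglongrightarrow> K * 0" using K(2,3) by (intro tendsto_intros LIMSEQ_power_zero) simp
  then have "(\<lambda>n. K * l ^ n) \<longlonglongrightarrow> 0" by simp
  moreover have "\<forall>\<^sub>F n in sequentially. norm (q n - 1 / mean) \<le> K * l ^ n" using K(4) by simp
  ultimately have "(\<lambda>n. q n - 1 / mean) \<longlonglongrightarrow> 0" by (rule Lim_null_comparison[rotated])
  then show ?thesis by (simp add: LIM_zero_iff)
qed

end

section \<open>Local limit of the number of renewals\<close>

lemma exp_diff_le: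
  fixes a c M :: real
  assumes "a \<le> M" "c \<le> M"
  shows "\<bar>exp a - exp c\<bar> \<le> exp M * \<bar>a - c\<bar>"
proof -
  have *: "exp u - exp v \<le> exp M * (u - v)" if "v \<le> u" "u \<le> M" for u v
  proof -
    have "1 - exp (v - u) \<le> u - v" using exp_ge_add_one_self[of "v - u"] by linarith
    then have "exp u * (1 - exp (v - u)) \<le> exp M * (u - v)" using that by (intro mult_mono) auto
    then show ?thesis by (simp add: right_diff_distrib exp_diff)
  qed
  show ?thesis
  proof (cases "c \<le> a")
    case True
    then show ?thesis using *[of c a] assms by simp
  next
    case False
    then show ?thesis using *[of a c] assms by (simp add: abs_minus_commute)
  qed
qed

lemma cis_approx: "norm (cis y - (1 + \<i> * of_real y - of_real (y\<^sup>2 / 2))) \<le> \<bar>y\<bar> ^ 3 / 6"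
proof -
  have "(\<Sum>k\<le>2. (\<i> * of_real y) ^ k / fact k) = 1 + \<i> * of_real y - of_real (y\<^sup>2 / 2)"
    by (simp add: eval_nat_numeral, simp add: complex_eq_iff)
  then show ?thesis using iexp_approx1[of y 2] by (simp add: cis_conv_exp eval_nat_numeral)
qed

section \<open>Tilts on the unit circle and the characteristic function of the core-size\<close>

context renewal
begin

lemma sums_cbeta: "norm z \<le> 1 \<Longrightarrow> (\<lambda>m. of_real (b m) * z ^ m) sums cbeta z"
  unfolding cbeta_def by (rule summable_sums, rule summable_cbeta) (use R'(1) in linarith)

lemma sums_b_complex: "(\<lambda>m. of_real (b m) :: complex) sums 1"
  using sums_of_real[OF b_sums, where 'a=complex] by (simp only: of_real_1)

lemma cbeta_lipschitz:
  assumes "norm x \<le> 1"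
  shows "norm (cbeta x - 1) \<le> mean * norm (x - 1)"
proof -
  have s: "(\<lambda>m. of_real (b m) * x ^ m - of_real (b m)) sums (cbeta x - 1)"
    by (rule sums_diff[OF sums_cbeta[OF assms] sums_b_complex])
  have "norm (\<Sum>m. of_real (b m) * x ^ m - of_real (b m)) \<le> (\<Sum>m. real m ^ 1 * b m * norm (x - 1))"
  proof (rule norm_suminf_le)
    fix m
    have "norm (x ^ m - 1 ^ m) \<le> real m * norm (x - 1)" using assms by (intro norm_power_diff) auto
    then have "b m * norm (x ^ m - 1) \<le> b m * (real m * norm (x - 1))" by (intro mult_left_mono b_nonneg) simp
    moreover have "norm (of_real (b m) * x ^ m - of_real (b m)) = b m * norm (x ^ m - 1)"
    proof -
      have "of_real (b m) * x ^ m - of_real (b m) = of_real (b m) * (x ^ m - 1)" by (simp add: right_diff_distrib)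
      then show ?thesis using b_nonneg[of m] by (simp only: norm_mult norm_of_real abs_of_nonneg)
    qed
    ultimately show "norm (of_real (b m) * x ^ m - of_real (b m)) \<le> real m ^ 1 * b m * norm (x - 1)"
      by (simp add: mult_ac)
  qed (intro summable_mult2 summable_b_mom)
  also have "\<dots> = mean * norm (x - 1)"
    unfolding mean_def using suminf_mult2[OF summable_b_mom[of 1]] by simp
  finally show ?thesis using sums_unique[OF s] by simp
qed

lemma cbeta_norm_le:
  assumes "norm x \<le> 1"
  shows "norm (cbeta x) \<le> 1"
proof -
  have "norm (\<Sum>m. of_real (b m) * x ^ m) \<le> (\<Sum>m. b m)"
  proof (rule norm_suminf_le)
    show "norm (of_real (b m) * x ^ m) \<le> b m" for m
      using mult_left_mono[OF power_le_one[OF norm_ge_zero assms, of m] b_nonneg[of m]] b_nonneg[of m]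
      by (simp add: norm_mult norm_power)
  qed (rule summable_b)
  then show ?thesis unfolding cbeta_def suminf_b .
qed

text \<open>With the normalisation \<open>cbeta x\<close> the tilted sequence still sums to 1, so
  its difference from \<open>b\<close> sums to 0. The partial sums that are the coefficients of
  \<open>cH - gH x (cbeta x)\<close> are therefore minus the tails, which decay like a power of
  \<open>1 / R'\<close> and carry the factor \<open>norm (x - 1)\<close>.\<close>

lemma tilt_l1:
  obtains A where "A \<ge> 0" "\<And>x n. norm x \<le> 1 \<Longrightarrow> norm (cbeta x) \<ge> 1 / 2 \<Longrightarrow> l1 n (cH - gH x (cbeta x)) \<le> A * norm (x - 1)"
proof -
  define G where "G = (\<Sum>j. (real j + mean) * b j * R' ^ j)"
  have sG: "summable (\<lambda>j. (real j + mean) * b j * R' ^ j)"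
  proof -
    have "summable (\<lambda>j. real j ^ 1 * b j * R' ^ j + mean * (real j ^ 0 * b j * R' ^ j))"
      using R' by (intro summable_add summable_mult summable_b_pow) auto
    then show ?thesis by (simp add: algebra_simps)
  qed
  have m0: "mean \<ge> 0" using mean_ge_1 by linarith
  have G0: "G \<ge> 0" unfolding G_def using R' m0 by (intro suminf_nonneg sG mult_nonneg_nonneg) (auto simp: b_nonneg)
  \<comment> \<open>The 2 comes from \<open>norm (cbeta x) \<ge> 1 / 2\<close>, the last factor is
    the geometric series in \<open>1 / R'\<close>.\<close>
  define A where "A = 2 * G * (1 / (1 - 1 / R'))"
  have A0: "A \<ge> 0" unfolding A_def using R' G0 by (intro mult_nonneg_nonneg) auto
  have "l1 n (cH - gH x (cbeta x)) \<le> A * norm (x - 1)"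
    if x: "norm x \<le> 1" and c: "norm (cbeta x) \<ge> 1 / 2" for x n
  proof -
    let ?d = "norm (x - 1)"
    define f where "f j = of_real (b j) * x ^ j / cbeta x - of_real (b j)" for j
    define g where "g j = 2 * ?d * ((real j + mean) * b j)" for j
    have c0: "cbeta x \<noteq> 0" using c by auto
    have fg: "norm (f j) \<le> g j" for j
    proof -
      have "f j = of_real (b j) * ((x ^ j - 1) + (1 - cbeta x)) / cbeta x"
        using c0 by (simp add: f_def field_simps)
      then have "norm (f j) = b j * norm ((x ^ j - 1) + (1 - cbeta x)) / norm (cbeta x)"
        using b_nonneg[of j] by (simp add: norm_mult norm_divide)
      also have "\<dots> \<le> b j * ((real j + mean) * ?d) / (1 / 2)"
      proof (intro frac_le mult_left_mono b_nonneg c)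
        have "norm (x ^ j - 1 ^ j) \<le> real j * ?d" using x by (intro norm_power_diff) auto
        moreover have "norm (1 - cbeta x) \<le> mean * ?d" using cbeta_lipschitz[OF x] by (simp add: norm_minus_commute)
        ultimately have "norm (x ^ j - 1) + norm (1 - cbeta x) \<le> (real j + mean) * ?d"
          unfolding distrib_right power_one by (rule add_mono)
        then show "norm (x ^ j - 1 + (1 - cbeta x)) \<le> (real j + mean) * ?d"
          by (rule order_trans[OF norm_triangle_ineq])
      qed (use b_nonneg m0 in auto)
      finally show ?thesis by (simp add: g_def mult_ac)
    qed
    have gR: "(\<lambda>j. g j * R' ^ j) = (\<lambda>j. 2 * ?d * ((real j + mean) * b j * R' ^ j))"
      by (simp add: g_def fun_eq_iff mult_ac)
    have sg: "summable (\<lambda>j. g j * R' ^ j)" unfolding gR by (intro summable_mult sG)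
    have sgv: "(\<Sum>j. g j * R' ^ j) = 2 * ?d * G" unfolding gR G_def by (rule suminf_mult[OF sG])
    have R1: "R' \<ge> 1" using R'(1) by linarith
    have "f sums (cbeta x / cbeta x - 1)" unfolding f_def
      by (intro sums_diff sums_divide sums_cbeta x sums_b_complex)
    then have f0: "suminf f = 0" using c0 by (simp add: sums_iff)
    have nth: "norm (fps_nth (cH - gH x (cbeta x)) m) \<le> 2 * ?d * G * (1 / R') ^ m" for m
    proof -
      have "fps_nth (cH - gH x (cbeta x)) m = (\<Sum>j\<le>m. f j)"
        by (simp add: gH_def f_def sum_subtractf)
      also have "\<dots> = suminf f - (\<Sum>j. f (j + Suc m))"
        using suminf_split_initial_segment[OF tail_norm_le(1)[OF fg R1 sg], of "Suc m"]
        by (simp add: lessThan_Suc_atMost)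
      finally have "norm (fps_nth (cH - gH x (cbeta x)) m) = norm (\<Sum>j. f (j + Suc m))" using f0 by simp
      also have "\<dots> \<le> 2 * ?d * G / R' ^ Suc m" using tail_norm_le(2)[OF fg R1 sg, of "Suc m"] unfolding sgv .
      also have "\<dots> \<le> 2 * ?d * G / R' ^ m"
        using G0 R' by (intro divide_left_mono) auto
      finally show ?thesis by (simp add: power_divide)
    qed
    have geo: "summable (\<lambda>m. (1 / R') ^ m)" using R' by (intro summable_geometric) auto
    have "l1 n (cH - gH x (cbeta x)) \<le> (\<Sum>m\<le>n. 2 * ?d * G * (1 / R') ^ m)"
      unfolding l1_def by (intro sum_mono nth)
    also have "\<dots> = 2 * ?d * G * (\<Sum>m\<le>n. (1 / R') ^ m)" by (simp add: sum_distrib_left)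
    also have "\<dots> \<le> 2 * ?d * G * (\<Sum>m. (1 / R') ^ m)"
      using G0 R' by (intro mult_left_mono sum_le_suminf geo) auto
    also have "(\<Sum>m. (1 / R') ^ m) = 1 / (1 - 1 / R')" using R' by (intro suminf_geometric) auto
    finally show ?thesis by (simp add: A_def mult_ac)
  qed
  with A0 show ?thesis by (rule that)
qed

text \<open>The tilted value at \<open>n\<close> differs from \<open>q n\<close> by at most the l1
  distance, truncated at \<open>n\<close>, of the two inverses. The perturbation bound is uniform in
  the truncation, so \<open>x n\<close> may approach 1 at any speed.\<close>

lemma tilt_limit:
  assumes x1: "\<And>n. norm (x n) \<le> 1" and x: "x \<longlonglongrightarrow> 1"
  shows "(\<lambda>n. \<Sum>k\<le>n. of_real (hit k n) * x n ^ n / cbeta (x n) ^ k) \<longlonglongrightarrow> of_real (1 / mean)"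
proof -
  obtain K l where K: "0 < K" "0 < l" "l < 1" "\<And>n. norm (fps_nth (inverse cH) n) \<le> K * l ^ n"
    using inverse_cH_decay by blast
  obtain A where A: "A \<ge> 0" "\<And>x n. norm x \<le> 1 \<Longrightarrow> norm (cbeta x) \<ge> 1 / 2 \<Longrightarrow> l1 n (cH - gH x (cbeta x)) \<le> A * norm (x - 1)"
    by (rule tilt_l1) (rule that)
  define w where "w = (\<Sum>n. K * l ^ n)"
  have geo: "summable (\<lambda>n. K * l ^ n)" using K by (intro summable_mult summable_geometric) auto
  have w: "l1 n (inverse cH) \<le> w" for n
  proof -
    have "l1 n (inverse cH) \<le> (\<Sum>j\<le>n. K * l ^ j)" unfolding l1_def by (intro sum_mono K)
    also have "\<dots> \<le> w" unfolding w_def using K by (intro sum_le_suminf geo) auto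
    finally show ?thesis .
  qed
  have x0: "(\<lambda>n. norm (x n - 1)) \<longlonglongrightarrow> 0"
    using tendsto_norm[OF tendsto_diff[OF x tendsto_const[of 1]]] by simp
  have "(\<lambda>n. w * (A * norm (x n - 1))) \<longlonglongrightarrow> w * (A * 0)" by (intro tendsto_intros x0)
  then have e1: "\<forall>\<^sub>F n in sequentially. w * (A * norm (x n - 1)) < 1 / 2" by (rule order_tendstoD) simp
  have "(\<lambda>n. mean * norm (x n - 1)) \<longlonglongrightarrow> mean * 0" by (intro tendsto_intros x0)
  then have e2: "\<forall>\<^sub>F n in sequentially. mean * norm (x n - 1) < 1 / 2" by (rule order_tendstoD) simp
  have ev: "\<forall>\<^sub>F n in sequentially. norm ((\<Sum>k\<le>n. of_real (hit k n) * x n ^ n / cbeta (x n) ^ k) - of_real (q n))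
      \<le> 2 * w * w * (A * norm (x n - 1))"
    using e1 e2
  proof eventually_elim
    case (elim n)
    have "norm (cbeta (x n) - 1) < 1 / 2" using cbeta_lipschitz[OF x1[of n]] elim(2) by linarith
    then have c: "norm (cbeta (x n)) \<ge> 1 / 2"
      using norm_triangle_ineq4[of "cbeta (x n)" "cbeta (x n) - 1"] by simp
    have "(\<Sum>k\<le>n. of_real (hit k n) * x n ^ n / cbeta (x n) ^ k) - of_real (q n) =
        (\<Sum>j\<le>n. fps_nth (inverse (gH (x n) (cbeta (x n))) - inverse cH) j)"
      unfolding gH_renewal q_complex by (simp add: sum_subtractf)
    also have "norm \<dots> \<le> l1 n (inverse (gH (x n) (cbeta (x n))) - inverse cH)"
      unfolding l1_def by (rule norm_sum)
    also have "\<dots> \<le> 2 * w * w * (A * norm (x n - 1))"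
      using w A(2)[OF x1 c] elim(1) by (intro l1_inverse_perturb) auto
    finally show ?case .
  qed
  have "(\<lambda>n. 2 * w * w * (A * norm (x n - 1))) \<longlonglongrightarrow> 2 * w * w * (A * 0)" by (intro tendsto_intros x0)
  then have lim0: "(\<lambda>n. (\<Sum>k\<le>n. of_real (hit k n) * x n ^ n / cbeta (x n) ^ k) - of_real (q n)) \<longlonglongrightarrow> 0"
    using Lim_null_comparison[OF ev] by simp
  have "(\<lambda>n. ((\<Sum>k\<le>n. of_real (hit k n) * x n ^ n / cbeta (x n) ^ k) - of_real (q n)) + of_real (q n)) \<longlonglongrightarrow> 0 + of_real (1 / mean)"
    by (intro tendsto_add lim0 tendsto_of_real q_tendsto)
  then show ?thesis by simp
qed

text \<open>Third-order Taylor expansion of the centred characteristic function of one size.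
  \<open>C\<close> adds a bound for a sixth of the third absolute central moment and the error of
  \<open>1 - u\<close> against \<open>exp (- u)\<close> for
  \<open>u = var * h^2 / 2\<close>.\<close>

lemma centred_cbeta_approx:
  obtains C where "C \<ge> 0" "\<And>h. \<bar>h\<bar> \<le> 1 \<Longrightarrow> norm (cis (- (mean * h)) * cbeta (cis h) - of_real (exp (- (var * h\<^sup>2 / 2)))) \<le> C * \<bar>h\<bar> ^ 3"
proof -
  define S3 where "S3 = (\<Sum>m. b m * (real m + mean) ^ 3)"
  have s3: "summable (\<lambda>m. b m * (real m + mean) ^ 3)"
  proof -
    have "summable (\<lambda>m. real m ^ 3 * b m + 3 * mean * (real m ^ 2 * b m) + 3 * mean\<^sup>2 * (real m ^ 1 * b m) + mean ^ 3 * (real m ^ 0 * b m))"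
      by (intro summable_add summable_mult summable_b_mom)
    then show ?thesis by (simp add: power3_eq_cube power2_eq_square algebra_simps)
  qed
  define C where "C = S3 / 6 + var\<^sup>2 / 8 * exp (var / 2)"
  have m0: "mean \<ge> 0" using mean_ge_1 by linarith
  have S30: "S3 \<ge> 0" unfolding S3_def using m0 by (intro suminf_nonneg s3) (auto simp: b_nonneg)
  have C0: "C \<ge> 0" unfolding C_def using S30 by simp
  have "norm (cis (- (mean * h)) * cbeta (cis h) - of_real (exp (- (var * h\<^sup>2 / 2)))) \<le> C * \<bar>h\<bar> ^ 3"
    if h: "\<bar>h\<bar> \<le> 1" for h
  proof -
    define y where "y m = (real m - mean) * h" for m
    let ?t = "\<lambda>m. 1 + \<i> * of_real (y m) - of_real ((y m)\<^sup>2 / 2)"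
    have s1: "(\<lambda>m. of_real (b m) * cis (y m)) sums (cis (- (mean * h)) * cbeta (cis h))"
    proof -
      have "(\<lambda>m. cis (- (mean * h)) * (of_real (b m) * cis h ^ m)) sums (cis (- (mean * h)) * cbeta (cis h))"
        by (intro sums_mult sums_cbeta) simp
      moreover have "cis (- (mean * h)) * (of_real (b m) * cis h ^ m) = of_real (b m) * cis (y m)" for m
      proof -
        have "cis (- (mean * h)) * cis (real m * h) = cis (y m)" by (simp add: cis_mult y_def algebra_simps)
        moreover have "cis (- (mean * h)) * (of_real (b m) * cis h ^ m) =
            of_real (b m) * (cis (- (mean * h)) * cis (real m * h))" by (simp only: Complex.DeMoivre mult.left_commute)
        ultimately show ?thesis by (simp only:)
      qed
      ultimately show ?thesis by simp
    qed
    have s2: "(\<lambda>m. of_real (b m) * ?t m) sums of_real (1 - var * h\<^sup>2 / 2)"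
    proof -
      have "(\<lambda>m. real m * b m - mean * b m) sums (mean - mean * 1)"
        using summable_b_mom[of 1] by (intro sums_diff sums_mult b_sums) (simp add: mean_def summable_sums)
      then have "(\<lambda>m. (real m - mean) * b m) sums 0" by (simp add: algebra_simps)
      then have a: "(\<lambda>m. complex_of_real ((real m - mean) * b m)) sums 0"
        using sums_of_real[of _ 0, where 'a=complex] by fastforce
      have bb: "(\<lambda>m. complex_of_real ((real m - mean)\<^sup>2 * b m)) sums of_real var"
        unfolding var_def by (intro sums_of_real summable_sums summable_var)
      have "(\<lambda>m. of_real (b m) + \<i> * of_real h * complex_of_real ((real m - mean) * b m)
          - of_real (h\<^sup>2 / 2) * complex_of_real ((real m - mean)\<^sup>2 * b m)) sums
          (1 + \<i> * of_real h * 0 - of_real (h\<^sup>2 / 2) * of_real var)"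
        by (intro sums_add sums_diff sums_mult a bb sums_b_complex)
      moreover have "of_real (b m) + \<i> * of_real h * complex_of_real ((real m - mean) * b m)
          - of_real (h\<^sup>2 / 2) * complex_of_real ((real m - mean)\<^sup>2 * b m) = of_real (b m) * ?t m" for m
        by (simp add: y_def power2_eq_square field_simps)
      ultimately show ?thesis by (simp add: mult_ac)
    qed
    have "norm (\<Sum>m. of_real (b m) * cis (y m) - of_real (b m) * ?t m) \<le> (\<Sum>m. \<bar>h\<bar> ^ 3 / 6 * (b m * (real m + mean) ^ 3))"
    proof (rule norm_suminf_le)
      fix m
      have "norm (of_real (b m) * cis (y m) - of_real (b m) * ?t m) = b m * norm (cis (y m) - ?t m)"
        using b_nonneg[of m] unfolding right_diff_distrib[symmetric] by (simp add: norm_mult)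
      also have "\<dots> \<le> b m * (\<bar>y m\<bar> ^ 3 / 6)" by (intro mult_left_mono cis_approx b_nonneg)
      also have "\<dots> \<le> b m * (((real m + mean) * \<bar>h\<bar>) ^ 3 / 6)"
        unfolding y_def abs_mult using m0
        by (intro mult_left_mono divide_right_mono power_mono mult_right_mono b_nonneg) auto
      finally show "norm (of_real (b m) * cis (y m) - of_real (b m) * ?t m) \<le> \<bar>h\<bar> ^ 3 / 6 * (b m * (real m + mean) ^ 3)"
        by (simp add: power_mult_distrib mult_ac)
    qed (intro summable_mult s3)
    also have "\<dots> = \<bar>h\<bar> ^ 3 / 6 * S3" unfolding S3_def by (rule suminf_mult[OF s3])
    finally have 1: "norm (cis (- (mean * h)) * cbeta (cis h) - of_real (1 - var * h\<^sup>2 / 2)) \<le> \<bar>h\<bar> ^ 3 / 6 * S3"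
      using sums_unique[OF sums_diff[OF s1 s2]] by simp
    define u where "u = var * h\<^sup>2 / 2"
    have h2: "h\<^sup>2 \<le> 1" using h by (simp add: abs_square_le_1)
    have u: "0 \<le> u" "u \<le> var / 2" using var_pos h2 by (auto simp: u_def intro: mult_left_le)
    have h4: "(h\<^sup>2)\<^sup>2 \<le> \<bar>h\<bar> ^ 3"
    proof -
      have "(h\<^sup>2)\<^sup>2 = \<bar>h\<bar> ^ 4" by (simp flip: power_mult)
      also have "\<dots> \<le> \<bar>h\<bar> ^ 3" using h by (intro power_decreasing) auto
      finally show ?thesis .
    qed
    have "exp (- u) - (1 - u) \<le> u\<^sup>2 / 2 * exp u" using exp_le_quad[of "- u"] u by simp
    also have "\<dots> \<le> u\<^sup>2 / 2 * exp (var / 2)" using u by (intro mult_left_mono) auto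
    also have "u\<^sup>2 = var\<^sup>2 / 4 * (h\<^sup>2)\<^sup>2" by (simp add: u_def power2_eq_square)
    also have "var\<^sup>2 / 4 * (h\<^sup>2)\<^sup>2 / 2 * exp (var / 2) \<le> var\<^sup>2 / 4 * \<bar>h\<bar> ^ 3 / 2 * exp (var / 2)"
      using h4 by (intro mult_right_mono divide_right_mono mult_left_mono) auto
    finally have "exp (- u) - (1 - u) \<le> \<bar>h\<bar> ^ 3 * (var\<^sup>2 / 8 * exp (var / 2))" by (simp add: mult_ac)
    moreover have "exp (- u) - (1 - u) \<ge> 0" using exp_ge_add_one_self[of "- u"] by linarith
    ultimately have "norm (of_real (1 - u) - of_real (exp (- u)) :: complex) \<le> \<bar>h\<bar> ^ 3 * (var\<^sup>2 / 8 * exp (var / 2))"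
      unfolding of_real_diff[symmetric] norm_of_real by simp
    then have "norm (cis (- (mean * h)) * cbeta (cis h) - of_real (exp (- u))) \<le> \<bar>h\<bar> ^ 3 / 6 * S3 + \<bar>h\<bar> ^ 3 * (var\<^sup>2 / 8 * exp (var / 2))"
      using norm_triangle_le[OF add_mono[OF 1[folded u_def]]] by fastforce
    then show ?thesis unfolding u_def C_def by (simp add: algebra_simps)
  qed
  with C0 show ?thesis by (rule that)
qed

definition dev :: "nat \<Rightarrow> nat \<Rightarrow> real" where "dev n k = (real k * mean - real n) / sqrt (real n)"

lemma exp_moment_bound_dev:
  "\<exists>K>0. \<forall>\<^sub>F n in sequentially. (\<Sum>k\<le>n. hit k n * exp \<bar>dev n k\<bar>) \<le> K"
  unfolding dev_def by (rule exp_moment_bound) blast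

text \<open>For \<open>x = cis (\<theta> / sqrt n)\<close> the tilting factor
  \<open>x^n / cbeta x ^ k\<close> equals \<open>cis (- (\<theta> * dev n k)) / \<psi>^k\<close>,
  with \<open>\<psi>\<close> the centred characteristic function of one size. As
  \<open>k / n\<close> concentrates at \<open>1 / mean\<close>, \<open>1 / \<psi>^k\<close> is
  nearly the constant \<open>exp a\<close>. So the tilted sum, which tends to
  \<open>1 / mean\<close> by \<open>tilt_limit\<close>, is nearly \<open>exp a\<close> times the sum
  in question.\<close>

lemma char_limit_dev:
  "(\<lambda>n. \<Sum>k\<le>n. of_real (hit k n) * cis (- (\<theta> * dev n k))) \<longlonglongrightarrow> of_real (exp (- (var * \<theta>\<^sup>2 / (2 * mean))) / mean)"
proof -
  define h where "h n = \<theta> / sqrt (real n)" for n :: nat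
  define x where "x n = cis (h n)" for n
  define a where "a = var * \<theta>\<^sup>2 / (2 * mean)"
  define M where "M = var * \<theta>\<^sup>2 / 2"
  define \<psi> where "\<psi> n = cis (- (mean * h n)) * cbeta (x n)" for n
  define \<xi> where "\<xi> n = exp (- (var * (h n)\<^sup>2 / 2))" for n
  define Z where "Z n = (\<Sum>k\<le>n. of_real (hit k n) * cis (- (\<theta> * dev n k)))" for n
  obtain C where C: "C \<ge> 0" "\<And>h. \<bar>h\<bar> \<le> 1 \<Longrightarrow> norm (cis (- (mean * h)) * cbeta (cis h) - of_real (exp (- (var * h\<^sup>2 / 2)))) \<le> C * \<bar>h\<bar> ^ 3"
    by (rule centred_cbeta_approx) (rule that)
  obtain K where K: "K > 0" "\<forall>\<^sub>F n in sequentially. (\<Sum>k\<le>n. hit k n * exp \<bar>dev n k\<bar>) \<le> K"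
    using exp_moment_bound_dev by blast
  have m1: "mean \<ge> 1" by (rule mean_ge_1)
  have M0: "M \<ge> 0" using var_pos by (simp add: M_def)
  have aM: "a \<le> M" "a \<ge> 0"
  proof -
    have "M / mean \<le> M / 1" using M0 m1 by (intro divide_left_mono) auto
    then show "a \<le> M" by (simp add: a_def M_def)
    show "a \<ge> 0" using var_pos m1 by (simp add: a_def)
  qed
  \<comment> \<open>\<open>D\<close> measures the replacement of \<open>\<psi> ^ k\<close> by the
    Gaussian \<open>\<xi> ^ k\<close>, and \<open>D'\<close> the replacement of \<open>k / n\<close>
    by \<open>1 / mean\<close>; both errors carry a further \<open>1 / sqrt n\<close>.\<close>
  define D where "D = 2 * exp M * exp M * C * \<bar>\<theta>\<bar> ^ 3"
  define D' where "D' = exp M * M / mean"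
  have D0: "D \<ge> 0" "D' \<ge> 0" using C M0 m1 by (auto simp: D_def D'_def)
  have h0: "h \<longlonglongrightarrow> 0" unfolding h_def by real_asymp
  have xl: "x \<longlonglongrightarrow> 1"
  proof -
    have "(\<lambda>n. cis (h n)) \<longlonglongrightarrow> cis 0" by (intro tendsto_intros h0)
    then show ?thesis by (simp add: x_def[abs_def])
  qed
  have tl: "(\<lambda>n. \<Sum>k\<le>n. of_real (hit k n) * x n ^ n / cbeta (x n) ^ k) \<longlonglongrightarrow> of_real (1 / mean)"
    by (rule tilt_limit[OF _ xl]) (simp add: x_def)
  have el: "(\<lambda>n. C * \<bar>\<theta>\<bar> ^ 3 / sqrt (real n)) \<longlonglongrightarrow> 0" by real_asymp
  have eh: "\<forall>\<^sub>F n in sequentially. norm (h n) < 1" using tendsto_norm_zero[OF h0] by (rule order_tendstoD) simp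
  have ee: "\<forall>\<^sub>F n in sequentially. C * \<bar>\<theta>\<bar> ^ 3 / sqrt (real n) < exp (- M) / 2" using el by (rule order_tendstoD) simp
  have ev: "\<forall>\<^sub>F n in sequentially. norm ((\<Sum>k\<le>n. of_real (hit k n) * x n ^ n / cbeta (x n) ^ k) - of_real (exp a) * Z n)
      \<le> (D + D') * K / sqrt (real n)"
    using K(2) eh ee eventually_gt_at_top[of 0]
  proof eventually_elim
    case (elim n)
    have n: "real n > 0" using elim(4) by simp
    have h2: "(h n)\<^sup>2 = \<theta>\<^sup>2 / real n" by (simp add: h_def power_divide)
    have h3: "\<bar>h n\<bar> ^ 3 = \<bar>\<theta>\<bar> ^ 3 / (real n * sqrt (real n))"
      by (simp add: h_def power_divide abs_divide power3_eq_cube)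
    define \<epsilon> where "\<epsilon> = C * \<bar>\<theta>\<bar> ^ 3 / sqrt (real n)"
    have \<epsilon>: "\<epsilon> < exp (- M) / 2" "\<epsilon> \<ge> 0" using elim(3) C(1) by (auto simp: \<epsilon>_def)
    have \<psi>\<xi>: "norm (\<psi> n - of_real (\<xi> n)) \<le> C * \<bar>h n\<bar> ^ 3"
      using C(2)[of "h n"] elim(2) by (simp add: \<psi>_def \<xi>_def x_def)
    have \<psi>1: "norm (\<psi> n) \<le> 1" using cbeta_norm_le[of "x n"] by (simp add: \<psi>_def x_def norm_mult)
    have \<xi>1: "norm (of_real (\<xi> n) :: complex) \<le> 1" using var_pos by (simp add: \<xi>_def)
    have trm: "norm (of_real (hit k n) * x n ^ n / cbeta (x n) ^ k - of_real (exp a) * (of_real (hit k n) * cis (- (\<theta> * dev n k))))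
        \<le> hit k n * exp \<bar>dev n k\<bar> * ((D + D') / sqrt (real n))" if k: "k \<le> n" for k
    proof -
      have kn: "real k \<le> real n" using k by simp
      have xik: "\<xi> n ^ k = exp (- (M * (real k / real n)))"
        unfolding \<xi>_def h2 exp_of_nat_mult[symmetric] by (rule arg_cong[of _ _ exp]) (simp add: M_def mult_ac)
      have kM: "M * (real k / real n) \<le> M" using kn n M0 by (intro mult_left_le) auto
      have xik0: "\<xi> n ^ k \<ge> exp (- M)" unfolding xik using kM by simp
      \<comment> \<open>At most \<open>n\<close> errors of order \<open>n^(-3/2)\<close> accumulate,
        which leaves order \<open>n^(-1/2)\<close>.\<close>
      have "norm (\<psi> n ^ k - of_real (\<xi> n) ^ k) \<le> real k * norm (\<psi> n - of_real (\<xi> n))"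
        by (rule norm_power_diff[OF \<psi>1 \<xi>1])
      also have "\<dots> \<le> real n * (C * \<bar>h n\<bar> ^ 3)" using \<psi>\<xi> kn by (intro mult_mono) auto
      also have "\<dots> = \<epsilon>" using n by (simp add: h3 \<epsilon>_def)
      finally have d1: "norm (\<psi> n ^ k - of_real (\<xi> n ^ k)) \<le> \<epsilon>" by simp
      have "norm (of_real (\<xi> n ^ k) :: complex) - norm (\<psi> n ^ k) \<le> \<epsilon>"
        using d1 norm_triangle_ineq3[of "of_real (\<xi> n ^ k)" "\<psi> n ^ k"] by (simp add: norm_minus_commute)
      moreover have "norm (of_real (\<xi> n ^ k) :: complex) = \<xi> n ^ k" by (simp add: xik)
      ultimately have psik: "norm (\<psi> n ^ k) \<ge> exp (- M) / 2" using xik0 \<epsilon>(1) by linarith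
      then have psi0: "\<psi> n ^ k \<noteq> 0" by (metis exp_gt_zero half_gt_zero_iff norm_zero not_le)
      have d2: "norm (1 / \<psi> n ^ k - 1 / of_real (\<xi> n ^ k)) \<le> D / sqrt (real n)"
      proof -
        have xz: "\<xi> n ^ k > 0" using xik0 by (rule less_le_trans[rotated]) simp
        have "1 / \<psi> n ^ k - 1 / of_real (\<xi> n ^ k) = - (\<psi> n ^ k - of_real (\<xi> n ^ k)) / (\<psi> n ^ k * of_real (\<xi> n ^ k))"
        proof -
          have "1 / z - 1 / w = - (z - w) / (z * w)" if "z \<noteq> 0" "w \<noteq> 0" for z w :: complex
            using that by (simp add: field_simps)
          moreover have "of_real (\<xi> n ^ k) \<noteq> (0 :: complex)" unfolding of_real_eq_0_iff using xz by linarith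
          ultimately show ?thesis using psi0 by blast
        qed
        then have "norm (1 / \<psi> n ^ k - 1 / of_real (\<xi> n ^ k)) = norm (\<psi> n ^ k - of_real (\<xi> n ^ k)) / (norm (\<psi> n ^ k) * \<xi> n ^ k)"
          using xz by (simp only: norm_divide norm_mult norm_minus_cancel norm_of_real abs_of_pos)
        also have "\<dots> \<le> \<epsilon> / (exp (- M) / 2 * exp (- M))"
          using d1 psik xik0 \<epsilon>(2) by (intro frac_le mult_mono mult_pos_pos) auto
        also have "\<dots> = D / sqrt (real n)" by (simp add: \<epsilon>_def D_def exp_minus field_simps)
        finally show ?thesis .
      qed
      have d3: "\<bar>1 / \<xi> n ^ k - exp a\<bar> \<le> D' * \<bar>dev n k\<bar> / sqrt (real n)"
      proof -
        have "1 / \<xi> n ^ k = exp (M * (real k / real n))" by (simp add: xik exp_minus inverse_eq_divide)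
        then have "\<bar>1 / \<xi> n ^ k - exp a\<bar> \<le> exp M * \<bar>M * (real k / real n) - a\<bar>"
          using exp_diff_le[OF kM aM(1)] by simp
        also have "M * (real k / real n) - a = M / mean * (dev n k / sqrt (real n))"
          using n m1 by (simp add: a_def M_def dev_def field_simps)
        also have "exp M * \<bar>M / mean * (dev n k / sqrt (real n))\<bar> = D' * \<bar>dev n k\<bar> / sqrt (real n)"
          using M0 m1 by (simp add: D'_def abs_mult abs_divide)
        finally show ?thesis .
      qed
      have le: "norm (1 / \<psi> n ^ k - of_real (exp a)) \<le> exp \<bar>dev n k\<bar> * ((D + D') / sqrt (real n))"
      proof -
        have "1 / of_real (\<xi> n ^ k) - of_real (exp a) = (of_real (1 / \<xi> n ^ k - exp a) :: complex)"
          by (simp only: of_real_1 of_real_diff of_real_divide)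
        then have d3': "norm (1 / of_real (\<xi> n ^ k) - of_real (exp a) :: complex) \<le> D' * \<bar>dev n k\<bar> / sqrt (real n)"
          using d3 by (simp only: norm_of_real)
        have "norm (1 / \<psi> n ^ k - of_real (exp a)) \<le> D / sqrt (real n) + D' * \<bar>dev n k\<bar> / sqrt (real n)"
          using norm_triangle_le[OF add_mono[OF d2 d3']] by simp
        \<comment> \<open>Both terms receive the factor \<open>exp \<bar>dev n k\<bar>\<close>, so
          that one exponential moment bounds the sum over \<open>k\<close>.\<close>
        also have "\<dots> \<le> D * exp \<bar>dev n k\<bar> / sqrt (real n) + D' * exp \<bar>dev n k\<bar> / sqrt (real n)"
        proof (intro add_mono divide_right_mono)
          show "D \<le> D * exp \<bar>dev n k\<bar>" using mult_left_mono[of 1 "exp \<bar>dev n k\<bar>" D] D0 by simp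
          show "D' * \<bar>dev n k\<bar> \<le> D' * exp \<bar>dev n k\<bar>"
          proof (rule mult_left_mono)
            show "\<bar>dev n k\<bar> \<le> exp \<bar>dev n k\<bar>" using exp_ge_add_one_self[of "\<bar>dev n k\<bar>"] by linarith
          qed (rule D0)
        qed auto
        finally show ?thesis by (simp add: add_divide_distrib algebra_simps)
      qed
      have c: "x n ^ n / cbeta (x n) ^ k = cis (- (\<theta> * dev n k)) / \<psi> n ^ k"
      proof -
        have e1: "x n ^ n = cis (real n * h n)" unfolding x_def by (rule Complex.DeMoivre)
        have e2: "\<psi> n ^ k = cis (real k * (- (mean * h n))) * cbeta (x n) ^ k"
          unfolding \<psi>_def power_mult_distrib Complex.DeMoivre ..
        have e3: "cis (- (\<theta> * dev n k)) = cis (real n * h n) * cis (real k * (- (mean * h n)))"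
          unfolding cis_mult by (rule arg_cong[of _ _ cis]) (simp add: h_def dev_def diff_divide_distrib algebra_simps)
        show ?thesis unfolding e1 e2 e3 by simp
      qed
      have "of_real (hit k n) * x n ^ n / cbeta (x n) ^ k - of_real (exp a) * (of_real (hit k n) * cis (- (\<theta> * dev n k)))
          = of_real (hit k n) * cis (- (\<theta> * dev n k)) * (1 / \<psi> n ^ k - of_real (exp a))"
        unfolding times_divide_eq_right[symmetric] c by (simp add: algebra_simps)
      then have "norm (of_real (hit k n) * x n ^ n / cbeta (x n) ^ k - of_real (exp a) * (of_real (hit k n) * cis (- (\<theta> * dev n k))))
          = hit k n * norm (1 / \<psi> n ^ k - of_real (exp a))"
        using hit_nonneg[of k n] by (simp only: norm_mult norm_of_real norm_cis abs_of_nonneg mult_1_right)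
      also have "\<dots> \<le> hit k n * (exp \<bar>dev n k\<bar> * ((D + D') / sqrt (real n)))"
        by (intro mult_left_mono le hit_nonneg)
      finally show ?thesis by (simp add: mult_ac)
    qed
    have "norm ((\<Sum>k\<le>n. of_real (hit k n) * x n ^ n / cbeta (x n) ^ k) - of_real (exp a) * Z n) \<le>
        (\<Sum>k\<le>n. hit k n * exp \<bar>dev n k\<bar> * ((D + D') / sqrt (real n)))"
      unfolding Z_def sum_distrib_left sum_subtractf[symmetric] using trm by (intro sum_norm_le) auto
    also have "\<dots> = (\<Sum>k\<le>n. hit k n * exp \<bar>dev n k\<bar>) * ((D + D') / sqrt (real n))" by (rule sum_distrib_right[symmetric])
    also have "\<dots> \<le> K * ((D + D') / sqrt (real n))" using elim(1) D0 by (intro mult_right_mono) auto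
    finally show ?case by (simp add: mult_ac)
  qed
  have "(\<lambda>n. (D + D') * K / sqrt (real n)) \<longlonglongrightarrow> 0" by real_asymp
  from Lim_null_comparison[OF ev this]
  have "(\<lambda>n. (\<Sum>k\<le>n. of_real (hit k n) * x n ^ n / cbeta (x n) ^ k) -
      ((\<Sum>k\<le>n. of_real (hit k n) * x n ^ n / cbeta (x n) ^ k) - of_real (exp a) * Z n)) \<longlonglongrightarrow> of_real (1 / mean) - 0"
    by (intro tendsto_diff tl)
  then have "(\<lambda>n. of_real (exp (- a)) * (of_real (exp a) * Z n)) \<longlonglongrightarrow> of_real (exp (- a)) * of_real (1 / mean)"
    by (intro tendsto_mult tendsto_const) simp
  moreover have "of_real (exp (- a)) * (of_real (exp a) * Z n) = Z n" for n
    by (simp add: exp_minus)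
  ultimately have "Z \<longlonglongrightarrow> of_real (exp (- a)) * of_real (1 / mean)" by (simp only:)
  moreover have "of_real (exp (- a)) * of_real (1 / mean) = (of_real (exp (- a) / mean) :: complex)" by simp
  ultimately have "Z \<longlonglongrightarrow> of_real (exp (- a) / mean)" by (simp only:)
  then show ?thesis unfolding Z_def[abs_def] a_def .
qed

section \<open>Conditional expectation given a hit, and convergence in law\<close>

definition E :: "nat \<Rightarrow> (nat \<Rightarrow> real) \<Rightarrow> real" where "E n f = (\<Sum>k\<le>n. hit k n * f k) / q n"

definition T :: "nat \<Rightarrow> nat \<Rightarrow> real" where "T n k = (real k - real n / mean) / (sqrt var * sqrt (real n / mean ^ 3))"

lemma T_eq: "n > 0 \<Longrightarrow> T n k = sqrt mean / sqrt var * dev n k"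
  using mean_ge_1 var_pos
  by (simp add: T_def dev_def real_sqrt_divide power3_eq_cube real_sqrt_mult field_simps)

lemma q_pos_ev: "\<forall>\<^sub>F n in sequentially. q n > 0"
  using q_tendsto by (rule order_tendstoD) (use mean_ge_1 in simp)

lemma E_add: "E n (\<lambda>k. f k + g k) = E n f + E n g"
  by (simp add: E_def distrib_left sum.distrib add_divide_distrib)

lemma E_cmult: "E n (\<lambda>k. c * f k) = c * E n f"
  by (simp add: E_def sum_distrib_left mult_ac sum_divide_distrib)

lemma E_diff: "E n (\<lambda>k. f k - g k) = E n f - E n g"
  by (simp add: E_def right_diff_distrib sum_subtractf diff_divide_distrib)

lemma E_sum: "E n (\<lambda>k. \<Sum>i\<in>A. f i k) = (\<Sum>i\<in>A. E n (f i))"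
  unfolding E_def sum_distrib_left by (subst sum.swap) (simp add: sum_divide_distrib)

lemma E_const: "q n > 0 \<Longrightarrow> E n (\<lambda>k. c) = c"
  by (simp add: E_def q_def flip: sum_distrib_right)

lemma hit_0: "n > 0 \<Longrightarrow> hit 0 n = 0"
  by (simp add: hit_def)

text \<open>No run of zero components hits a positive size, so only \<open>k \<ge> 1\<close> needs
  comparison. This matters because the weights and bounds below are controlled for
  \<open>k \<ge> 1\<close> only.\<close>

lemma E_mono:
  assumes "n > 0" "\<And>k. 1 \<le> k \<Longrightarrow> k \<le> n \<Longrightarrow> f k \<le> g k"
  shows "E n f \<le> E n g"
  unfolding E_def
proof (intro divide_right_mono sum_mono q_nonneg)
  fix k assume "k \<in> {..n}"
  then show "hit k n * f k \<le> hit k n * g k"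
    using assms hit_0[OF assms(1)] hit_nonneg[of k n] by (cases "k = 0") (auto intro: mult_left_mono)
qed

lemma E_abs_le: "\<bar>E n f\<bar> \<le> E n (\<lambda>k. \<bar>f k\<bar>)"
proof -
  have "\<bar>\<Sum>k\<le>n. hit k n * f k\<bar> \<le> (\<Sum>k\<le>n. \<bar>hit k n * f k\<bar>)" by (rule sum_abs)
  also have "\<dots> = (\<Sum>k\<le>n. hit k n * \<bar>f k\<bar>)" by (simp add: abs_mult hit_nonneg)
  finally show ?thesis using q_nonneg[of n] by (simp add: E_def abs_divide divide_right_mono)
qed

text \<open>Any power of \<open>1 + T^2\<close> is dominated by a multiple of
  \<open>exp \<bar>dev n k\<bar>\<close>, whose conditional mean is bounded.\<close>

lemma T_moment_bound: "\<exists>C\<ge>0. \<forall>\<^sub>F n in sequentially. E n (\<lambda>k. (1 + (T n k)\<^sup>2) ^ M) \<le> C"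
proof -
  obtain K where K: "K > 0" "\<forall>\<^sub>F n in sequentially. (\<Sum>k\<le>n. hit k n * exp \<bar>dev n k\<bar>) \<le> K"
    using exp_moment_bound_dev by blast
  define s where "s = sqrt mean / sqrt var"
  have s: "s > 0" using mean_ge_1 var_pos by (simp add: s_def)
  define B where "B = s ^ (2 * M) * fact (2 * M) * exp (1 / s)"
  have B: "B > 0" unfolding B_def using s by (intro mult_pos_pos) auto
  have bd: "(1 + t\<^sup>2) ^ M \<le> B * exp \<bar>y\<bar>" if "t = s * y" for t y
  proof -
    have "1 + t\<^sup>2 \<le> (1 + \<bar>t\<bar>)\<^sup>2" by (simp add: power2_sum)
    then have "(1 + t\<^sup>2) ^ M \<le> ((1 + \<bar>t\<bar>)\<^sup>2) ^ M" by (intro power_mono) auto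
    also have "\<dots> = s ^ (2 * M) * ((1 + \<bar>t\<bar>) / s) ^ (2 * M)" using s by (simp add: power_divide power_mult)
    also have "\<dots> \<le> s ^ (2 * M) * (fact (2 * M) * exp ((1 + \<bar>t\<bar>) / s))"
      using s by (intro mult_left_mono power_le_fact_exp) auto
    also have "(1 + \<bar>t\<bar>) / s = 1 / s + \<bar>y\<bar>" using s that by (simp add: abs_mult add_divide_distrib)
    finally show ?thesis by (simp add: B_def exp_add mult_ac)
  qed
  have l: "\<forall>\<^sub>F n in sequentially. q n > 1 / (2 * mean)"
    using q_tendsto by (rule order_tendstoD) (use mean_ge_1 in \<open>simp add: field_simps\<close>)
  have "\<forall>\<^sub>F n in sequentially. E n (\<lambda>k. (1 + (T n k)\<^sup>2) ^ M) \<le> B * K * (2 * mean)"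
    using K(2) l eventually_gt_at_top[of 0]
  proof eventually_elim
    case (elim n)
    have "(\<Sum>k\<le>n. hit k n * (1 + (T n k)\<^sup>2) ^ M) \<le> (\<Sum>k\<le>n. hit k n * (B * exp \<bar>dev n k\<bar>))"
      using elim(3) by (intro sum_mono mult_left_mono hit_nonneg bd) (simp add: T_eq s_def)
    also have "\<dots> = B * (\<Sum>k\<le>n. hit k n * exp \<bar>dev n k\<bar>)" by (simp add: sum_distrib_left mult_ac)
    also have "\<dots> \<le> B * K" using elim(1) B by (intro mult_left_mono) auto
    finally have "E n (\<lambda>k. (1 + (T n k)\<^sup>2) ^ M) \<le> B * K / q n"
      unfolding E_def using elim(2) by (intro divide_right_mono q_nonneg)
    also have "\<dots> \<le> B * K / (1 / (2 * mean))"
    proof (intro divide_left_mono mult_pos_pos)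
      have "0 < 1 / (2 * mean)" using mean_ge_1 by simp
      then show "0 < q n" "0 < 1 / (2 * mean)" using elim(2) by linarith+
    qed (use B K(1) elim(2) in auto)
    finally show ?case by simp
  qed
  moreover have "0 \<le> B * K * (2 * mean)" using B K mean_ge_1 by simp
  ultimately show ?thesis by blast
qed

text \<open>The default value for \<open>q n = 0\<close> makes \<open>MT n\<close> a probability
  measure for every \<open>n\<close>, as Levy's continuity theorem is applied to the whole
  sequence.\<close>

definition core :: "nat \<Rightarrow> nat pmf" where
  "core n = (if q n > 0 then embed_pmf (\<lambda>k. if k \<le> n then hit k n / q n else 0) else return_pmf 0)"

lemma pmf_core:
  assumes q: "q n > 0"
  shows "pmf (core n) k = (if k \<le> n then hit k n / q n else 0)"
proof -
  have "(\<integral>\<^sup>+ k. ennreal (if k \<le> n then hit k n / q n else 0) \<partial>count_space UNIV)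
      = (\<Sum>k\<in>{..n}. ennreal (if k \<le> n then hit k n / q n else 0))"
    by (rule nn_integral_count_space') auto
  also have "\<dots> = (\<Sum>k\<le>n. ennreal (hit k n / q n))" by (intro sum.cong) auto
  also have "\<dots> = ennreal (\<Sum>k\<le>n. hit k n / q n)"
    using q hit_nonneg by (intro sum_ennreal) auto
  also have "(\<Sum>k\<le>n. hit k n / q n) = 1" using q by (simp add: q_def flip: sum_divide_distrib)
  finally have "pmf (embed_pmf (\<lambda>k. if k \<le> n then hit k n / q n else 0)) k = (if k \<le> n then hit k n / q n else 0)"
    using q hit_nonneg by (intro pmf_embed_pmf) auto
  then show ?thesis using q by (simp add: core_def)
qed

lemma integral_core:
  fixes f :: "nat \<Rightarrow> 'b::{banach, second_countable_topology}"
  assumes q: "q n > 0"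
  shows "(LINT k|measure_pmf (core n). f k) = (\<Sum>k\<le>n. (hit k n / q n) *\<^sub>R f k)"
proof -
  have "(LINT k|measure_pmf (core n). f k) = (\<Sum>k\<in>{..n}. pmf (core n) k *\<^sub>R f k)"
  proof (rule integral_measure_pmf)
    fix k assume "k \<in> set_pmf (core n)"
    then have "pmf (core n) k \<noteq> 0" by (simp add: set_pmf_iff)
    then show "k \<in> {..n}" using pmf_core[OF q, of k] by (auto split: if_splits)
  qed simp
  also have "\<dots> = (\<Sum>k\<le>n. (hit k n / q n) *\<^sub>R f k)" by (intro sum.cong) (auto simp: pmf_core[OF q])
  finally show ?thesis .
qed

definition MT :: "nat \<Rightarrow> real measure" where "MT n = distr (measure_pmf (core n)) borel (T n)"

lemma real_distribution_MT: "real_distribution (MT n)"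
  unfolding MT_def by (rule prob_space.real_distribution_distr[OF measure_pmf.prob_space_axioms]) simp

lemma integral_MT:
  fixes G :: "real \<Rightarrow> real"
  assumes "q n > 0" "G \<in> borel_measurable borel"
  shows "integral\<^sup>L (MT n) G = E n (\<lambda>k. G (T n k))"
  unfolding MT_def using assms
  by (simp add: integral_distr integral_core E_def sum_divide_distrib)

lemma weak_conv_MT: "weak_conv_m MT std_normal_distribution"
proof (rule levy_continuity[OF real_distribution_MT real_dist_normal_dist])
  fix u :: real
  \<comment> \<open>Chosen so that \<open>- (\<theta> * dev n k) = u * T n k\<close>; the limiting
    Gaussian then has variance 1, and the factor \<open>1 / mean\<close> is cancelled by the limit
    of \<open>q n\<close>.\<close>
  define \<theta> where "\<theta> = - (u * (sqrt mean / sqrt var))"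
  have m: "mean > 0" using mean_ge_1 by linarith
  have q0: "(of_real (1 / mean) :: complex) \<noteq> 0" using m by simp
  have "(\<lambda>n. (\<Sum>k\<le>n. of_real (hit k n) * cis (- (\<theta> * dev n k))) / of_real (q n)) \<longlonglongrightarrow>
      of_real (exp (- (var * \<theta>\<^sup>2 / (2 * mean))) / mean) / of_real (1 / mean)"
    by (intro tendsto_divide char_limit_dev tendsto_of_real q_tendsto q0)
  moreover have "(of_real (exp (- (var * \<theta>\<^sup>2 / (2 * mean))) / mean) / of_real (1 / mean) :: complex) = char std_normal_distribution u"
  proof -
    have "var * \<theta>\<^sup>2 / (2 * mean) = u\<^sup>2 / 2"
      using m var_pos by (simp add: \<theta>_def power_mult_distrib power_divide)
    then have "exp (- (var * \<theta>\<^sup>2 / (2 * mean))) = exp (- u\<^sup>2 / 2)" by simp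
    then show ?thesis using m unfolding char_std_normal_distribution of_real_divide[symmetric] by simp
  qed
  moreover have "\<forall>\<^sub>F n in sequentially. (\<Sum>k\<le>n. of_real (hit k n) * cis (- (\<theta> * dev n k))) / of_real (q n) = char (MT n) u"
    using q_pos_ev eventually_gt_at_top[of 0]
  proof eventually_elim
    case (elim n)
    have "char (MT n) u = (LINT k|measure_pmf (core n). iexp (u * T n k))"
      unfolding char_def MT_def by (subst integral_distr) auto
    also have "\<dots> = (\<Sum>k\<le>n. (hit k n / q n) *\<^sub>R iexp (u * T n k))" by (rule integral_core[OF elim(1)])
    also have "\<dots> = (\<Sum>k\<le>n. of_real (hit k n) * cis (- (\<theta> * dev n k)) / of_real (q n))"
    proof (rule sum.cong[OF refl])
      fix k
      have "u * T n k = - (\<theta> * dev n k)" using elim(2) by (simp add: \<theta>_def T_eq)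
      then show "(hit k n / q n) *\<^sub>R iexp (u * T n k) = of_real (hit k n) * cis (- (\<theta> * dev n k)) / of_real (q n)"
        by (simp add: cis_conv_exp scaleR_conv_of_real)
    qed
    finally show ?case by (simp add: sum_divide_distrib)
  qed
  ultimately show "(\<lambda>n. char (MT n) u) \<longlonglongrightarrow> char std_normal_distribution u"
    by (simp add: tendsto_cong)
qed

lemma integrable_std_normal_power: "integrable std_normal_distribution (\<lambda>t. (1 + t\<^sup>2) ^ M)"
proof -
  have "(1 + t\<^sup>2) ^ M = (\<Sum>i\<le>M. of_nat (M choose i) * t ^ (2 * (M - i)))" for t :: real
    by (simp add: binomial_ring power_mult)
  then show ?thesis by (simp add: integrable_std_normal_distribution_moment)
qed

text \<open>Convergence in law reaches bounded continuous functions. Truncating \<open>G\<close> at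
  level \<open>L\<close> costs at most \<open>G^2 / L\<close>, and the conditional means of
  \<open>G^2\<close> are bounded, so the cost is small uniformly in \<open>n\<close>.\<close>

theorem E_tendsto:
  fixes G :: "real \<Rightarrow> real"
  assumes cont: "\<And>t. isCont G t" and bd: "\<And>t. \<bar>G t\<bar> \<le> C * (1 + t\<^sup>2) ^ M"
  shows "(\<lambda>n. E n (\<lambda>k. G (T n k))) \<longlonglongrightarrow> integral\<^sup>L std_normal_distribution G"
proof -
  have C0: "C \<ge> 0" using bd[of 0] by simp
  have meas: "G \<in> borel_measurable borel"
    by (intro borel_measurable_continuous_onI continuous_at_imp_continuous_on ballI cont)
  interpret N: real_distribution std_normal_distribution by (rule real_dist_normal_dist)
  obtain C2 where C2: "C2 \<ge> 0" "\<forall>\<^sub>F n in sequentially. E n (\<lambda>k. (1 + (T n k)\<^sup>2) ^ (2 * M)) \<le> C2"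
    using T_moment_bound by blast
  define N2 where "N2 = integral\<^sup>L std_normal_distribution (\<lambda>t. (1 + t\<^sup>2) ^ (2 * M))"
  have N20: "N2 \<ge> 0" unfolding N2_def by (intro integral_nonneg_AE) simp
  have intG: "integrable std_normal_distribution G"
  proof (rule Bochner_Integration.integrable_bound)
    show "integrable std_normal_distribution (\<lambda>t. C * (1 + t\<^sup>2) ^ M)"
      by (intro integrable_mult_right integrable_std_normal_power)
    show "AE x in std_normal_distribution. norm (G x) \<le> norm (C * (1 + x\<^sup>2) ^ M)"
      using bd C0 by (intro AE_I2) (simp add: abs_mult)
  qed (use meas in simp)
  show ?thesis
  proof (rule tendstoI)
    fix e :: real assume e: "e > 0"
    \<comment> \<open>Large enough that \<open>C^2 * x / L < e / 3\<close> for every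
      \<open>x\<close> up to \<open>C2 + N2\<close>; this serves the conditional law and the
      Gaussian law at once. The added 1 keeps \<open>L\<close> positive when
      \<open>C = 0\<close>.\<close>
    define L where "L = 3 * (C\<^sup>2 * (C2 + N2) + 1) / e"
    have part: "C\<^sup>2 / L * x < e / 3" if x: "0 \<le> x" "x \<le> C2 + N2" for x
    proof -
      define X where "X = C\<^sup>2 * (C2 + N2) + 1"
      have "C\<^sup>2 * x \<le> C\<^sup>2 * (C2 + N2)" using x by (intro mult_left_mono) auto
      moreover have "0 \<le> C\<^sup>2 * x" using x by simp
      ultimately have X: "C\<^sup>2 * x < X" "X > 0" by (auto simp: X_def)
      have "C\<^sup>2 / L * x = C\<^sup>2 * x / X * (e / 3)"
      proof -
        have "L = 3 * X / e" unfolding L_def X_def ..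
        then show ?thesis by (simp add: mult_ac)
      qed
      also have "\<dots> < 1 * (e / 3)" using X e by (intro mult_strict_right_mono) auto
      finally show ?thesis by simp
    qed
    have L: "L > 0" unfolding L_def using e C2(1) N20 by (intro divide_pos_pos mult_pos_pos add_nonneg_pos) auto
    define GL where "GL t = max (- L) (min L (G t))" for t
    have GLb: "\<bar>GL t\<bar> \<le> L" for t using L by (auto simp: GL_def)
    have contL: "isCont GL t" for t unfolding GL_def[abs_def] by (intro continuous_max continuous_min continuous_const cont)
    have measL: "GL \<in> borel_measurable borel"
      by (intro borel_measurable_continuous_onI continuous_at_imp_continuous_on ballI contL)
    have diff: "\<bar>G t - GL t\<bar> \<le> C\<^sup>2 / L * (1 + t\<^sup>2) ^ (2 * M)" for t
    proof -
      have "\<bar>G t - GL t\<bar> \<le> (G t)\<^sup>2 / L"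
      proof (cases "\<bar>G t\<bar> \<le> L")
        case True
        then have "GL t = G t" by (auto simp: GL_def)
        then show ?thesis using L by simp
      next
        case False
        then have "\<bar>G t - GL t\<bar> \<le> \<bar>G t\<bar>" using L by (auto simp: GL_def)
        also have "\<dots> \<le> \<bar>G t\<bar> * (\<bar>G t\<bar> / L)" using False L mult_left_mono[of 1 "\<bar>G t\<bar> / L" "\<bar>G t\<bar>"] by simp
        also have "\<dots> = (G t)\<^sup>2 / L" by (simp add: power2_eq_square)
        finally show ?thesis .
      qed
      also have "\<dots> \<le> C\<^sup>2 * (1 + t\<^sup>2) ^ (2 * M) / L"
      proof (rule divide_right_mono)
        have "\<bar>G t\<bar>\<^sup>2 \<le> (C * (1 + t\<^sup>2) ^ M)\<^sup>2" using bd[of t] by (intro power_mono) auto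
        also have "\<dots> = C\<^sup>2 * (1 + t\<^sup>2) ^ (2 * M)" by (simp add: power_mult_distrib power_mult[symmetric] mult.commute)
        finally show "(G t)\<^sup>2 \<le> C\<^sup>2 * (1 + t\<^sup>2) ^ (2 * M)" by simp
      qed (use L in simp)
      finally show ?thesis by simp
    qed
    have intL: "integrable std_normal_distribution GL"
      using GLb measL by (intro N.integrable_const_bound[of _ L]) auto
    have "\<bar>integral\<^sup>L std_normal_distribution G - integral\<^sup>L std_normal_distribution GL\<bar> \<le> C\<^sup>2 / L * N2"
    proof -
      have "\<bar>integral\<^sup>L std_normal_distribution G - integral\<^sup>L std_normal_distribution GL\<bar>
          = \<bar>integral\<^sup>L std_normal_distribution (\<lambda>t. G t - GL t)\<bar>" using intG intL by simp
      also have "\<dots> \<le> integral\<^sup>L std_normal_distribution (\<lambda>t. \<bar>G t - GL t\<bar>)"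
        by (rule integral_abs_bound)
      also have "\<dots> \<le> integral\<^sup>L std_normal_distribution (\<lambda>t. C\<^sup>2 / L * (1 + t\<^sup>2) ^ (2 * M))"
        using intG intL integrable_std_normal_power diff by (intro integral_mono integrable_abs) auto
      finally show ?thesis by (simp add: N2_def)
    qed
    also have "C\<^sup>2 / L * N2 < e / 3" using N20 C2(1) by (intro part) auto
    finally have d1: "\<bar>integral\<^sup>L std_normal_distribution G - integral\<^sup>L std_normal_distribution GL\<bar> < e / 3" .
    have "(\<lambda>n. integral\<^sup>L (MT n) GL) \<longlonglongrightarrow> integral\<^sup>L std_normal_distribution GL"
      using GLb by (intro weak_conv_imp_integral_bdd_continuous_conv[OF real_distribution_MT real_dist_normal_dist weak_conv_MT contL]) auto
    then have "\<forall>\<^sub>F n in sequentially. dist (integral\<^sup>L (MT n) GL) (integral\<^sup>L std_normal_distribution GL) < e / 3"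
      using e by (intro tendstoD) auto
    then show "\<forall>\<^sub>F n in sequentially. dist (E n (\<lambda>k. G (T n k))) (integral\<^sup>L std_normal_distribution G) < e"
      using q_pos_ev C2(2) eventually_gt_at_top[of 0]
    proof eventually_elim
      case (elim n)
      have "\<bar>E n (\<lambda>k. G (T n k)) - E n (\<lambda>k. GL (T n k))\<bar> \<le> E n (\<lambda>k. \<bar>G (T n k) - GL (T n k)\<bar>)"
        unfolding E_diff[symmetric] by (rule E_abs_le)
      also have "\<dots> \<le> E n (\<lambda>k. C\<^sup>2 / L * (1 + (T n k)\<^sup>2) ^ (2 * M))" using elim(4) by (intro E_mono diff)
      also have "\<dots> = C\<^sup>2 / L * E n (\<lambda>k. (1 + (T n k)\<^sup>2) ^ (2 * M))" by (rule E_cmult)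
      also have "\<dots> \<le> C\<^sup>2 / L * C2" using elim(3) L by (intro mult_left_mono) auto
      also have "\<dots> < e / 3" using N20 C2(1) by (intro part) auto
      finally have d2: "\<bar>E n (\<lambda>k. G (T n k)) - E n (\<lambda>k. GL (T n k))\<bar> < e / 3" .
      have tri: "\<bar>x - z\<bar> < e" if "\<bar>x - y\<bar> < e / 3" "\<bar>z - w\<bar> < e / 3" "\<bar>y - w\<bar> < e / 3" for x y z w :: real
        using that by linarith
      have d3: "\<bar>E n (\<lambda>k. GL (T n k)) - integral\<^sup>L std_normal_distribution GL\<bar> < e / 3"
        using elim(1) unfolding integral_MT[OF elim(2) measL] dist_real_def .
      show ?case unfolding dist_real_def by (rule tri[OF d2 d1 d3])
    qed
  qed
qed

end

section \<open>Conditional moments\<close>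

lemma poly_null_at_top:
  fixes p :: "real poly"
  assumes "(\<lambda>n. poly p (real n)) \<longlonglongrightarrow> 0"
  shows "p = 0"
  using assms
proof (induction p)
  case (pCons a p)
  have "(\<lambda>n. inverse (real n) * (poly (pCons a p) (real n) - a)) \<longlonglongrightarrow> 0 * (0 - a)"
    by (intro tendsto_mult tendsto_diff pCons.prems lim_inverse_n tendsto_const)
  moreover have "\<forall>\<^sub>F n in sequentially. inverse (real n) * (poly (pCons a p) (real n) - a) = poly p (real n)"
    using eventually_gt_at_top[of 0] by eventually_elim (simp add: field_simps)
  ultimately have "(\<lambda>n. poly p (real n)) \<longlonglongrightarrow> 0 * (0 - a)" by (rule Lim_transform_eventually)
  then have "(\<lambda>n. poly p (real n)) \<longlonglongrightarrow> 0" by simp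
  then have "p = 0" by (rule pCons.IH)
  then show ?case using pCons.prems by (simp add: LIMSEQ_const_iff)
qed simp

text \<open>Both this bound and \<open>poly_null_at_top\<close> strip the constant coefficient by a
  division by \<open>n\<close> and induct.\<close>

lemma degree_le_if_bigo:
  fixes p :: "real poly"
  assumes "\<forall>\<^sub>F n in sequentially. \<bar>poly p (real n)\<bar> \<le> C * real n ^ e"
  shows "degree p \<le> e"
  using assms
proof (induction e arbitrary: p C)
  case 0
  obtain a p' where p: "p = pCons a p'" by (cases p)
  have "(\<lambda>n. C * inverse (real n) + \<bar>a\<bar> * inverse (real n)) \<longlonglongrightarrow> C * 0 + \<bar>a\<bar> * 0"
    by (intro tendsto_intros lim_inverse_n)
  then have lim: "(\<lambda>n. C * inverse (real n) + \<bar>a\<bar> * inverse (real n)) \<longlonglongrightarrow> 0" by simp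
  have "\<forall>\<^sub>F n in sequentially. norm (poly p' (real n)) \<le> C * inverse (real n) + \<bar>a\<bar> * inverse (real n)"
    using 0 eventually_gt_at_top[of 0]
  proof eventually_elim
    case (elim n)
    then have "\<bar>a + real n * poly p' (real n)\<bar> \<le> C" by (simp add: p)
    then have "\<bar>real n * poly p' (real n)\<bar> \<le> C + \<bar>a\<bar>" by linarith
    then show ?case using elim(2) by (simp add: abs_mult field_simps)
  qed
  from Lim_null_comparison[OF this lim] have "p' = 0" by (rule poly_null_at_top)
  then show ?case by (simp add: p)
next
  case (Suc e)
  obtain a p' where p: "p = pCons a p'" by (cases p)
  have "degree p' \<le> e"
  proof (rule Suc.IH)
    show "\<forall>\<^sub>F n in sequentially. \<bar>poly p' (real n)\<bar> \<le> (C + \<bar>a\<bar>) * real n ^ e"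
      using Suc.prems eventually_gt_at_top[of 0]
    proof eventually_elim
      case (elim n)
      have n1: "real n \<ge> 1" using elim(2) by simp
      have "\<bar>a + real n * poly p' (real n)\<bar> \<le> C * real n ^ Suc e" using elim(1) by (simp add: p)
      then have "\<bar>real n * poly p' (real n)\<bar> \<le> C * real n ^ Suc e + \<bar>a\<bar>" by linarith
      also have "\<bar>a\<bar> \<le> \<bar>a\<bar> * real n ^ Suc e" using one_le_power[OF n1, of "Suc e"] by (simp only: mult_left_mono[of 1 _ "\<bar>a\<bar>", simplified])
      finally have "real n * \<bar>poly p' (real n)\<bar> \<le> real n * ((C + \<bar>a\<bar>) * real n ^ e)"
        by (simp add: abs_mult algebra_simps)
      then show ?case using n1 by simp
    qed
  qed
  then show ?case by (simp add: p degree_pCons_le order_trans[OF degree_pCons_le])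
qed

text \<open>Half of the decay is spent: \<open>l\<close> is the product of two equal factors
  \<open>exp (- c)\<close>, one of which absorbs the power of \<open>n\<close>.\<close>

lemma power_times_power_le:
  assumes "0 < l" "l < (1::real)"
  shows "\<exists>C l'. 0 < C \<and> 0 < l' \<and> l' < 1 \<and> (\<forall>n. real n ^ j * l ^ n \<le> C * l' ^ n)"
proof -
  define c where "c = - ln l / 2"
  have c: "c > 0" using assms by (simp add: c_def)
  have l: "l = exp (- c) * exp (- c)" using assms by (simp add: c_def flip: exp_add)
  have "real n ^ j * l ^ n \<le> (fact j / c ^ j) * exp (- c) ^ n" for n
  proof -
    have "(c * real n) ^ j \<le> fact j * exp (c * real n)" using c by (intro power_le_fact_exp) auto
    then have "real n ^ j \<le> fact j / c ^ j * exp (c * real n)" using c by (simp add: power_mult_distrib field_simps)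
    then have "real n ^ j * l ^ n \<le> fact j / c ^ j * exp (c * real n) * l ^ n"
      using assms by (intro mult_right_mono) auto
    also have "\<dots> = fact j / c ^ j * (exp (c * real n) * l ^ n)" by simp
    also have "exp (c * real n) * l ^ n = exp (- c) ^ n"
      unfolding l power_mult_distrib by (simp add: exp_minus field_simps flip: exp_of_nat2_mult)
    finally show ?thesis .
  qed
  moreover have "0 < fact j / c ^ j" using c by simp
  ultimately show ?thesis using c by (intro exI[of _ "fact j / c ^ j"] exI[of _ "exp (- c)"]) simp
qed

section \<open>Sequences that are polynomial up to an exponentially small error\<close>

definition exp_small :: "(nat \<Rightarrow> real) \<Rightarrow> bool" where
  "exp_small u \<longleftrightarrow> (\<exists>K l. 0 < l \<and> l < 1 \<and> (\<forall>n. \<bar>u n\<bar> \<le> K * l ^ n))"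

lemma exp_smallE:
  assumes "exp_small u"
  obtains K l where "K > 0" "0 < l" "l < 1" "\<And>n. \<bar>u n\<bar> \<le> K * l ^ n"
proof -
  obtain K l where kl: "0 < l" "l < 1" "\<And>n. \<bar>u n\<bar> \<le> K * l ^ n" using assms by (auto simp: exp_small_def)
  have "\<bar>u n\<bar> \<le> (\<bar>K\<bar> + 1) * l ^ n" for n
  proof -
    have "K * l ^ n \<le> (\<bar>K\<bar> + 1) * l ^ n" using kl(1) by (intro mult_right_mono) auto
    then show ?thesis using kl(3)[of n] by linarith
  qed
  then show ?thesis using that[of "\<bar>K\<bar> + 1" l] kl by simp
qed

lemma exp_small_mono_rate:
  assumes "K > 0" "0 < l" "l \<le> l'" "\<And>n. \<bar>u n\<bar> \<le> K * l ^ n"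
  shows "\<bar>u n\<bar> \<le> K * (l'::real) ^ n"
proof -
  have "K * l ^ n \<le> K * l' ^ n" using assms(1-3) by (intro mult_left_mono power_mono) auto
  then show ?thesis using assms(4)[of n] by linarith
qed

lemma exp_small_add: "exp_small u \<Longrightarrow> exp_small v \<Longrightarrow> exp_small (\<lambda>n. u n + v n)"
proof -
  assume u: "exp_small u" and v: "exp_small v"
  obtain K l where 1: "K > 0" "0 < l" "l < 1" "\<And>n. \<bar>u n\<bar> \<le> K * l ^ n" using u by (rule exp_smallE) (rule that)
  obtain K' l' where 2: "K' > 0" "0 < l'" "l' < 1" "\<And>n. \<bar>v n\<bar> \<le> K' * l' ^ n" using v by (rule exp_smallE) (rule that)
  have "\<bar>u n + v n\<bar> \<le> (K + K') * max l l' ^ n" for n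
    using exp_small_mono_rate[OF 1(1,2) _ 1(4), of "max l l'" n] exp_small_mono_rate[OF 2(1,2) _ 2(4), of "max l l'" n]
    by (simp add: distrib_right)
  then show ?thesis unfolding exp_small_def using 1 2 by (intro exI[of _ "K + K'"] exI[of _ "max l l'"]) auto
qed

lemma exp_small_cmult: "exp_small u \<Longrightarrow> exp_small (\<lambda>n. c * u n)"
proof -
  assume "exp_small u"
  then obtain K l where 1: "0 < l" "l < 1" "\<And>n. \<bar>u n\<bar> \<le> K * l ^ n" by (auto simp: exp_small_def)
  have "\<bar>c * u n\<bar> \<le> (\<bar>c\<bar> * K) * l ^ n" for n
    using mult_left_mono[OF 1(3)[of n], of "\<bar>c\<bar>"] by (simp add: abs_mult mult_ac)
  then show ?thesis unfolding exp_small_def using 1 by blast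
qed

lemma exp_small_power_mult: "exp_small u \<Longrightarrow> exp_small (\<lambda>n. real n ^ j * u n)"
proof -
  assume "exp_small u"
  then obtain K l where 1: "K > 0" "0 < l" "l < 1" "\<And>n. \<bar>u n\<bar> \<le> K * l ^ n" by (rule exp_smallE) (rule that)
  obtain C l' where 2: "0 < C" "0 < l'" "l' < 1" "\<forall>n. real n ^ j * l ^ n \<le> C * l' ^ n"
    using power_times_power_le[OF 1(2,3)] by blast
  have "\<bar>real n ^ j * u n\<bar> \<le> (K * C) * l' ^ n" for n
  proof -
    have "\<bar>real n ^ j * u n\<bar> \<le> real n ^ j * (K * l ^ n)" using 1(4)[of n] by (simp add: abs_mult mult_left_mono)
    also have "\<dots> \<le> K * (C * l' ^ n)" using mult_left_mono[of _ _ K, OF spec[OF 2(4), of n]] 1(1) by (simp add: mult_ac)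
    finally show ?thesis by (simp add: mult_ac)
  qed
  then show ?thesis unfolding exp_small_def using 2 by blast
qed

lemma exp_small_poly_mult: "exp_small u \<Longrightarrow> exp_small (\<lambda>n. poly p (real n) * u n)"
proof (induction p)
  case 0
  show ?case unfolding exp_small_def by (intro exI[of _ 0] exI[of _ "1/2"]) simp
next
  case (pCons a p)
  have "exp_small (\<lambda>n. a * u n + real n ^ 1 * (poly p (real n) * u n))"
    using pCons by (intro exp_small_add exp_small_cmult exp_small_power_mult)
  then show ?case by (simp add: algebra_simps)
qed

text \<open>Once both rates are raised to their maximum \<open>m\<close>, each of the
  \<open>n + 1\<close> products is at most \<open>K * K' * m ^ n\<close>; the factor
  \<open>n + 1\<close> is absorbed by a slightly larger rate.\<close>

lemma exp_small_conv:
  fixes F G :: "real fps"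
  assumes "exp_small (fps_nth F)" "exp_small (fps_nth G)"
  shows "exp_small (fps_nth (F * G))"
proof -
  obtain K l where 1: "K > 0" "0 < l" "l < 1" "\<And>n. \<bar>fps_nth F n\<bar> \<le> K * l ^ n" using assms(1) by (rule exp_smallE) (rule that)
  obtain K' l' where 2: "K' > 0" "0 < l'" "l' < 1" "\<And>n. \<bar>fps_nth G n\<bar> \<le> K' * l' ^ n" using assms(2) by (rule exp_smallE) (rule that)
  define m where "m = max l l'"
  have m: "0 < m" "m < 1" using 1 2 by (auto simp: m_def)
  obtain C r where 3: "0 < C" "0 < r" "r < 1" "\<forall>n. real n ^ 1 * m ^ n \<le> C * r ^ n"
    using power_times_power_le[OF m, of 1] by blast
  have e: "exp_small (\<lambda>n. K * K' * (real n ^ 1 * m ^ n + m ^ n))"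
  proof (intro exp_small_cmult exp_small_add exp_small_power_mult)
    show "exp_small (\<lambda>n. m ^ n)" unfolding exp_small_def using m by (intro exI[of _ 1] exI[of _ m]) simp
    then show "exp_small (\<lambda>n. m ^ n)" .
  qed
  have b: "\<bar>fps_nth (F * G) n\<bar> \<le> K * K' * (real n ^ 1 * m ^ n + m ^ n)" for n
  proof -
    have "\<bar>fps_nth (F * G) n\<bar> \<le> (\<Sum>i=0..n. \<bar>fps_nth F i * fps_nth G (n - i)\<bar>)"
      unfolding fps_mult_nth by (rule sum_abs)
    also have "\<dots> \<le> (\<Sum>i=0..n. K * K' * m ^ n)"
    proof (rule sum_mono)
      fix i assume i: "i \<in> {0..n}"
      have "\<bar>fps_nth F i\<bar> \<le> K * m ^ i" by (rule exp_small_mono_rate[OF 1(1,2) _ 1(4)]) (simp add: m_def)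
      moreover have "\<bar>fps_nth G (n - i)\<bar> \<le> K' * m ^ (n - i)" by (rule exp_small_mono_rate[OF 2(1,2) _ 2(4)]) (simp add: m_def)
      ultimately have "\<bar>fps_nth F i * fps_nth G (n - i)\<bar> \<le> (K * m ^ i) * (K' * m ^ (n - i))"
        unfolding abs_mult using 1 m by (intro mult_mono) auto
      also have "\<dots> = K * K' * (m ^ i * m ^ (n - i))" by (simp only: mult_ac)
      also have "m ^ i * m ^ (n - i) = m ^ n" using i by (simp flip: power_add)
      finally show "\<bar>fps_nth F i * fps_nth G (n - i)\<bar> \<le> K * K' * m ^ n" .
    qed
    also have "\<dots> = K * K' * (real n ^ 1 * m ^ n + m ^ n)" by (simp add: algebra_simps)
    finally show ?thesis .
  qed
  obtain K2 l2 where "0 < l2" "l2 < 1" "\<And>n. \<bar>K * K' * (real n ^ 1 * m ^ n + m ^ n)\<bar> \<le> K2 * l2 ^ n"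
    using e by (auto simp: exp_small_def)
  then show ?thesis unfolding exp_small_def using b by (meson abs_ge_self order_trans)
qed

text \<open>The form of the coefficients of a function whose only singularity in some disk of radius
  above 1 is a pole at 1. The class is stable under partial sums, that is, under multiplication by
  \<open>1 / (1 - X)\<close>.\<close>

definition poly_exp :: "(nat \<Rightarrow> real) \<Rightarrow> bool" where
  "poly_exp u \<longleftrightarrow> (\<exists>p. exp_small (\<lambda>n. u n - poly p (real n)))"

lemma poly_exp_add: "poly_exp u \<Longrightarrow> poly_exp v \<Longrightarrow> poly_exp (\<lambda>n. u n + v n)"
proof -
  assume "poly_exp u" "poly_exp v"
  then obtain p p' where "exp_small (\<lambda>n. u n - poly p (real n))" "exp_small (\<lambda>n. v n - poly p' (real n))"
    by (auto simp: poly_exp_def)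
  from exp_small_add[OF this] have "exp_small (\<lambda>n. u n + v n - poly (p + p') (real n))" by (simp add: algebra_simps)
  then show ?thesis unfolding poly_exp_def by blast
qed

lemma poly_exp_poly_mult: "poly_exp u \<Longrightarrow> poly_exp (\<lambda>n. poly r (real n) * u n)"
proof -
  assume "poly_exp u"
  then obtain p where "exp_small (\<lambda>n. u n - poly p (real n))" by (auto simp: poly_exp_def)
  from exp_small_poly_mult[OF this, of r]
  have "exp_small (\<lambda>n. poly r (real n) * u n - poly (r * p) (real n))" by (simp add: algebra_simps)
  then show ?thesis unfolding poly_exp_def by blast
qed

lemma poly_exp_cmult: "poly_exp u \<Longrightarrow> poly_exp (\<lambda>n. c * u n)"
  using poly_exp_poly_mult[of u "[:c:]"] by simp

lemma poly_exp_poly: "poly_exp (\<lambda>n. poly p (real n))"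
  unfolding poly_exp_def exp_small_def by (intro exI[of _ p] exI[of _ 0] exI[of _ "1/2"]) simp

lemma poly_exp_sum: "finite A \<Longrightarrow> (\<And>i. i \<in> A \<Longrightarrow> poly_exp (u i)) \<Longrightarrow> poly_exp (\<lambda>n. \<Sum>i\<in>A. u i n)"
proof (induction A rule: finite_induct)
  case empty
  then show ?case using poly_exp_poly[of 0] by simp
qed (simp add: poly_exp_add)

text \<open>Telescoping \<open>(m + 1)^(d+1) - m^(d+1)\<close> expresses the sum of
  \<open>d\<close>th powers through lower ones. The range starts at 0, so the telescoped value is
  \<open>(n + 1)^(d+1)\<close> without a boundary term.\<close>

lemma power_partial_sums: "\<exists>P. \<forall>n. (\<Sum>m\<le>n. real m ^ d) = poly P (real n)"
proof (induction d rule: less_induct)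
  case (less d)
  then have "\<forall>i. \<exists>P. i < d \<longrightarrow> (\<forall>n. (\<Sum>m\<le>n. real m ^ i) = poly P (real n))" by blast
  then obtain P where P: "\<And>i n. i < d \<Longrightarrow> (\<Sum>m\<le>n. real m ^ i) = poly (P i) (real n)" by metis
  define Q where "Q = smult (1 / real (Suc d)) ([:1, 1:] ^ Suc d - (\<Sum>i<d. smult (real (Suc d choose i)) (P i)) - (if d = 0 then 0 else 0))"
  have "(\<Sum>m\<le>n. real m ^ d) = poly Q (real n)" for n
  proof -
    have e: "(real m + 1) ^ Suc d - real m ^ Suc d = real (Suc d) * real m ^ d + (\<Sum>i<d. real (Suc d choose i) * real m ^ i)" for m
    proof -
      have "(real m + 1) ^ Suc d = (\<Sum>i\<le>Suc d. real (Suc d choose i) * real m ^ i)"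
        using binomial_ring[of "real m" 1 "Suc d"] by (simp del: power_Suc)
      also have "\<dots> = real m ^ Suc d + real (Suc d) * real m ^ d + (\<Sum>i<d. real (Suc d choose i) * real m ^ i)"
        by (simp add: lessThan_Suc_atMost[symmetric] del: power_Suc)
      finally show ?thesis by simp
    qed
    have "(real n + 1) ^ Suc d = (\<Sum>m\<le>n. (real m + 1) ^ Suc d - real m ^ Suc d)"
      by (induction n) (simp_all add: add.commute)
    also have "\<dots> = real (Suc d) * (\<Sum>m\<le>n. real m ^ d) + (\<Sum>i<d. real (Suc d choose i) * (\<Sum>m\<le>n. real m ^ i))"
      unfolding e sum.distrib sum_distrib_left by (subst (2) sum.swap) simp
    also have "(\<Sum>i<d. real (Suc d choose i) * (\<Sum>m\<le>n. real m ^ i)) = (\<Sum>i<d. real (Suc d choose i) * poly (P i) (real n))"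
      using P by (intro sum.cong) auto
    finally have "(\<Sum>m\<le>n. real m ^ d) = ((real n + 1) ^ Suc d - (\<Sum>i<d. real (Suc d choose i) * poly (P i) (real n))) / real (Suc d)"
      by (simp add: field_simps)
    then show ?thesis by (simp add: Q_def poly_sum poly_power add.commute del: power_Suc)
  qed
  then show ?case by blast
qed

lemma poly_partial_sums: "\<exists>P. \<forall>n. (\<Sum>m\<le>n. poly p (real m)) = poly P (real n)"
proof -
  obtain Q where Q: "\<And>d n. (\<Sum>m\<le>n. real m ^ d) = poly (Q d) (real n)" using power_partial_sums by metis
  have "(\<Sum>m\<le>n. poly p (real m)) = poly (\<Sum>i\<le>degree p. smult (coeff p i) (Q i)) (real n)" for n
  proof -
    have "(\<Sum>m\<le>n. poly p (real m)) = (\<Sum>i\<le>degree p. \<Sum>m\<le>n. coeff p i * real m ^ i)"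
      unfolding poly_altdef by (rule sum.swap)
    also have "\<dots> = (\<Sum>i\<le>degree p. coeff p i * poly (Q i) (real n))" by (simp add: Q flip: sum_distrib_left)
    finally show ?thesis by (simp add: poly_sum)
  qed
  then show ?thesis by blast
qed

text \<open>The partial sums of the exponentially small part converge exponentially fast; their
  limit joins the polynomial as a constant.\<close>

lemma poly_exp_partial_sums:
  assumes "poly_exp u"
  shows "poly_exp (\<lambda>n. \<Sum>m\<le>n. u m)"
proof -
  obtain p where p: "exp_small (\<lambda>n. u n - poly p (real n))" using assms by (auto simp: poly_exp_def)
  obtain P where P: "\<And>n. (\<Sum>m\<le>n. poly p (real m)) = poly P (real n)" using poly_partial_sums by metis
  define v where "v n = u n - poly p (real n)" for n
  have "exp_small v" using p by (simp add: v_def[abs_def])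
  then obtain K l where 1: "K > 0" "0 < l" "l < 1" "\<And>n. \<bar>v n\<bar> \<le> K * l ^ n" by (rule exp_smallE) (rule that)
  have "\<bar>(\<Sum>m\<le>n. v m) - suminf v\<bar> \<le> K * l / (1 - l) * l ^ n" for n
    using geometric_partial_sums(2)[of v K l n] 1 by simp
  then have "exp_small (\<lambda>n. (\<Sum>m\<le>n. v m) - suminf v)" unfolding exp_small_def using 1 by blast
  moreover have "(\<Sum>m\<le>n. v m) - suminf v = (\<Sum>m\<le>n. u m) - poly (P + [:suminf v:]) (real n)" for n
    by (simp add: v_def sum_subtractf P)
  ultimately have "exp_small (\<lambda>n. (\<Sum>m\<le>n. u m) - poly (P + [:suminf v:]) (real n))" by (simp only:)
  then show ?thesis unfolding poly_exp_def by blast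
qed

section \<open>Moments of the core-size\<close>

context renewal
begin

text \<open>The real form of \<open>1 / cH\<close>. Its coefficients are the increments of
  \<open>q\<close>, hence exponentially small.\<close>

definition Wr :: "real fps" where "Wr = (1 - fps_X) * inverse (1 - Abs_fps b)"

lemma Wr_nth: "fps_nth Wr n = (if n = 0 then q 0 else q n - q (n - 1))"
  by (cases n) (simp_all add: Wr_def left_diff_distrib q_eq)

lemma exp_small_Wr: "exp_small (fps_nth Wr)"
proof -
  obtain K l where K: "0 < K" "0 < l" "l < 1" "\<And>n. \<bar>q n - 1 / mean\<bar> \<le> K * l ^ n" using q_limit by blast
  define K' where "K' = \<bar>q 0\<bar> + K + K / l"
  have "\<bar>fps_nth Wr n\<bar> \<le> K' * l ^ n" for n
  proof (cases n)
    case 0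
    then show ?thesis using K by (simp add: Wr_nth K'_def)
  next
    case (Suc m)
    have "\<bar>fps_nth Wr n\<bar> \<le> K * l ^ Suc m + K * l ^ m"
      using K(4)[of m] K(4)[of "Suc m"] Suc unfolding Wr_nth by simp
    also have "\<dots> = (K + K / l) * l ^ n" using K(2) Suc by (simp add: field_simps)
    also have "\<dots> \<le> K' * l ^ n" using K by (intro mult_right_mono) (auto simp: K'_def)
    finally show ?thesis .
  qed
  then show ?thesis unfolding exp_small_def using K by blast
qed

text \<open>The power \<open>1 / (1 - B)^(j+1)\<close> is \<open>Wr^(j+1)\<close>, with
  exponentially small coefficients, times \<open>1 / (1 - X)^(j+1)\<close>, a pole of order
  \<open>j + 1\<close>. Each polar factor is one summation, which preserves the class.\<close>

lemma poly_exp_binomial: "poly_exp (\<lambda>n. \<Sum>k\<le>n. real ((k + j) choose j) * hit k n)"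
proof -
  let ?Q = "inverse (1 - Abs_fps b)"
  have sm: "exp_small (fps_nth (Wr ^ Suc i))" for i
    by (induction i) (use exp_small_Wr exp_small_conv in auto)
  \<comment> \<open>\<open>V i\<close> carries only \<open>i\<close> of the \<open>j + 1\<close>
    polar factors; the induction adds them one at a time.\<close>
  define V where "V i = Wr ^ Suc j * inverse (1 - fps_X :: real fps) ^ i" for i
  have step: "fps_nth (V (Suc i)) n = (\<Sum>m\<le>n. fps_nth (V i) m)" for i n
  proof -
    have "(1 - fps_X) * V (Suc i) = V i"
    proof -
      have "(1 - fps_X :: real fps) * inverse (1 - fps_X) = 1" by (rule inverse_mult_eq_1') simp
      then show ?thesis unfolding V_def power_Suc
        by (metis (no_types, lifting) mult.assoc mult.commute mult.left_neutral)
    qed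
    then have h: "fps_nth (V i) m = (if m = 0 then fps_nth (V (Suc i)) 0 else fps_nth (V (Suc i)) m - fps_nth (V (Suc i)) (m - 1))" for m
    proof -
      have "fps_nth (V i) m = fps_nth ((1 - fps_X) * V (Suc i)) m" using \<open>(1 - fps_X) * V (Suc i) = V i\<close> by simp
      also have "\<dots> = (if m = 0 then fps_nth (V (Suc i)) 0 else fps_nth (V (Suc i)) m - fps_nth (V (Suc i)) (m - 1))"
        by (cases m) (simp_all add: left_diff_distrib)
      finally show ?thesis .
    qed
    show ?thesis by (induction n) (simp_all add: h)
  qed
  have "poly_exp (fps_nth (V i))" for i
  proof (induction i)
    case 0
    then show ?case using sm[of j] unfolding poly_exp_def V_def by (intro exI[of _ 0]) simp
  next
    case (Suc i)
    have "fps_nth (V (Suc i)) = (\<lambda>n. \<Sum>m\<le>n. fps_nth (V i) m)" by (rule ext) (rule step)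
    then show ?case using poly_exp_partial_sums[OF Suc.IH] by (simp only:)
  qed
  from this[of "Suc j"] have "poly_exp (fps_nth (V (Suc j)))" .
  moreover have "V (Suc j) = ?Q ^ Suc j"
  proof -
    have "(1 - fps_X :: real fps) * inverse (1 - fps_X) = 1" by (rule inverse_mult_eq_1') simp
    moreover have "Wr * inverse (1 - fps_X) = ((1 - fps_X) * inverse (1 - fps_X)) * ?Q"
      unfolding Wr_def by (simp only: mult_ac)
    ultimately have "Wr * inverse (1 - fps_X) = ?Q" by (simp only: mult_1)
    then show ?thesis unfolding V_def by (simp only: power_mult_distrib[symmetric])
  qed
  moreover have "fps_nth (?Q ^ Suc j) = (\<lambda>n. \<Sum>k\<le>n. real ((k + j) choose j) * hit k n)"
  proof (rule ext)
    show "fps_nth (?Q ^ Suc j) n = (\<Sum>k\<le>n. real ((k + j) choose j) * hit k n)" for n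
      using fps_inverse_one_minus_nth[of "Abs_fps b" j n] by (simp add: b_0 hit_def)
  qed
  ultimately show ?thesis by (simp only:)
qed

text \<open>The identity \<open>k C(k+j,j) = (j+1) (C(k+j+1,j+1) - C(k+j,j))\<close> trades a power
  of \<open>k\<close> for a higher binomial coefficient. The parameter \<open>j\<close> is there for
  the induction; ordinary moments are the case \<open>j = 0\<close>.\<close>

lemma poly_exp_power_binomial: "poly_exp (\<lambda>n. \<Sum>k\<le>n. real k ^ i * real ((k + j) choose j) * hit k n)"
proof (induction i arbitrary: j)
  case 0
  then show ?case using poly_exp_binomial[of j] by simp
next
  case (Suc i)
  have e: "real k * real ((k + j) choose j) = real (j + 1) * real ((k + Suc j) choose Suc j) - real (j + 1) * real ((k + j) choose j)" for k
  proof -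
    have "Suc j * (Suc (k + j) choose Suc j) = Suc (k + j) * ((k + j) choose j)" by (rule Suc_times_binomial)
    then have "real (Suc j) * real (Suc (k + j) choose Suc j) = real (Suc (k + j)) * real ((k + j) choose j)"
      by (metis of_nat_mult)
    then show ?thesis by (simp add: algebra_simps)
  qed
  have "poly_exp (\<lambda>n. real (j + 1) * (\<Sum>k\<le>n. real k ^ i * real ((k + Suc j) choose Suc j) * hit k n)
      + (- real (j + 1)) * (\<Sum>k\<le>n. real k ^ i * real ((k + j) choose j) * hit k n))"
    by (intro poly_exp_add poly_exp_cmult Suc.IH)
  moreover have "real (j + 1) * (\<Sum>k\<le>n. real k ^ i * real ((k + Suc j) choose Suc j) * hit k n)
      + (- real (j + 1)) * (\<Sum>k\<le>n. real k ^ i * real ((k + j) choose j) * hit k n)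
      = (\<Sum>k\<le>n. real k ^ Suc i * real ((k + j) choose j) * hit k n)" for n
    unfolding sum_distrib_left sum.distrib[symmetric]
  proof (rule sum.cong[OF refl])
    fix k
    have ring: "c * (x * X * h) + (- c) * (x * Y * h) = x * (c * X - c * Y) * h" for c x X Y h :: real
      by (simp add: algebra_simps)
    show "real (j + 1) * (real k ^ i * real ((k + Suc j) choose Suc j) * hit k n)
      + (- real (j + 1)) * (real k ^ i * real ((k + j) choose j) * hit k n)
      = real k ^ Suc i * real ((k + j) choose j) * hit k n" unfolding ring e[symmetric] by (simp add: mult_ac)
  qed
  ultimately show ?case by (simp only:)
qed

text \<open>Division by \<open>q n\<close>, which is \<open>1 / mean\<close> up to an exponentially
  small error, keeps the numerator polynomial up to negligible terms. The degree bound comes from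
  the trivial estimate \<open>\<bar>k - n / mean\<bar> \<le> n\<close>.\<close>

lemma centred_moment_expansion:
  "\<exists>P. degree P \<le> j \<and> (\<forall>N. \<exists>C. \<forall>\<^sub>F n in sequentially. \<bar>E n (\<lambda>k. (real k - real n / mean) ^ j) - poly P (real n)\<bar> \<le> C / real n ^ N)"
proof -
  define S where "S n = (\<Sum>k\<le>n. hit k n * (real k - real n / mean) ^ j)" for n
  have m1: "mean \<ge> 1" by (rule mean_ge_1)
  have "poly_exp (\<lambda>n. \<Sum>i\<le>j. poly ([:0, - (1 / mean):] ^ (j - i) * [:real (j choose i):]) (real n) * (\<Sum>k\<le>n. real k ^ i * real ((k + 0) choose 0) * hit k n))"
    by (intro poly_exp_sum poly_exp_poly_mult poly_exp_power_binomial) simp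
  moreover have "(\<Sum>i\<le>j. poly ([:0, - (1 / mean):] ^ (j - i) * [:real (j choose i):]) (real n) * (\<Sum>k\<le>n. real k ^ i * real ((k + 0) choose 0) * hit k n)) = S n" for n
  proof -
    have "S n = (\<Sum>k\<le>n. \<Sum>i\<le>j. real (j choose i) * real k ^ i * (- (real n / mean)) ^ (j - i) * hit k n)"
    proof -
      have "(real k - real n / mean) ^ j = (\<Sum>i\<le>j. real (j choose i) * real k ^ i * (- (real n / mean)) ^ (j - i))" for k
        using binomial_ring[of "real k" "- (real n / mean)" j] by simp
      then show ?thesis unfolding S_def by (simp add: sum_distrib_left mult_ac)
    qed
    also have "\<dots> = (\<Sum>i\<le>j. \<Sum>k\<le>n. real (j choose i) * real k ^ i * (- (real n / mean)) ^ (j - i) * hit k n)" by (rule sum.swap)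
    finally show ?thesis by (simp add: sum_distrib_left mult_ac)
  qed
  ultimately have "poly_exp S" by (simp only:)
  then obtain p where p: "exp_small (\<lambda>n. S n - poly p (real n))" by (auto simp: poly_exp_def)
  \<comment> \<open>Division by \<open>q n\<close> amounts to multiplication by \<open>mean\<close>;
    the discrepancy is the second summand of \<open>num\<close> below.\<close>
  define P where "P = smult mean p"
  have qs: "exp_small (\<lambda>n. q n - 1 / mean)" unfolding exp_small_def using q_limit by blast
  have num: "exp_small (\<lambda>n. (S n - poly p (real n)) + (- mean) * (poly p (real n) * (q n - 1 / mean)))"
    by (intro exp_small_add p exp_small_cmult exp_small_poly_mult qs)
  have l: "\<forall>\<^sub>F n in sequentially. q n > 1 / (2 * mean)"
    using q_tendsto by (rule order_tendstoD) (use m1 in \<open>simp add: field_simps\<close>)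
  have ex: "\<exists>C. \<forall>\<^sub>F n in sequentially. \<bar>E n (\<lambda>k. (real k - real n / mean) ^ j) - poly P (real n)\<bar> \<le> C / real n ^ N" for N
  proof -
    obtain K l' where K: "K > 0" "0 < l'" "l' < 1"
      "\<And>n. \<bar>real n ^ N * ((S n - poly p (real n)) + (- mean) * (poly p (real n) * (q n - 1 / mean)))\<bar> \<le> K * l' ^ n"
      using exp_small_power_mult[OF num, of N] by (rule exp_smallE) (rule that)
    have "\<forall>\<^sub>F n in sequentially. \<bar>E n (\<lambda>k. (real k - real n / mean) ^ j) - poly P (real n)\<bar> \<le> (K * (2 * mean)) / real n ^ N"
      using l eventually_gt_at_top[of 0]
    proof eventually_elim
      case (elim n)
      let ?v = "(S n - poly p (real n)) + (- mean) * (poly p (real n) * (q n - 1 / mean))"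
      have m2: "0 < 1 / (2 * mean)" using m1 by simp
      have q0: "q n > 0" using elim(1) m2 by linarith
      have "E n (\<lambda>k. (real k - real n / mean) ^ j) - poly P (real n) = ?v / q n"
      proof -
        have "E n (\<lambda>k. (real k - real n / mean) ^ j) = S n / q n" by (simp only: E_def S_def)
        then show ?thesis using q0 m1 by (simp add: P_def field_simps)
      qed
      then have "\<bar>E n (\<lambda>k. (real k - real n / mean) ^ j) - poly P (real n)\<bar> = \<bar>?v\<bar> / q n" using q0 by simp
      also have "\<dots> \<le> \<bar>?v\<bar> / (1 / (2 * mean))" by (rule divide_left_mono[OF less_imp_le[OF elim(1)] abs_ge_zero mult_pos_pos[OF q0 m2]])
      also have "\<dots> = \<bar>?v\<bar> * (2 * mean)" by simp
      also have "\<bar>?v\<bar> \<le> K / real n ^ N"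
      proof -
        have "real n ^ N * \<bar>?v\<bar> \<le> K * l' ^ n" using K(4)[of n] by (simp only: abs_mult power_abs abs_of_nat)
        also have "\<dots> \<le> K" using K by (intro mult_left_le power_le_one) auto
        finally show ?thesis using elim(2) by (simp add: field_simps)
      qed
      finally show ?case using m1 by (simp add: mult_right_mono)
    qed
    then show ?thesis by blast
  qed
  \<comment> \<open>A bounded error, that is \<open>N = 0\<close>, suffices to read off the
    degree.\<close>
  obtain C where C: "\<forall>\<^sub>F n in sequentially. \<bar>E n (\<lambda>k. (real k - real n / mean) ^ j) - poly P (real n)\<bar> \<le> C / real n ^ 0"
    using ex[of 0] by blast
  have "degree P \<le> j"
  proof (rule degree_le_if_bigo)
    show "\<forall>\<^sub>F n in sequentially. \<bar>poly P (real n)\<bar> \<le> (1 + \<bar>C\<bar>) * real n ^ j"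
      using C q_pos_ev eventually_gt_at_top[of 0]
    proof eventually_elim
      case (elim n)
      have n1: "real n \<ge> 1" using elim(3) by simp
      have "\<bar>E n (\<lambda>k. (real k - real n / mean) ^ j)\<bar> \<le> E n (\<lambda>k. \<bar>(real k - real n / mean) ^ j\<bar>)" by (rule E_abs_le)
      also have "\<dots> \<le> E n (\<lambda>k. real n ^ j)"
      proof (rule E_mono[OF elim(3)])
        fix k assume k: "1 \<le> k" "k \<le> n"
        have "real n / mean \<le> real n / 1" using m1 by (intro divide_left_mono) auto
        moreover have "0 \<le> real n / mean" using m1 by simp
        moreover have "real k \<le> real n" "0 \<le> real k" using k by auto
        ultimately have "\<bar>real k - real n / mean\<bar> \<le> real n" by linarith
        then show "\<bar>(real k - real n / mean) ^ j\<bar> \<le> real n ^ j" unfolding power_abs by (intro power_mono) auto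
      qed
      also have "\<dots> = real n ^ j" by (rule E_const[OF elim(2)])
      finally have "\<bar>poly P (real n)\<bar> \<le> real n ^ j + \<bar>C\<bar>" using elim(1) by simp
      also have "\<bar>C\<bar> \<le> \<bar>C\<bar> * real n ^ j" using mult_left_mono[OF one_le_power[OF n1, of j], of "\<bar>C\<bar>"] by simp
      finally show ?case by (simp add: algebra_simps)
    qed
  qed
  with ex show ?thesis by blast
qed

end

section \<open>Asymptotic expansions\<close>

text \<open>For such a polynomial the conditional mean of \<open>p(T) n^(-m/2)\<close> expands in
  integer powers of \<open>1/n\<close>, as \<open>parity_poly_approx\<close> shows. The bound
  \<open>j \<le> m\<close> and the parity are kept in one predicate because every operation on
  expansions preserves both.\<close>

definition parity_poly :: "nat \<Rightarrow> real poly \<Rightarrow> bool" where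
  "parity_poly m p \<longleftrightarrow> (\<forall>j. coeff p j \<noteq> 0 \<longrightarrow> j \<le> m \<and> even (m - j))"

lemma parity_poly_0: "parity_poly m 0"
  by (simp add: parity_poly_def)

lemma parity_poly_add: "parity_poly m p \<Longrightarrow> parity_poly m p' \<Longrightarrow> parity_poly m (p + p')"
  unfolding parity_poly_def coeff_add by (metis add.right_neutral)

lemma parity_poly_smult: "parity_poly m p \<Longrightarrow> parity_poly m (smult c p)"
  by (simp add: parity_poly_def)

lemma parity_poly_sum: "(\<And>i. i \<in> A \<Longrightarrow> parity_poly m (p i)) \<Longrightarrow> parity_poly m (\<Sum>i\<in>A. p i)"
  by (induction A rule: infinite_finite_induct) (auto simp: parity_poly_0 parity_poly_add)

lemma parity_poly_monom: "parity_poly m (monom c m)"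
  by (simp add: parity_poly_def)

lemma parity_poly_shift: "2 * l \<le> m \<Longrightarrow> parity_poly (m - 2 * l) p \<Longrightarrow> parity_poly m p"
  unfolding parity_poly_def
proof (intro allI impI)
  fix j assume l: "2 * l \<le> m" and h: "\<forall>j. coeff p j \<noteq> 0 \<longrightarrow> j \<le> m - 2 * l \<and> even (m - 2 * l - j)" and j: "coeff p j \<noteq> 0"
  then have a: "j \<le> m - 2 * l" "even (m - 2 * l - j)" by blast+
  then have eq: "m - j = (m - 2 * l - j) + 2 * l" using l by linarith
  have "even (m - 2 * l - j + 2 * l)" using a(2) by (rule dvd_add) simp
  then have "even (m - j)" by (subst eq)
  moreover have "j \<le> m" using a(1) by linarith
  ultimately show "j \<le> m \<and> even (m - j)" by blast
qed

lemma parity_poly_degree: "parity_poly m p \<Longrightarrow> degree p \<le> m"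
  unfolding parity_poly_def by (cases "p = 0") (auto simp: leading_coeff_0_iff)

lemma parity_poly_minus:
  assumes "parity_poly m p"
  shows "poly p (- x) = (- 1) ^ m * poly p x"
proof -
  have "coeff p i * (- x) ^ i = (- 1) ^ m * (coeff p i * x ^ i)" for i
  proof (cases "coeff p i = 0")
    case False
    then have "i \<le> m" "even (m - i)" using assms by (auto simp: parity_poly_def)
    then have "even m = even i" using even_diff_nat[of m i] by auto
    then have "(- 1) ^ m = ((- 1) ^ i :: real)" by (simp add: uminus_power_if)
    moreover have "(- x) ^ i = (- 1) ^ i * x ^ i" by (rule power_minus)
    ultimately show ?thesis by simp
  qed simp
  then show ?thesis unfolding poly_altdef sum_distrib_left by (intro sum.cong) auto
qed

lemma poly_bound_sqrt:
  assumes "degree p \<le> m"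
  shows "\<exists>C\<ge>0. \<forall>t::real. \<bar>poly p t\<bar> \<le> C * sqrt (1 + t\<^sup>2) ^ m"
proof -
  define C where "C = (\<Sum>i\<le>degree p. \<bar>coeff p i\<bar>)"
  have "\<bar>poly p t\<bar> \<le> C * sqrt (1 + t\<^sup>2) ^ m" for t
  proof -
    have s1: "sqrt (1 + t\<^sup>2) \<ge> 1" by simp
    have st: "\<bar>t\<bar> \<le> sqrt (1 + t\<^sup>2)" using real_sqrt_le_mono[of "t\<^sup>2" "1 + t\<^sup>2"] by simp
    have "\<bar>poly p t\<bar> \<le> (\<Sum>i\<le>degree p. \<bar>coeff p i * t ^ i\<bar>)" unfolding poly_altdef by (rule sum_abs)
    also have "\<dots> \<le> (\<Sum>i\<le>degree p. \<bar>coeff p i\<bar> * sqrt (1 + t\<^sup>2) ^ m)"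
    proof (rule sum_mono)
      fix i assume "i \<in> {..degree p}"
      then have "\<bar>t\<bar> ^ i \<le> sqrt (1 + t\<^sup>2) ^ i" "sqrt (1 + t\<^sup>2) ^ i \<le> sqrt (1 + t\<^sup>2) ^ m"
        using st s1 assms by (auto intro: power_mono power_increasing)
      then show "\<bar>coeff p i * t ^ i\<bar> \<le> \<bar>coeff p i\<bar> * sqrt (1 + t\<^sup>2) ^ m"
        unfolding abs_mult power_abs by (intro mult_left_mono) auto
    qed
    finally show ?thesis by (simp add: C_def sum_distrib_right)
  qed
  moreover have "C \<ge> 0" by (simp add: C_def sum_nonneg)
  ultimately show ?thesis by blast
qed

lemma binomial_remainder:
  fixes \<beta> :: real
  shows "\<exists>C\<ge>0. \<forall>x. \<bar>x\<bar> \<le> 1 / 2 \<longrightarrow> \<bar>(1 + x) powr \<beta> - (\<Sum>m\<le>r. (\<beta> gchoose m) * x ^ m)\<bar> \<le> C * \<bar>x\<bar> ^ Suc r"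
proof -
  define g where "g j = \<bar>\<beta> gchoose j\<bar>" for j
  \<comment> \<open>Convergence at \<open>3 / 4\<close> gives absolute convergence at
    \<open>1 / 2\<close>, the edge of the range of \<open>x\<close>.\<close>
  have "summable (\<lambda>j. (\<beta> gchoose j) * (3 / 4) ^ j)"
    using gen_binomial_real[of "3 / 4" \<beta>] by (simp add: sums_iff)
  then have s: "summable (\<lambda>j. norm ((\<beta> gchoose j) * (1 / 2) ^ j))"
    by (rule powser_insidea) simp
  define C where "C = (\<Sum>j. norm ((\<beta> gchoose j) * (1 / 2) ^ j)) * 2 ^ Suc r"
  have C0: "C \<ge> 0" unfolding C_def by (intro mult_nonneg_nonneg suminf_nonneg s) auto
  have "\<bar>(1 + x) powr \<beta> - (\<Sum>m\<le>r. (\<beta> gchoose m) * x ^ m)\<bar> \<le> C * \<bar>x\<bar> ^ Suc r" if x: "\<bar>x\<bar> \<le> 1 / 2" for x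
  proof (cases "x = 0")
    case True
    have "(\<Sum>m\<le>r. (\<beta> gchoose m) * (0::real) ^ m) = 1"
      by (subst sum.remove[of _ 0]) (auto intro!: sum.neutral)
    then show ?thesis using True by simp
  next
    case False
    define f where "f j = (\<beta> gchoose j) * x ^ j" for j
    \<comment> \<open>With this ratio the weighted terms are those of the series at
      \<open>1 / 2\<close>, uniformly in \<open>x\<close>, and \<open>1 / y ^ Suc r\<close> yields
      the power of \<open>\<bar>x\<bar>\<close>.\<close>
    define y where "y = 1 / (2 * \<bar>x\<bar>)"
    have y: "y \<ge> 1" using x False by (simp add: y_def field_simps)
    have gy: "\<bar>f j\<bar> * y ^ j = norm ((\<beta> gchoose j) * (1 / 2) ^ j)" for j
      using False by (simp add: f_def y_def abs_mult power_abs power_divide power_mult_distrib)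
    have sg: "summable (\<lambda>j. \<bar>f j\<bar> * y ^ j)" unfolding gy by (rule s)
    have fs: "suminf f = (1 + x) powr \<beta>"
      unfolding f_def using gen_binomial_real[of x \<beta>] x by (simp add: sums_iff)
    have ff: "norm (f j) \<le> \<bar>f j\<bar>" for j by simp
    have "suminf f = (\<Sum>j. f (j + Suc r)) + (\<Sum>j<Suc r. f j)"
      by (rule suminf_split_initial_segment[OF tail_norm_le(1)[OF ff y sg]])
    then have "\<bar>(1 + x) powr \<beta> - (\<Sum>m\<le>r. (\<beta> gchoose m) * x ^ m)\<bar> = norm (\<Sum>j. f (j + Suc r))"
      unfolding fs by (simp add: f_def lessThan_Suc_atMost)
    also have "\<dots> \<le> (\<Sum>j. \<bar>f j\<bar> * y ^ j) / y ^ Suc r" by (rule tail_norm_le(2)[OF ff y sg])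
    also have "\<dots> = C * \<bar>x\<bar> ^ Suc r"
      unfolding gy using False by (simp add: C_def y_def power_divide power_mult_distrib del: power_Suc)
    finally show ?thesis .
  qed
  with C0 show ?thesis by blast
qed

section \<open>Expansions in integer powers of the reciprocal index\<close>

definition asymp_exp :: "(nat \<Rightarrow> real) \<Rightarrow> real \<Rightarrow> (nat \<Rightarrow> real) \<Rightarrow> bool" where
  "asymp_exp h \<alpha> f \<longleftrightarrow> (\<forall>N. \<exists>C. \<forall>\<^sub>F k in sequentially.
     \<bar>h k / real k powr \<alpha> - (\<Sum>l\<le>N. f l * (1 / real k) ^ l)\<bar> \<le> C * (1 / real k) ^ Suc N)"

lemma poly_small_order:
  fixes d :: "real poly"
  assumes "\<And>i. i < N \<Longrightarrow> coeff d i = 0"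
  shows "\<exists>C\<ge>0. \<forall>x. 0 \<le> x \<and> x \<le> 1 \<longrightarrow> \<bar>poly d x\<bar> \<le> C * x ^ N"
proof -
  define C where "C = (\<Sum>i\<le>degree d. \<bar>coeff d i\<bar>)"
  have "\<bar>poly d x\<bar> \<le> C * x ^ N" if x: "0 \<le> x" "x \<le> 1" for x
  proof -
    have "\<bar>poly d x\<bar> \<le> (\<Sum>i\<le>degree d. \<bar>coeff d i * x ^ i\<bar>)" unfolding poly_altdef by (rule sum_abs)
    also have "\<dots> \<le> (\<Sum>i\<le>degree d. \<bar>coeff d i\<bar> * x ^ N)"
    proof (rule sum_mono)
      fix i
      show "\<bar>coeff d i * x ^ i\<bar> \<le> \<bar>coeff d i\<bar> * x ^ N"
      proof (cases "i < N")
        case False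
        then have "x ^ i \<le> x ^ N" using x by (intro power_decreasing) auto
        then show ?thesis using x by (simp add: abs_mult mult_left_mono)
      qed (use assms x in simp)
    qed
    finally show ?thesis by (simp add: C_def sum_distrib_right)
  qed
  moreover have "C \<ge> 0" by (simp add: C_def sum_nonneg)
  ultimately show ?thesis by blast
qed

lemma poly_of_sum: "poly (\<Sum>l\<le>N. monom (f l) l) (x :: real) = (\<Sum>l\<le>N. f l * x ^ l)"
  by (simp add: poly_sum poly_monom)

lemma coeff_of_sum: "coeff (\<Sum>l\<le>N. monom (f l) l) i = (if i \<le> N then f i else 0)"
  by (simp add: coeff_sum)

lemma asymp_exp_tendsto:
  assumes "asymp_exp h \<alpha> f"
  shows "(\<lambda>k. h k / real k powr \<alpha>) \<longlonglongrightarrow> f 0"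
proof -
  obtain C where "\<forall>\<^sub>F k in sequentially. \<bar>h k / real k powr \<alpha> - (\<Sum>l\<le>0. f l * (1 / real k) ^ l)\<bar> \<le> C * (1 / real k) ^ Suc 0"
    using assms unfolding asymp_exp_def by blast
  then have ev: "\<forall>\<^sub>F k in sequentially. norm (h k / real k powr \<alpha> - f 0) \<le> C * (1 / real k)" by simp
  have "(\<lambda>k. C * (1 / real k)) \<longlonglongrightarrow> C * 0" by (intro tendsto_intros lim_1_over_n)
  then have "(\<lambda>k. C * (1 / real k)) \<longlonglongrightarrow> 0" by simp
  from Lim_null_comparison[OF ev this] show ?thesis by (simp add: LIM_zero_iff)
qed

text \<open>The truncations \<open>A\<close> of the series and \<open>V\<close> of its formal
  inverse satisfy \<open>A * V = 1\<close> below order \<open>N + 1\<close>. As \<open>u\<close>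
  agrees with \<open>A\<close> to that order and stays above \<open>1 / 2\<close>, its reciprocal
  agrees with \<open>V\<close>.\<close>

lemma asymp_exp_inverse:
  assumes h: "asymp_exp h \<alpha> f" and f0: "f 0 = 1"
  shows "asymp_exp (\<lambda>k. 1 / h k) (- \<alpha>) (fps_nth (inverse (Abs_fps f)))"
  unfolding asymp_exp_def
proof
  fix N
  define v where "v = fps_nth (inverse (Abs_fps f))"
  define u where "u k = h k / real k powr \<alpha>" for k
  define A where "A = (\<Sum>l\<le>N. monom (f l) l)"
  define V where "V = (\<Sum>l\<le>N. monom (v l) l)"
  have inv: "Abs_fps f * inverse (Abs_fps f) = 1" by (rule inverse_mult_eq_1') (simp add: f0)
  have "coeff (1 - A * V) i = 0" if i: "i < Suc N" for i
  proof -
    have "coeff (A * V) i = (\<Sum>j\<le>i. f j * v (i - j))"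
      unfolding coeff_mult A_def V_def coeff_of_sum using i by (intro sum.cong) auto
    also have "\<dots> = fps_nth (Abs_fps f * inverse (Abs_fps f)) i" by (simp add: fps_mult_nth v_def atLeast0AtMost)
    finally show ?thesis unfolding inv by (cases i) (simp_all add: one_pCons)
  qed
  then obtain C1 where C1: "C1 \<ge> 0" "\<And>x. 0 \<le> x \<Longrightarrow> x \<le> 1 \<Longrightarrow> \<bar>poly (1 - A * V) x\<bar> \<le> C1 * x ^ Suc N"
    using poly_small_order[of "Suc N" "1 - A * V"] by blast
  obtain C2 where C2: "C2 \<ge> 0" "\<And>x. 0 \<le> x \<Longrightarrow> x \<le> 1 \<Longrightarrow> \<bar>poly V x\<bar> \<le> C2 * x ^ 0"
    using poly_small_order[of 0 V] by blast
  obtain C where C: "\<forall>\<^sub>F k in sequentially. \<bar>u k - (\<Sum>l\<le>N. f l * (1 / real k) ^ l)\<bar> \<le> C * (1 / real k) ^ Suc N"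
    using h unfolding asymp_exp_def u_def by blast
  have "u \<longlonglongrightarrow> 1" using asymp_exp_tendsto[OF h] unfolding u_def f0 .
  then have half: "\<forall>\<^sub>F k in sequentially. u k > 1 / 2" by (rule order_tendstoD) simp
  have "\<forall>\<^sub>F k in sequentially. \<bar>(1 / h k) / real k powr (- \<alpha>) - (\<Sum>l\<le>N. v l * (1 / real k) ^ l)\<bar> \<le> (2 * (C1 + \<bar>C\<bar> * C2)) * (1 / real k) ^ Suc N"
    using C half eventually_gt_at_top[of 0]
  proof eventually_elim
    case (elim k)
    define x where "x = 1 / real k"
    have x: "0 \<le> x" "x \<le> 1" using elim(3) by (auto simp: x_def)
    have xp: "x ^ Suc N \<ge> 0" using x by simp
    have "(1 / h k) / real k powr (- \<alpha>) = 1 / u k" using elim(3) by (simp add: u_def powr_minus field_simps)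
    then have "(1 / h k) / real k powr (- \<alpha>) - (\<Sum>l\<le>N. v l * (1 / real k) ^ l) = 1 / u k - poly V x"
      unfolding V_def poly_of_sum x_def by simp
    also have "\<dots> = (poly (1 - A * V) x - (u k - poly A x) * poly V x) / u k"
      using elim(2) by (simp add: field_simps)
    finally have "\<bar>(1 / h k) / real k powr (- \<alpha>) - (\<Sum>l\<le>N. v l * (1 / real k) ^ l)\<bar> =
        \<bar>poly (1 - A * V) x - (u k - poly A x) * poly V x\<bar> / u k" using elim(2) by simp
    also have "\<dots> \<le> (C1 * x ^ Suc N + (\<bar>C\<bar> * x ^ Suc N) * C2) / (1 / 2)"
    proof (rule frac_le)
      have "\<bar>u k - poly A x\<bar> \<le> C * x ^ Suc N" using elim(1) unfolding A_def poly_of_sum x_def .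
      also have "\<dots> \<le> \<bar>C\<bar> * x ^ Suc N" using xp by (intro mult_right_mono) auto
      finally have "\<bar>(u k - poly A x) * poly V x\<bar> \<le> (\<bar>C\<bar> * x ^ Suc N) * C2"
        unfolding abs_mult using C2(2)[OF x] xp by (intro mult_mono) auto
      then show "\<bar>poly (1 - A * V) x - (u k - poly A x) * poly V x\<bar> \<le> C1 * x ^ Suc N + (\<bar>C\<bar> * x ^ Suc N) * C2"
        using C1(2)[OF x] by linarith
      show "0 \<le> C1 * x ^ Suc N + (\<bar>C\<bar> * x ^ Suc N) * C2" using C1(1) C2(1) xp by simp
    qed (use elim(2) in auto)
    finally show ?case by (simp add: x_def algebra_simps)
  qed
  then show "\<exists>C. \<forall>\<^sub>F k in sequentially. \<bar>(1 / h k) / real k powr (- \<alpha>) - (\<Sum>l\<le>N. fps_nth (inverse (Abs_fps f)) l * (1 / real k) ^ l)\<bar> \<le> C * (1 / real k) ^ Suc N"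
    unfolding v_def by blast
qed

lemma poly_coeffs_zero:
  fixes d :: "real poly"
  assumes "\<forall>\<^sub>F n in sequentially. \<bar>poly d (1 / real n)\<bar> \<le> C * (1 / real n) ^ N" and "i < N"
  shows "coeff d i = 0"
  using assms
proof (induction N arbitrary: d i)
  case (Suc N)
  obtain a d' where d: "d = pCons a d'" by (cases d)
  have "(\<lambda>n. poly d (1 / real n)) \<longlonglongrightarrow> poly d 0"
    by (intro isCont_tendsto_compose[OF poly_isCont] lim_1_over_n)
  moreover have "(\<lambda>n. poly d (1 / real n)) \<longlonglongrightarrow> 0"
  proof (rule Lim_null_comparison)
    show "\<forall>\<^sub>F n in sequentially. norm (poly d (1 / real n)) \<le> C * (1 / real n) ^ Suc N" using Suc.prems(1) by simp
    have "(\<lambda>n. C * (1 / real n) ^ Suc N) \<longlonglongrightarrow> C * 0 ^ Suc N" by (intro tendsto_intros lim_1_over_n)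
    then show "(\<lambda>n. C * (1 / real n) ^ Suc N) \<longlonglongrightarrow> 0" by simp
  qed
  ultimately have a0: "a = 0" using LIMSEQ_unique by (fastforce simp: d)
  have "\<forall>\<^sub>F n in sequentially. \<bar>poly d' (1 / real n)\<bar> \<le> C * (1 / real n) ^ N"
    using Suc.prems(1) eventually_gt_at_top[of 0]
  proof eventually_elim
    case (elim n)
    then have "(1 / real n) * \<bar>poly d' (1 / real n)\<bar> \<le> (1 / real n) * (C * (1 / real n) ^ N)"
      by (simp add: d a0 abs_mult)
    moreover have "0 < 1 / real n" using elim(2) by simp
    ultimately show ?case by (rule mult_left_le_imp_le)
  qed
  then have "coeff d' j = 0" if "j < N" for j using Suc.IH that by blast
  then show ?case using Suc.prems(2) a0 by (cases i) (auto simp: d)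
qed simp

text \<open>The polynomial may depend on \<open>N\<close>. In this weak form approximations add up
  termwise without any bookkeeping of coefficients; one coefficient sequence is extracted at the
  end.\<close>

definition poly_approx :: "nat \<Rightarrow> (nat \<Rightarrow> real) \<Rightarrow> bool" where
  "poly_approx N u \<longleftrightarrow> (\<exists>p C. \<forall>\<^sub>F n in sequentially. \<bar>u n - poly p (1 / real n)\<bar> \<le> C * (1 / real n) ^ N)"

lemma poly_approx_add: "poly_approx N u \<Longrightarrow> poly_approx N v \<Longrightarrow> poly_approx N (\<lambda>n. u n + v n)"
proof -
  assume "poly_approx N u" "poly_approx N v"
  then obtain p p' C C' where "\<forall>\<^sub>F n in sequentially. \<bar>u n - poly p (1 / real n)\<bar> \<le> C * (1 / real n) ^ N"
    "\<forall>\<^sub>F n in sequentially. \<bar>v n - poly p' (1 / real n)\<bar> \<le> C' * (1 / real n) ^ N" unfolding poly_approx_def by blast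
  then have "\<forall>\<^sub>F n in sequentially. \<bar>u n + v n - poly (p + p') (1 / real n)\<bar> \<le> (C + C') * (1 / real n) ^ N"
  proof eventually_elim
    case (elim n)
    then show ?case unfolding poly_add distrib_right by linarith
  qed
  then show ?thesis unfolding poly_approx_def by blast
qed

lemma poly_approx_cmult: "poly_approx N u \<Longrightarrow> poly_approx N (\<lambda>n. c * u n)"
proof -
  assume "poly_approx N u"
  then obtain p C where "\<forall>\<^sub>F n in sequentially. \<bar>u n - poly p (1 / real n)\<bar> \<le> C * (1 / real n) ^ N"
    unfolding poly_approx_def by blast
  then have "\<forall>\<^sub>F n in sequentially. \<bar>c * u n - poly (smult c p) (1 / real n)\<bar> \<le> (\<bar>c\<bar> * C) * (1 / real n) ^ N"
  proof eventually_elim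
    case (elim n)
    have "c * u n - poly (smult c p) (1 / real n) = c * (u n - poly p (1 / real n))" by (simp add: algebra_simps)
    then show ?case using mult_left_mono[OF elim, of "\<bar>c\<bar>"] by (simp add: abs_mult mult.assoc)
  qed
  then show ?thesis unfolding poly_approx_def by blast
qed

lemma poly_approx_small: "\<forall>\<^sub>F n in sequentially. \<bar>u n\<bar> \<le> C * (1 / real n) ^ N \<Longrightarrow> poly_approx N u"
  unfolding poly_approx_def by (intro exI[of _ 0] exI[of _ C]) simp

lemma poly_approx_sum: "finite A \<Longrightarrow> (\<And>i. i \<in> A \<Longrightarrow> poly_approx N (u i)) \<Longrightarrow> poly_approx N (\<lambda>n. \<Sum>i\<in>A. u i n)"
proof (induction A rule: finite_induct)
  case empty
  then show ?case by (intro poly_approx_small[of _ 0]) simp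
qed (simp add: poly_approx_add)

text \<open>A polynomial in \<open>1/n\<close> of size \<open>n^(-N)\<close> has no coefficients
  below \<open>N\<close>, so the approximants of orders \<open>N \<le> M\<close> share their first
  \<open>N\<close> coefficients, and the diagonal choice of \<open>f\<close> is consistent with all
  of them.\<close>

lemma asymp_exp_of_poly_approx:
  assumes "\<And>N. poly_approx N u"
  shows "\<exists>f. asymp_exp u 0 f"
proof -
  obtain p C where pC: "\<And>N. \<forall>\<^sub>F n in sequentially. \<bar>u n - poly (p N) (1 / real n)\<bar> \<le> C N * (1 / real n) ^ N"
    using assms unfolding poly_approx_def by metis
  have agree: "coeff (p N) i = coeff (p M) i" if "i < N" "N \<le> M" for N M i
  proof -
    have "\<forall>\<^sub>F n in sequentially. \<bar>poly (p N - p M) (1 / real n)\<bar> \<le> (C N + \<bar>C M\<bar>) * (1 / real n) ^ N"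
      using pC[of N] pC[of M] eventually_gt_at_top[of 0]
    proof eventually_elim
      case (elim n)
      have "(1 / real n) ^ M \<le> (1 / real n) ^ N" using that elim(3) by (intro power_decreasing) auto
      then have "\<bar>C M\<bar> * (1 / real n) ^ M \<le> \<bar>C M\<bar> * (1 / real n) ^ N" by (intro mult_left_mono) auto
      moreover have "C M * (1 / real n) ^ M \<le> \<bar>C M\<bar> * (1 / real n) ^ M" by (intro mult_right_mono) auto
      ultimately show ?case using elim(1,2) unfolding poly_diff distrib_right by linarith
    qed
    from poly_coeffs_zero[OF this that(1)] show ?thesis by simp
  qed
  define f where "f i = coeff (p (Suc i)) i" for i
  have "asymp_exp u 0 f" unfolding asymp_exp_def
  proof
    fix N
    define d where "d = p (Suc N) - (\<Sum>l\<le>N. monom (f l) l)"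
    have "coeff d i = 0" if "i < Suc N" for i
      using agree[of i "Suc i" "Suc N"] that unfolding d_def coeff_diff coeff_of_sum f_def by simp
    then obtain C1 where C1: "C1 \<ge> 0" "\<And>x. 0 \<le> x \<Longrightarrow> x \<le> 1 \<Longrightarrow> \<bar>poly d x\<bar> \<le> C1 * x ^ Suc N"
      using poly_small_order[of "Suc N" d] by blast
    have "\<forall>\<^sub>F n in sequentially. \<bar>u n / real n powr 0 - (\<Sum>l\<le>N. f l * (1 / real n) ^ l)\<bar> \<le> (C (Suc N) + C1) * (1 / real n) ^ Suc N"
      using pC[of "Suc N"] eventually_gt_at_top[of 0]
    proof eventually_elim
      case (elim n)
      have "\<bar>poly d (1 / real n)\<bar> \<le> C1 * (1 / real n) ^ Suc N" using elim(2) by (intro C1(2)) auto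
      then show ?case using elim unfolding d_def poly_diff poly_of_sum distrib_right by simp
    qed
    then show "\<exists>C. \<forall>\<^sub>F k in sequentially. \<bar>u k / real k powr 0 - (\<Sum>l\<le>N. f l * (1 / real k) ^ l)\<bar> \<le> C * (1 / real k) ^ Suc N" by blast
  qed
  then show ?thesis by blast
qed

section \<open>Expansions uniform in the core-size\<close>

context renewal
begin

definition sn :: "nat \<Rightarrow> real" where "sn n = 1 / sqrt (real n)"

text \<open>The unit of error. It dominates both \<open>sn n\<close> and
  \<open>\<bar>T n k\<bar> * sn n\<close>, so a polynomial of degree at most \<open>m\<close> in
  \<open>T\<close> times \<open>sn n ^ m\<close> is of order \<open>eta ^ m\<close>; it stays
  bounded while \<open>\<bar>T n k\<bar> \<le> \<delta> * sqrt n\<close>.\<close>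

definition eta :: "nat \<Rightarrow> nat \<Rightarrow> real" where "eta n k = sqrt (1 + (T n k)\<^sup>2) * sn n"

lemma sn_bounds: "n > 0 \<Longrightarrow> 0 < sn n" "n > 0 \<Longrightarrow> sn n \<le> 1" "0 \<le> sn n" "(sn n)\<^sup>2 = 1 / real n"
  by (auto simp: sn_def power_divide)

lemma sn_even_power: "sn n ^ (2 * l) = (1 / real n) ^ l"
  by (simp add: power_mult sn_bounds)

lemma eta_nonneg: "eta n k \<ge> 0"
  by (simp add: eta_def sn_bounds)

lemma sn_le_eta: "sn n \<le> eta n k"
  using mult_right_mono[of 1 "sqrt (1 + (T n k)\<^sup>2)" "sn n"] sn_bounds(3) by (simp add: eta_def)

lemma T_sn_le_eta: "\<bar>T n k\<bar> * sn n \<le> eta n k"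
  unfolding eta_def using real_sqrt_le_mono[of "(T n k)\<^sup>2" "1 + (T n k)\<^sup>2"]
  by (intro mult_right_mono sn_bounds) simp

lemma eta_le:
  assumes "n > 0" "\<bar>T n k\<bar> \<le> \<delta> * sqrt (real n)"
  shows "eta n k \<le> 1 + \<delta>"
proof -
  have d0: "\<delta> \<ge> 0"
  proof (rule ccontr)
    assume "\<not> \<delta> \<ge> 0"
    then have "\<delta> * sqrt (real n) < 0" using assms(1) by (simp add: mult_neg_pos)
    then show False using assms(2) abs_ge_zero[of "T n k"] by linarith
  qed
  have "1 + (T n k)\<^sup>2 \<le> (1 + \<bar>T n k\<bar>)\<^sup>2" by (simp add: power2_sum)
  then have "sqrt (1 + (T n k)\<^sup>2) \<le> 1 + \<bar>T n k\<bar>" by (intro real_le_lsqrt) auto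
  then have "eta n k \<le> (1 + \<bar>T n k\<bar>) * sn n" unfolding eta_def by (intro mult_right_mono sn_bounds)
  also have "\<dots> = sn n + \<bar>T n k\<bar> * sn n" by (simp add: distrib_right)
  also have "\<bar>T n k\<bar> * sn n \<le> \<delta> * sqrt (real n) * sn n" using assms(2) by (intro mult_right_mono sn_bounds)
  also have "\<delta> * sqrt (real n) * sn n = \<delta>" using assms(1) by (simp add: sn_def)
  finally show ?thesis using sn_bounds(2)[OF assms(1)] by linarith
qed

lemma poly_term_bound:
  assumes "degree p \<le> m"
  shows "\<exists>C\<ge>0. \<forall>n k. \<bar>poly p (T n k) * sn n ^ m\<bar> \<le> C * eta n k ^ m"
proof -
  obtain C where C: "C \<ge> 0" "\<And>t. \<bar>poly p t\<bar> \<le> C * sqrt (1 + t\<^sup>2) ^ m" using poly_bound_sqrt[OF assms] by blast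
  have "\<bar>poly p (T n k) * sn n ^ m\<bar> \<le> C * eta n k ^ m" for n k
  proof -
    have "\<bar>poly p (T n k) * sn n ^ m\<bar> = \<bar>poly p (T n k)\<bar> * sn n ^ m"
      using sn_bounds(3)[of n] by (simp add: abs_mult)
    also have "\<dots> \<le> C * sqrt (1 + (T n k)\<^sup>2) ^ m * sn n ^ m" using sn_bounds(3)[of n] by (intro mult_right_mono C) auto
    finally show ?thesis by (simp add: eta_def power_mult_distrib mult.assoc)
  qed
  then show ?thesis using C(1) by blast
qed

text \<open>The range of \<open>T\<close> is a window of \<open>k\<close> around
  \<open>n / mean\<close> with width proportional to \<open>n\<close>. A fixed
  \<open>\<delta>\<close> is convenient since finitely many expansions can be added on the smallest
  window, and every \<open>o(sqrt n)\<close> range ends up inside it.\<close>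

definition EXP :: "nat \<Rightarrow> (nat \<Rightarrow> nat \<Rightarrow> real) \<Rightarrow> (nat \<Rightarrow> real poly) \<Rightarrow> bool" where
  "EXP r F P \<longleftrightarrow> (\<exists>K \<delta>. \<delta> > 0 \<and> (\<forall>\<^sub>F n in sequentially. \<forall>k. \<bar>T n k\<bar> \<le> \<delta> * sqrt (real n) \<longrightarrow>
     \<bar>F n k - (\<Sum>m\<le>r. poly (P m) (T n k) * sn n ^ m)\<bar> \<le> K * eta n k ^ Suc r))"

lemma EXP_I:
  assumes "\<delta> > 0" "\<forall>\<^sub>F n in sequentially. \<forall>k. \<bar>T n k\<bar> \<le> \<delta> * sqrt (real n) \<longrightarrow>
     \<bar>F n k - (\<Sum>m\<le>r. poly (P m) (T n k) * sn n ^ m)\<bar> \<le> K * eta n k ^ Suc r"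
  shows "EXP r F P"
  using assms unfolding EXP_def by blast

lemma EXP_E:
  assumes "EXP r F P"
  shows "\<exists>K \<delta>. K \<ge> 0 \<and> \<delta> > 0 \<and> (\<forall>\<^sub>F n in sequentially. \<forall>k. \<bar>T n k\<bar> \<le> \<delta> * sqrt (real n) \<longrightarrow>
     \<bar>F n k - (\<Sum>m\<le>r. poly (P m) (T n k) * sn n ^ m)\<bar> \<le> K * eta n k ^ Suc r)"
proof -
  obtain K \<delta> where d: "\<delta> > 0" and K: "\<forall>\<^sub>F n in sequentially. \<forall>k. \<bar>T n k\<bar> \<le> \<delta> * sqrt (real n) \<longrightarrow>
     \<bar>F n k - (\<Sum>m\<le>r. poly (P m) (T n k) * sn n ^ m)\<bar> \<le> K * eta n k ^ Suc r"
    using assms unfolding EXP_def by blast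
  have le: "K * eta n k ^ Suc r \<le> \<bar>K\<bar> * eta n k ^ Suc r" for n k
    using eta_nonneg[of n k] by (intro mult_right_mono) auto
  have "\<forall>\<^sub>F n in sequentially. \<forall>k. \<bar>T n k\<bar> \<le> \<delta> * sqrt (real n) \<longrightarrow>
     \<bar>F n k - (\<Sum>m\<le>r. poly (P m) (T n k) * sn n ^ m)\<bar> \<le> \<bar>K\<bar> * eta n k ^ Suc r"
    using K by eventually_elim (use le order_trans in blast)
  then show ?thesis using d abs_ge_zero[of K] by blast
qed

lemma EXP_add:
  assumes "EXP r F P" "EXP r G Q"
  shows "EXP r (\<lambda>n k. F n k + G n k) (\<lambda>m. P m + Q m)"
proof -
  obtain K \<delta> where 1: "\<delta> > 0" "\<forall>\<^sub>F n in sequentially. \<forall>k. \<bar>T n k\<bar> \<le> \<delta> * sqrt (real n) \<longrightarrow>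
     \<bar>F n k - (\<Sum>m\<le>r. poly (P m) (T n k) * sn n ^ m)\<bar> \<le> K * eta n k ^ Suc r" using assms(1) unfolding EXP_def by blast
  obtain K' \<delta>' where 2: "\<delta>' > 0" "\<forall>\<^sub>F n in sequentially. \<forall>k. \<bar>T n k\<bar> \<le> \<delta>' * sqrt (real n) \<longrightarrow>
     \<bar>G n k - (\<Sum>m\<le>r. poly (Q m) (T n k) * sn n ^ m)\<bar> \<le> K' * eta n k ^ Suc r" using assms(2) unfolding EXP_def by blast
  show ?thesis
  proof (rule EXP_I)
    show "min \<delta> \<delta>' > 0" using 1 2 by simp
    show "\<forall>\<^sub>F n in sequentially. \<forall>k. \<bar>T n k\<bar> \<le> min \<delta> \<delta>' * sqrt (real n) \<longrightarrow>
       \<bar>F n k + G n k - (\<Sum>m\<le>r. poly (P m + Q m) (T n k) * sn n ^ m)\<bar> \<le> (K + K') * eta n k ^ Suc r"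
      using 1(2) 2(2)
    proof eventually_elim
      case (elim n)
      show ?case
      proof (intro allI impI)
        fix k assume t: "\<bar>T n k\<bar> \<le> min \<delta> \<delta>' * sqrt (real n)"
        have "min \<delta> \<delta>' * sqrt (real n) \<le> \<delta> * sqrt (real n)" "min \<delta> \<delta>' * sqrt (real n) \<le> \<delta>' * sqrt (real n)"
          by (intro mult_right_mono; simp)+
        then have "\<bar>F n k - (\<Sum>m\<le>r. poly (P m) (T n k) * sn n ^ m)\<bar> \<le> K * eta n k ^ Suc r"
          "\<bar>G n k - (\<Sum>m\<le>r. poly (Q m) (T n k) * sn n ^ m)\<bar> \<le> K' * eta n k ^ Suc r"
          using elim t order_trans by blast+
        then show "\<bar>F n k + G n k - (\<Sum>m\<le>r. poly (P m + Q m) (T n k) * sn n ^ m)\<bar> \<le> (K + K') * eta n k ^ Suc r"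
          unfolding poly_add distrib_right sum.distrib by linarith
      qed
    qed
  qed
qed

lemma EXP_cmult:
  assumes "EXP r F P"
  shows "EXP r (\<lambda>n k. c * F n k) (\<lambda>m. smult c (P m))"
proof -
  obtain K \<delta> where 1: "\<delta> > 0" "\<forall>\<^sub>F n in sequentially. \<forall>k. \<bar>T n k\<bar> \<le> \<delta> * sqrt (real n) \<longrightarrow>
     \<bar>F n k - (\<Sum>m\<le>r. poly (P m) (T n k) * sn n ^ m)\<bar> \<le> K * eta n k ^ Suc r" using assms(1) unfolding EXP_def by blast
  show ?thesis
  proof (rule EXP_I[OF 1(1)])
    show "\<forall>\<^sub>F n in sequentially. \<forall>k. \<bar>T n k\<bar> \<le> \<delta> * sqrt (real n) \<longrightarrow>
       \<bar>c * F n k - (\<Sum>m\<le>r. poly (smult c (P m)) (T n k) * sn n ^ m)\<bar> \<le> (\<bar>c\<bar> * K) * eta n k ^ Suc r"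
      using 1(2)
    proof eventually_elim
      case (elim n)
      show ?case
      proof (intro allI impI)
        fix k assume t: "\<bar>T n k\<bar> \<le> \<delta> * sqrt (real n)"
        have "c * F n k - (\<Sum>m\<le>r. poly (smult c (P m)) (T n k) * sn n ^ m) =
            c * (F n k - (\<Sum>m\<le>r. poly (P m) (T n k) * sn n ^ m))"
          by (simp add: right_diff_distrib sum_distrib_left mult.assoc)
        then have "\<bar>c * F n k - (\<Sum>m\<le>r. poly (smult c (P m)) (T n k) * sn n ^ m)\<bar> =
            \<bar>c\<bar> * \<bar>F n k - (\<Sum>m\<le>r. poly (P m) (T n k) * sn n ^ m)\<bar>" by (simp only: abs_mult)
        also have "\<dots> \<le> \<bar>c\<bar> * (K * eta n k ^ Suc r)" using elim t by (intro mult_left_mono) auto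
        finally show "\<bar>c * F n k - (\<Sum>m\<le>r. poly (smult c (P m)) (T n k) * sn n ^ m)\<bar> \<le> (\<bar>c\<bar> * K) * eta n k ^ Suc r"
          by (simp only: mult.assoc)
      qed
    qed
  qed
qed

lemma EXP_zero: "EXP r (\<lambda>n k. 0) (\<lambda>m. 0)"
  by (rule EXP_I[of 1 _ _ _ 0]) simp_all

lemma EXP_sum:
  "finite A \<Longrightarrow> (\<And>i. i \<in> A \<Longrightarrow> EXP r (F i) (P i)) \<Longrightarrow> EXP r (\<lambda>n k. \<Sum>i\<in>A. F i n k) (\<lambda>m. \<Sum>i\<in>A. P i m)"
  by (induction A rule: finite_induct) (simp_all add: EXP_zero EXP_add)

lemma EXP_cong_poly: "(\<And>m. m \<le> r \<Longrightarrow> P m = Q m) \<Longrightarrow> EXP r F P \<Longrightarrow> EXP r F Q"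
  unfolding EXP_def by (simp cong: sum.cong_simp)

lemma EXP_trunc_Suc:
  assumes "EXP (Suc r) F P" "degree (P (Suc r)) \<le> Suc r"
  shows "EXP r F P"
proof -
  obtain K \<delta> where 1: "K \<ge> 0" "\<delta> > 0" "\<forall>\<^sub>F n in sequentially. \<forall>k. \<bar>T n k\<bar> \<le> \<delta> * sqrt (real n) \<longrightarrow>
     \<bar>F n k - (\<Sum>m\<le>Suc r. poly (P m) (T n k) * sn n ^ m)\<bar> \<le> K * eta n k ^ Suc (Suc r)" using EXP_E[OF assms(1)] by blast
  obtain C where C: "\<And>n k. \<bar>poly (P (Suc r)) (T n k) * sn n ^ Suc r\<bar> \<le> C * eta n k ^ Suc r"
    using poly_term_bound[OF assms(2)] by blast
  show ?thesis
  proof (rule EXP_I[OF 1(2)])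
    show "\<forall>\<^sub>F n in sequentially. \<forall>k. \<bar>T n k\<bar> \<le> \<delta> * sqrt (real n) \<longrightarrow>
       \<bar>F n k - (\<Sum>m\<le>r. poly (P m) (T n k) * sn n ^ m)\<bar> \<le> (K * (1 + \<delta>) + C) * eta n k ^ Suc r"
      using 1(3) eventually_gt_at_top[of 0]
    proof eventually_elim
      case (elim n)
      show ?case
      proof (intro allI impI)
        fix k assume t: "\<bar>T n k\<bar> \<le> \<delta> * sqrt (real n)"
        have a: "\<bar>F n k - ((\<Sum>m\<le>r. poly (P m) (T n k) * sn n ^ m) + poly (P (Suc r)) (T n k) * sn n ^ Suc r)\<bar> \<le> K * eta n k ^ Suc (Suc r)"
          using elim(1) t by simp
        have "K * eta n k ^ Suc (Suc r) = K * eta n k * eta n k ^ Suc r" by simp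
        also have "\<dots> \<le> K * (1 + \<delta>) * eta n k ^ Suc r"
          using eta_le[OF elim(2) t] 1(1) eta_nonneg[of n k] by (intro mult_right_mono mult_left_mono) auto
        finally show "\<bar>F n k - (\<Sum>m\<le>r. poly (P m) (T n k) * sn n ^ m)\<bar> \<le> (K * (1 + \<delta>) + C) * eta n k ^ Suc r"
          using a C[of n k] unfolding distrib_right by linarith
      qed
    qed
  qed
qed

lemma EXP_trunc:
  assumes "\<And>m. parity_poly m (P m)" "EXP (r + j) F P"
  shows "EXP r F P"
  using assms(2)
proof (induction j)
  case (Suc j)
  then show ?case using EXP_trunc_Suc[of "r + j" F P] parity_poly_degree[OF assms(1)] by simp
qed simp

lemma sum_shift_if: "(\<Sum>m\<le>r + j. if m < j then 0 else f (m - j)) = (\<Sum>m\<le>r. f m)" for f :: "nat \<Rightarrow> real"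
proof (induction j)
  case (Suc j)
  have "(\<Sum>m\<le>r + Suc j. if m < Suc j then 0 else f (m - Suc j)) = (\<Sum>m\<le>r + j. if m < j then 0 else f (m - j))"
    by (simp only: add_Suc_right sum.atMost_Suc_shift) (simp cong: if_cong)
  then show ?case using Suc.IH by simp
qed simp

text \<open>A factor \<open>1 / n ^ l\<close> is \<open>sn n ^ (2 * l)\<close> and moves the index
  by \<open>2 * l\<close>, which leaves the parity condition intact.\<close>

definition shift_poly :: "nat \<Rightarrow> (nat \<Rightarrow> real poly) \<Rightarrow> nat \<Rightarrow> real poly" where
  "shift_poly l P m = (if m < 2 * l then 0 else P (m - 2 * l))"

lemma parity_shift_poly: "(\<And>m. parity_poly m (P m)) \<Longrightarrow> parity_poly m (shift_poly l P m)"
  unfolding shift_poly_def using parity_poly_shift[of l m "P (m - 2 * l)"] parity_poly_0 by simp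

text \<open>The shift first yields an expansion of order \<open>r + 2 * l\<close>; cutting it back
  to order \<open>r\<close> relies on the degree bounds contained in the parity condition.\<close>

lemma EXP_shift:
  assumes par: "\<And>m. parity_poly m (P m)" and F: "EXP r F P"
  shows "EXP r (\<lambda>n k. (1 / real n) ^ l * F n k) (shift_poly l P)"
proof -
  obtain K \<delta> where 1: "K \<ge> 0" "\<delta> > 0" "\<forall>\<^sub>F n in sequentially. \<forall>k. \<bar>T n k\<bar> \<le> \<delta> * sqrt (real n) \<longrightarrow>
     \<bar>F n k - (\<Sum>m\<le>r. poly (P m) (T n k) * sn n ^ m)\<bar> \<le> K * eta n k ^ Suc r" using EXP_E[OF F] by blast
  have "EXP (r + 2 * l) (\<lambda>n k. (1 / real n) ^ l * F n k) (shift_poly l P)"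
  proof (rule EXP_I[OF 1(2)])
    show "\<forall>\<^sub>F n in sequentially. \<forall>k. \<bar>T n k\<bar> \<le> \<delta> * sqrt (real n) \<longrightarrow>
       \<bar>(1 / real n) ^ l * F n k - (\<Sum>m\<le>r + 2 * l. poly (shift_poly l P m) (T n k) * sn n ^ m)\<bar> \<le> K * eta n k ^ Suc (r + 2 * l)"
      using 1(3)
    proof eventually_elim
      case (elim n)
      show ?case
      proof (intro allI impI)
        fix k assume t: "\<bar>T n k\<bar> \<le> \<delta> * sqrt (real n)"
        let ?S = "\<Sum>m\<le>r. poly (P m) (T n k) * sn n ^ m"
        have "(\<Sum>m\<le>r + 2 * l. poly (shift_poly l P m) (T n k) * sn n ^ m) =
            (\<Sum>m\<le>r + 2 * l. if m < 2 * l then 0 else sn n ^ (2 * l) * (poly (P (m - 2 * l)) (T n k) * sn n ^ (m - 2 * l)))"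
          by (intro sum.cong refl) (auto simp: shift_poly_def mult_ac simp flip: power_add)
        also have "\<dots> = (\<Sum>m\<le>r. sn n ^ (2 * l) * (poly (P m) (T n k) * sn n ^ m))" by (rule sum_shift_if)
        also have "\<dots> = sn n ^ (2 * l) * ?S" by (simp add: sum_distrib_left)
        finally have "(1 / real n) ^ l * F n k - (\<Sum>m\<le>r + 2 * l. poly (shift_poly l P m) (T n k) * sn n ^ m) = sn n ^ (2 * l) * (F n k - ?S)"
          by (simp add: sn_even_power right_diff_distrib)
        then have "\<bar>(1 / real n) ^ l * F n k - (\<Sum>m\<le>r + 2 * l. poly (shift_poly l P m) (T n k) * sn n ^ m)\<bar> = sn n ^ (2 * l) * \<bar>F n k - ?S\<bar>"
          using sn_bounds(3)[of n] by (simp add: abs_mult)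
        also have "\<dots> \<le> eta n k ^ (2 * l) * (K * eta n k ^ Suc r)"
          using elim t sn_bounds(3)[of n] sn_le_eta[of n k] eta_nonneg[of n k] by (intro mult_mono power_mono) auto
        also have "\<dots> = K * eta n k ^ Suc (r + 2 * l)" by (simp add: power_add mult_ac)
        finally show "\<bar>(1 / real n) ^ l * F n k - (\<Sum>m\<le>r + 2 * l. poly (shift_poly l P m) (T n k) * sn n ^ m)\<bar> \<le> K * eta n k ^ Suc (r + 2 * l)" .
      qed
    qed
  qed
  then show ?thesis by (rule EXP_trunc[rotated]) (rule parity_shift_poly[OF par])
qed

text \<open>The factor \<open>\<sigma> / sqrt \<mu>\<close> in the relative deviation
  \<open>X\<close> of \<open>k\<close> from \<open>n / mean\<close>.\<close>

definition tau :: real where "tau = sqrt var / sqrt mean"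

definition X :: "nat \<Rightarrow> nat \<Rightarrow> real" where "X n k = tau * T n k * sn n"

lemma tau_pos: "tau > 0" using var_pos mean_ge_1 by (simp add: tau_def)

lemma k_eq:
  assumes n: "n > 0"
  shows "real k = real n / mean * (1 + X n k)"
proof -
  have "tau * T n k = dev n k" using mean_ge_1 var_pos by (simp add: T_eq[OF n] tau_def)
  then have "X n k = (real k * mean - real n) / (sqrt (real n) * sqrt (real n))"
    by (simp add: X_def dev_def sn_def)
  then have "X n k = (real k * mean - real n) / real n" by simp
  then show ?thesis using mean_ge_1 n by (simp add: field_simps)
qed

lemma X_le: "\<bar>X n k\<bar> \<le> tau * eta n k"
  using mult_left_mono[OF T_sn_le_eta, of tau n k] tau_pos sn_bounds(3)[of n] by (simp add: X_def abs_mult mult.assoc)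

lemma X_half:
  assumes "n > 0" "\<bar>T n k\<bar> \<le> 1 / (2 * tau) * sqrt (real n)"
  shows "\<bar>X n k\<bar> \<le> 1 / 2"
proof -
  have "\<bar>X n k\<bar> = tau * \<bar>T n k\<bar> * sn n" using tau_pos sn_bounds(3)[of n] by (simp add: X_def abs_mult)
  also have "\<dots> \<le> tau * (1 / (2 * tau) * sqrt (real n)) * sn n" using assms tau_pos sn_bounds(3)[of n]
    by (intro mult_right_mono mult_left_mono) auto
  also have "\<dots> = 1 / 2" using tau_pos assms(1) by (simp add: sn_def)
  finally show ?thesis .
qed

definition bin_poly :: "real \<Rightarrow> nat \<Rightarrow> real poly" where
  "bin_poly \<beta> m = monom ((\<beta> gchoose m) * tau ^ m) m"

lemma parity_bin_poly: "parity_poly m (bin_poly \<beta> m)"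
  by (simp add: bin_poly_def parity_poly_monom)

lemma EXP_binomial: "EXP r (\<lambda>n k. (1 + X n k) powr \<beta>) (bin_poly \<beta>)"
proof -
  obtain C where C: "C \<ge> 0" "\<And>x. \<bar>x\<bar> \<le> 1 / 2 \<Longrightarrow> \<bar>(1 + x) powr \<beta> - (\<Sum>m\<le>r. (\<beta> gchoose m) * x ^ m)\<bar> \<le> C * \<bar>x\<bar> ^ Suc r"
    using binomial_remainder by blast
  show ?thesis
  proof (rule EXP_I)
    \<comment> \<open>In this window \<open>\<bar>X n k\<bar> \<le> 1 / 2\<close>, the range of
      \<open>binomial_remainder\<close>.\<close>
    show "1 / (2 * tau) > 0" using tau_pos by simp
    show "\<forall>\<^sub>F n in sequentially. \<forall>k. \<bar>T n k\<bar> \<le> 1 / (2 * tau) * sqrt (real n) \<longrightarrow>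
       \<bar>(1 + X n k) powr \<beta> - (\<Sum>m\<le>r. poly (bin_poly \<beta> m) (T n k) * sn n ^ m)\<bar> \<le> (C * tau ^ Suc r) * eta n k ^ Suc r"
      using eventually_gt_at_top[of 0]
    proof eventually_elim
      case (elim n)
      show ?case
      proof (intro allI impI)
        fix k assume t: "\<bar>T n k\<bar> \<le> 1 / (2 * tau) * sqrt (real n)"
        have "(\<Sum>m\<le>r. poly (bin_poly \<beta> m) (T n k) * sn n ^ m) = (\<Sum>m\<le>r. (\<beta> gchoose m) * X n k ^ m)"
          by (simp add: bin_poly_def poly_monom X_def power_mult_distrib mult_ac)
        then have "\<bar>(1 + X n k) powr \<beta> - (\<Sum>m\<le>r. poly (bin_poly \<beta> m) (T n k) * sn n ^ m)\<bar> \<le> C * \<bar>X n k\<bar> ^ Suc r"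
          using C(2)[OF X_half[OF elim t]] by simp
        also have "\<dots> \<le> C * (tau * eta n k) ^ Suc r" using C(1) X_le by (intro mult_left_mono power_mono) auto
        finally show "\<bar>(1 + X n k) powr \<beta> - (\<Sum>m\<le>r. poly (bin_poly \<beta> m) (T n k) * sn n ^ m)\<bar> \<le> (C * tau ^ Suc r) * eta n k ^ Suc r"
          by (simp only: power_mult_distrib mult.assoc)
      qed
    qed
  qed
qed

lemma EXP_bounded:
  assumes F: "EXP r F P" and par: "\<And>m. parity_poly m (P m)"
  shows "\<exists>B \<delta>. B \<ge> 0 \<and> \<delta> > 0 \<and> (\<forall>\<^sub>F n in sequentially. \<forall>k. \<bar>T n k\<bar> \<le> \<delta> * sqrt (real n) \<longrightarrow> \<bar>F n k\<bar> \<le> B)"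
proof -
  have "EXP 0 F P" using EXP_trunc[of P 0 r F] par F by simp
  then obtain K \<delta> where 1: "K \<ge> 0" "\<delta> > 0" "\<forall>\<^sub>F n in sequentially. \<forall>k. \<bar>T n k\<bar> \<le> \<delta> * sqrt (real n) \<longrightarrow>
     \<bar>F n k - (\<Sum>m\<le>0. poly (P m) (T n k) * sn n ^ m)\<bar> \<le> K * eta n k ^ Suc 0" using EXP_E by blast
  obtain C where C: "C \<ge> 0" "\<And>n k. \<bar>poly (P 0) (T n k) * sn n ^ 0\<bar> \<le> C * eta n k ^ 0"
    using poly_term_bound[OF parity_poly_degree[OF par]] by blast
  have "\<forall>\<^sub>F n in sequentially. \<forall>k. \<bar>T n k\<bar> \<le> \<delta> * sqrt (real n) \<longrightarrow> \<bar>F n k\<bar> \<le> K * (1 + \<delta>) + C"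
    using 1(3) eventually_gt_at_top[of 0]
  proof eventually_elim
    case (elim n)
    show ?case
    proof (intro allI impI)
      fix k assume t: "\<bar>T n k\<bar> \<le> \<delta> * sqrt (real n)"
      have "K * eta n k \<le> K * (1 + \<delta>)" using eta_le[OF elim(2) t] 1(1) by (intro mult_left_mono)
      moreover have "\<bar>F n k - poly (P 0) (T n k)\<bar> \<le> K * eta n k" using elim(1) t by simp
      moreover have "\<bar>poly (P 0) (T n k)\<bar> \<le> C" using C(2)[of n k] by simp
      ultimately show "\<bar>F n k\<bar> \<le> K * (1 + \<delta>) + C" by linarith
    qed
  qed
  moreover have "K * (1 + \<delta>) + C \<ge> 0" using 1 C by simp
  ultimately show ?thesis using 1(2) by blast
qed

text \<open>The result of substituting \<open>k = n / mean * (1 + X)\<close> into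
  \<open>k^\<alpha> \<Sum> f l k^(-l)\<close> and dividing by \<open>(n / mean)^\<alpha>\<close>:
  the \<open>l\<close>th term becomes \<open>f l mean^l n^(-l) (1 + X)^(\<alpha> - l)\<close>. Only
  \<open>l \<le> m\<close> can reach the index \<open>m\<close>.\<close>

definition ratio_poly :: "(nat \<Rightarrow> real) \<Rightarrow> real \<Rightarrow> nat \<Rightarrow> real poly" where
  "ratio_poly f \<alpha> m = (\<Sum>l\<le>m. smult (f l * mean ^ l) (shift_poly l (bin_poly (\<alpha> - real l)) m))"

lemma parity_ratio_poly: "parity_poly m (ratio_poly f \<alpha> m)"
  unfolding ratio_poly_def by (intro parity_poly_sum parity_poly_smult parity_shift_poly parity_bin_poly)

lemma ratio_poly_0: "ratio_poly f \<alpha> 0 = [:f 0:]"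
  by (simp add: ratio_poly_def shift_poly_def bin_poly_def monom_0)

text \<open>In the window \<open>k \<ge> n / (2 * mean)\<close>, so \<open>k\<close> tends to
  infinity uniformly and the expansion of \<open>h\<close> may be used at \<open>k\<close>. Its
  error, a power of \<open>1 / k\<close>, is a multiple of the same power of \<open>eta\<close>
  because \<open>1 / k \<le> 2 * mean * sn n ^ 2\<close>.\<close>

lemma EXP_ratio:
  assumes h: "asymp_exp h \<alpha> f"
  shows "EXP r (\<lambda>n k. h k * (real n / mean) powr (- \<alpha>)) (ratio_poly f \<alpha>)"
proof -
  have m1: "mean \<ge> 1" by (rule mean_ge_1)
  define G where "G n k = (\<Sum>l\<le>r. f l * mean ^ l * ((1 / real n) ^ l * (1 + X n k) powr (\<alpha> - real l)))" for n k
  have "EXP r G (\<lambda>m. \<Sum>l\<le>r. smult (f l * mean ^ l) (shift_poly l (bin_poly (\<alpha> - real l)) m))"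
    unfolding G_def by (intro EXP_sum EXP_cmult EXP_shift parity_bin_poly EXP_binomial) simp
  then have G: "EXP r G (ratio_poly f \<alpha>)"
  proof (rule EXP_cong_poly[rotated])
    fix m assume "m \<le> r"
    then show "(\<Sum>l\<le>r. smult (f l * mean ^ l) (shift_poly l (bin_poly (\<alpha> - real l)) m)) = ratio_poly f \<alpha> m"
      unfolding ratio_poly_def by (intro sum.mono_neutral_right) (auto simp: shift_poly_def)
  qed
  obtain C where C: "\<forall>\<^sub>F k in sequentially. \<bar>h k / real k powr \<alpha> - (\<Sum>l\<le>r. f l * (1 / real k) ^ l)\<bar> \<le> C * (1 / real k) ^ Suc r"
    using h unfolding asymp_exp_def by blast
  then obtain k0 where k0: "\<And>k. k \<ge> k0 \<Longrightarrow> \<bar>h k / real k powr \<alpha> - (\<Sum>l\<le>r. f l * (1 / real k) ^ l)\<bar> \<le> C * (1 / real k) ^ Suc r"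
    unfolding eventually_sequentially by blast
  obtain B \<delta>0 where B: "B \<ge> 0" "\<delta>0 > 0" "\<forall>\<^sub>F n in sequentially. \<forall>k. \<bar>T n k\<bar> \<le> \<delta>0 * sqrt (real n) \<longrightarrow> \<bar>(1 + X n k) powr \<alpha>\<bar> \<le> B"
    using EXP_bounded[OF EXP_binomial parity_bin_poly] by blast
  define \<delta> where "\<delta> = min \<delta>0 (1 / (2 * tau))"
  have d: "\<delta> > 0" "\<delta> \<le> \<delta>0" "\<delta> \<le> 1 / (2 * tau)" using B tau_pos by (auto simp: \<delta>_def)
  have "EXP r (\<lambda>n k. h k * (real n / mean) powr (- \<alpha>) - G n k) (\<lambda>m. 0)"
  proof (rule EXP_I[OF d(1)])
    have "\<forall>\<^sub>F n in sequentially. (real k0 + 1) * (2 * mean) \<le> real n"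
      using filterlim_real_sequentially unfolding filterlim_at_top by blast
    then have "\<forall>\<^sub>F n in sequentially. real n / (2 * mean) \<ge> real k0 + 1"
      by eventually_elim (use m1 in \<open>simp add: field_simps\<close>)
    then show "\<forall>\<^sub>F n in sequentially. \<forall>k. \<bar>T n k\<bar> \<le> \<delta> * sqrt (real n) \<longrightarrow>
       \<bar>h k * (real n / mean) powr (- \<alpha>) - G n k - (\<Sum>m\<le>r. poly 0 (T n k) * sn n ^ m)\<bar> \<le> (\<bar>C\<bar> * (2 * mean) ^ Suc r * B) * eta n k ^ Suc r"
      using B(3) eventually_gt_at_top[of 0]
    proof eventually_elim
      case (elim n)
      show ?case
      proof (intro allI impI)
        fix k assume t: "\<bar>T n k\<bar> \<le> \<delta> * sqrt (real n)"
        have t1: "\<bar>T n k\<bar> \<le> \<delta>0 * sqrt (real n)" "\<bar>T n k\<bar> \<le> 1 / (2 * tau) * sqrt (real n)"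
          using t d(2,3) mult_right_mono[of _ _ "sqrt (real n)"] by (meson order_trans real_sqrt_ge_zero of_nat_0_le_iff)+
        have x: "\<bar>X n k\<bar> \<le> 1 / 2" by (rule X_half[OF elim(3) t1(2)])
        have x1: "1 + X n k \<ge> 1 / 2" using x by linarith
        have n0: "real n / mean > 0" using elim(3) m1 by simp
        have ke: "real k = real n / mean * (1 + X n k)" by (rule k_eq[OF elim(3)])
        have kge: "real k \<ge> real n / (2 * mean)"
          using mult_left_mono[OF x1, of "real n / mean"] n0 ke by simp
        then have kk: "k \<ge> k0" "real k > 0" using elim(1) by linarith+
        have kp: "real k powr \<alpha> * (real n / mean) powr (- \<alpha>) = (1 + X n k) powr \<alpha>"
        proof -
          have "(x * y) powr \<alpha> * x powr (- \<alpha>) = y powr \<alpha>" if "x > 0" "y > 0" for x y :: real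
            using that by (simp add: powr_mult powr_minus)
          moreover have "1 + X n k > 0" using x1 by linarith
          ultimately show ?thesis unfolding ke using n0 by blast
        qed
        have kl: "(1 / real k) ^ l * (1 + X n k) powr \<alpha> = mean ^ l * ((1 / real n) ^ l * (1 + X n k) powr (\<alpha> - real l))" for l
        proof -
          have "1 / real k = mean * (1 / real n) * (1 / (1 + X n k))" unfolding ke using m1 elim(3) by simp
          moreover have "(1 + X n k) powr (\<alpha> - real l) = (1 / (1 + X n k)) ^ l * (1 + X n k) powr \<alpha>"
            using x1 by (simp add: powr_diff powr_realpow power_divide)
          ultimately show ?thesis by (simp only: power_mult_distrib mult.assoc)
        qed
        have "h k * (real n / mean) powr (- \<alpha>) = h k / real k powr \<alpha> * (1 + X n k) powr \<alpha>"
          using kk(2) unfolding kp[symmetric] by simp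
        moreover have "G n k = (\<Sum>l\<le>r. f l * (1 / real k) ^ l) * (1 + X n k) powr \<alpha>"
          unfolding G_def sum_distrib_right mult.assoc kl ..
        ultimately have "h k * (real n / mean) powr (- \<alpha>) - G n k = (h k / real k powr \<alpha> - (\<Sum>l\<le>r. f l * (1 / real k) ^ l)) * (1 + X n k) powr \<alpha>"
          by (simp only: left_diff_distrib)
        then have "\<bar>h k * (real n / mean) powr (- \<alpha>) - G n k\<bar> = \<bar>h k / real k powr \<alpha> - (\<Sum>l\<le>r. f l * (1 / real k) ^ l)\<bar> * \<bar>(1 + X n k) powr \<alpha>\<bar>"
          by (simp only: abs_mult)
        also have "\<dots> \<le> (\<bar>C\<bar> * (1 / real k) ^ Suc r) * B"
        proof (rule mult_mono)
          show "\<bar>h k / real k powr \<alpha> - (\<Sum>l\<le>r. f l * (1 / real k) ^ l)\<bar> \<le> \<bar>C\<bar> * (1 / real k) ^ Suc r"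
            using k0[OF kk(1)] mult_right_mono[OF abs_ge_self[of C], of "(1 / real k) ^ Suc r"] by simp
          show "\<bar>(1 + X n k) powr \<alpha>\<bar> \<le> B" using elim(2) t1 by blast
        qed auto
        also have "\<dots> \<le> (\<bar>C\<bar> * (2 * mean * eta n k) ^ Suc r) * B"
        proof (intro mult_right_mono mult_left_mono power_mono B(1))
          have "1 / real k \<le> 1 / (real n / (2 * mean))" using kge kk(2) elim(3) m1 by (intro divide_left_mono mult_pos_pos divide_pos_pos) auto
          also have "\<dots> = 2 * mean * (sn n * sn n)" using sn_bounds(4)[of n] by (simp add: power2_eq_square)
          also have "\<dots> \<le> 2 * mean * (eta n k * 1)"
            using m1 sn_le_eta[of n k] sn_bounds[of n] elim(3) eta_nonneg[of n k] by (intro mult_left_mono mult_mono) auto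
          finally show "1 / real k \<le> 2 * mean * eta n k" by simp
        qed auto
        finally show "\<bar>h k * (real n / mean) powr (- \<alpha>) - G n k - (\<Sum>m\<le>r. poly 0 (T n k) * sn n ^ m)\<bar> \<le> (\<bar>C\<bar> * (2 * mean) ^ Suc r * B) * eta n k ^ Suc r"
          by (simp add: power_mult_distrib mult_ac)
      qed
    qed
  qed
  from EXP_add[OF this G] show ?thesis by simp
qed

lemma sqrt_1_le: "sqrt (1 + t\<^sup>2) \<le> 1 + t\<^sup>2" for t :: real
proof (rule real_le_lsqrt)
  show "1 + t\<^sup>2 \<le> (1 + t\<^sup>2)\<^sup>2" by (rule self_le_power) simp_all
qed simp

text \<open>The region \<open>T^4 \<le> n\<close> lies in the window of any given
  \<open>\<delta>\<close> once \<open>n \<ge> 1 / \<delta>^4\<close>, so expansions with different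
  \<open>\<delta>\<close> can be used on it together; outside it \<open>n\<close> is bounded by a
  power of \<open>T\<close>.\<close>

lemma region_le:
  assumes "\<delta> > 0"
  shows "\<forall>\<^sub>F n in sequentially. \<forall>k. T n k ^ 4 \<le> real n \<longrightarrow> \<bar>T n k\<bar> \<le> \<delta> * sqrt (real n)"
proof -
  have "\<forall>\<^sub>F n in sequentially. 1 / \<delta> ^ 4 \<le> real n"
    using filterlim_real_sequentially unfolding filterlim_at_top by blast
  then show ?thesis
  proof eventually_elim
    case (elim n)
    show ?case
    proof (intro allI impI)
      fix k assume t: "T n k ^ 4 \<le> real n"
      have "real n * 1 \<le> real n * (\<delta> ^ 4 * real n)"
        using elim assms by (intro mult_left_mono) (auto simp: field_simps)
      then have "\<bar>T n k\<bar> ^ 4 \<le> (\<delta> * sqrt (real n)) ^ 4"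
        using t by (simp add: power_mult_distrib power4_eq_xxxx mult_ac)
      then show "\<bar>T n k\<bar> \<le> \<delta> * sqrt (real n)" by (subst (asm) power_mono_iff) (use assms in auto)
    qed
  qed
qed

text \<open>Outside the region \<open>T n k ^ 4 \<le> n\<close> any polynomial factor in \<open>n\<close> is absorbed by a power of \<open>T n k\<close>.\<close>

lemma globalize:
  assumes r: "\<forall>\<^sub>F n in sequentially. \<forall>k. T n k ^ 4 \<le> real n \<longrightarrow> \<Phi> n k \<le> C1 * (1 + (T n k)\<^sup>2) ^ M1 * sn n ^ j"
    and c: "\<forall>\<^sub>F n in sequentially. \<forall>k. 1 \<le> k \<and> k \<le> n \<longrightarrow> \<Phi> n k \<le> C2 * real n ^ B * (1 + (T n k)\<^sup>2) ^ M2"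
  shows "\<exists>C M. C \<ge> 0 \<and> (\<forall>\<^sub>F n in sequentially. \<forall>k. 1 \<le> k \<and> k \<le> n \<longrightarrow> \<Phi> n k \<le> C * (1 + (T n k)\<^sup>2) ^ M * sn n ^ j)"
proof -
  define Q where "Q = B + j"
  define M where "M = M1 + M2 + 2 * Q"
  have "\<forall>\<^sub>F n in sequentially. \<forall>k. 1 \<le> k \<and> k \<le> n \<longrightarrow> \<Phi> n k \<le> (\<bar>C1\<bar> + \<bar>C2\<bar>) * (1 + (T n k)\<^sup>2) ^ M * sn n ^ j"
    using r c eventually_gt_at_top[of 0]
  proof eventually_elim
    case (elim n)
    have s0: "sn n ^ j \<ge> 0" "sn n \<le> 1" "0 \<le> sn n" using sn_bounds[of n] elim(3) by auto
    show ?case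
    proof (intro allI impI)
      fix k assume k: "1 \<le> k \<and> k \<le> n"
      define U where "U = 1 + (T n k)\<^sup>2"
      have U: "U \<ge> 1" by (simp add: U_def)
      show "\<Phi> n k \<le> (\<bar>C1\<bar> + \<bar>C2\<bar>) * (1 + (T n k)\<^sup>2) ^ M * sn n ^ j"
      proof (cases "T n k ^ 4 \<le> real n")
        case True
        then have "\<Phi> n k \<le> C1 * U ^ M1 * sn n ^ j" using elim(1) by (simp add: U_def)
        also have "\<dots> \<le> (\<bar>C1\<bar> + \<bar>C2\<bar>) * U ^ M * sn n ^ j"
          using U s0 by (intro mult_right_mono mult_mono power_increasing) (auto simp: M_def)
        finally show ?thesis by (simp add: U_def)
      next
        case False
        have "T n k ^ 4 \<le> U\<^sup>2"
        proof -
          have "((T n k)\<^sup>2)\<^sup>2 \<le> U\<^sup>2" by (intro power_mono) (auto simp: U_def)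
          then show ?thesis by (simp flip: power_mult)
        qed
        then have nU: "real n \<le> U\<^sup>2" using False by linarith
        have "real n ^ B \<le> U ^ (2 * Q) * sn n ^ j"
        proof -
          have "real n ^ B = real n ^ Q * (sn n ^ (2 * j))"
            using elim(3) by (simp add: sn_even_power Q_def power_add power_divide)
          also have "\<dots> \<le> (U\<^sup>2) ^ Q * sn n ^ j"
            using nU s0 by (intro mult_mono power_mono power_decreasing) auto
          finally show ?thesis by (simp add: power_mult)
        qed
        have "\<Phi> n k \<le> C2 * real n ^ B * U ^ M2" using elim(2) k by (simp add: U_def)
        also have "\<dots> \<le> \<bar>C2\<bar> * (U ^ (2 * Q) * sn n ^ j) * U ^ M2"
          using \<open>real n ^ B \<le> _\<close> U by (intro mult_right_mono mult_mono) auto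
        also have "\<dots> = \<bar>C2\<bar> * U ^ (2 * Q + M2) * sn n ^ j" by (simp add: power_add mult_ac)
        also have "\<dots> \<le> (\<bar>C1\<bar> + \<bar>C2\<bar>) * U ^ M * sn n ^ j"
          using U s0 by (intro mult_right_mono mult_mono power_increasing) (auto simp: M_def)
        finally show ?thesis by (simp add: U_def)
      qed
    qed
  qed
  moreover have "\<bar>C1\<bar> + \<bar>C2\<bar> \<ge> 0" by simp
  ultimately show ?thesis by blast
qed

lemma E_globalize:
  assumes "\<forall>\<^sub>F n in sequentially. \<forall>k. 1 \<le> k \<and> k \<le> n \<longrightarrow> \<Phi> n k \<le> C * (1 + (T n k)\<^sup>2) ^ M * sn n ^ j" "C \<ge> 0"
  shows "\<exists>C'\<ge>0. \<forall>\<^sub>F n in sequentially. E n (\<Phi> n) \<le> C' * sn n ^ j"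
proof -
  obtain C2 where C2: "C2 \<ge> 0" "\<forall>\<^sub>F n in sequentially. E n (\<lambda>k. (1 + (T n k)\<^sup>2) ^ M) \<le> C2"
    using T_moment_bound by blast
  have "\<forall>\<^sub>F n in sequentially. E n (\<Phi> n) \<le> (C * C2) * sn n ^ j"
    using assms(1) C2(2) eventually_gt_at_top[of 0]
  proof eventually_elim
    case (elim n)
    have "E n (\<Phi> n) \<le> E n (\<lambda>k. (C * sn n ^ j) * (1 + (T n k)\<^sup>2) ^ M)"
      using elim(1,3) by (intro E_mono) (auto simp: mult_ac)
    also have "\<dots> = (C * sn n ^ j) * E n (\<lambda>k. (1 + (T n k)\<^sup>2) ^ M)" by (rule E_cmult)
    also have "\<dots> \<le> (C * sn n ^ j) * C2" using elim(2) assms(2) sn_bounds(3)[of n] by (intro mult_left_mono) auto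
    finally show ?case by (simp add: mult_ac)
  qed
  moreover have "C * C2 \<ge> 0" using assms(2) C2(1) by simp
  ultimately show ?thesis by blast
qed

lemma poly_term_crude:
  assumes "degree p \<le> m"
  shows "\<exists>C\<ge>0. \<forall>n k. n > 0 \<longrightarrow> \<bar>poly p (T n k) * sn n ^ m\<bar> \<le> C * (1 + (T n k)\<^sup>2) ^ m"
proof -
  obtain C where C: "C \<ge> 0" "\<And>n k. \<bar>poly p (T n k) * sn n ^ m\<bar> \<le> C * eta n k ^ m" using poly_term_bound[OF assms] by blast
  have "\<bar>poly p (T n k) * sn n ^ m\<bar> \<le> C * (1 + (T n k)\<^sup>2) ^ m" if n: "n > 0" for n k
  proof -
    have "eta n k \<le> (1 + (T n k)\<^sup>2) * 1"
      unfolding eta_def using sqrt_1_le sn_bounds(1,2)[OF n] by (intro mult_mono) auto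
    then have "C * eta n k ^ m \<le> C * (1 + (T n k)\<^sup>2) ^ m" using C(1) eta_nonneg by (intro mult_left_mono power_mono) auto
    then show ?thesis using C(2)[of n k] by linarith
  qed
  then show ?thesis using C(1) by blast
qed

lemma poly_sum_crude:
  assumes "\<And>m. m \<in> A \<Longrightarrow> degree (P m) \<le> m" "finite A"
  shows "\<exists>C M. C \<ge> 0 \<and> (\<forall>n k. n > 0 \<longrightarrow> \<bar>\<Sum>m\<in>A. poly (P m) (T n k) * sn n ^ m\<bar> \<le> C * (1 + (T n k)\<^sup>2) ^ M)"
  using assms(2,1)
proof (induction A rule: finite_induct)
  case empty
  show ?case by (intro exI[of _ 0]) simp
next
  case (insert x A)
  then obtain C M where 1: "C \<ge> 0" "\<And>n k. n > 0 \<Longrightarrow> \<bar>\<Sum>m\<in>A. poly (P m) (T n k) * sn n ^ m\<bar> \<le> C * (1 + (T n k)\<^sup>2) ^ M"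
    by (metis insertCI)
  obtain C' where 2: "C' \<ge> 0" "\<And>n k. n > 0 \<Longrightarrow> \<bar>poly (P x) (T n k) * sn n ^ x\<bar> \<le> C' * (1 + (T n k)\<^sup>2) ^ x"
    using poly_term_crude[of "P x" x] insert.prems by blast
  have "\<bar>\<Sum>m\<in>insert x A. poly (P m) (T n k) * sn n ^ m\<bar> \<le> (C + C') * (1 + (T n k)\<^sup>2) ^ (M + x)" if n: "n > 0" for n k
  proof -
    have "C * (1 + (T n k)\<^sup>2) ^ M \<le> C * (1 + (T n k)\<^sup>2) ^ (M + x)" "C' * (1 + (T n k)\<^sup>2) ^ x \<le> C' * (1 + (T n k)\<^sup>2) ^ (M + x)"
      using 1(1) 2(1) by (intro mult_left_mono power_increasing; simp)+
    then show ?thesis using 1(2)[OF n, of k] 2(2)[OF n, of k] insert.hyps by (simp add: distrib_right)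
  qed
  then show ?case using 1(1) 2(1) by (intro exI[of _ "C + C'"] exI[of _ "M + x"]) auto
qed

text \<open>Justifies integrating a uniform expansion term by term: on \<open>T^4 \<le> n\<close>
  its error applies, and elsewhere a bound on \<open>F\<close> polynomial in \<open>n\<close>
  suffices by \<open>globalize\<close>.\<close>

lemma E_expansion:
  assumes F: "EXP r F P" and deg: "\<And>m. degree (P m) \<le> m"
    and crude: "\<forall>\<^sub>F n in sequentially. \<forall>k. 1 \<le> k \<and> k \<le> n \<longrightarrow> \<bar>F n k\<bar> \<le> A * real n ^ B"
  shows "\<exists>C\<ge>0. \<forall>\<^sub>F n in sequentially. \<bar>E n (F n) - (\<Sum>m\<le>r. E n (\<lambda>k. poly (P m) (T n k)) * sn n ^ m)\<bar> \<le> C * sn n ^ Suc r"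
proof -
  define \<Phi> where "\<Phi> n k = \<bar>F n k - (\<Sum>m\<le>r. poly (P m) (T n k) * sn n ^ m)\<bar>" for n k
  obtain K \<delta> where 1: "K \<ge> 0" "\<delta> > 0" "\<forall>\<^sub>F n in sequentially. \<forall>k. \<bar>T n k\<bar> \<le> \<delta> * sqrt (real n) \<longrightarrow>
     \<bar>F n k - (\<Sum>m\<le>r. poly (P m) (T n k) * sn n ^ m)\<bar> \<le> K * eta n k ^ Suc r" using EXP_E[OF F] by blast
  obtain C M where 2: "C \<ge> 0" "\<And>n k. n > 0 \<Longrightarrow> \<bar>\<Sum>m\<le>r. poly (P m) (T n k) * sn n ^ m\<bar> \<le> C * (1 + (T n k)\<^sup>2) ^ M"
    using poly_sum_crude[of "{..r}" P] deg by blast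
  have "\<exists>C M. C \<ge> 0 \<and> (\<forall>\<^sub>F n in sequentially. \<forall>k. 1 \<le> k \<and> k \<le> n \<longrightarrow> \<Phi> n k \<le> C * (1 + (T n k)\<^sup>2) ^ M * sn n ^ Suc r)"
  proof (rule globalize)
    show "\<forall>\<^sub>F n in sequentially. \<forall>k. T n k ^ 4 \<le> real n \<longrightarrow> \<Phi> n k \<le> K * (1 + (T n k)\<^sup>2) ^ Suc r * sn n ^ Suc r"
      using 1(3) region_le[OF 1(2)]
    proof eventually_elim
      case (elim n)
      show ?case
      proof (intro allI impI)
        fix k assume "T n k ^ 4 \<le> real n"
        then have "\<Phi> n k \<le> K * eta n k ^ Suc r" using elim by (simp add: \<Phi>_def)
        also have "\<dots> \<le> K * ((1 + (T n k)\<^sup>2) * sn n) ^ Suc r"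
          using 1(1) eta_nonneg[of n k] sqrt_1_le sn_bounds(3)[of n] unfolding eta_def
          by (intro mult_left_mono power_mono mult_right_mono) auto
        finally show "\<Phi> n k \<le> K * (1 + (T n k)\<^sup>2) ^ Suc r * sn n ^ Suc r" by (simp only: power_mult_distrib mult.assoc)
      qed
    qed
    show "\<forall>\<^sub>F n in sequentially. \<forall>k. 1 \<le> k \<and> k \<le> n \<longrightarrow> \<Phi> n k \<le> (\<bar>A\<bar> + C) * real n ^ B * (1 + (T n k)\<^sup>2) ^ M"
      using crude eventually_gt_at_top[of 0]
    proof eventually_elim
      case (elim n)
      show ?case
      proof (intro allI impI)
        fix k assume k: "1 \<le> k \<and> k \<le> n"
        have U: "(1 + (T n k)\<^sup>2) ^ M \<ge> 1" by (intro one_le_power) simp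
        have nB: "real n ^ B \<ge> 1" using elim(2) by (intro one_le_power) simp
        have "\<bar>F n k\<bar> \<le> A * real n ^ B" using elim(1) k by blast
        also have "\<dots> \<le> \<bar>A\<bar> * real n ^ B" by (intro mult_right_mono) auto
        also have "\<dots> \<le> \<bar>A\<bar> * real n ^ B * (1 + (T n k)\<^sup>2) ^ M"
          using mult_left_mono[OF U, of "\<bar>A\<bar> * real n ^ B"] by simp
        finally have a: "\<bar>F n k\<bar> \<le> \<bar>A\<bar> * real n ^ B * (1 + (T n k)\<^sup>2) ^ M" .
        have "C * (1 + (T n k)\<^sup>2) ^ M * 1 \<le> C * (1 + (T n k)\<^sup>2) ^ M * real n ^ B"
          using nB 2(1) by (intro mult_left_mono) auto
        then have b: "\<bar>\<Sum>m\<le>r. poly (P m) (T n k) * sn n ^ m\<bar> \<le> C * real n ^ B * (1 + (T n k)\<^sup>2) ^ M"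
          using 2(2)[OF elim(2), of k] by (simp add: mult_ac)
        have "\<Phi> n k \<le> \<bar>F n k\<bar> + \<bar>\<Sum>m\<le>r. poly (P m) (T n k) * sn n ^ m\<bar>" unfolding \<Phi>_def by (rule abs_triangle_ineq4)
        then show "\<Phi> n k \<le> (\<bar>A\<bar> + C) * real n ^ B * (1 + (T n k)\<^sup>2) ^ M"
          using a b unfolding distrib_right by linarith
      qed
    qed
  qed
  then obtain C' M' where "C' \<ge> 0" "\<forall>\<^sub>F n in sequentially. \<forall>k. 1 \<le> k \<and> k \<le> n \<longrightarrow> \<Phi> n k \<le> C' * (1 + (T n k)\<^sup>2) ^ M' * sn n ^ Suc r" by blast
  from E_globalize[OF this(2,1)] obtain C3 where C3: "C3 \<ge> 0" "\<forall>\<^sub>F n in sequentially. E n (\<Phi> n) \<le> C3 * sn n ^ Suc r" by blast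
  have "\<forall>\<^sub>F n in sequentially. \<bar>E n (F n) - (\<Sum>m\<le>r. E n (\<lambda>k. poly (P m) (T n k)) * sn n ^ m)\<bar> \<le> C3 * sn n ^ Suc r"
    using C3(2)
  proof eventually_elim
    case (elim n)
    have "(\<Sum>m\<le>r. E n (\<lambda>k. poly (P m) (T n k)) * sn n ^ m) = E n (\<lambda>k. \<Sum>m\<le>r. poly (P m) (T n k) * sn n ^ m)"
      unfolding E_sum by (intro sum.cong refl) (simp add: mult.commute[of _ "sn n ^ _"] E_cmult)
    then have "\<bar>E n (F n) - (\<Sum>m\<le>r. E n (\<lambda>k. poly (P m) (T n k)) * sn n ^ m)\<bar> = \<bar>E n (\<lambda>k. F n k - (\<Sum>m\<le>r. poly (P m) (T n k) * sn n ^ m))\<bar>"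
      by (simp only: E_diff)
    also have "\<dots> \<le> E n (\<Phi> n)" unfolding \<Phi>_def by (rule E_abs_le)
    finally show ?case using elim by linarith
  qed
  then show ?thesis using C3(1) by blast
qed

text \<open>As \<open>T\<close> is a multiple of \<open>sn n * (k - n / mean)\<close>, the
  expression carries the factor \<open>n^(-(m+j)/2)\<close>, an integer power by equal parity, times
  a moment polynomial in \<open>n\<close> of degree at most \<open>j\<close>. From
  \<open>j \<le> (m + j) / 2\<close> the product is a polynomial in \<open>1/n\<close> up to the
  error.\<close>

lemma T_power_poly_approx:
  assumes "j \<le> m" "even (m - j)"
  shows "poly_approx N (\<lambda>n. E n (\<lambda>k. T n k ^ j) * sn n ^ m)"
proof -
  define \<omega> where "\<omega> = sqrt mean / sqrt var * mean"
  obtain i where i: "m - j = 2 * i" using assms(2) by (elim evenE)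
  define Q where "Q = j + i"
  have mj: "m + j = 2 * Q" using i assms(1) by (simp add: Q_def)
  obtain P where P: "degree P \<le> j" and ex: "\<And>N. \<exists>C. \<forall>\<^sub>F n in sequentially. \<bar>E n (\<lambda>k. (real k - real n / mean) ^ j) - poly P (real n)\<bar> \<le> C / real n ^ N"
    using centred_moment_expansion[of j] by blast
  obtain C where C: "\<forall>\<^sub>F n in sequentially. \<bar>E n (\<lambda>k. (real k - real n / mean) ^ j) - poly P (real n)\<bar> \<le> C / real n ^ N" using ex by blast
  \<comment> \<open>The moment polynomial reversed: \<open>n^i\<close> times \<open>n^(-Q)\<close>
    is \<open>(1/n)^(Q-i)\<close>.\<close>
  define P' where "P' = smult (\<omega> ^ j) (\<Sum>i\<le>degree P. monom (coeff P i) (Q - i))"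
  have "\<forall>\<^sub>F n in sequentially. \<bar>E n (\<lambda>k. T n k ^ j) * sn n ^ m - poly P' (1 / real n)\<bar> \<le> (\<bar>\<omega> ^ j\<bar> * \<bar>C\<bar>) * (1 / real n) ^ N"
    using C eventually_gt_at_top[of 0]
  proof eventually_elim
    case (elim n)
    have n: "real n > 0" using elim(2) by simp
    have T: "T n k = \<omega> * sn n * (real k - real n / mean)" for k
    proof -
      have "mean * (real k - real n / mean) = real k * mean - real n" using mean_ge_1 by (simp add: field_simps)
      then have "\<omega> * sn n * (real k - real n / mean) = sqrt mean / sqrt var * sn n * (real k * mean - real n)"
        by (simp add: \<omega>_def mult_ac)
      then show ?thesis by (simp add: T_eq[OF elim(2)] dev_def sn_def)
    qed
    have "E n (\<lambda>k. T n k ^ j) * sn n ^ m = (\<omega> * sn n) ^ j * E n (\<lambda>k. (real k - real n / mean) ^ j) * sn n ^ m"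
      unfolding T power_mult_distrib[of "\<omega> * sn n"] E_cmult ..
    also have "\<dots> = \<omega> ^ j * sn n ^ (m + j) * E n (\<lambda>k. (real k - real n / mean) ^ j)"
      by (simp add: power_mult_distrib power_add mult_ac)
    also have "sn n ^ (m + j) = (1 / real n) ^ Q" unfolding mj by (rule sn_even_power)
    finally have e1: "E n (\<lambda>k. T n k ^ j) * sn n ^ m = \<omega> ^ j * (1 / real n) ^ Q * E n (\<lambda>k. (real k - real n / mean) ^ j)" .
    have "poly P' (1 / real n) = \<omega> ^ j * (\<Sum>i\<le>degree P. coeff P i * (1 / real n) ^ (Q - i))"
      by (simp add: P'_def poly_sum poly_monom)
    also have "(\<Sum>i\<le>degree P. coeff P i * (1 / real n) ^ (Q - i)) = (\<Sum>i\<le>degree P. (1 / real n) ^ Q * (coeff P i * real n ^ i))"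
    proof (rule sum.cong[OF refl])
      fix i assume "i \<in> {..degree P}"
      then have "i \<le> Q" using P by (simp add: Q_def)
      then have "(1 / real n) ^ Q = (1 / real n) ^ (Q - i) * (1 / real n) ^ i" by (simp flip: power_add)
      then show "coeff P i * (1 / real n) ^ (Q - i) = (1 / real n) ^ Q * (coeff P i * real n ^ i)"
        using n by (simp add: power_divide)
    qed
    also have "\<dots> = (1 / real n) ^ Q * poly P (real n)" by (simp add: poly_altdef sum_distrib_left)
    finally have e2: "poly P' (1 / real n) = \<omega> ^ j * (1 / real n) ^ Q * poly P (real n)" by simp
    have "\<bar>E n (\<lambda>k. T n k ^ j) * sn n ^ m - poly P' (1 / real n)\<bar> = \<bar>\<omega> ^ j\<bar> * (1 / real n) ^ Q * \<bar>E n (\<lambda>k. (real k - real n / mean) ^ j) - poly P (real n)\<bar>"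
      unfolding e1 e2 right_diff_distrib[symmetric] by (simp add: abs_mult)
    also have "\<dots> \<le> \<bar>\<omega> ^ j\<bar> * 1 * (\<bar>C\<bar> * (1 / real n) ^ N)"
    proof (intro mult_mono)
      show "(1 / real n) ^ Q \<le> 1" using elim(2) by (intro power_le_one) auto
      have "C / real n ^ N \<le> \<bar>C\<bar> / real n ^ N" using n by (intro divide_right_mono) auto
      then show "\<bar>E n (\<lambda>k. (real k - real n / mean) ^ j) - poly P (real n)\<bar> \<le> \<bar>C\<bar> * (1 / real n) ^ N"
        using elim(1) by (simp add: power_divide)
    qed auto
    finally show ?case by simp
  qed
  then show ?thesis unfolding poly_approx_def by blast
qed

lemma parity_poly_approx:
  assumes "parity_poly m p"
  shows "poly_approx N (\<lambda>n. E n (\<lambda>k. poly p (T n k)) * sn n ^ m)"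
proof -
  have "poly_approx N (\<lambda>n. \<Sum>j\<le>degree p. coeff p j * (E n (\<lambda>k. T n k ^ j) * sn n ^ m))"
  proof (rule poly_approx_sum)
    fix j
    show "poly_approx N (\<lambda>n. coeff p j * (E n (\<lambda>k. T n k ^ j) * sn n ^ m))"
    proof (cases "coeff p j = 0")
      case True
      then show ?thesis by (intro poly_approx_small[of _ 0]) simp
    next
      case False
      then show ?thesis using assms unfolding parity_poly_def by (intro poly_approx_cmult T_power_poly_approx) blast+
    qed
  qed simp
  moreover have "(\<Sum>j\<le>degree p. coeff p j * (E n (\<lambda>k. T n k ^ j) * sn n ^ m)) = E n (\<lambda>k. poly p (T n k)) * sn n ^ m" for n
    unfolding poly_altdef E_sum E_cmult sum_distrib_right mult.assoc ..
  ultimately show ?thesis by (simp only:)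
qed

end

text \<open>\<open>h k\<close> stands for \<open>a_k B(\<rho>)^k\<close> divided by its leading
  constant, whence \<open>f 0 = 1\<close>, and \<open>\<alpha>\<close> for \<open>s - 1\<close>.
  Positivity starts at \<open>k = 1\<close> since there may be no core of size 0.\<close>

locale weighted_renewal = renewal +
  fixes h :: "nat \<Rightarrow> real" and \<alpha> :: real and f :: "nat \<Rightarrow> real"
  assumes h_pos: "k \<ge> 1 \<Longrightarrow> h k > 0" and h_exp: "asymp_exp h \<alpha> f" and f_0: "f 0 = 1"
begin

definition Eh :: "nat \<Rightarrow> real" where "Eh n = E n h"

text \<open>The distortion factor: \<open>c_n \<rho>^n / q_n\<close> is the conditional mean of the
  weights \<open>a_k B(\<rho>)^k\<close>, and the constant by which \<open>h\<close> differs from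
  them cancels.\<close>

definition D :: "nat \<Rightarrow> nat \<Rightarrow> real" where "D n k = Eh n / h k"

definition cn :: "nat \<Rightarrow> real" where "cn n = E n (\<lambda>k. h k * (real n / mean) powr (- \<alpha>))"

lemma h_crude: "\<exists>A B. A \<ge> 0 \<and> (\<forall>k\<ge>1. h k \<le> A * real k ^ B)"
proof -
  have "Bseq (\<lambda>k. h k / real k powr \<alpha>)"
    using asymp_exp_tendsto[OF h_exp] by (rule convergent_imp_Bseq[OF convergentI])
  then obtain A where A: "A > 0" "\<And>k. norm (h k / real k powr \<alpha>) \<le> A" by (auto elim: BseqE)
  define B where "B = nat \<lceil>\<bar>\<alpha>\<bar>\<rceil>"
  have B: "\<alpha> \<le> real B" by (simp add: B_def) linarith
  have "h k \<le> A * real k ^ B" if k: "k \<ge> 1" for k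
  proof -
    have "h k / real k powr \<alpha> \<le> A" by (rule abs_le_D1[OF A(2)[of k, unfolded real_norm_def]])
    then have "h k \<le> A * real k powr \<alpha>" using k by (simp add: field_simps)
    also have "\<dots> \<le> A * real k powr real B" using k B A(1) by (intro mult_left_mono powr_mono) auto
    also have "real k powr real B = real k ^ B" using k by (simp add: powr_realpow)
    finally show ?thesis .
  qed
  then show ?thesis using A(1) by (intro exI[of _ A] exI[of _ B]) auto
qed

lemma npowr_crude: "\<exists>A B. A \<ge> 0 \<and> (\<forall>n\<ge>1. (real n / mean) powr \<beta> \<le> A * real n ^ B)"
proof -
  define B where "B = nat \<lceil>\<bar>\<beta>\<bar>\<rceil>"
  have B: "\<beta> \<le> real B" by (simp add: B_def) linarith
  have "(real n / mean) powr \<beta> \<le> mean powr (- \<beta>) * real n ^ B" if n: "n \<ge> 1" for n :: nat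
  proof -
    have "(real n / mean) powr \<beta> = mean powr (- \<beta>) * real n powr \<beta>"
      using n mean_ge_1 by (simp add: powr_divide powr_minus_divide)
    also have "\<dots> \<le> mean powr (- \<beta>) * real n powr real B" using n B by (intro mult_left_mono powr_mono) auto
    finally show ?thesis using n by (simp add: powr_realpow)
  qed
  then show ?thesis by (intro exI[of _ "mean powr (- \<beta>)"] exI[of _ B]) auto
qed

lemma h_ratio_crude:
  "\<exists>A B. A \<ge> 0 \<and> (\<forall>\<^sub>F n in sequentially. \<forall>k. 1 \<le> k \<and> k \<le> n \<longrightarrow> \<bar>h k * (real n / mean) powr (- \<alpha>)\<bar> \<le> A * real n ^ B)"
proof -
  obtain A B where 1: "A \<ge> 0" "\<And>k. k \<ge> 1 \<Longrightarrow> h k \<le> A * real k ^ B" using h_crude by blast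
  obtain A' B' where 2: "A' \<ge> 0" "\<And>n. n \<ge> 1 \<Longrightarrow> (real n / mean) powr (- \<alpha>) \<le> A' * real n ^ B'" using npowr_crude by blast
  have "\<bar>h k * (real n / mean) powr (- \<alpha>)\<bar> \<le> A * A' * real n ^ (B + B')" if k: "1 \<le> k \<and> k \<le> n" for n k
  proof -
    have "h k \<le> A * real n ^ B"
      using 1(2)[of k] k 1(1) mult_left_mono[OF power_mono[of "real k" "real n" B], of A] by simp
    moreover have "0 < h k" using k h_pos by blast
    moreover have "(real n / mean) powr (- \<alpha>) \<le> A' * real n ^ B'" using k by (intro 2(2)) simp
    ultimately have "h k * (real n / mean) powr (- \<alpha>) \<le> (A * real n ^ B) * (A' * real n ^ B')" by (intro mult_mono) auto
    then show ?thesis using \<open>0 < h k\<close> by (simp add: power_add mult_ac)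
  qed
  then show ?thesis using 1(1) 2(1) by (intro exI[of _ "A * A'"] exI[of _ "B + B'"]) (auto intro!: always_eventually)
qed

text \<open>Integrating the uniform expansion of the weights leaves only integer powers of
  \<open>1/n\<close>, by parity. This amounts to the complete expansion of the coefficients of
  \<open>C\<close>.\<close>

lemma cn_expansion: "\<exists>c. asymp_exp cn 0 c \<and> c 0 = 1"
proof -
  obtain A B where AB: "\<forall>\<^sub>F n in sequentially. \<forall>k. 1 \<le> k \<and> k \<le> n \<longrightarrow> \<bar>h k * (real n / mean) powr (- \<alpha>)\<bar> \<le> A * real n ^ B"
    using h_ratio_crude by blast
  have deg: "degree (ratio_poly f \<alpha> m) \<le> m" for m by (rule parity_poly_degree[OF parity_ratio_poly])
  have "poly_approx N cn" for N
  proof -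
    \<comment> \<open>Precision \<open>n^(-N)\<close> is \<open>sn n ^ (2 * N)\<close>.\<close>
    define r where "r = 2 * N"
    obtain C where C: "C \<ge> 0" "\<forall>\<^sub>F n in sequentially. \<bar>cn n - (\<Sum>m\<le>r. E n (\<lambda>k. poly (ratio_poly f \<alpha> m) (T n k)) * sn n ^ m)\<bar> \<le> C * sn n ^ Suc r"
      unfolding cn_def using E_expansion[OF EXP_ratio[OF h_exp] deg AB, of r] by blast
    have "poly_approx N (\<lambda>n. cn n - (\<Sum>m\<le>r. E n (\<lambda>k. poly (ratio_poly f \<alpha> m) (T n k)) * sn n ^ m))"
    proof (rule poly_approx_small)
      show "\<forall>\<^sub>F n in sequentially. \<bar>cn n - (\<Sum>m\<le>r. E n (\<lambda>k. poly (ratio_poly f \<alpha> m) (T n k)) * sn n ^ m)\<bar> \<le> C * (1 / real n) ^ N"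
        using C(2) eventually_gt_at_top[of 0]
      proof eventually_elim
        case (elim n)
        have "sn n ^ Suc r \<le> sn n ^ r" using sn_bounds[of n] elim(2) by (intro power_decreasing) auto
        then have "C * sn n ^ Suc r \<le> C * sn n ^ r" using C(1) by (intro mult_left_mono)
        then show ?case using elim(1) by (simp add: r_def sn_even_power)
      qed
    qed
    moreover have "poly_approx N (\<lambda>n. \<Sum>m\<le>r. E n (\<lambda>k. poly (ratio_poly f \<alpha> m) (T n k)) * sn n ^ m)"
      by (intro poly_approx_sum parity_poly_approx parity_ratio_poly) simp
    ultimately show ?thesis using poly_approx_add by fastforce
  qed
  then obtain c where c: "asymp_exp cn 0 c" using asymp_exp_of_poly_approx by blast
  \<comment> \<open>Order 0 identifies the limit, since the polynomial of index 0 is the constant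
    \<open>f 0 = 1\<close>.\<close>
  obtain C where C: "C \<ge> 0" "\<forall>\<^sub>F n in sequentially. \<bar>cn n - (\<Sum>m\<le>0. E n (\<lambda>k. poly (ratio_poly f \<alpha> m) (T n k)) * sn n ^ m)\<bar> \<le> C * sn n ^ Suc 0"
    unfolding cn_def using E_expansion[OF EXP_ratio[OF h_exp] deg AB, of 0] by blast
  have "\<forall>\<^sub>F n in sequentially. norm (cn n - 1) \<le> C * sn n"
    using C(2) q_pos_ev
  proof eventually_elim
    case (elim n)
    have "E n (\<lambda>k. poly (ratio_poly f \<alpha> 0) (T n k)) = 1" unfolding ratio_poly_0 using E_const[OF elim(2)] f_0 by simp
    then show ?case using elim(1) by simp
  qed
  moreover have "(\<lambda>n. C * sn n) \<longlonglongrightarrow> 0" unfolding sn_def by real_asymp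
  ultimately have "(\<lambda>n. cn n - 1) \<longlonglongrightarrow> 0" by (rule Lim_null_comparison)
  then have lim1: "cn \<longlonglongrightarrow> 1" by (simp add: LIM_zero_iff)
  have "(\<lambda>n. cn n / real n powr 0) \<longlonglongrightarrow> 1"
  proof (rule Lim_transform_eventually[OF lim1])
    show "\<forall>\<^sub>F n in sequentially. cn n = cn n / real n powr 0" using eventually_gt_at_top[of 0] by eventually_elim simp
  qed
  then have "c 0 = 1" using asymp_exp_tendsto[OF c] LIMSEQ_unique by blast
  then show ?thesis using c by blast
qed

lemma Eh_eq: "n > 0 \<Longrightarrow> Eh n = cn n * (real n / mean) powr \<alpha>"
proof -
  assume n: "n > 0"
  have "cn n = (real n / mean) powr (- \<alpha>) * Eh n" unfolding cn_def Eh_def by (simp add: mult.commute[of "h _"] E_cmult)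
  then show ?thesis using n mean_ge_1 by (simp add: powr_minus field_simps)
qed

text \<open>The factor \<open>cn n\<close> is constant in \<open>k\<close> and expands in integer
  powers of \<open>1/n\<close>, so multiplying the expansion of \<open>1 / h\<close> by it preserves
  parity. The polynomials obtained have the degree and parity that the distortion polynomials must
  have.\<close>

lemma D_expansion:
  "\<exists>P. (\<forall>m. parity_poly m (P m)) \<and> P 0 = 1 \<and> (\<forall>r. EXP r D P)"
proof -
  define v where "v = fps_nth (inverse (Abs_fps f))"
  have v0: "v 0 = 1" by (simp add: v_def f_0)
  have hv: "asymp_exp (\<lambda>k. 1 / h k) (- \<alpha>) v" unfolding v_def by (rule asymp_exp_inverse[OF h_exp f_0])
  obtain c where c: "asymp_exp cn 0 c" "c 0 = 1" using cn_expansion by blast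
  define V where "V = ratio_poly v (- \<alpha>)"
  define F where "F n k = 1 / h k * (real n / mean) powr (- (- \<alpha>))" for n k
  have F: "EXP r F V" for r unfolding F_def V_def by (rule EXP_ratio[OF hv])
  have parV: "parity_poly m (V m)" for m unfolding V_def by (rule parity_ratio_poly)
  define P where "P m = (\<Sum>l\<le>m. smult (c l) (shift_poly l V m))" for m
  have "EXP r D P" for r
  proof -
    define G where "G n k = (\<Sum>l\<le>r. c l * ((1 / real n) ^ l * F n k))" for n k
    have "EXP r G (\<lambda>m. \<Sum>l\<le>r. smult (c l) (shift_poly l V m))"
      unfolding G_def by (intro EXP_sum EXP_cmult EXP_shift parV F) simp
    then have G: "EXP r G P"
    proof (rule EXP_cong_poly[rotated])
      fix m assume "m \<le> r"
      then show "(\<Sum>l\<le>r. smult (c l) (shift_poly l V m)) = P m"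
        unfolding P_def by (intro sum.mono_neutral_right) (auto simp: shift_poly_def)
    qed
    obtain B \<delta> where B: "B \<ge> 0" "\<delta> > 0" "\<forall>\<^sub>F n in sequentially. \<forall>k. \<bar>T n k\<bar> \<le> \<delta> * sqrt (real n) \<longrightarrow> \<bar>F n k\<bar> \<le> B"
      using EXP_bounded[OF F parV] by blast
    obtain C where C: "\<forall>\<^sub>F n in sequentially. \<bar>cn n / real n powr 0 - (\<Sum>l\<le>r. c l * (1 / real n) ^ l)\<bar> \<le> C * (1 / real n) ^ Suc r"
      using c(1) unfolding asymp_exp_def by blast
    have "EXP r (\<lambda>n k. D n k - G n k) (\<lambda>m. 0)"
    proof (rule EXP_I[OF B(2)])
      show "\<forall>\<^sub>F n in sequentially. \<forall>k. \<bar>T n k\<bar> \<le> \<delta> * sqrt (real n) \<longrightarrow>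
         \<bar>D n k - G n k - (\<Sum>m\<le>r. poly 0 (T n k) * sn n ^ m)\<bar> \<le> (\<bar>C\<bar> * B) * eta n k ^ Suc r"
        using C B(3) eventually_gt_at_top[of 0]
      proof eventually_elim
        case (elim n)
        show ?case
        proof (intro allI impI)
          fix k assume t: "\<bar>T n k\<bar> \<le> \<delta> * sqrt (real n)"
          have "D n k = cn n * F n k" unfolding D_def Eh_eq[OF elim(3)] F_def by simp
          moreover have "G n k = (\<Sum>l\<le>r. c l * (1 / real n) ^ l) * F n k" by (simp add: G_def sum_distrib_right mult.assoc)
          ultimately have "D n k - G n k = (cn n - (\<Sum>l\<le>r. c l * (1 / real n) ^ l)) * F n k" by (simp only: left_diff_distrib)
          then have "\<bar>D n k - G n k\<bar> = \<bar>cn n - (\<Sum>l\<le>r. c l * (1 / real n) ^ l)\<bar> * \<bar>F n k\<bar>" by (simp only: abs_mult)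
          also have "\<dots> \<le> (\<bar>C\<bar> * (1 / real n) ^ Suc r) * B"
          proof (rule mult_mono)
            have "C * (1 / real n) ^ Suc r \<le> \<bar>C\<bar> * (1 / real n) ^ Suc r" by (intro mult_right_mono) auto
            then show "\<bar>cn n - (\<Sum>l\<le>r. c l * (1 / real n) ^ l)\<bar> \<le> \<bar>C\<bar> * (1 / real n) ^ Suc r" using elim(1,3) by simp
            show "\<bar>F n k\<bar> \<le> B" using elim(2) t by blast
          qed auto
          also have "\<dots> \<le> (\<bar>C\<bar> * eta n k ^ Suc r) * B"
          proof (intro mult_right_mono mult_left_mono power_mono B(1))
            have "1 / real n = sn n * sn n" using sn_bounds(4)[of n] by (simp add: power2_eq_square)
            also have "\<dots> \<le> 1 * sn n" using sn_bounds[of n] elim(3) by (intro mult_right_mono) auto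
            finally show "1 / real n \<le> eta n k" using sn_le_eta[of n k] by simp
          qed auto
          finally show "\<bar>D n k - G n k - (\<Sum>m\<le>r. poly 0 (T n k) * sn n ^ m)\<bar> \<le> (\<bar>C\<bar> * B) * eta n k ^ Suc r"
            by (simp add: mult_ac)
        qed
      qed
    qed
    from EXP_add[OF this G] show ?thesis by simp
  qed
  moreover have "parity_poly m (P m)" for m
    unfolding P_def by (intro parity_poly_sum parity_poly_smult parity_shift_poly parV)
  moreover have "P 0 = 1"
    by (simp add: P_def shift_poly_def V_def ratio_poly_0 v0 c(2) one_pCons)
  ultimately show ?thesis by blast
qed

end

section \<open>Limits for the rejection sequence\<close>

context renewal
begin

lemma eta_small:
  assumes "\<epsilon> > 0"
  shows "\<forall>\<^sub>F n in sequentially. \<forall>k. T n k ^ 4 \<le> real n \<longrightarrow> eta n k \<le> \<epsilon>"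
proof -
  have "sn \<longlonglongrightarrow> 0" unfolding sn_def[abs_def] by real_asymp
  then have "\<forall>\<^sub>F n in sequentially. sn n < \<epsilon> / 2" by (rule order_tendstoD) (use assms in simp)
  moreover have "\<forall>\<^sub>F n in sequentially. \<forall>k. T n k ^ 4 \<le> real n \<longrightarrow> \<bar>T n k\<bar> \<le> \<epsilon> / 2 * sqrt (real n)"
    by (rule region_le) (use assms in simp)
  ultimately show ?thesis using eventually_gt_at_top[of 0]
  proof eventually_elim
    case (elim n)
    show ?case
    proof (intro allI impI)
      fix k assume "T n k ^ 4 \<le> real n"
      then have t: "\<bar>T n k\<bar> \<le> \<epsilon> / 2 * sqrt (real n)" using elim(2) by blast
      have "1 + (T n k)\<^sup>2 \<le> (1 + \<bar>T n k\<bar>)\<^sup>2" by (simp add: power2_sum)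
      then have "sqrt (1 + (T n k)\<^sup>2) \<le> 1 + \<bar>T n k\<bar>" by (intro real_le_lsqrt) auto
      then have "eta n k \<le> (1 + \<bar>T n k\<bar>) * sn n" unfolding eta_def by (intro mult_right_mono sn_bounds)
      also have "\<dots> \<le> (1 + \<epsilon> / 2 * sqrt (real n)) * sn n" using t by (intro mult_right_mono sn_bounds) simp
      also have "\<dots> = sn n + \<epsilon> / 2" using elim(3) by (simp add: sn_def field_simps)
      finally show "eta n k \<le> \<epsilon>" using elim(1) by simp
    qed
  qed
qed

lemma poly_sum_eta:
  assumes "\<And>i. i \<in> A \<Longrightarrow> 1 \<le> i \<and> degree (p i) \<le> i" "finite A"
  shows "\<exists>C\<ge>0. \<forall>n k. eta n k \<le> 1 \<longrightarrow> \<bar>\<Sum>i\<in>A. poly (p i) (T n k) * sn n ^ i\<bar> \<le> C * eta n k"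
  using assms(2,1)
proof (induction A rule: finite_induct)
  case empty
  show ?case by (intro exI[of _ 0]) simp
next
  case (insert x A)
  then obtain C where 1: "C \<ge> 0" "\<And>n k. eta n k \<le> 1 \<Longrightarrow> \<bar>\<Sum>i\<in>A. poly (p i) (T n k) * sn n ^ i\<bar> \<le> C * eta n k"
    by (metis insertCI)
  obtain C' where 2: "C' \<ge> 0" "\<And>n k. \<bar>poly (p x) (T n k) * sn n ^ x\<bar> \<le> C' * eta n k ^ x"
    using poly_term_bound[of "p x" x] insert.prems by blast
  have "\<bar>\<Sum>i\<in>insert x A. poly (p i) (T n k) * sn n ^ i\<bar> \<le> (C + C') * eta n k" if e: "eta n k \<le> 1" for n k
  proof -
    have "eta n k ^ x \<le> eta n k ^ 1" using insert.prems e eta_nonneg by (intro power_decreasing) auto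
    then have "C' * eta n k ^ x \<le> C' * eta n k" using 2(1) by (simp add: mult_left_mono)
    then show ?thesis using 1(2)[OF e] 2(2)[of n k] insert.hyps by (simp add: distrib_right)
  qed
  then show ?case using 1(1) 2(1) by (intro exI[of _ "C + C'"]) auto
qed

lemma E_poly_tendsto:
  "(\<lambda>n. E n (\<lambda>k. poly p (T n k))) \<longlonglongrightarrow> integral\<^sup>L std_normal_distribution (poly p)"
  "(\<lambda>n. E n (\<lambda>k. \<bar>poly p (T n k)\<bar>)) \<longlonglongrightarrow> integral\<^sup>L std_normal_distribution (\<lambda>t. \<bar>poly p t\<bar>)"
proof -
  obtain C where C: "C \<ge> 0" "\<And>t. \<bar>poly p t\<bar> \<le> C * sqrt (1 + t\<^sup>2) ^ degree p" using poly_bound_sqrt[of p "degree p"] by blast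
  have b: "\<bar>poly p t\<bar> \<le> C * (1 + t\<^sup>2) ^ degree p" for t
  proof -
    have "C * sqrt (1 + t\<^sup>2) ^ degree p \<le> C * (1 + t\<^sup>2) ^ degree p"
      using C(1) sqrt_1_le by (intro mult_left_mono power_mono) auto
    then show ?thesis using C(2)[of t] by linarith
  qed
  show "(\<lambda>n. E n (\<lambda>k. poly p (T n k))) \<longlonglongrightarrow> integral\<^sup>L std_normal_distribution (poly p)"
    by (rule E_tendsto[OF poly_isCont b])
  show "(\<lambda>n. E n (\<lambda>k. \<bar>poly p (T n k)\<bar>)) \<longlonglongrightarrow> integral\<^sup>L std_normal_distribution (\<lambda>t. \<bar>poly p t\<bar>)"
    by (rule E_tendsto) (use b in \<open>auto intro: continuous_intros\<close>)
qed

end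

context weighted_renewal
begin

lemma Eh_pos: "n > 0 \<Longrightarrow> q n > 0 \<Longrightarrow> Eh n > 0"
proof -
  assume n: "n > 0" and q: "q n > 0"
  have "\<exists>k\<in>{..n}. hit k n \<noteq> 0" using q unfolding q_def by (metis less_irrefl sum.neutral)
  then obtain k where k: "k \<le> n" "hit k n \<noteq> 0" by auto
  then have k0: "k \<noteq> 0" using hit_0[OF n] by metis
  have nn: "0 \<le> hit i n * h i" for i
    using hit_nonneg[of i n] hit_0[OF n] h_pos[of i] by (cases "i = 0") auto
  have "0 < hit k n * h k" using k k0 hit_nonneg[of k n] h_pos[of k] by simp
  then have "0 < (\<Sum>i\<le>n. hit i n * h i)" using k nn by (intro sum_pos2[of _ k]) auto
  then show ?thesis using q by (simp add: Eh_def E_def)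
qed

text \<open>\<open>1 / D\<close> is \<open>h\<close> divided by its own conditional mean. This exact
  identity later determines the normalisation of the rejection sequence.\<close>

lemma E_inv_D: "n > 0 \<Longrightarrow> q n > 0 \<Longrightarrow> E n (\<lambda>k. 1 / D n k) = 1"
proof -
  assume n: "n > 0" and q: "q n > 0"
  have "E n (\<lambda>k. 1 / D n k) = E n (\<lambda>k. (1 / Eh n) * h k)" by (simp add: D_def)
  also have "\<dots> = 1" unfolding E_cmult using Eh_pos[OF n q] by (simp add: Eh_def)
  finally show ?thesis .
qed

lemma inv_D_crude:
  "\<exists>A B. A \<ge> 0 \<and> (\<forall>\<^sub>F n in sequentially. \<forall>k. 1 \<le> k \<and> k \<le> n \<longrightarrow> \<bar>1 / D n k\<bar> \<le> A * real n ^ B)"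
proof -
  obtain A B where 1: "A \<ge> 0" "\<forall>\<^sub>F n in sequentially. \<forall>k. 1 \<le> k \<and> k \<le> n \<longrightarrow> \<bar>h k * (real n / mean) powr (- \<alpha>)\<bar> \<le> A * real n ^ B"
    using h_ratio_crude by blast
  obtain c where c: "asymp_exp cn 0 c" "c 0 = 1" using cn_expansion by blast
  have "(\<lambda>n. cn n / real n powr 0) \<longlonglongrightarrow> 1" using asymp_exp_tendsto[OF c(1)] c(2) by simp
  then have "\<forall>\<^sub>F n in sequentially. cn n / real n powr 0 > 1 / 2" by (rule order_tendstoD) simp
  then have "\<forall>\<^sub>F n in sequentially. \<forall>k. 1 \<le> k \<and> k \<le> n \<longrightarrow> \<bar>1 / D n k\<bar> \<le> (2 * A) * real n ^ B"
    using 1(2) eventually_gt_at_top[of 0]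
  proof eventually_elim
    case (elim n)
    show ?case
    proof (intro allI impI)
      fix k assume k: "1 \<le> k \<and> k \<le> n"
      have cn: "cn n > 1 / 2" using elim(1,3) by simp
      have "1 / D n k = (h k * (real n / mean) powr (- \<alpha>)) / cn n"
        unfolding D_def Eh_eq[OF elim(3)] by (simp add: powr_minus field_simps)
      then have "\<bar>1 / D n k\<bar> = \<bar>h k * (real n / mean) powr (- \<alpha>)\<bar> / cn n" using cn by simp
      also have "\<dots> \<le> (A * real n ^ B) / (1 / 2)" using elim(2) k cn 1(1) by (intro frac_le) auto
      finally show "\<bar>1 / D n k\<bar> \<le> (2 * A) * real n ^ B" by simp
    qed
  qed
  then show ?thesis using 1(1) by (intro exI[of _ "2 * A"] exI[of _ B]) simp
qed

definition yp :: "(nat \<Rightarrow> real poly) \<Rightarrow> nat \<Rightarrow> nat \<Rightarrow> nat \<Rightarrow> real" where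
  "yp p r n k = 1 + (\<Sum>i=1..r. poly (p i) (T n k) * sn n ^ i)"

definition wp :: "(nat \<Rightarrow> real poly) \<Rightarrow> nat \<Rightarrow> real \<Rightarrow> nat \<Rightarrow> nat \<Rightarrow> real" where
  "wp p r a n k = (if yp p r n k \<ge> a then a / yp p r n k else 1)"

lemma wp_bounds: "0 < a \<Longrightarrow> a < 1 \<Longrightarrow> 0 < wp p r a n k" "0 < a \<Longrightarrow> a < 1 \<Longrightarrow> wp p r a n k \<le> 1"
  by (auto simp: wp_def)

text \<open>First-order expansion of a reciprocal. Both \<open>d\<close> and \<open>y\<close> are at
  least \<open>1 / 2\<close>, so dividing by \<open>d * y\<close> costs the factor 4;
  \<open>\<bar>d * y - 1\<bar> \<le> 3 * (c * x)\<close> then explains the 12.\<close>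

lemma inverse_diff_bound:
  fixes y d P e x :: real
  assumes y: "\<bar>y - 1\<bar> \<le> c * x" and d: "\<bar>d - 1\<bar> \<le> c * x" and cx: "c * x \<le> 1 / 2" and c: "c \<ge> 0" "x \<ge> 0"
    and e: "\<bar>d - (y + P)\<bar> \<le> e"
  shows "\<bar>1 / d - 1 / y + P\<bar> \<le> 4 * e + 12 * \<bar>P\<bar> * (c * x)"
proof -
  have yd: "y \<ge> 1 / 2" "y \<le> 2" "d \<ge> 1 / 2" using y d cx unfolding abs_le_iff by linarith+
  have dy: "d * y \<ge> 1 / 4" using mult_mono[OF yd(3,1)] yd by simp
  have dy0: "d * y > 0" "d \<noteq> 0" "y \<noteq> 0" using dy yd by auto
  have "1 / d - 1 / y + P = (- (d - (y + P)) + P * (d * y - 1)) / (d * y)"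
    using dy0 by (simp add: field_simps)
  then have "\<bar>1 / d - 1 / y + P\<bar> = \<bar>- (d - (y + P)) + P * (d * y - 1)\<bar> / (d * y)" using dy0 by simp
  also have "\<dots> \<le> (e + \<bar>P\<bar> * (3 * (c * x))) / (1 / 4)"
  proof (rule frac_le)
    have "d * y - 1 = (d - 1) * y + (y - 1)" by (simp add: algebra_simps)
    then have "\<bar>d * y - 1\<bar> \<le> \<bar>d - 1\<bar> * \<bar>y\<bar> + \<bar>y - 1\<bar>" using abs_triangle_ineq[of "(d - 1) * y" "y - 1"] by (simp add: abs_mult)
    also have "\<dots> \<le> (c * x) * 2 + c * x" using y d yd c by (intro add_mono mult_mono) auto
    finally have "\<bar>P\<bar> * \<bar>d * y - 1\<bar> \<le> \<bar>P\<bar> * (3 * (c * x))" by (intro mult_left_mono) auto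
    then show "\<bar>- (d - (y + P)) + P * (d * y - 1)\<bar> \<le> e + \<bar>P\<bar> * (3 * (c * x))"
      using e abs_triangle_ineq[of "- (d - (y + P))" "P * (d * y - 1)"] by (simp add: abs_mult abs_minus_commute)
    have "0 \<le> e" using e by linarith
    then show "0 \<le> e + \<bar>P\<bar> * (3 * (c * x))" using c by simp
  qed (use dy in auto)
  finally show ?thesis by simp
qed

text \<open>The comparison is made with \<open>w / a\<close> first, because on the main region it is
  the reciprocal of \<open>y\<close> and misses from \<open>1 / D\<close> just the term of index
  \<open>r + 1\<close>. The true normalisation \<open>Z\<close> enters afterwards through
  \<open>J\<close>, whose limit follows from expectations.\<close>

theorem rejection_limits:
  assumes deg: "\<And>i. i \<ge> 1 \<Longrightarrow> degree (p i) \<le> i" and a: "0 < a" "a < 1"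
    and ex: "\<exists>K. \<forall>\<^sub>F n in sequentially. \<forall>k. T n k ^ 4 \<le> real n \<longrightarrow>
        \<bar>D n k - (1 + (\<Sum>i=1..Suc r. poly (p i) (T n k) * sn n ^ i))\<bar> \<le> K * eta n k ^ Suc (Suc r)"
    and I: "I = integral\<^sup>L std_normal_distribution (poly (p (Suc r)))"
  shows "(\<lambda>n. E n (wp p r a n)) \<longlonglongrightarrow> a"
    and "(\<lambda>n. E n (\<lambda>k. \<bar>1 / D n k - wp p r a n k / E n (wp p r a n)\<bar>) / sn n ^ Suc r)
      \<longlonglongrightarrow> integral\<^sup>L std_normal_distribution (\<lambda>t. \<bar>poly (p (Suc r)) t - I\<bar>)"
proof -
  define pr where "pr = p (Suc r)"
  define y where "y = yp p r"
  define w where "w = wp p r a"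
  define Z where "Z n = E n (w n)" for n
  define P where "P n k = poly pr (T n k) * sn n ^ Suc r" for n k
  \<comment> \<open>The error after the missing term \<open>P\<close> is restored; its mean will be
    of order \<open>n^(-(r+2)/2)\<close>. For \<open>\<Psi>\<close> order \<open>n^(-1/2)\<close> is
    enough, as it is used only against terms already of the final order.\<close>
  define \<Phi> where "\<Phi> n k = \<bar>1 / D n k - w n k / a + P n k\<bar>" for n k
  define \<Psi> where "\<Psi> n k = \<bar>w n k / a - 1\<bar>" for n k
  obtain K' where K': "\<forall>\<^sub>F n in sequentially. \<forall>k. T n k ^ 4 \<le> real n \<longrightarrow>
        \<bar>D n k - (1 + (\<Sum>i=1..Suc r. poly (p i) (T n k) * sn n ^ i))\<bar> \<le> K' * eta n k ^ Suc (Suc r)" using ex by blast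
  define K where "K = \<bar>K'\<bar>"
  have K: "\<forall>\<^sub>F n in sequentially. \<forall>k. T n k ^ 4 \<le> real n \<longrightarrow> \<bar>D n k - (y n k + P n k)\<bar> \<le> K * eta n k ^ Suc (Suc r)"
    using K'
  proof eventually_elim
    case (elim n)
    show ?case
    proof (intro allI impI)
      fix k assume "T n k ^ 4 \<le> real n"
      then have "\<bar>D n k - (1 + (\<Sum>i=1..Suc r. poly (p i) (T n k) * sn n ^ i))\<bar> \<le> K' * eta n k ^ Suc (Suc r)" using elim by blast
      also have "\<dots> \<le> K * eta n k ^ Suc (Suc r)" unfolding K_def using eta_nonneg by (intro mult_right_mono) auto
      also have "1 + (\<Sum>i=1..Suc r. poly (p i) (T n k) * sn n ^ i) = y n k + P n k"
        by (simp add: y_def yp_def P_def pr_def)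
      finally show "\<bar>D n k - (y n k + P n k)\<bar> \<le> K * eta n k ^ Suc (Suc r)" .
    qed
  qed
  obtain C0 where C0: "C0 \<ge> 0" "\<And>n k. eta n k \<le> 1 \<Longrightarrow> \<bar>\<Sum>i=1..r. poly (p i) (T n k) * sn n ^ i\<bar> \<le> C0 * eta n k"
    using poly_sum_eta[of "{1..r}" p] deg by auto
  obtain C1 where C1: "C1 \<ge> 0" "\<And>n k. \<bar>P n k\<bar> \<le> C1 * eta n k ^ Suc r"
    using poly_term_bound[of pr "Suc r"] deg[of "Suc r"] unfolding P_def pr_def by auto
  \<comment> \<open>One constant bounding \<open>y - 1\<close> and \<open>D - 1\<close> by multiples
    of \<open>eta\<close>; the added 1 makes it positive.\<close>
  define c where "c = C0 + C1 + K + 1"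
  have c: "c > 0" "C0 \<le> c" using C0 C1 by (auto simp: c_def K_def)
  \<comment> \<open>For \<open>eta \<le> \<epsilon>\<close> the bound \<open>c * eta\<close> is at
    most \<open>1 - a\<close>, so \<open>y \<ge> a\<close> and \<open>w\<close> is the quotient
    \<open>a / y\<close>; this is where \<open>a < 1\<close> enters. The bound \<open>1 / 2\<close>
    is for the reciprocals.\<close>
  define \<epsilon> where "\<epsilon> = min 1 (min (1 / 2) (1 - a) / c)"
  have eps: "\<epsilon> > 0" unfolding \<epsilon>_def using a c by simp
  have region: "\<forall>\<^sub>F n in sequentially. \<forall>k. T n k ^ 4 \<le> real n \<longrightarrow>
      \<bar>y n k - 1\<bar> \<le> c * eta n k \<and> \<bar>D n k - 1\<bar> \<le> c * eta n k \<and> c * eta n k \<le> 1 / 2 \<and> w n k = a / y n k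
       \<and> \<bar>D n k - (y n k + P n k)\<bar> \<le> K * eta n k ^ Suc (Suc r)"
    using K eta_small[OF eps]
  proof eventually_elim
    case (elim n)
    show ?case
    proof (intro allI impI)
      fix k assume t: "T n k ^ 4 \<le> real n"
      have e0: "eta n k \<ge> 0" by (rule eta_nonneg)
      have ee: "eta n k \<le> \<epsilon>" using elim(2) t by blast
      then have e1: "eta n k \<le> 1" and e2: "eta n k \<le> min (1 / 2) (1 - a) / c" by (auto simp: \<epsilon>_def)
      have ce: "c * eta n k \<le> min (1 / 2) (1 - a)" using e2 c(1) by (simp add: pos_le_divide_eq mult.commute)
      have p1: "eta n k ^ Suc r \<le> eta n k" "eta n k ^ Suc (Suc r) \<le> eta n k"
        using power_decreasing[of 1 "Suc r" "eta n k"] power_decreasing[of 1 "Suc (Suc r)" "eta n k"] e0 e1 by auto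
      have y1: "\<bar>y n k - 1\<bar> \<le> C0 * eta n k" using C0(2)[OF e1] by (simp add: y_def yp_def)
      have "C0 * eta n k \<le> c * eta n k" using c(2) e0 by (intro mult_right_mono)
      then have y2: "\<bar>y n k - 1\<bar> \<le> c * eta n k" using y1 by linarith
      have d0: "\<bar>D n k - (y n k + P n k)\<bar> \<le> K * eta n k ^ Suc (Suc r)" using elim(1) t by blast
      have "K * eta n k ^ Suc (Suc r) \<le> K * eta n k" "C1 * eta n k ^ Suc r \<le> C1 * eta n k"
        using p1 C1(1) by (auto simp: K_def intro: mult_left_mono)
      then have "\<bar>D n k - 1\<bar> \<le> C0 * eta n k + C1 * eta n k + K * eta n k"
        using d0 y1 C1(2)[of n k] by linarith
      also have "\<dots> \<le> c * eta n k" using e0 by (simp add: c_def distrib_right)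
      finally have d2: "\<bar>D n k - 1\<bar> \<le> c * eta n k" .
      have "y n k \<ge> a" using y2 ce by (simp add: abs_le_iff)
      then have "w n k = a / y n k" by (simp add: w_def wp_def y_def)
      then show "\<bar>y n k - 1\<bar> \<le> c * eta n k \<and> \<bar>D n k - 1\<bar> \<le> c * eta n k \<and> c * eta n k \<le> 1 / 2 \<and> w n k = a / y n k
       \<and> \<bar>D n k - (y n k + P n k)\<bar> \<le> K * eta n k ^ Suc (Suc r)"
        using y2 d2 ce d0 by auto
    qed
  qed
  have eU: "eta n k \<le> (1 + (T n k)\<^sup>2) * sn n" for n k
    unfolding eta_def using sqrt_1_le sn_bounds(3) by (intro mult_right_mono) auto
  define C3 where "C3 = 4 * K + 12 * C1 * c"
  have C3: "C3 \<ge> 0" using C1(1) c(1) by (simp add: C3_def K_def)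
  have r1: "\<forall>\<^sub>F n in sequentially. \<forall>k. T n k ^ 4 \<le> real n \<longrightarrow> \<Phi> n k \<le> C3 * (1 + (T n k)\<^sup>2) ^ Suc (Suc r) * sn n ^ Suc (Suc r)"
    using region
  proof eventually_elim
    case (elim n)
    show ?case
    proof (intro allI impI)
      fix k assume t: "T n k ^ 4 \<le> real n"
      note R = elim[rule_format, OF t]
      have "w n k / a = 1 / y n k" using R a by simp
      then have "\<Phi> n k \<le> 4 * (K * eta n k ^ Suc (Suc r)) + 12 * \<bar>P n k\<bar> * (c * eta n k)"
        unfolding \<Phi>_def using R c(1) eta_nonneg by (simp only:) (intro inverse_diff_bound, auto)
      also have "\<dots> \<le> 4 * (K * eta n k ^ Suc (Suc r)) + 12 * (C1 * eta n k ^ Suc r) * (c * eta n k)"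
        using C1(2)[of n k] c(1) eta_nonneg[of n k] by (intro add_left_mono mult_right_mono mult_left_mono) auto
      also have "\<dots> = C3 * eta n k ^ Suc (Suc r)" by (simp add: C3_def algebra_simps)
      also have "\<dots> \<le> C3 * ((1 + (T n k)\<^sup>2) * sn n) ^ Suc (Suc r)"
        using C3 eU eta_nonneg by (intro mult_left_mono power_mono) auto
      finally show "\<Phi> n k \<le> C3 * (1 + (T n k)\<^sup>2) ^ Suc (Suc r) * sn n ^ Suc (Suc r)"
        by (simp only: power_mult_distrib mult.assoc)
    qed
  qed
  obtain A B where A: "A \<ge> 0" "\<forall>\<^sub>F n in sequentially. \<forall>k. 1 \<le> k \<and> k \<le> n \<longrightarrow> \<bar>1 / D n k\<bar> \<le> A * real n ^ B"
    using inv_D_crude by blast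
  obtain C4 where C4: "C4 \<ge> 0" "\<And>n k. n > 0 \<Longrightarrow> \<bar>P n k\<bar> \<le> C4 * (1 + (T n k)\<^sup>2) ^ Suc r"
    using poly_term_crude[of pr "Suc r"] deg[of "Suc r"] unfolding P_def pr_def by auto
  have wb: "0 < w n k" "w n k \<le> 1" for n k unfolding w_def using wp_bounds[OF a] by auto
  have c1: "\<forall>\<^sub>F n in sequentially. \<forall>k. 1 \<le> k \<and> k \<le> n \<longrightarrow> \<Phi> n k \<le> (A + 1 / a + C4) * real n ^ B * (1 + (T n k)\<^sup>2) ^ Suc r"
    using A(2) eventually_gt_at_top[of 0]
  proof eventually_elim
    case (elim n)
    show ?case
    proof (intro allI impI)
      fix k assume k: "1 \<le> k \<and> k \<le> n"
      define U where "U = (1 + (T n k)\<^sup>2) ^ Suc r"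
      have U: "U \<ge> 1" unfolding U_def by (intro one_le_power) simp
      have nB: "real n ^ B \<ge> 1" using elim(2) by (intro one_le_power) simp
      have nU: "real n ^ B * U \<ge> 1 * 1" using nB U by (intro mult_mono) auto
      have nU2: "real n ^ B * U \<ge> U" "real n ^ B * U \<ge> real n ^ B" using nB U mult_right_mono[of 1 "real n ^ B" U] mult_left_mono[of 1 U "real n ^ B"] by auto
      have "\<bar>1 / D n k\<bar> \<le> A * real n ^ B" using elim(1) k by blast
      also have "\<dots> \<le> A * (real n ^ B * U)" using nU2 A(1) by (intro mult_left_mono)
      finally have t1: "\<bar>1 / D n k\<bar> \<le> A * (real n ^ B * U)" .
      have "\<bar>w n k / a\<bar> \<le> 1 / a" using wb[of n k] a by (simp add: divide_right_mono)
      also have "\<dots> \<le> 1 / a * (real n ^ B * U)" using mult_left_mono[of 1 "real n ^ B * U" "1 / a"] nU a by simp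
      finally have t2: "\<bar>w n k / a\<bar> \<le> 1 / a * (real n ^ B * U)" .
      have "\<bar>P n k\<bar> \<le> C4 * U" using C4(2)[OF elim(2)] by (simp add: U_def)
      also have "\<dots> \<le> C4 * (real n ^ B * U)" using nU2 C4(1) by (intro mult_left_mono)
      finally have t3: "\<bar>P n k\<bar> \<le> C4 * (real n ^ B * U)" .
      have "\<Phi> n k \<le> \<bar>1 / D n k\<bar> + \<bar>w n k / a\<bar> + \<bar>P n k\<bar>" unfolding \<Phi>_def by linarith
      also have "\<dots> \<le> (A + 1 / a + C4) * (real n ^ B * U)" unfolding distrib_right using t1 t2 t3 by linarith
      finally show "\<Phi> n k \<le> (A + 1 / a + C4) * real n ^ B * (1 + (T n k)\<^sup>2) ^ Suc r" by (simp only: U_def mult.assoc)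
    qed
  qed
  obtain C5 M5 where "C5 \<ge> 0" "\<forall>\<^sub>F n in sequentially. \<forall>k. 1 \<le> k \<and> k \<le> n \<longrightarrow> \<Phi> n k \<le> C5 * (1 + (T n k)\<^sup>2) ^ M5 * sn n ^ Suc (Suc r)"
    using globalize[OF r1 c1] by blast
  from E_globalize[OF this(2,1)] obtain C6 where C6: "C6 \<ge> 0" "\<forall>\<^sub>F n in sequentially. E n (\<Phi> n) \<le> C6 * sn n ^ Suc (Suc r)" by blast
  have r2: "\<forall>\<^sub>F n in sequentially. \<forall>k. T n k ^ 4 \<le> real n \<longrightarrow> \<Psi> n k \<le> (2 * c) * (1 + (T n k)\<^sup>2) ^ 1 * sn n ^ 1"
    using region
  proof eventually_elim
    case (elim n)
    show ?case
    proof (intro allI impI)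
      fix k assume t: "T n k ^ 4 \<le> real n"
      note R = elim[rule_format, OF t]
      have y: "y n k \<ge> 1 / 2" using R unfolding abs_le_iff by linarith
      have "w n k / a - 1 = - (y n k - 1) / y n k" using R a y by (simp add: field_simps)
      then have "\<Psi> n k = \<bar>y n k - 1\<bar> / y n k" using y unfolding \<Psi>_def by (simp add: abs_minus_commute)
      also have "\<dots> \<le> (c * eta n k) / (1 / 2)" using R y c eta_nonneg[of n k] by (intro frac_le) auto
      also have "\<dots> = (2 * c) * eta n k" by simp
      also have "\<dots> \<le> (2 * c) * ((1 + (T n k)\<^sup>2) * sn n)" using eU c(1) by (intro mult_left_mono) auto
      finally show "\<Psi> n k \<le> (2 * c) * (1 + (T n k)\<^sup>2) ^ 1 * sn n ^ 1" by simp
    qed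
  qed
  have c2: "\<forall>\<^sub>F n in sequentially. \<forall>k. 1 \<le> k \<and> k \<le> n \<longrightarrow> \<Psi> n k \<le> (1 / a + 1) * real n ^ 0 * (1 + (T n k)\<^sup>2) ^ 0"
  proof (intro always_eventually allI impI)
    fix n k
    have "\<bar>w n k / a\<bar> \<le> 1 / a" using wb[of n k] a by (simp add: divide_right_mono)
    then have "\<bar>w n k / a - 1\<bar> \<le> 1 / a + 1" by linarith
    then show "\<Psi> n k \<le> (1 / a + 1) * real n ^ 0 * (1 + (T n k)\<^sup>2) ^ 0" unfolding \<Psi>_def by simp
  qed
  obtain C7 M7 where "C7 \<ge> 0" "\<forall>\<^sub>F n in sequentially. \<forall>k. 1 \<le> k \<and> k \<le> n \<longrightarrow> \<Psi> n k \<le> C7 * (1 + (T n k)\<^sup>2) ^ M7 * sn n ^ 1"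
    using globalize[OF r2 c2] by blast
  from E_globalize[OF this(2,1)] obtain C8 where C8: "C8 \<ge> 0" "\<forall>\<^sub>F n in sequentially. E n (\<Psi> n) \<le> C8 * sn n ^ 1" by blast
  have sn0: "sn \<longlonglongrightarrow> 0" unfolding sn_def[abs_def] by real_asymp
  have Za: "\<forall>\<^sub>F n in sequentially. \<bar>Z n / a - 1\<bar> \<le> C8 * sn n"
    using C8(2) q_pos_ev
  proof eventually_elim
    case (elim n)
    have "Z n / a - 1 = E n (\<lambda>k. w n k / a - 1)"
      unfolding E_diff Z_def E_const[OF elim(2)] using E_cmult[of n "1 / a" "w n"] by simp
    then show ?case using E_abs_le[of n "\<lambda>k. w n k / a - 1"] elim(1) unfolding \<Psi>_def by simp
  qed
  have C8s: "(\<lambda>n. C8 * sn n) \<longlonglongrightarrow> 0" using tendsto_mult[OF tendsto_const[of C8] sn0] by simp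
  have "(\<lambda>n. Z n / a - 1) \<longlonglongrightarrow> 0" using Za by (intro Lim_null_comparison[OF _ C8s]) simp
  then have "(\<lambda>n. Z n / a) \<longlonglongrightarrow> 1" by (simp add: LIM_zero_iff)
  from tendsto_mult[OF this tendsto_const[of a]] have Zlim: "Z \<longlonglongrightarrow> a" using a by simp
  then show "(\<lambda>n. E n (wp p r a n)) \<longlonglongrightarrow> a" by (simp add: Z_def[abs_def] w_def)
  \<comment> \<open>The relative error of \<open>Z\<close> against \<open>a\<close>, on the scale of
    the result. The mean of \<open>1 / D - w / a + P\<close> is small, while \<open>1 / D\<close>
    has mean 1 and \<open>w / a\<close> has mean \<open>Z / a\<close>; so \<open>J\<close> is close
    to the mean of \<open>p (r + 1)\<close> at \<open>T\<close>.\<close>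
  define J where "J n = (Z n / a - 1) / sn n ^ Suc r" for n
  have Jb: "\<forall>\<^sub>F n in sequentially. \<bar>J n - E n (\<lambda>k. poly pr (T n k))\<bar> \<le> C6 * sn n"
    using C6(2) q_pos_ev eventually_gt_at_top[of 0]
  proof eventually_elim
    case (elim n)
    have s: "sn n > 0" by (rule sn_bounds(1)[OF elim(3)])
    have "E n (\<lambda>k. 1 / D n k - w n k / a + P n k) = 1 - Z n / a + E n (\<lambda>k. poly pr (T n k)) * sn n ^ Suc r"
    proof -
      have "E n (\<lambda>k. w n k / a) = Z n / a" unfolding Z_def using E_cmult[of n "1 / a" "w n"] by simp
      moreover have "E n (P n) = E n (\<lambda>k. poly pr (T n k)) * sn n ^ Suc r"
        unfolding P_def using E_cmult[of n "sn n ^ Suc r" "\<lambda>k. poly pr (T n k)"] by (simp add: mult_ac)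
      ultimately show ?thesis unfolding E_add E_diff E_inv_D[OF elim(3,2)] by simp
    qed
    then have "\<bar>1 - Z n / a + E n (\<lambda>k. poly pr (T n k)) * sn n ^ Suc r\<bar> \<le> C6 * sn n ^ Suc (Suc r)"
      using E_abs_le[of n "\<lambda>k. 1 / D n k - w n k / a + P n k"] elim(1) unfolding \<Phi>_def by simp
    moreover have "1 - Z n / a + E n (\<lambda>k. poly pr (T n k)) * sn n ^ Suc r = - (J n - E n (\<lambda>k. poly pr (T n k))) * sn n ^ Suc r"
      unfolding J_def left_diff_distrib minus_mult_left[symmetric] using s by simp
    ultimately have "\<bar>J n - E n (\<lambda>k. poly pr (T n k))\<bar> * sn n ^ Suc r \<le> (C6 * sn n) * sn n ^ Suc r"
      using s by (simp add: abs_mult mult_ac abs_minus_commute)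
    then show ?case using s by (simp add: mult_le_cancel_right)
  qed
  have C6s: "(\<lambda>n. C6 * sn n) \<longlonglongrightarrow> 0" using tendsto_mult[OF tendsto_const[of C6] sn0] by simp
  have "(\<lambda>n. J n - E n (\<lambda>k. poly pr (T n k))) \<longlonglongrightarrow> 0" using Jb by (intro Lim_null_comparison[OF _ C6s]) simp
  from tendsto_add[OF this E_poly_tendsto(1)[of pr]] have Jlim: "J \<longlonglongrightarrow> I" unfolding I pr_def by simp
  define Q where "Q n = E n (\<lambda>k. \<bar>1 / D n k - w n k / Z n\<bar>) / sn n ^ Suc r" for n
  \<comment> \<open>The limit \<open>I\<close> of \<open>J\<close> is the shift in the final
    integrand.\<close>
  define q' where "q' = pr - [:I:]"
  have Qb: "\<forall>\<^sub>F n in sequentially. \<bar>Q n - E n (\<lambda>k. \<bar>poly q' (T n k)\<bar>)\<bar> \<le> C6 * sn n + \<bar>J n - I\<bar> + \<bar>J n\<bar> * (a / Z n) * (2 * (C8 * sn n))"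
  proof -
    have "\<forall>\<^sub>F n in sequentially. Z n > 0" using Zlim a(1) by (rule order_tendstoD)
    then show ?thesis using C6(2) C8(2) Za q_pos_ev eventually_gt_at_top[of 0]
    proof eventually_elim
      case (elim n)
      have s: "sn n > 0" by (rule sn_bounds(1)[OF elim(6)])
      define S where "S = sn n ^ Suc r"
      have S: "S > 0" using s by (simp add: S_def)
      have pw: "\<bar>\<bar>1 / D n k - w n k / Z n\<bar> / S - \<bar>poly q' (T n k)\<bar>\<bar> \<le> \<Phi> n k * (1 / S) + (\<bar>J n - I\<bar> + \<bar>J n\<bar> * (a / Z n) * (\<Psi> n k + \<bar>Z n / a - 1\<bar>))" for k
      proof -
        have JS: "J n * S = Z n / a - 1" using s by (simp add: J_def S_def)
        \<comment> \<open>Splits off the change of normalisation: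
          \<open>w / a - w / Z = w / Z * (Z / a - 1)\<close>.\<close>
        have e1: "1 / D n k - w n k / Z n = (1 / D n k - w n k / a + P n k) - P n k + w n k / Z n * (J n * S)"
        proof -
          have "w n k / Z n * (Z n / a - 1) = w n k / a - w n k / Z n"
            using elim(1) a by (simp add: right_diff_distrib)
          then show ?thesis unfolding JS by simp
        qed
        have PS: "P n k = poly pr (T n k) * S" by (simp add: P_def S_def)
        have e2: "(1 / D n k - w n k / Z n) / S = (1 / D n k - w n k / a + P n k) / S + (w n k / Z n * J n - I) - poly q' (T n k)"
          unfolding e1 using S by (simp add: PS q'_def diff_divide_distrib add_divide_distrib)
        have "\<bar>\<bar>1 / D n k - w n k / Z n\<bar> / S - \<bar>poly q' (T n k)\<bar>\<bar> = \<bar>\<bar>(1 / D n k - w n k / Z n) / S\<bar> - \<bar>- poly q' (T n k)\<bar>\<bar>"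
          using S by simp
        also have "\<dots> \<le> \<bar>(1 / D n k - w n k / Z n) / S - (- poly q' (T n k))\<bar>" by (rule abs_triangle_ineq3)
        also have "\<dots> = \<bar>(1 / D n k - w n k / a + P n k) / S + (w n k / Z n * J n - I)\<bar>" unfolding e2 by simp
        also have "\<dots> \<le> \<bar>(1 / D n k - w n k / a + P n k) / S\<bar> + \<bar>w n k / Z n * J n - I\<bar>" by (rule abs_triangle_ineq)
        also have "\<bar>(1 / D n k - w n k / a + P n k) / S\<bar> = \<Phi> n k * (1 / S)" unfolding \<Phi>_def using S by simp
        \<comment> \<open>\<open>w / Z\<close> is close to 1 only on average over \<open>k\<close>;
          \<open>\<Psi>\<close> and the error of \<open>Z\<close> record its distance, to be
          integrated later.\<close>
        also have "\<bar>w n k / Z n * J n - I\<bar> \<le> \<bar>J n - I\<bar> + \<bar>J n\<bar> * (a / Z n) * (\<Psi> n k + \<bar>Z n / a - 1\<bar>)"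
        proof -
          have "w n k / Z n * J n - I = (J n - I) + J n * (a / Z n) * ((w n k / a - 1) - (Z n / a - 1))"
          proof -
            have "(a / Z n) * ((w n k / a - 1) - (Z n / a - 1)) = w n k / Z n - 1"
              using elim(1) a by (simp add: field_simps)
            then have "J n * (a / Z n) * ((w n k / a - 1) - (Z n / a - 1)) = J n * (w n k / Z n - 1)"
              by (simp only: mult.assoc)
            then show ?thesis by (simp add: right_diff_distrib)
          qed
          then have "\<bar>w n k / Z n * J n - I\<bar> \<le> \<bar>J n - I\<bar> + \<bar>J n * (a / Z n) * ((w n k / a - 1) - (Z n / a - 1))\<bar>"
            using abs_triangle_ineq[of "J n - I" "J n * (a / Z n) * ((w n k / a - 1) - (Z n / a - 1))"] by simp
          also have "\<bar>J n * (a / Z n) * ((w n k / a - 1) - (Z n / a - 1))\<bar> = \<bar>J n\<bar> * (a / Z n) * \<bar>(w n k / a - 1) - (Z n / a - 1)\<bar>"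
            using elim(1) a by (simp add: abs_mult)
          also have "\<dots> \<le> \<bar>J n\<bar> * (a / Z n) * (\<Psi> n k + \<bar>Z n / a - 1\<bar>)"
            unfolding \<Psi>_def using elim(1) a by (intro mult_left_mono abs_triangle_ineq4) auto
          finally show ?thesis by simp
        qed
        finally show ?thesis by simp
      qed
      have "Q n - E n (\<lambda>k. \<bar>poly q' (T n k)\<bar>) = E n (\<lambda>k. \<bar>1 / D n k - w n k / Z n\<bar> / S - \<bar>poly q' (T n k)\<bar>)"
        unfolding E_diff Q_def S_def[symmetric] using E_cmult[of n "1 / S" "\<lambda>k. \<bar>1 / D n k - w n k / Z n\<bar>"] by simp
      then have "\<bar>Q n - E n (\<lambda>k. \<bar>poly q' (T n k)\<bar>)\<bar> \<le> E n (\<lambda>k. \<bar>\<bar>1 / D n k - w n k / Z n\<bar> / S - \<bar>poly q' (T n k)\<bar>\<bar>)"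
        using E_abs_le by simp
      also have "\<dots> \<le> E n (\<lambda>k. \<Phi> n k * (1 / S) + (\<bar>J n - I\<bar> + \<bar>J n\<bar> * (a / Z n) * (\<Psi> n k + \<bar>Z n / a - 1\<bar>)))"
        by (intro E_mono elim(6) pw)
      also have "\<dots> = E n (\<Phi> n) * (1 / S) + (\<bar>J n - I\<bar> + \<bar>J n\<bar> * (a / Z n) * (E n (\<Psi> n) + \<bar>Z n / a - 1\<bar>))"
        unfolding mult.commute[of "\<Phi> n _"] E_add E_cmult E_const[OF elim(5)] by (simp add: mult.commute)
      also have "\<dots> \<le> C6 * sn n + (\<bar>J n - I\<bar> + \<bar>J n\<bar> * (a / Z n) * (C8 * sn n + C8 * sn n))"
      proof (intro add_mono mult_left_mono order_refl)
        have "E n (\<Phi> n) * (1 / S) \<le> C6 * sn n ^ Suc (Suc r) * (1 / S)" using elim(2) S by (intro mult_right_mono) auto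
        also have "\<dots> = C6 * sn n" using S s by (simp add: S_def)
        finally show "E n (\<Phi> n) * (1 / S) \<le> C6 * sn n" .
      qed (use elim a in auto)
      finally show ?case by simp
    qed
  qed
  have "(\<lambda>n. C6 * sn n + \<bar>J n - I\<bar> + \<bar>J n\<bar> * (a / Z n) * (2 * (C8 * sn n))) \<longlonglongrightarrow> 0 + \<bar>I - I\<bar> + \<bar>I\<bar> * (a / a) * (2 * 0)"
    using a by (intro tendsto_intros C6s Jlim Zlim C8s) auto
  then have lim0: "(\<lambda>n. C6 * sn n + \<bar>J n - I\<bar> + \<bar>J n\<bar> * (a / Z n) * (2 * (C8 * sn n))) \<longlonglongrightarrow> 0" by simp
  have "(\<lambda>n. Q n - E n (\<lambda>k. \<bar>poly q' (T n k)\<bar>)) \<longlonglongrightarrow> 0" using Qb by (intro Lim_null_comparison[OF _ lim0]) simp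
  from tendsto_add[OF this E_poly_tendsto(2)[of q']]
  have "Q \<longlonglongrightarrow> integral\<^sup>L std_normal_distribution (\<lambda>t. \<bar>poly q' t\<bar>)" by simp
  then show "(\<lambda>n. E n (\<lambda>k. \<bar>1 / D n k - wp p r a n k / E n (wp p r a n)\<bar>) / sn n ^ Suc r)
      \<longlonglongrightarrow> integral\<^sup>L std_normal_distribution (\<lambda>t. \<bar>poly (p (Suc r)) t - I\<bar>)"
    by (simp add: Q_def[abs_def] Z_def w_def q'_def pr_def)
qed

end

section \<open>Repeated trials and sequential sampling\<close>

lemma nn_integral_bind_spmf:
  "(\<integral>\<^sup>+ y. f y \<partial>measure_spmf (bind_spmf p g)) = (\<integral>\<^sup>+ x. \<integral>\<^sup>+ y. f y \<partial>measure_spmf (g x) \<partial>measure_spmf p)"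
  unfolding measure_spmf_bind o_def
  by (rule nn_integral_bind[where B = "count_space UNIV"]) (simp_all add: space_subprob_algebra subprob_space_measure_spmf measurable_def)

lemma integrable_spmf_bounded:
  fixes f :: "'a \<Rightarrow> real"
  assumes "\<And>x. \<bar>f x\<bar> \<le> B"
  shows "integrable (measure_spmf p) f"
  using assms by (intro measure_spmf.integrable_const_bound[of _ B]) auto

lemma failure_prob:
  assumes "lossless_spmf trial"
  shows "measure (measure_spmf trial) {(x, u). x = None} = 1 - success_prob trial"
proof -
  have "measure (measure_spmf trial) UNIV = 1" using assms by (simp add: lossless_spmf_def weight_spmf_def space_measure_spmf)
  moreover have U: "UNIV = {(x, u). x = None} \<union> {(x, u). x \<noteq> None}" by auto
  have "measure (measure_spmf trial) UNIV =
      measure (measure_spmf trial) {(x, u). x = None} + measure (measure_spmf trial) {(x, u). x \<noteq> None}"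
    by (subst U) (rule measure_spmf.finite_measure_Union, auto)
  ultimately show ?thesis by (simp add: success_prob_def)
qed

lemma success_prob_le_1: "success_prob trial \<le> 1"
  by (simp add: success_prob_def measure_spmf.subprob_measure_le_1)

text \<open>
  This replaces uniqueness of the fixed point in the definition of \<open>retry\<close>: it is applied to the difference
  between a probability for \<open>retry\<close> and its claimed value.
\<close>

lemma retry_contraction:
  fixes \<delta> :: "nat \<Rightarrow> real"
  assumes ll: "lossless_spmf trial" and s: "success_prob trial > 0"
    and B: "\<And>t. \<bar>\<delta> t\<bar> \<le> B"
    and eq: "\<And>t. \<delta> t = (\<integral>z. (if fst z = None then \<delta> (t + snd z) else 0) \<partial>measure_spmf trial)"
  shows "\<delta> t = 0"
proof -
  let ?s = "success_prob trial"
  have B0: "B \<ge> 0" using B[of 0] by linarith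
  have bd: "\<bar>\<delta> t\<bar> \<le> B * (1 - ?s) ^ n" for n t
  proof (induction n arbitrary: t)
    case (Suc n)
    let ?C = "B * (1 - ?s) ^ n"
    have C0: "?C \<ge> 0" using B0 success_prob_le_1[of trial] by simp
    have i1: "integrable (measure_spmf trial) (\<lambda>z. \<bar>if fst z = None then \<delta> (t + snd z) else 0\<bar>)"
      using B B0 by (intro integrable_spmf_bounded[of _ B]) auto
    have i2: "integrable (measure_spmf trial) (\<lambda>z. indicator {(x, u). x = None} z * ?C)"
      using C0 by (intro integrable_spmf_bounded[of _ ?C]) (auto simp: indicator_def)
    have "\<bar>\<delta> t\<bar> \<le> (\<integral>z. \<bar>if fst z = None then \<delta> (t + snd z) else 0\<bar> \<partial>measure_spmf trial)"
      unfolding eq[of t] by (rule integral_abs_bound)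
    also have "\<dots> \<le> (\<integral>z. indicator {(x, u). x = None} z * ?C \<partial>measure_spmf trial)"
      using Suc.IH by (intro integral_mono i1 i2) (auto simp: indicator_def split: prod.splits)
    also have "\<dots> = measure (measure_spmf trial) {(x, u). x = None} * ?C" by simp
    also have "\<dots> = B * (1 - ?s) ^ Suc n" using failure_prob[OF ll] by simp
    finally show ?case .
  qed (use B in simp)
  have "(\<lambda>n. B * (1 - ?s) ^ n) \<longlonglongrightarrow> B * 0"
    using s success_prob_le_1[of trial] by (intro tendsto_mult tendsto_const LIMSEQ_power_zero) auto
  then have "\<bar>\<delta> t\<bar> \<le> B * 0" by (rule LIMSEQ_le_const) (use bd in blast)
  then show ?thesis by simp
qed

lemma retry_simps':
  "retry trial t = bind_spmf trial (\<lambda>z. case fst z of None \<Rightarrow> retry trial (t + snd z) | Some y \<Rightarrow> return_spmf (y, t + snd z))"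
  by (subst retry.simps) (simp add: case_prod_unfold)

text \<open>The defect \<open>1 - weight\<close> is bounded and is reproduced by a failed trial, so
  \<open>retry_contraction\<close> makes it vanish.\<close>

lemma lossless_retry:
  assumes ll: "lossless_spmf trial" and s: "success_prob trial > 0"
  shows "lossless_spmf (retry trial t)"
proof -
  have "1 - weight_spmf (retry trial t) = 0"
  proof (rule retry_contraction[OF ll s])
    show "\<bar>1 - weight_spmf (retry trial t)\<bar> \<le> 1" for t
      using weight_spmf_le_1[of "retry trial t"] weight_spmf_nonneg[of "retry trial t"] by simp
    fix t
    let ?g = "\<lambda>z. weight_spmf (case fst z of None \<Rightarrow> retry trial (t + snd z) | Some y \<Rightarrow> return_spmf (y, t + snd z))"
    have "weight_spmf (retry trial t) = (\<integral>z. ?g z \<partial>measure_spmf trial)"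
      unfolding arg_cong[OF retry_simps', of weight_spmf trial t] by (simp only: weight_bind_spmf o_def)
    moreover have "(\<integral>z. 1 \<partial>measure_spmf trial) = (1::real)" using ll by (simp add: lossless_spmf_def weight_spmf_def)
    ultimately have "1 - weight_spmf (retry trial t) = (\<integral>z. 1 - ?g z \<partial>measure_spmf trial)"
      by (subst Bochner_Integration.integral_diff) (auto intro!: integrable_spmf_bounded[of _ 1] simp: weight_spmf_nonneg weight_spmf_le_1)
    also have "\<dots> = (\<integral>z. (if fst z = None then 1 - weight_spmf (retry trial (t + snd z)) else 0) \<partial>measure_spmf trial)"
      by (intro Bochner_Integration.integral_cong) (auto split: option.splits)
    finally show "1 - weight_spmf (retry trial t) = \<dots>" .
  qed
  then show ?thesis by (simp add: lossless_spmf_def)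
qed

text \<open>The output has the law of one trial conditioned on success, whatever time has already
  accumulated. The claimed value solves the same equation,
  \<open>P / s = (1 - s) * P / s + P\<close>, so the difference falls under the contraction.\<close>

lemma spmf_retry:
  assumes ll: "lossless_spmf trial" and s: "success_prob trial > 0"
  shows "spmf (map_spmf fst (retry trial t)) y = spmf (map_spmf fst trial) (Some y) / success_prob trial"
proof -
  let ?s = "success_prob trial"
  define P where "P = spmf (map_spmf fst trial) (Some y)"
  have P: "P = measure (measure_spmf trial) {z. fst z = Some y}"
    unfolding P_def spmf_map by (simp add: vimage_def)
  have P1: "0 \<le> P" "P / ?s \<ge> 0" using s by (auto simp: P_def)
  have "spmf (map_spmf fst (retry trial t)) y - P / ?s = 0"
  proof (rule retry_contraction[OF ll s])
    show "\<bar>spmf (map_spmf fst (retry trial t)) y - P / ?s\<bar> \<le> 1 + P / ?s" for t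
      using pmf_le_1[of "map_spmf fst (retry trial t)" "Some y"] pmf_nonneg[of "map_spmf fst (retry trial t)" "Some y"] P1(2)
      unfolding abs_le_iff by linarith
    fix t
    let ?f = "\<lambda>t. spmf (map_spmf fst (retry trial t)) y"
    have "map_spmf fst (retry trial t) = bind_spmf trial (\<lambda>z. case fst z of None \<Rightarrow> map_spmf fst (retry trial (t + snd z)) | Some y' \<Rightarrow> return_spmf y')"
      by (subst retry_simps') (auto simp: map_spmf_bind_spmf o_def intro!: bind_spmf_cong split: option.splits)
    then have "?f t = (\<integral>z. spmf (case fst z of None \<Rightarrow> map_spmf fst (retry trial (t + snd z)) | Some y' \<Rightarrow> return_spmf y') y \<partial>measure_spmf trial)"
      by (simp add: spmf_bind)
    also have "\<dots> = (\<integral>z. (if fst z = None then ?f (t + snd z) else 0) + indicator {z. fst z = Some y} z \<partial>measure_spmf trial)"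
      by (intro Bochner_Integration.integral_cong) (auto split: option.splits simp: indicator_def)
    also have "\<dots> = (\<integral>z. ((if fst z = None then ?f (t + snd z) - P / ?s else 0) + P / ?s * indicator {(x, u). x = None} z) + indicator {z. fst z = Some y} z \<partial>measure_spmf trial)"
      by (intro Bochner_Integration.integral_cong) (auto simp: indicator_def split: prod.splits)
    also have "\<dots> = (\<integral>z. (if fst z = None then ?f (t + snd z) - P / ?s else 0) \<partial>measure_spmf trial) + P / ?s * (1 - ?s) + P"
    proof -
      have "integrable (measure_spmf trial) (\<lambda>z. if fst z = None then ?f (t + snd z) - P / ?s else 0)"
      proof (rule integrable_spmf_bounded[of _ "1 + P / ?s"])
        fix z :: "'a option \<times> nat"
        obtain v where v: "?f (t + snd z) = v" "0 \<le> v" "v \<le> 1" using that[OF refl pmf_nonneg pmf_le_1] .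
        show "\<bar>if fst z = None then ?f (t + snd z) - P / ?s else 0\<bar> \<le> 1 + P / ?s"
          unfolding v(1) using v(2,3) P1(2) by (simp add: abs_le_iff)
      qed
      moreover have "integrable (measure_spmf trial) (\<lambda>z. P / ?s * indicator {(x, u). x = None} z)"
        by (intro integrable_mult_right integrable_spmf_bounded[of _ 1]) (simp add: indicator_def)
      moreover have "integrable (measure_spmf trial) (indicator {z. fst z = Some y} :: _ \<Rightarrow> real)"
        by (intro integrable_spmf_bounded[of _ 1]) (simp add: indicator_def)
      ultimately show ?thesis using failure_prob[OF ll] by (simp add: P)
    qed
    finally have "?f t = (\<integral>z. (if fst z = None then ?f (t + snd z) - P / ?s else 0) \<partial>measure_spmf trial) + P / ?s"
      using s by (simp add: right_diff_distrib)
    then show "?f t - P / ?s = (\<integral>z. (if fst z = None then ?f (t + snd z) - P / ?s else 0) \<partial>measure_spmf trial)" by simp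
  qed
  then show ?thesis by (simp add: P_def)
qed

text \<open>In contrast to \<open>expected_time\<close>, nontermination contributes nothing, so the
  quantity decomposes along \<open>bind_spmf\<close>; for lossless programs the two agree.\<close>

definition mean_time :: "('x \<times> nat) spmf \<Rightarrow> ennreal" where
  "mean_time p = (\<integral>\<^sup>+ z. of_nat (snd z) \<partial>measure_spmf p)"

lemma expected_time_eq:
  assumes "lossless_spmf p"
  shows "expected_time p = mean_time p"
proof -
  obtain p' where p: "p = spmf_of_pmf p'" using assms by (auto simp: lossless_spmf_conv_spmf_of_pmf)
  have "expected_time p = (\<integral>\<^sup>+ z. of_nat (snd z) \<partial>measure_pmf p')"
    unfolding expected_time_def p by (simp add: spmf_of_pmf_def nn_integral_map_pmf case_prod_unfold)
  then show ?thesis unfolding mean_time_def p by (simp only: measure_spmf_spmf_of_pmf)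
qed

lemma nn_integral_min_tendsto:
  "(\<And>M. (\<integral>\<^sup>+ z. of_nat (min (f z) M) \<partial>N) \<le> (C::ennreal)) \<Longrightarrow> f \<in> measurable N (count_space UNIV) \<Longrightarrow> (\<integral>\<^sup>+ z. of_nat (f z) \<partial>N) \<le> C"
proof -
  assume b: "\<And>M. (\<integral>\<^sup>+ z. of_nat (min (f z) M) \<partial>N) \<le> (C::ennreal)" and m: "f \<in> measurable N (count_space UNIV)"
  have sup: "(SUP M. of_nat (min (f z) M)) = (of_nat (f z) :: ennreal)" for z
  proof (rule antisym)
    show "(SUP M. of_nat (min (f z) M)) \<le> (of_nat (f z) :: ennreal)" by (intro SUP_least) simp
    have "(of_nat (f z) :: ennreal) = of_nat (min (f z) (f z))" by simp
    then show "(of_nat (f z) :: ennreal) \<le> (SUP M. of_nat (min (f z) M))" by (metis SUP_upper UNIV_I)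
  qed
  have "(\<integral>\<^sup>+ z. of_nat (f z) \<partial>N) = (\<integral>\<^sup>+ z. (SUP M. of_nat (min (f z) M)) \<partial>N)" unfolding sup ..
  also have "\<dots> = (SUP M. \<integral>\<^sup>+ z. of_nat (min (f z) M) \<partial>N)"
  proof (rule nn_integral_monotone_convergence_SUP)
    show "incseq (\<lambda>M z. of_nat (min (f z) M) :: ennreal)" by (auto simp: incseq_def le_fun_def)
    show "(\<lambda>z. of_nat (min (f z) M) :: ennreal) \<in> borel_measurable N" for M
      using m by (rule measurable_compose) simp
  qed
  also have "\<dots> \<le> C" using b by (intro SUP_least)
  finally show ?thesis .
qed

text \<open>Wald's bound. The mean could a priori be infinite, so the time is capped at
  \<open>M\<close>: after \<open>n\<close> unfoldings the cap contributes at most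
  \<open>M * (1 - s)^n\<close>. Letting first \<open>n\<close> and then \<open>M\<close> tend to
  infinity leaves the fixed point \<open>t + T / s\<close>.\<close>

lemma mean_time_retry:
  assumes ll: "lossless_spmf trial" and s: "success_prob trial > 0"
    and T: "mean_time trial \<le> ennreal T" and T0: "T \<ge> 0"
  shows "mean_time (retry trial t) \<le> ennreal (real t + T / success_prob trial)"
proof -
  let ?s = "success_prob trial"
  have s1: "?s \<le> 1" by (rule success_prob_le_1)
  define e where "e M t = (\<integral>\<^sup>+ z. of_nat (min (snd z) M) \<partial>measure_spmf (retry trial t))" for M t
  have bd: "e M t \<le> ennreal (real t + T / ?s + real M * (1 - ?s) ^ n)" for M n t
  proof (induction n arbitrary: t)
    case 0
    have "e M t \<le> (\<integral>\<^sup>+ z. of_nat M \<partial>measure_spmf (retry trial t))" unfolding e_def by (intro nn_integral_mono) simp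
    also have "\<dots> = of_nat M * emeasure (measure_spmf (retry trial t)) UNIV" by (simp add: space_measure_spmf)
    also have "\<dots> \<le> of_nat M * 1" by (intro mult_left_mono) (auto simp: measure_spmf.emeasure_eq_measure measure_spmf.subprob_measure_le_1)
    also have "\<dots> = ennreal (real M)" by (simp add: ennreal_of_nat_eq_real_of_nat)
    also have "\<dots> \<le> ennreal (real t + T / ?s + real M * (1 - ?s) ^ 0)" using T0 s by (intro ennreal_leI) simp
    finally show ?case .
  next
    case (Suc n)
    \<comment> \<open>The induction bound for a restart at time 0; it is charged only on failure,
      with probability \<open>1 - s\<close>.\<close>
    define C where "C = T / ?s + real M * (1 - ?s) ^ n"
    have C0: "C \<ge> 0" unfolding C_def using T0 s s1 by simp
    have "e M t = (\<integral>\<^sup>+ z. (\<integral>\<^sup>+ z'. of_nat (min (snd z') M) \<partial>measure_spmf (case fst z of None \<Rightarrow> retry trial (t + snd z) | Some y \<Rightarrow> return_spmf (y, t + snd z))) \<partial>measure_spmf trial)"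
      unfolding e_def by (subst retry_simps') (rule nn_integral_bind_spmf)
    also have "\<dots> \<le> (\<integral>\<^sup>+ z. ennreal (real t) + of_nat (snd z) + ennreal C * indicator {(x, u). x = None} z \<partial>measure_spmf trial)"
    proof (rule nn_integral_mono)
      fix z :: "'a option \<times> nat"
      show "(\<integral>\<^sup>+ z'. of_nat (min (snd z') M) \<partial>measure_spmf (case fst z of None \<Rightarrow> retry trial (t + snd z) | Some y \<Rightarrow> return_spmf (y, t + snd z)))
          \<le> ennreal (real t) + of_nat (snd z) + ennreal C * indicator {(x, u). x = None} z"
      proof (cases "fst z")
        case None
        have "e M (t + snd z) \<le> ennreal (real (t + snd z) + T / ?s + real M * (1 - ?s) ^ n)" by (rule Suc.IH)
        also have "\<dots> = ennreal (real t) + of_nat (snd z) + ennreal C"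
          using C0 by (simp add: C_def ennreal_of_nat_eq_real_of_nat add.assoc flip: ennreal_plus)
        finally show ?thesis using None by (simp add: e_def indicator_def case_prod_beta)
      next
        case (Some y)
        have "of_nat (min (t + snd z) M) \<le> (of_nat (t + snd z) :: ennreal)" by (rule of_nat_mono) simp
        also have "\<dots> = ennreal (real t) + of_nat (snd z)" by (simp add: ennreal_of_nat_eq_real_of_nat)
        finally show ?thesis using Some by (simp add: nn_integral_return indicator_def case_prod_beta measure_spmf_return_spmf)
      qed
    qed
    also have "\<dots> = ennreal (real t) + mean_time trial + ennreal C * emeasure (measure_spmf trial) {(x, u). x = None}"
    proof -
      have "emeasure (measure_spmf trial) UNIV = 1" using ll by (simp add: lossless_spmf_def weight_spmf_def measure_spmf.emeasure_eq_measure space_measure_spmf)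
      then show ?thesis by (simp add: nn_integral_add nn_integral_cmult mean_time_def space_measure_spmf)
    qed
    also have "emeasure (measure_spmf trial) {(x, u). x = None} = ennreal (1 - ?s)"
      using failure_prob[OF ll] by (simp add: measure_spmf.emeasure_eq_measure)
    also have "ennreal (real t) + mean_time trial + ennreal C * ennreal (1 - ?s) \<le> ennreal (real t) + ennreal T + ennreal C * ennreal (1 - ?s)"
      using T by (intro add_mono) auto
    also have "\<dots> = ennreal (real t + T + C * (1 - ?s))"
    proof -
      have m: "ennreal C * ennreal (1 - ?s) = ennreal (C * (1 - ?s))" using C0 s1 by (intro ennreal_mult[symmetric]) auto
      have "0 \<le> C * (1 - ?s)" using C0 s1 by simp
      then show ?thesis unfolding m using T0 by (simp only: ennreal_plus of_nat_0_le_iff add_nonneg_nonneg)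
    qed
    also have "real t + T + C * (1 - ?s) = real t + T / ?s + real M * (1 - ?s) ^ Suc n"
      using s by (simp add: C_def field_simps)
    finally show ?case .
  qed
  have le: "e M t \<le> ennreal (real t + T / ?s)" for M
  proof (rule tendsto_lowerbound)
    have "(\<lambda>n. real t + T / ?s + real M * (1 - ?s) ^ n) \<longlonglongrightarrow> real t + T / ?s + real M * 0"
      using s s1 by (intro tendsto_intros LIMSEQ_power_zero) auto
    then show "(\<lambda>n. ennreal (real t + T / ?s + real M * (1 - ?s) ^ n)) \<longlonglongrightarrow> ennreal (real t + T / ?s)"
      by (intro tendsto_ennrealI) simp
  qed (use bd in auto)
  show ?thesis unfolding mean_time_def
    by (rule nn_integral_min_tendsto[OF le[unfolded e_def]]) simp
qed

section \<open>Drawing components until a given size is exceeded\<close>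

lemma total_size_simps [simp]: "total_size B [] = 0" "total_size B (xs @ ys) = total_size B xs + total_size B ys"
  "total_size B (x # xs) = osize B x + total_size B xs"
  by (simp_all add: total_size_def)

lemma fill_simps':
  "fill smp B n \<beta>s t = bind_pmf smp (\<lambda>z. if total_size B \<beta>s + osize B (fst z) \<le> n then fill smp B n (\<beta>s @ [fst z]) (t + snd z)
     else return_spmf (\<beta>s, t + snd z))"
  by (subst fill.simps) (simp add: case_prod_unfold)

text \<open>Each component takes at least one unit of the remaining space, which bounds the number
  of draws and gives termination.\<close>

lemma fill_support:
  assumes pos: "\<And>z. z \<in> set_pmf smp \<Longrightarrow> fst z \<in> objs B \<and> osize B (fst z) \<ge> 1"
    and "total_size B \<beta>s \<le> n" "set \<beta>s \<subseteq> objs B"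
  shows "lossless_spmf (fill smp B n \<beta>s t) \<and> (\<forall>z\<in>set_spmf (fill smp B n \<beta>s t). set (fst z) \<subseteq> objs B \<and> total_size B (fst z) \<le> n)"
  using assms(2,3)
proof (induction "n - total_size B \<beta>s" arbitrary: \<beta>s t rule: less_induct)
  case less
  have step: "lossless_spmf (fill smp B n (\<beta>s @ [fst z]) u) \<and> (\<forall>z'\<in>set_spmf (fill smp B n (\<beta>s @ [fst z]) u). set (fst z') \<subseteq> objs B \<and> total_size B (fst z') \<le> n)"
    if z: "z \<in> set_pmf smp" and le: "total_size B \<beta>s + osize B (fst z) \<le> n" for z u
    using pos[OF z] le less.prems by (intro less.hyps) auto
  have "lossless_spmf (fill smp B n \<beta>s t)"
    by (subst fill_simps') (use step in \<open>auto simp flip: bind_spmf_of_pmf\<close>)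
  moreover have "\<forall>z\<in>set_spmf (fill smp B n \<beta>s t). set (fst z) \<subseteq> objs B \<and> total_size B (fst z) \<le> n"
  proof
    fix r assume "r \<in> set_spmf (fill smp B n \<beta>s t)"
    then obtain z where z: "z \<in> set_pmf smp"
      "r \<in> set_spmf (if total_size B \<beta>s + osize B (fst z) \<le> n then fill smp B n (\<beta>s @ [fst z]) (t + snd z) else return_spmf (\<beta>s, t + snd z))"
      by (subst (asm) fill_simps') (auto simp: set_spmf_bind_pmf Set.bind_def)
    show "set (fst r) \<subseteq> objs B \<and> total_size B (fst r) \<le> n"
    proof (cases "total_size B \<beta>s + osize B (fst z) \<le> n")
      case True
      then show ?thesis using step[OF z(1) True, of "t + snd z"] z(2) by simp
    qed (use z(2) less.prems in simp)
  qed
  ultimately show ?case by blast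
qed

text \<open>At most one accepted draw per unit of remaining space, and one more draw that overflows:
  hence the \<open>+ 1\<close>.\<close>

lemma fill_mean_time:
  assumes pos: "\<And>z. z \<in> set_pmf smp \<Longrightarrow> osize B (fst z) \<ge> 1"
    and c: "(\<integral>\<^sup>+ z. of_nat (snd z) \<partial>measure_pmf smp) \<le> ennreal c" "c \<ge> 0"
    and "total_size B \<beta>s \<le> n"
  shows "mean_time (fill smp B n \<beta>s t) \<le> ennreal (real t + c * (real (n - total_size B \<beta>s) + 1))"
  using assms(4)
proof (induction "n - total_size B \<beta>s" arbitrary: \<beta>s t rule: less_induct)
  case less
  let ?m = "n - total_size B \<beta>s"
  have "mean_time (fill smp B n \<beta>s t) = (\<integral>\<^sup>+ z. mean_time (if total_size B \<beta>s + osize B (fst z) \<le> n then fill smp B n (\<beta>s @ [fst z]) (t + snd z)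
     else return_spmf (\<beta>s, t + snd z)) \<partial>measure_pmf smp)"
    by (subst fill_simps') (simp add: mean_time_def nn_integral_bind_spmf flip: bind_spmf_of_pmf)
  also have "\<dots> \<le> (\<integral>\<^sup>+ z. of_nat (snd z) + ennreal (real t + c * real ?m) \<partial>measure_pmf smp)"
  proof (rule nn_integral_mono_AE, unfold AE_measure_pmf_iff, intro ballI)
    fix z assume z: "z \<in> set_pmf smp"
    show "mean_time (if total_size B \<beta>s + osize B (fst z) \<le> n then fill smp B n (\<beta>s @ [fst z]) (t + snd z)
     else return_spmf (\<beta>s, t + snd z)) \<le> of_nat (snd z) + ennreal (real t + c * real ?m)"
    proof (cases "total_size B \<beta>s + osize B (fst z) \<le> n")
      case True
      have "mean_time (fill smp B n (\<beta>s @ [fst z]) (t + snd z)) \<le> ennreal (real (t + snd z) + c * (real (n - total_size B (\<beta>s @ [fst z])) + 1))"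
        using pos[OF z] True less.prems by (intro less.hyps) auto
      also have "\<dots> \<le> ennreal (real (t + snd z) + c * real ?m)"
        using pos[OF z] True c(2) by (intro ennreal_leI add_left_mono mult_left_mono) auto
      also have "\<dots> = of_nat (snd z) + ennreal (real t + c * real ?m)"
        using c(2) by (simp add: ennreal_of_nat_eq_real_of_nat add_ac flip: ennreal_plus)
      finally show ?thesis using True by simp
    next
      case False
      have "(of_nat (t + snd z) :: ennreal) \<le> of_nat (snd z) + ennreal (real t + c * real ?m)"
        using c(2) by (simp add: ennreal_of_nat_eq_real_of_nat flip: ennreal_plus)
      then show ?thesis using False by (simp add: mean_time_def nn_integral_return measure_spmf_return_spmf)
    qed
  qed
  also have "\<dots> = (\<integral>\<^sup>+ z. of_nat (snd z) \<partial>measure_pmf smp) + ennreal (real t + c * real ?m)"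
    by (simp add: nn_integral_add)
  also have "\<dots> \<le> ennreal c + ennreal (real t + c * real ?m)" using c(1) by (intro add_mono) auto
  also have "\<dots> = ennreal (real t + c * (real ?m + 1))" using c(2) by (simp add: algebra_simps flip: ennreal_plus)
  finally show ?case .
qed

text \<open>A list that fills size \<open>n\<close> exactly is returned precisely when the draws
  begin with it, since the next component has positive size and cannot fit. Running times do not
  affect the list and are projected away.\<close>

lemma spmf_fill:
  assumes pos: "\<And>\<beta>. \<beta> \<in> objs B \<Longrightarrow> osize B \<beta> \<ge> 1" and supp: "set_pmf p \<subseteq> objs B"
    and "set ys \<subseteq> objs B" "total_size B (\<beta>s @ ys) = n"
  shows "spmf (map_spmf fst (fill (timed p tB) B n \<beta>s t)) (\<beta>s @ ys) = prod_list (map (pmf p) ys)"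
  using assms(3,4)
proof (induction ys arbitrary: \<beta>s t)
  case Nil
  have sp: "fst z \<in> objs B" if "z \<in> set_pmf (timed p tB)" for z
    using that supp by (auto simp: timed_def)
  have "map_spmf fst (fill (timed p tB) B n \<beta>s t) = bind_pmf (timed p tB) (\<lambda>z. return_spmf \<beta>s)"
    unfolding fill_simps'[of _ _ _ \<beta>s t] map_bind_pmf
  proof (intro bind_pmf_cong refl)
    fix z assume "z \<in> set_pmf (timed p tB)"
    then have "\<not> total_size B \<beta>s + osize B (fst z) \<le> n" using sp pos[of "fst z"] Nil.prems by auto
    then show "map_spmf fst (if total_size B \<beta>s + osize B (fst z) \<le> n then fill (timed p tB) B n (\<beta>s @ [fst z]) (t + snd z)
      else return_spmf (\<beta>s, t + snd z)) = return_spmf \<beta>s" by simp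
  qed
  then show ?case by simp
next
  case (Cons y ys)
  let ?F = "\<lambda>z. map_spmf fst (if total_size B \<beta>s + osize B (fst z) \<le> n then fill (timed p tB) B n (\<beta>s @ [fst z]) (t + snd z)
     else return_spmf (\<beta>s, t + snd z))"
  \<comment> \<open>Accepted components are never removed, so a run with a first draw other than
    \<open>y\<close> cannot return the given list.\<close>
  have lp: "\<exists>zs. fst r = (\<beta>s @ [b]) @ zs" if "r \<in> set_spmf (fill (timed p tB) B n (\<beta>s @ [b]) u)" "total_size B (\<beta>s @ [b]) \<le> n" for r b u
  proof -
    have "\<exists>zs. fst r = xs @ zs" if "r \<in> set_spmf (fill (timed p tB) B n xs u)" "total_size B xs \<le> n" for xs u
      using that
    proof (induction "n - total_size B xs" arbitrary: xs u rule: less_induct)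
      case less
      from less.prems(1) obtain z where z: "z \<in> set_pmf (timed p tB)"
        "r \<in> set_spmf (if total_size B xs + osize B (fst z) \<le> n then fill (timed p tB) B n (xs @ [fst z]) (u + snd z) else return_spmf (xs, u + snd z))"
        by (subst (asm) fill_simps') (auto simp: set_spmf_bind_pmf Set.bind_def)
      have o1: "osize B (fst z) \<ge> 1" using z(1) supp pos by (auto simp: timed_def)
      show ?case
      proof (cases "total_size B xs + osize B (fst z) \<le> n")
        case True
        then have "r \<in> set_spmf (fill (timed p tB) B n (xs @ [fst z]) (u + snd z))" using z(2) by simp
        then have "\<exists>zs. fst r = (xs @ [fst z]) @ zs"
          using True o1 less.prems by (intro less.hyps[of "xs @ [fst z]" "u + snd z"]) auto
        then show ?thesis by auto
      qed (use z(2) in auto)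
    qed
    then show ?thesis using that by blast
  qed
  have F: "spmf (?F z) (\<beta>s @ y # ys) = indicator {y} (fst z) * prod_list (map (pmf p) ys)" for z
  proof (cases "total_size B \<beta>s + osize B (fst z) \<le> n")
    case True
    show ?thesis
    proof (cases "fst z = y")
      case True2: True
      have "spmf (map_spmf fst (fill (timed p tB) B n (\<beta>s @ [y]) (t + snd z))) ((\<beta>s @ [y]) @ ys) = prod_list (map (pmf p) ys)"
        using Cons.prems by (intro Cons.IH) auto
      then show ?thesis using True True2 by simp
    next
      case False
      have "\<beta>s @ y # ys \<notin> fst ` set_spmf (fill (timed p tB) B n (\<beta>s @ [fst z]) (t + snd z))"
        using lp[of _ "fst z" "t + snd z"] True False by fastforce
      then show ?thesis using True False by (simp add: spmf_map_outside)
    qed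
  next
    case False
    moreover have "osize B y + total_size B \<beta>s \<le> n" using Cons.prems by simp
    ultimately have "fst z \<noteq> y" by (auto simp: add.commute)
    then show ?thesis using False by simp
  qed
  have "spmf (map_spmf fst (fill (timed p tB) B n \<beta>s t)) (\<beta>s @ y # ys) = (\<integral>z. spmf (?F z) (\<beta>s @ y # ys) \<partial>measure_pmf (timed p tB))"
    by (subst fill_simps') (simp only: map_bind_pmf[of "map_option fst", symmetric] pmf_bind map_bind_pmf if_distrib)
  also have "\<dots> = (\<integral>z. indicator {y} (fst z) \<partial>measure_pmf (timed p tB)) * prod_list (map (pmf p) ys)" unfolding F by simp
  also have "(\<integral>z. indicator {y} (fst z) \<partial>measure_pmf (timed p tB)) = (\<integral>z. indicator {y} z \<partial>measure_pmf (map_pmf fst (timed p tB)) :: real)"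
    by (simp only: integral_map_pmf)
  also have "map_pmf fst (timed p tB) = p"
    by (simp add: timed_def map_bind_pmf map_pmf_comp bind_return_pmf')
  also have "(\<integral>z. indicator {y} z \<partial>measure_pmf p :: real) = pmf p y" by (simp add: pmf.rep_eq)
  finally show ?case by simp
qed

section \<open>Labeled assemblies\<close>

lemma relabel_bij_betw:
  assumes C: "is_comb_class Labeled C" and \<tau>: "\<tau> permutes {1..m}"
  shows "bij_betw (relabel C \<tau>) (objs_of_size C m) (objs_of_size C m)"
proof -
  have i: "inv \<tau> permutes {1..m}" using \<tau> by (rule permutes_inv)
  have cl: "relabel C \<sigma> x \<in> objs_of_size C m" if "\<sigma> permutes {1..m}" "x \<in> objs_of_size C m" for \<sigma> x
    using C that by (auto simp: is_comb_class_def)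
  have comp: "relabel C \<sigma> (relabel C \<sigma>' x) = x" if "\<sigma> permutes {1..m}" "\<sigma>' permutes {1..m}" "\<sigma> \<circ> \<sigma>' = id" "x \<in> objs_of_size C m" for \<sigma> \<sigma>' x
  proof -
    have "relabel C (\<sigma> \<circ> \<sigma>') x = relabel C \<sigma> (relabel C \<sigma>' x)" "relabel C id x = x"
      using C that(1,2,4) unfolding is_comb_class_def by blast+
    then show ?thesis using that(3) by simp
  qed
  show ?thesis
    by (rule bij_betw_byWitness[where f' = "relabel C (inv \<tau>)"])
       (use cl[OF \<tau>] cl[OF i] comp[OF i \<tau>] comp[OF \<tau> i] permutes_inv_o[OF \<tau>] in auto)
qed

lemma rank_in_bij_betw:
  assumes "finite U"
  shows "bij_betw (rank_in U) U {1..card U}"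
proof -
  have less: "rank_in U x < rank_in U y" if "x \<in> U" "y \<in> U" "x < y" for x y
    unfolding rank_in_def
  proof (rule psubset_card_mono)
    have "y \<in> {z \<in> U. z \<le> y}" "y \<notin> {z \<in> U. z \<le> x}" using that by auto
    moreover have "{z \<in> U. z \<le> x} \<subseteq> {z \<in> U. z \<le> y}" using that(3) by auto
    ultimately show "{z \<in> U. z \<le> x} \<subset> {z \<in> U. z \<le> y}" by blast
  qed (use assms in simp)
  have inj: "inj_on (rank_in U) U"
    by (rule inj_onI) (metis less less_irrefl linorder_less_linear)
  have "rank_in U ` U \<subseteq> {1..card U}"
  proof
    fix i assume "i \<in> rank_in U ` U"
    then obtain x where x: "x \<in> U" "i = card {y \<in> U. y \<le> x}" by (auto simp: rank_in_def)
    have "card {y \<in> U. y \<le> x} > 0" using x assms by (auto simp: card_gt_0_iff)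
    moreover have "card {y \<in> U. y \<le> x} \<le> card U" using assms by (intro card_mono) auto
    ultimately show "i \<in> {1..card U}" using x by simp
  qed
  then have "rank_in U ` U = {1..card U}" using inj by (intro card_subset_eq) (auto simp: card_image)
  then show ?thesis using inj by (simp add: bij_betw_def)
qed

lemma bij_betw_nth_pred:
  assumes "distinct xs" "length xs = k" "set xs = M"
  shows "bij_betw (\<lambda>i. xs ! (i - 1)) {1..k} M"
proof -
  have "bij_betw (\<lambda>i. i - 1) {1..k} {..<k}"
    by (rule bij_betw_byWitness[where f' = Suc]) auto
  moreover have "bij_betw ((!) xs) {..<k} M" using assms by (intro bij_betw_nth) auto
  ultimately show ?thesis using bij_betw_trans by (fastforce simp: o_def)
qed

text \<open>Three bijections in a row: the increasing listing of \<open>U\<close>, then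
  \<open>\<sigma>\<close>, then the rank within the image block.\<close>

lemma block_perm_permutes:
  assumes U: "finite U" and \<sigma>: "inj_on \<sigma> U"
  shows "block_perm \<sigma> U permutes {1..card U}"
proof (rule bij_imp_permutes)
  have "bij_betw (\<lambda>i. sorted_list_of_set U ! (i - 1)) {1..card U} U"
    using U by (intro bij_betw_nth_pred) auto
  moreover have "bij_betw \<sigma> U (\<sigma> ` U)" using \<sigma> by (simp add: bij_betw_def)
  moreover have "bij_betw (rank_in (\<sigma> ` U)) (\<sigma> ` U) {1..card U}"
    using rank_in_bij_betw[of "\<sigma> ` U"] U \<sigma> by (simp add: card_image)
  ultimately have "bij_betw (rank_in (\<sigma> ` U) \<circ> (\<sigma> \<circ> (\<lambda>i. sorted_list_of_set U ! (i - 1)))) {1..card U} {1..card U}"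
    by (intro bij_betw_trans[of _ _ "\<sigma> ` U"] bij_betw_trans[of _ _ U])
  then show "bij_betw (block_perm \<sigma> U) {1..card U} {1..card U}"
    by (rule iffD1[OF bij_betw_cong, rotated]) (simp add: block_perm_def)
qed (auto simp: block_perm_def)

lemma core_perm_permutes:
  assumes "distinct (map Min Us)"
  shows "core_perm Us permutes {1..length Us}"
proof (rule bij_imp_permutes)
  have "bij_betw (\<lambda>i. map Min Us ! (i - 1)) {1..length Us} (Min ` set Us)"
    using assms by (intro bij_betw_nth_pred) auto
  moreover have "card (Min ` set Us) = length Us" using distinct_card[OF assms] by simp
  then have "bij_betw (rank_in (Min ` set Us)) (Min ` set Us) {1..length Us}"
    using rank_in_bij_betw[of "Min ` set Us"] by simp
  ultimately have "bij_betw (rank_in (Min ` set Us) \<circ> (\<lambda>i. map Min Us ! (i - 1))) {1..length Us} {1..length Us}"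
    by (rule bij_betw_trans)
  then show "bij_betw (core_perm Us) {1..length Us} {1..length Us}"
    by (rule iffD1[OF bij_betw_cong, rotated]) (auto simp: core_perm_def)
qed (auto simp: core_perm_def)

section \<open>Counting permutations that cut an interval into given blocks\<close>

lemma length_interval_blocks [simp]: "length (interval_blocks m ls) = length ls"
  by (induction m ls rule: interval_blocks.induct) auto

lemma card_interval_blocks: "map card (interval_blocks m ls) = ls"
  by (induction m ls rule: interval_blocks.induct) auto

lemma Union_interval_blocks: "\<Union> (set (interval_blocks m ls)) = {m + 1..m + sum_list ls}"
proof (induction m ls rule: interval_blocks.induct)
  case (2 m l ls)
  have "\<Union> (set (interval_blocks m (l # ls))) = {m + 1..m + l} \<union> {m + l + 1..m + l + sum_list ls}" using 2 by simp
  also have "\<dots> = {m + 1..m + sum_list (l # ls)}" by auto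
  finally show ?case .
qed simp

lemma interval_blocks_disjoint:
  "i < length ls \<Longrightarrow> j < length ls \<Longrightarrow> i \<noteq> j \<Longrightarrow> interval_blocks m ls ! i \<inter> interval_blocks m ls ! j = {}"
proof (induction m ls arbitrary: i j rule: interval_blocks.induct)
  case (2 m l ls)
  have *: "{m + 1..m + l} \<inter> interval_blocks (m + l) ls ! i = {}" if "i < length ls" for i
  proof -
    have "interval_blocks (m + l) ls ! i \<subseteq> {m + l + 1..m + l + sum_list ls}"
      using that unfolding Union_interval_blocks[symmetric] by (intro Union_upper) simp
    then show ?thesis by fastforce
  qed
  show ?case using 2 *[of "i - 1"] *[of "j - 1"]
    by (cases i; cases j) (auto simp: Int_commute)
qed simp

lemma finite_interval_blocks: "U \<in> set (interval_blocks m ls) \<Longrightarrow> finite U"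
  by (induction m ls rule: interval_blocks.induct) auto

lemma concat_interval_blocks: "concat (map sorted_list_of_set (interval_blocks m ls)) = [m + 1..<m + sum_list ls + 1]"
proof (induction m ls rule: interval_blocks.induct)
  case (2 m l ls)
  have s: "sorted_list_of_set {Suc m..m + l} = [Suc m..<Suc (m + l)]"
    by (rule sorted_distinct_set_unique) (auto simp del: upt_Suc)
  have "concat (map sorted_list_of_set (interval_blocks m (l # ls))) = [m + 1..<m + l + 1] @ [m + l + 1..<m + l + sum_list ls + 1]"
    using 2 by (simp add: s del: upt_Suc)
  also have "\<dots> = [m + 1..<m + l + 1 + sum_list ls]"
    using upt_add_eq_append[of "m + 1" "m + l + 1" "sum_list ls"] by (simp add: ac_simps del: upt_Suc)
  finally show ?case by (simp add: ac_simps del: upt_Suc)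
qed simp

text \<open>An order of the blocks together with a linear order on each: a model of
  \<open>labeled_cuts\<close> that is counted by removing the first block.\<close>

definition block_listings :: "'x set set \<Rightarrow> 'x list list set" where
  "block_listings \<U> = {xss. map set xss \<in> permutations_of_set \<U> \<and> (\<forall>xs\<in>set xss. distinct xs)}"

lemma block_listings_card:
  assumes "finite \<U>" "\<And>U. U \<in> \<U> \<Longrightarrow> finite U"
  shows "finite (block_listings \<U>) \<and> card (block_listings \<U>) = fact (card \<U>) * (\<Prod>U\<in>\<U>. fact (card U))"
  using assms
proof (induction "card \<U>" arbitrary: \<U>)
  case 0
  then have "\<U> = {}" by simp
  then have "block_listings \<U> = {[]}" by (auto simp: block_listings_def)
  then show ?case using \<open>\<U> = {}\<close> by simp
next
  case (Suc k)
  let ?L = "\<lambda>U. (\<lambda>(xs, xss). xs # xss) ` (permutations_of_set U \<times> block_listings (\<U> - {U}))"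
  have eq: "block_listings \<U> = (\<Union>U\<in>\<U>. ?L U)"
  proof (intro set_eqI iffI)
    fix xss assume x: "xss \<in> block_listings \<U>"
    then have "xss \<noteq> []" using Suc.hyps(2) by (auto simp: block_listings_def permutations_of_set_def)
    then obtain xs yss where xss: "xss = xs # yss" by (cases xss) auto
    have "set xs \<in> \<U>" "(xs, yss) \<in> permutations_of_set (set xs) \<times> block_listings (\<U> - {set xs})"
      using x unfolding xss by (auto simp: block_listings_def permutations_of_set_def)
    then show "xss \<in> (\<Union>U\<in>\<U>. ?L U)" unfolding xss by blast
  next
    fix xss assume "xss \<in> (\<Union>U\<in>\<U>. ?L U)"
    then obtain U xs yss where U: "U \<in> \<U>" and xs: "xs \<in> permutations_of_set U" and yss: "yss \<in> block_listings (\<U> - {U})"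
      and xss: "xss = xs # yss" by auto
    have "set xs = U" "distinct xs" "set (map set yss) = \<U> - {U}" "distinct (map set yss)" "\<forall>ys\<in>set yss. distinct ys"
      using xs yss by (simp_all add: block_listings_def permutations_of_set_def)
    moreover have "insert U (\<U> - {U}) = \<U>" using U by blast
    ultimately show "xss \<in> block_listings \<U>" unfolding xss block_listings_def permutations_of_set_def by simp
  qed
  have IH: "finite (block_listings (\<U> - {U})) \<and> card (block_listings (\<U> - {U})) = fact k * (\<Prod>V\<in>\<U> - {U}. fact (card V))" if "U \<in> \<U>" for U
  proof -
    have c: "k = card (\<U> - {U})" using Suc.hyps(2) Suc.prems(1) that by simp
    show ?thesis using Suc.hyps(1)[OF c] Suc.prems unfolding c[symmetric] by blast
  qed
  have cL: "card (?L U) = fact k * (\<Prod>V\<in>\<U>. fact (card V))" if "U \<in> \<U>" for U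
  proof -
    have "card (?L U) = card (permutations_of_set U \<times> block_listings (\<U> - {U}))"
      by (rule card_image) (auto simp: inj_on_def)
    also have "\<dots> = fact (card U) * (fact k * (\<Prod>V\<in>\<U> - {U}. fact (card V)))"
      using IH[OF that] Suc.prems(2)[OF that] by (simp add: card_cartesian_product)
    also have "\<dots> = fact k * (\<Prod>V\<in>\<U>. fact (card V))"
      using prod.remove[OF Suc.prems(1) that, of "\<lambda>V. fact (card V) :: nat"] by simp
    finally show ?thesis .
  qed
  have fin: "finite (?L U)" if "U \<in> \<U>" for U using IH[OF that] by auto
  have "card (block_listings \<U>) = (\<Sum>U\<in>\<U>. card (?L U))"
    unfolding eq
  proof (rule card_UN_disjoint)
    show "\<forall>U\<in>\<U>. \<forall>V\<in>\<U>. U \<noteq> V \<longrightarrow> ?L U \<inter> ?L V = {}"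
      by (auto simp: permutations_of_set_def)
  qed (use fin Suc.prems in auto)
  also have "\<dots> = card \<U> * (fact k * (\<Prod>V\<in>\<U>. fact (card V)))" using cL by simp
  also have "\<dots> = fact (card \<U>) * (\<Prod>V\<in>\<U>. fact (card V))" using Suc.hyps(2)[symmetric] by (simp add: algebra_simps)
  finally show ?case using fin Suc.prems unfolding eq by auto
qed

text \<open>The permutations that carry consecutive intervals of lengths \<open>ls\<close> onto the
  given blocks, in some order. They parametrise the ways in which a fixed labeled object can be
  assembled.\<close>

definition labeled_cuts :: "nat \<Rightarrow> nat set set \<Rightarrow> ((nat \<Rightarrow> nat) \<times> nat list) set" where
  "labeled_cuts n \<U> = {(\<sigma>, ls). \<sigma> permutes {1..n} \<and> sum_list ls = n \<and>
     map ((`) \<sigma>) (interval_blocks 0 ls) \<in> permutations_of_set \<U>}"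

text \<open>Reading the values of \<open>\<sigma>\<close> along each interval lists the blocks and
  the elements inside them. Conversely the concatenated lists recover \<open>\<sigma>\<close> and
  their lengths recover \<open>ls\<close>.\<close>

lemma card_labeled_cuts:
  assumes fin: "finite \<U>" and un: "\<Union> \<U> = {1..n}"
    and dj: "\<And>U V. U \<in> \<U> \<Longrightarrow> V \<in> \<U> \<Longrightarrow> U \<noteq> V \<Longrightarrow> U \<inter> V = {}"
  shows "finite (labeled_cuts n \<U>) \<and> card (labeled_cuts n \<U>) = fact (card \<U>) * (\<Prod>U\<in>\<U>. fact (card U))"
proof -
  let ?P = "\<lambda>(\<sigma>, ls). map (\<lambda>U. map \<sigma> (sorted_list_of_set U)) (interval_blocks 0 ls)"
  have finU: "finite U" if "U \<in> \<U>" for U using that un by (metis Union_upper finite_atLeastAtMost finite_subset)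
  have conc: "concat (?P (\<sigma>, ls)) = map \<sigma> [1..<n + 1]" if "sum_list ls = n" for \<sigma> ls
  proof -
    have "concat (?P (\<sigma>, ls)) = map \<sigma> (concat (map sorted_list_of_set (interval_blocks 0 ls)))"
      by (simp add: map_concat o_def)
    then show ?thesis unfolding concat_interval_blocks using that by simp
  qed
  have lens: "map length (?P (\<sigma>, ls)) = ls" for \<sigma> ls
  proof -
    have "map length (?P (\<sigma>, ls)) = map card (interval_blocks 0 ls)" by (simp add: o_def)
    then show ?thesis by (simp only: card_interval_blocks)
  qed
  have sets: "map set (?P (\<sigma>, ls)) = map ((`) \<sigma>) (interval_blocks 0 ls)" for \<sigma> ls
    using finite_interval_blocks by (auto simp: o_def)
  have bij: "bij_betw ?P (labeled_cuts n \<U>) (block_listings \<U>)"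
  proof (rule bij_betw_imageI)
    show "inj_on ?P (labeled_cuts n \<U>)"
    proof (rule inj_onI)
      fix x x' assume x: "x \<in> labeled_cuts n \<U>" "x' \<in> labeled_cuts n \<U>" and eq: "?P x = ?P x'"
      obtain \<sigma> ls \<sigma>' ls' where xx: "x = (\<sigma>, ls)" "x' = (\<sigma>', ls')" by (cases x; cases x')
      have p: "\<sigma> permutes {1..n}" "sum_list ls = n" "\<sigma>' permutes {1..n}" "sum_list ls' = n"
        using x unfolding xx by (auto simp: labeled_cuts_def)
      have ls: "ls = ls'" using lens[of \<sigma> ls] lens[of \<sigma>' ls'] eq unfolding xx by metis
      have m: "map \<sigma> [1..<n + 1] = map \<sigma>' [1..<n + 1]"
        using conc[OF p(2), of \<sigma>] conc[OF p(4), of \<sigma>'] eq unfolding xx by metis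
      have "\<sigma> i = \<sigma>' i" for i
      proof (cases "i \<in> {1..n}")
        case True
        then show ?thesis using m by (auto simp del: upt_Suc)
      next
        case False
        then show ?thesis using p by (simp add: permutes_def)
      qed
      then show "x = x'" using ls xx by auto
    qed
    show "?P ` labeled_cuts n \<U> = block_listings \<U>"
    proof (intro set_eqI iffI)
      fix xss assume "xss \<in> ?P ` labeled_cuts n \<U>"
      then obtain \<sigma> ls where c: "(\<sigma>, ls) \<in> labeled_cuts n \<U>" "xss = ?P (\<sigma>, ls)" by auto
      have "map set xss \<in> permutations_of_set \<U>" unfolding c(2) sets using c(1) by (simp add: labeled_cuts_def)
      moreover have "distinct xs" if "xs \<in> set xss" for xs
        using that c permutes_inj_on[of \<sigma> "{1..n}"] by (auto simp: labeled_cuts_def distinct_map)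
      ultimately show "xss \<in> block_listings \<U>" by (simp add: block_listings_def)
    next
      fix xss assume "xss \<in> block_listings \<U>"
      then have xss: "set (map set xss) = \<U>" "distinct (map set xss)" "\<And>xs. xs \<in> set xss \<Longrightarrow> distinct xs"
        by (auto simp: block_listings_def permutations_of_set_def)
      define xs where "xs = concat xss"
      define \<sigma> where "\<sigma> = (\<lambda>i. if i \<in> {1..n} then xs ! (i - 1) else i)"
      have setxs: "set xs = {1..n}" unfolding un[symmetric] xss(1)[symmetric] xs_def by simp
      have "sum_list (map card (map set xss)) = card (\<Union> \<U>)"
      proof -
        have "sum_list (map card (map set xss)) = sum card (set (map set xss))"
          by (rule sum_list_distinct_conv_sum_set[OF xss(2)])
        also have "\<dots> = card (\<Union> \<U>)" unfolding xss(1)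
          by (rule card_Union_disjoint[symmetric]) (use dj finU in \<open>auto simp: pairwise_def disjnt_def\<close>)
        finally show ?thesis .
      qed
      moreover have "map card (map set xss) = map length xss" using xss(3) by (auto simp: distinct_card)
      moreover have "card {1..n} = n" by simp
      ultimately have sl: "sum_list (map length xss) = n" by (simp only: un)
      then have lxs: "length xs = n" by (simp add: xs_def length_concat)
      then have dxs: "distinct xs" using setxs by (intro card_distinct) simp
      have "\<sigma> permutes {1..n}"
      proof (rule bij_imp_permutes)
        have "bij_betw (\<lambda>i. xs ! (i - 1)) {1..n} {1..n}" using dxs lxs setxs by (rule bij_betw_nth_pred)
        then show "bij_betw \<sigma> {1..n} {1..n}"
          by (rule iffD1[OF bij_betw_cong, rotated]) (simp add: \<sigma>_def)
      qed (auto simp: \<sigma>_def)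
      moreover have P: "?P (\<sigma>, map length xss) = xss"
      proof (rule concat_injective)
        have "map \<sigma> [1..<n + 1] = xs"
          by (rule nth_equalityI) (use lxs in \<open>auto simp: \<sigma>_def simp del: upt_Suc\<close>)
        then show "concat (?P (\<sigma>, map length xss)) = concat xss" by (simp only: conc[OF sl] xs_def)
        show "length (?P (\<sigma>, map length xss)) = length xss" by simp
        show "\<forall>(x, y)\<in>set (zip (?P (\<sigma>, map length xss)) xss). length x = length y"
        proof -
          have "length x = length y" if "(x, y) \<in> set (zip (?P (\<sigma>, map length xss)) xss)" for x y
          proof -
            from that obtain i where i: "i < length xss" "x = ?P (\<sigma>, map length xss) ! i" "y = xss ! i"
              by (auto simp: set_zip)
            have "map length (?P (\<sigma>, map length xss)) ! i = map length xss ! i" by (simp only: lens)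
            then show "length x = length y" using i by simp
          qed
          then show ?thesis by blast
        qed
      qed
      moreover have "map ((`) \<sigma>) (interval_blocks 0 (map length xss)) \<in> permutations_of_set \<U>"
        unfolding sets[symmetric] P using xss(1,2) by (simp add: permutations_of_set_def)
      ultimately have "(\<sigma>, map length xss) \<in> labeled_cuts n \<U>" using sl by (simp add: labeled_cuts_def)
      then show "xss \<in> ?P ` labeled_cuts n \<U>" by (rule rev_image_eqI) (rule P[symmetric])
    qed
  qed
  show ?thesis using block_listings_card[OF fin finU] bij_betw_finite[OF bij] bij_betw_same_card[OF bij] by simp
qed

text \<open>Makes the sorting of blocks by minimum unambiguous.\<close>

lemma distinct_map_Min:
  assumes "\<And>i. i < length Vs \<Longrightarrow> finite (Vs ! i) \<and> Vs ! i \<noteq> {}"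
    and "\<And>i j. i < length Vs \<Longrightarrow> j < length Vs \<Longrightarrow> i \<noteq> j \<Longrightarrow> Vs ! i \<inter> Vs ! j = {}"
  shows "distinct (map Min Vs)"
  unfolding distinct_conv_nth
proof (intro allI impI)
  fix i j assume ij: "i < length (map Min Vs)" "j < length (map Min Vs)" "i \<noteq> j"
  then have "Min (Vs ! i) \<in> Vs ! i" "Min (Vs ! j) \<in> Vs ! j" using assms(1) by auto
  then show "map Min Vs ! i \<noteq> map Min Vs ! j" using assms(2)[of i j] ij by auto
qed

section \<open>Labeled assembly by a random permutation of the labels\<close>

locale labeled_classes =
  fixes A :: "'a comb_class" and B :: "'b comb_class"
  assumes A: "is_comb_class Labeled A" and B: "is_comb_class Labeled B" and B_0: "objs_of_size B 0 = {}"
begin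

definition blocks :: "'b list \<Rightarrow> nat set list" where
  "blocks ys = interval_blocks 0 (map (osize B) ys)"

definition assembled :: "(nat \<Rightarrow> nat) \<Rightarrow> 'a \<Rightarrow> 'b list \<Rightarrow> ('a, 'b) composite" where
  "assembled \<sigma> \<alpha> ys = composite_relabel A B \<sigma> (\<alpha>, ys, blocks ys)"

definition moved :: "(nat \<Rightarrow> nat) \<Rightarrow> 'b list \<Rightarrow> nat set list" where
  "moved \<sigma> ys = map ((`) \<sigma>) (blocks ys)"

definition relabeled :: "(nat \<Rightarrow> nat) \<Rightarrow> 'b list \<Rightarrow> 'b list" where
  "relabeled \<sigma> ys = map2 (\<lambda>U. relabel B (block_perm \<sigma> U)) (blocks ys) ys"

abbreviation key :: "'b \<times> nat set \<Rightarrow> nat" where "key \<equiv> \<lambda>(\<beta>, V). Min V"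

lemma assembled_eq:
  "assembled \<sigma> \<alpha> ys = (let ps = sort_key key (zip (relabeled \<sigma> ys) (moved \<sigma> ys))
     in (relabel A (core_perm (moved \<sigma> ys)) \<alpha>, map fst ps, map snd ps))"
  by (simp add: assembled_def composite_relabel_def relabeled_def moved_def Let_def)

lemma osize_pos: "\<beta> \<in> objs B \<Longrightarrow> osize B \<beta> \<ge> 1"
  using B_0 by (cases "osize B \<beta>") (auto simp: objs_of_size_def)

context
  fixes \<sigma> n ys
  assumes \<sigma>: "\<sigma> permutes {1..n}" and ys: "set ys \<subseteq> objs B" and n: "total_size B ys = n"
begin

lemma lengths: "length (blocks ys) = length ys" "length (moved \<sigma> ys) = length ys" "length (relabeled \<sigma> ys) = length ys"
  by (simp_all add: blocks_def moved_def relabeled_def)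

lemma block_nth:
  assumes "i < length ys"
  shows "finite (blocks ys ! i)" "card (blocks ys ! i) = osize B (ys ! i)" "inj_on \<sigma> X"
    "moved \<sigma> ys ! i = \<sigma> ` (blocks ys ! i)" "finite (moved \<sigma> ys ! i)" "card (moved \<sigma> ys ! i) = osize B (ys ! i)" "moved \<sigma> ys ! i \<noteq> {}"
    "ys ! i \<in> objs_of_size B (osize B (ys ! i))"
proof -
  show f: "finite (blocks ys ! i)" using assms finite_interval_blocks lengths(1) nth_mem unfolding blocks_def by metis
  have "map card (blocks ys) ! i = map (osize B) ys ! i" unfolding blocks_def by (simp only: card_interval_blocks)
  then show c: "card (blocks ys ! i) = osize B (ys ! i)" using assms lengths(1) by simp
  show "inj_on \<sigma> X" for X using \<sigma> by (rule permutes_inj_on)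
  show m: "moved \<sigma> ys ! i = \<sigma> ` (blocks ys ! i)" using assms lengths(1) by (simp add: moved_def)
  show "finite (moved \<sigma> ys ! i)" unfolding m using f by simp
  show cm: "card (moved \<sigma> ys ! i) = osize B (ys ! i)" unfolding m using \<sigma> c by (simp add: card_image permutes_inj_on)
  have y: "ys ! i \<in> objs B" using ys assms nth_mem by blast
  then show "ys ! i \<in> objs_of_size B (osize B (ys ! i))" by (simp add: objs_of_size_def)
  have "osize B (ys ! i) \<noteq> 0" using osize_pos[OF y] by simp
  then show "moved \<sigma> ys ! i \<noteq> {}" unfolding cm[symmetric] by auto
qed

lemma moved_disjoint:
  assumes "i < length ys" "j < length ys" "i \<noteq> j"
  shows "moved \<sigma> ys ! i \<inter> moved \<sigma> ys ! j = {}"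
proof -
  have "blocks ys ! i \<inter> blocks ys ! j = {}" using assms unfolding blocks_def by (intro interval_blocks_disjoint) auto
  then show ?thesis using assms block_nth(4) permutes_inj[OF \<sigma>] by (simp add: image_Int[symmetric])
qed

lemma distinct_Min_moved: "distinct (map Min (moved \<sigma> ys))"
  using block_nth moved_disjoint lengths by (intro distinct_map_Min) auto

lemma distinct_moved: "distinct (moved \<sigma> ys)"
  using distinct_Min_moved by (simp add: distinct_map)

lemma Union_moved: "\<Union> (set (moved \<sigma> ys)) = {1..n}"
proof -
  have "\<Union> (set (moved \<sigma> ys)) = \<sigma> ` \<Union> (set (blocks ys))" by (auto simp: moved_def)
  also have "\<Union> (set (blocks ys)) = {1..n}" unfolding blocks_def Union_interval_blocks using n by (simp add: total_size_def)
  finally show ?thesis using permutes_image[OF \<sigma>] by simp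
qed

lemma block_perm_moves:
  assumes "i < length ys"
  shows "bij_betw (relabel B (block_perm \<sigma> (blocks ys ! i))) (objs_of_size B (osize B (ys ! i))) (objs_of_size B (osize B (ys ! i)))"
  using relabel_bij_betw[OF B block_perm_permutes] block_nth[OF assms] by metis

lemma relabeled_nth:
  assumes "i < length ys"
  shows "relabeled \<sigma> ys ! i = relabel B (block_perm \<sigma> (blocks ys ! i)) (ys ! i)" "relabeled \<sigma> ys ! i \<in> objs_of_size B (osize B (ys ! i))"
proof -
  show e: "relabeled \<sigma> ys ! i = relabel B (block_perm \<sigma> (blocks ys ! i)) (ys ! i)"
    using assms lengths(1) by (simp add: relabeled_def)
  show "relabeled \<sigma> ys ! i \<in> objs_of_size B (osize B (ys ! i))"
    unfolding e using block_perm_moves[OF assms] block_nth(8)[OF assms] by (rule bij_betw_apply)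
qed

lemma core_perm_moves:
  "bij_betw (relabel A (core_perm (moved \<sigma> ys))) (objs_of_size A (length ys)) (objs_of_size A (length ys))"
  using relabel_bij_betw[OF A core_perm_permutes[OF distinct_Min_moved]] lengths by simp

lemma inj_on_key: "inj_on key (set (zip (relabeled \<sigma> ys) (moved \<sigma> ys)))"
proof -
  have "map key (zip (relabeled \<sigma> ys) (moved \<sigma> ys)) = map Min (moved \<sigma> ys)"
    by (rule nth_equalityI) (simp_all add: lengths)
  then have "distinct (map key (zip (relabeled \<sigma> ys) (moved \<sigma> ys)))" using distinct_Min_moved by simp
  then show ?thesis by (simp only: distinct_map)
qed

text \<open>Objects and blocks are moved in pairs, so sizes still match after sorting; the sorting
  restores the canonical order of blocks, while the total size and the union of the blocks do not
  depend on the order.\<close>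

lemma assembled_in_composition:
  assumes \<alpha>: "\<alpha> \<in> objs_of_size A (length ys)"
  shows "assembled \<sigma> \<alpha> ys \<in> objs_of_size (composition Labeled A B) n \<and> core_size (assembled \<sigma> \<alpha> ys) = length ys"
proof -
  let ?zs = "zip (relabeled \<sigma> ys) (moved \<sigma> ys)"
  define ps where "ps = sort_key key ?zs"
  have ms: "mset ps = mset ?zs" by (simp add: ps_def)
  have len: "length ps = length ys" using mset_eq_length[OF ms] lengths by simp
  have mem: "\<exists>j<length ys. ps ! i = (relabeled \<sigma> ys ! j, moved \<sigma> ys ! j)" if "i < length ys" for i
  proof -
    have "ps ! i \<in> set ?zs" using that len mset_eq_setD[OF ms] nth_mem by metis
    then show ?thesis using lengths by (auto simp: set_zip)
  qed
  have a: "relabel A (core_perm (moved \<sigma> ys)) \<alpha> \<in> objs_of_size A (length ys)"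
    using core_perm_moves \<alpha> by (rule bij_betw_apply)
  have dk: "distinct (map key ps)"
  proof -
    have "distinct ?zs" using distinct_moved lengths by (simp add: distinct_zipI2)
    then have "distinct ps" using mset_eq_imp_distinct_iff[OF ms] by simp
    then show ?thesis using inj_on_key mset_eq_setD[OF ms] by (simp add: distinct_map)
  qed
  have sk: "sorted (map key ps)" by (simp add: ps_def)
  have o: "fst (ps ! i) \<in> objs B \<and> finite (snd (ps ! i)) \<and> card (snd (ps ! i)) = osize B (fst (ps ! i))" if "i < length ys" for i
    using mem[OF that] relabeled_nth(2) block_nth(5,6) by (auto simp: objs_of_size_def)
  have lt: "snd (ps ! i) \<inter> snd (ps ! j) = {} \<and> Min (snd (ps ! i)) < Min (snd (ps ! j))" if "i < j" "j < length ys" for i j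
  proof -
    have "map key ps ! i \<le> map key ps ! j" using sk that len by (intro sorted_nth_mono) auto
    moreover have "map key ps ! i \<noteq> map key ps ! j" using dk that len by (simp add: distinct_conv_nth)
    ultimately have l: "Min (snd (ps ! i)) < Min (snd (ps ! j))" using that len by (simp add: case_prod_unfold)
    have il: "i < length ys" using that by simp
    obtain i' j' where ij: "i' < length ys" "ps ! i = (relabeled \<sigma> ys ! i', moved \<sigma> ys ! i')"
        "j' < length ys" "ps ! j = (relabeled \<sigma> ys ! j', moved \<sigma> ys ! j')"
      using mem[OF il] mem[OF \<open>j < length ys\<close>] by blast
    then have "i' \<noteq> j'" using l by auto
    then show ?thesis using moved_disjoint ij l by simp
  qed
  have "set (map snd ps) = snd ` set ?zs" using mset_eq_setD[OF ms] by simp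
  also have "snd ` set ?zs = set (map snd ?zs)" by simp
  also have "map snd ?zs = moved \<sigma> ys" using lengths by simp
  finally have un: "\<Union> (set (map snd ps)) = {1..n}" using Union_moved by simp
  have "total_size B (map fst ps) = sum_mset (image_mset (\<lambda>z. osize B (fst z)) (mset ps))"
    by (simp add: total_size_def o_def flip: sum_mset_sum_list)
  also have "\<dots> = sum_list (map (\<lambda>z. osize B (fst z)) ?zs)"
    unfolding ms by (simp only: mset_map[symmetric] sum_mset_sum_list)
  also have "map (\<lambda>z. osize B (fst z)) ?zs = map (osize B) ys"
    by (rule nth_equalityI) (use relabeled_nth(2) lengths in \<open>auto simp: objs_of_size_def\<close>)
  finally have ts: "total_size B (map fst ps) = n" using n by (simp add: total_size_def)
  have asm: "assembled \<sigma> \<alpha> ys = (relabel A (core_perm (moved \<sigma> ys)) \<alpha>, map fst ps, map snd ps)"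
    by (simp add: assembled_eq ps_def Let_def)
  have "set (map fst ps) \<subseteq> objs B"
  proof
    fix b assume "b \<in> set (map fst ps)"
    then obtain i where "i < length ps" "b = map fst ps ! i" unfolding in_set_conv_nth by auto
    then show "b \<in> objs B" using o len by simp
  qed
  then have "assembled \<sigma> \<alpha> ys \<in> labeled_composites A B"
    unfolding asm labeled_composites_def using a o lt un ts len by (auto simp: objs_of_size_def)
  then show ?thesis using ts len by (simp add: objs_of_size_def composition_def asm core_size_def)
qed

end

text \<open>The fibre over \<open>\<gamma>\<close> of the assembly map; the probability of producing
  \<open>\<gamma>\<close> is a sum over it.\<close>

definition assemblies :: "nat \<Rightarrow> ('a, 'b) composite \<Rightarrow> ('b list \<times> 'a \<times> (nat \<Rightarrow> nat)) set" where
  "assemblies n \<gamma> = {(ys, \<alpha>, \<sigma>). set ys \<subseteq> objs B \<and> total_size B ys = n \<and> \<alpha> \<in> objs_of_size A (length ys) \<and>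
     \<sigma> permutes {1..n} \<and> assembled \<sigma> \<alpha> ys = \<gamma>}"

text \<open>The permutation and the sizes determine the rest: they fix the block onto which each
  interval goes, hence the object of \<open>\<gamma>\<close> that must come from it, and the
  relabelings of block objects and of the core are invertible. For the same reason every cut into
  the blocks of \<open>\<gamma>\<close> lifts.\<close>

lemma assemblies_cuts:
  assumes \<gamma>: "(\<alpha>0, \<beta>s0, Us0) \<in> objs_of_size (composition Labeled A B) n"
  shows "bij_betw (\<lambda>(ys, \<alpha>, \<sigma>). (\<sigma>, map (osize B) ys)) (assemblies n (\<alpha>0, \<beta>s0, Us0)) (labeled_cuts n (set Us0))"
proof -
  have g: "\<alpha>0 \<in> objs A" "set \<beta>s0 \<subseteq> objs B" "length \<beta>s0 = osize A \<alpha>0" "length Us0 = osize A \<alpha>0"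
    "\<And>i. i < length Us0 \<Longrightarrow> finite (Us0 ! i) \<and> card (Us0 ! i) = osize B (\<beta>s0 ! i)"
    "\<And>i j. j < length Us0 \<Longrightarrow> i < j \<Longrightarrow> Us0 ! i \<inter> Us0 ! j = {} \<and> Min (Us0 ! i) < Min (Us0 ! j)"
    "\<Union> (set Us0) = {1..n}" "total_size B \<beta>s0 = n"
    using \<gamma> by (auto simp: objs_of_size_def composition_def labeled_composites_def)
  have srt: "sorted (map Min Us0)" and dm: "distinct (map Min Us0)"
  proof -
    show "sorted (map Min Us0)" unfolding sorted_iff_nth_mono_less using g(6) by (auto intro: less_imp_le)
    show "distinct (map Min Us0)" unfolding distinct_conv_nth
    proof (intro allI impI)
      fix i j assume "i < length (map Min Us0)" "j < length (map Min Us0)" "i \<noteq> j"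
      then show "map Min Us0 ! i \<noteq> map Min Us0 ! j" using g(6)[of i j] g(6)[of j i] by (cases "i < j") auto
    qed
  qed
  have dU: "distinct Us0" using dm by (simp add: distinct_map)
  have zz: "zip \<beta>s0 Us0 = ps" if "map fst ps = \<beta>s0" "map snd ps = Us0" for ps
    using that zip_map_fst_snd by metis
  have cut: "length ys = length Us0 \<and> (\<sigma>, map (osize B) ys) \<in> labeled_cuts n (set Us0) \<and>
      mset (zip (relabeled \<sigma> ys) (moved \<sigma> ys)) = mset (zip \<beta>s0 Us0) \<and> relabel A (core_perm (moved \<sigma> ys)) \<alpha> = \<alpha>0"
    if "(ys, \<alpha>, \<sigma>) \<in> assemblies n (\<alpha>0, \<beta>s0, Us0)" for ys \<alpha> \<sigma>
  proof -
    have y: "set ys \<subseteq> objs B" "total_size B ys = n" "\<sigma> permutes {1..n}" and e: "assembled \<sigma> \<alpha> ys = (\<alpha>0, \<beta>s0, Us0)"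
      using that by (auto simp: assemblies_def)
    define ps where "ps = sort_key key (zip (relabeled \<sigma> ys) (moved \<sigma> ys))"
    have ps: "relabel A (core_perm (moved \<sigma> ys)) \<alpha> = \<alpha>0" "map fst ps = \<beta>s0" "map snd ps = Us0"
      using e by (auto simp: assembled_eq ps_def Let_def)
    have ms: "mset ps = mset (zip (relabeled \<sigma> ys) (moved \<sigma> ys))" by (simp add: ps_def)
    have L: "length (relabeled \<sigma> ys) = length ys" "length (moved \<sigma> ys) = length ys" using lengths[OF y(3,1,2)] by auto
    have "mset Us0 = image_mset snd (mset ps)" using ps(3) by (simp flip: mset_map)
    also have "\<dots> = mset (map snd (zip (relabeled \<sigma> ys) (moved \<sigma> ys)))" unfolding ms by simp
    finally have mV: "mset Us0 = mset (moved \<sigma> ys)" using L by simp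
    have "moved \<sigma> ys \<in> permutations_of_set (set Us0)"
      using distinct_moved[OF y(3,1,2)] mset_eq_setD[OF mV] by (simp add: permutations_of_set_def)
    moreover have "sum_list (map (osize B) ys) = n" using y(2) by (simp add: total_size_def)
    ultimately show ?thesis using ps zz[OF ps(2,3)] ms y(3) mset_eq_length[OF mV] L
      by (simp add: labeled_cuts_def moved_def blocks_def)
  qed
  show ?thesis
  proof (rule bij_betw_imageI)
    show "inj_on (\<lambda>(ys, \<alpha>, \<sigma>). (\<sigma>, map (osize B) ys)) (assemblies n (\<alpha>0, \<beta>s0, Us0))"
    proof (rule inj_onI, clarsimp simp only: prod.inject)
      fix ys \<alpha> \<sigma> ys' \<alpha>'
      assume t: "(ys, \<alpha>, \<sigma>) \<in> assemblies n (\<alpha>0, \<beta>s0, Us0)" "(ys', \<alpha>', \<sigma>) \<in> assemblies n (\<alpha>0, \<beta>s0, Us0)"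
        and eq: "map (osize B) ys = map (osize B) ys'"
      have y: "set ys \<subseteq> objs B" "total_size B ys = n" "\<sigma> permutes {1..n}" "\<alpha> \<in> objs_of_size A (length ys)"
        and y': "set ys' \<subseteq> objs B" "total_size B ys' = n" "\<alpha>' \<in> objs_of_size A (length ys')"
        using t by (auto simp: assemblies_def)
      have len: "length ys' = length ys" using map_eq_imp_length_eq[OF eq] by simp
      have bl: "blocks ys' = blocks ys" unfolding blocks_def eq ..
      then have mv: "moved \<sigma> ys' = moved \<sigma> ys" by (simp add: moved_def)
      note L = lengths[OF y(3,1,2)] and L' = lengths[OF y(3) y'(1,2)]
      have "relabel A (core_perm (moved \<sigma> ys)) \<alpha> = relabel A (core_perm (moved \<sigma> ys)) \<alpha>'"
        using cut[OF t(1)] cut[OF t(2)] mv by simp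
      then have a: "\<alpha> = \<alpha>'" using bij_betw_imp_inj_on[OF core_perm_moves[OF y(3,1,2)]] y(4) y'(3) len by (auto dest: inj_onD)
      have "ys ! i = ys' ! i" if i: "i < length ys" for i
      proof -
        have "set (zip (relabeled \<sigma> ys) (moved \<sigma> ys)) = set (zip (relabeled \<sigma> ys') (moved \<sigma> ys))"
          using cut[OF t(1)] cut[OF t(2)] mv by (intro mset_eq_setD) simp
        \<comment> \<open>Equal multisets of pairs allow a match at another position
          \<open>j\<close> only; distinctness of the blocks forces \<open>j = i\<close>.\<close>
        moreover have "(relabeled \<sigma> ys ! i, moved \<sigma> ys ! i) \<in> set (zip (relabeled \<sigma> ys) (moved \<sigma> ys))"
          using i L by (auto simp: set_zip)
        ultimately obtain j where j: "j < length ys" "relabeled \<sigma> ys ! i = relabeled \<sigma> ys' ! j" "moved \<sigma> ys ! i = moved \<sigma> ys ! j"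
          using L L' len by (auto simp: set_zip)
        have "i = j" using distinct_moved[OF y(3,1,2)] j i L by (simp add: distinct_conv_nth) metis
        then have r: "relabel B (block_perm \<sigma> (blocks ys ! i)) (ys ! i) = relabel B (block_perm \<sigma> (blocks ys ! i)) (ys' ! i)"
          using j(2) relabeled_nth(1)[OF y(3,1,2) i] relabeled_nth(1)[OF y(3) y'(1,2), of i] i len bl by simp
        have "map (osize B) ys ! i = map (osize B) ys' ! i" by (simp only: eq)
        then have o: "osize B (ys' ! i) = osize B (ys ! i)" using i len by simp
        have "ys' ! i \<in> objs_of_size B (osize B (ys ! i))" using block_nth(8)[OF y(3) y'(1,2), of i] i unfolding len o by simp
        with block_nth(8)[OF y(3,1,2) i] show ?thesis
          by (rule inj_onD[OF bij_betw_imp_inj_on[OF block_perm_moves[OF y(3,1,2) i]] r])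
      qed
      then have "ys = ys'" using len by (intro nth_equalityI) auto
      then show "ys = ys' \<and> \<alpha> = \<alpha>' \<and> \<sigma> = \<sigma>" using a by simp
    qed
    show "(\<lambda>(ys, \<alpha>, \<sigma>). (\<sigma>, map (osize B) ys)) ` assemblies n (\<alpha>0, \<beta>s0, Us0) = labeled_cuts n (set Us0)"
    proof (intro set_eqI iffI)
      fix z assume "z \<in> (\<lambda>(ys, \<alpha>, \<sigma>). (\<sigma>, map (osize B) ys)) ` assemblies n (\<alpha>0, \<beta>s0, Us0)"
      then show "z \<in> labeled_cuts n (set Us0)" using cut by auto
    next
      fix z assume "z \<in> labeled_cuts n (set Us0)"
      then obtain \<sigma> ls where z: "z = (\<sigma>, ls)" and \<sigma>: "\<sigma> permutes {1..n}" and ls: "sum_list ls = n"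
        and V: "set (map ((`) \<sigma>) (interval_blocks 0 ls)) = set Us0" "distinct (map ((`) \<sigma>) (interval_blocks 0 ls))"
        by (auto simp: labeled_cuts_def permutations_of_set_def)
      let ?I = "interval_blocks 0 ls" and ?V = "map ((`) \<sigma>) (interval_blocks 0 ls)"
      have mV: "mset ?V = mset Us0" using V dU by (simp only: set_eq_iff_mset_eq_distinct[symmetric])
      have len: "length ls = length Us0" using mset_eq_length[OF mV] by simp
      \<comment> \<open>The blocks are distinct, so the object on a block is a function of the
        block; the multiset of pairs can then be computed from the multiset of blocks.\<close>
      have "\<exists>\<phi>. \<forall>j<length Us0. \<phi> (Us0 ! j) = \<beta>s0 ! j"
      proof (intro exI allI impI)
        fix j assume j: "j < length Us0"
        then have "(THE i. i < length Us0 \<and> Us0 ! i = Us0 ! j) = j"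
          using dU by (intro the_equality) (auto simp: distinct_conv_nth)
        then show "\<beta>s0 ! (THE i. i < length Us0 \<and> Us0 ! i = Us0 ! j) = \<beta>s0 ! j" by simp
      qed
      then obtain \<phi> where \<phi>: "\<And>j. j < length Us0 \<Longrightarrow> \<phi> (Us0 ! j) = \<beta>s0 ! j" by blast
      have cI: "card (?I ! i) = ls ! i" "finite (?I ! i)" if "i < length ls" for i
      proof -
        have "map card ?I ! i = ls ! i" by (simp only: card_interval_blocks)
        then show "card (?I ! i) = ls ! i" using that by simp
        show "finite (?I ! i)" using that finite_interval_blocks[of "?I ! i" 0 ls] by simp
      qed
      have ex: "\<exists>\<beta>\<in>objs_of_size B (ls ! i). relabel B (block_perm \<sigma> (?I ! i)) \<beta> = \<phi> (?V ! i)" if i: "i < length ls" for i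
      proof -
        have "?V ! i \<in> set ?V" using i by (intro nth_mem) simp
        then have "?V ! i \<in> set Us0" unfolding V(1) .
        then obtain j where j: "j < length Us0" "?V ! i = Us0 ! j" by (metis in_set_conv_nth)
        have "card (?V ! i) = ls ! i" using i cI[OF i] permutes_inj_on[OF \<sigma>] by (simp add: card_image)
        then have "osize B (\<beta>s0 ! j) = ls ! i" using g(5)[OF j(1)] j(2) by simp
        then have "\<phi> (?V ! i) \<in> objs_of_size B (ls ! i)" using \<phi>[OF j(1)] j g(2,3,4) nth_mem[of j \<beta>s0] by (auto simp: objs_of_size_def)
        moreover have "bij_betw (relabel B (block_perm \<sigma> (?I ! i))) (objs_of_size B (ls ! i)) (objs_of_size B (ls ! i))"
          using relabel_bij_betw[OF B block_perm_permutes[OF cI(2)[OF i] permutes_inj_on[OF \<sigma>]]] cI(1)[OF i] by simp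
        ultimately show ?thesis unfolding bij_betw_def by (metis imageE)
      qed
      \<comment> \<open>The object to be drawn for the \<open>i\<close>th interval: the preimage,
        under relabeling, of what \<open>\<gamma>\<close> carries on the image of that
        interval.\<close>
      define Y where "Y i = (SOME \<beta>. \<beta> \<in> objs_of_size B (ls ! i) \<and> relabel B (block_perm \<sigma> (?I ! i)) \<beta> = \<phi> (?V ! i))" for i
      have Y: "Y i \<in> objs_of_size B (ls ! i) \<and> relabel B (block_perm \<sigma> (?I ! i)) (Y i) = \<phi> (?V ! i)" if "i < length ls" for i
        unfolding Y_def by (rule someI_ex) (use ex[OF that] in blast)
      define ys where "ys = map Y [0..<length ls]"
      have ol: "map (osize B) ys = ls"
        by (rule nth_equalityI) (use Y in \<open>auto simp: ys_def objs_of_size_def\<close>)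
      have y: "set ys \<subseteq> objs B" "total_size B ys = n"
        using Y ls ol by (auto simp: ys_def objs_of_size_def total_size_def)
      have ly: "length ys = length Us0" using len by (simp add: ys_def)
      have bl: "blocks ys = ?I" and mv: "moved \<sigma> ys = ?V" by (simp_all add: blocks_def moved_def ol)
      have rl: "relabeled \<sigma> ys = map \<phi> ?V"
        by (rule nth_equalityI) (use Y ly len in \<open>simp_all add: relabeled_def bl\<close>, simp add: ys_def)
      have "\<alpha>0 \<in> objs_of_size A (length ys)" using g(1,4) ly by (simp add: objs_of_size_def)
      then obtain \<alpha> where \<alpha>: "\<alpha> \<in> objs_of_size A (length ys)" "relabel A (core_perm (moved \<sigma> ys)) \<alpha> = \<alpha>0"
        using core_perm_moves[OF \<sigma> y] unfolding bij_betw_def by (metis imageE)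
      have "zip (map \<phi> ?V) ?V = map (\<lambda>V. (\<phi> V, V)) ?V" by (rule nth_equalityI) auto
      then have "mset (zip (relabeled \<sigma> ys) (moved \<sigma> ys)) = image_mset (\<lambda>V. (\<phi> V, V)) (mset ?V)"
        unfolding rl mv by (simp only: mset_map)
      also have "\<dots> = mset (map (\<lambda>V. (\<phi> V, V)) Us0)" unfolding mV by simp
      also have "map (\<lambda>V. (\<phi> V, V)) Us0 = zip \<beta>s0 Us0"
        by (rule nth_equalityI) (use g(3,4) \<phi> in auto)
      finally have ms: "mset (zip (relabeled \<sigma> ys) (moved \<sigma> ys)) = mset (zip \<beta>s0 Us0)" .
      have "map key (zip \<beta>s0 Us0) = map Min Us0" by (rule nth_equalityI) (use g(3,4) in auto)
      \<comment> \<open>Distinct keys make the sorted list a function of the multiset of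
        pairs.\<close>
      then have "sort_key key (zip (relabeled \<sigma> ys) (moved \<sigma> ys)) = zip \<beta>s0 Us0"
        using srt by (intro sort_key_inj_key_eq[OF ms inj_on_key[OF \<sigma> y]]) simp
      then have "assembled \<sigma> \<alpha> ys = (\<alpha>0, \<beta>s0, Us0)" using \<alpha>(2) g(3,4) by (simp add: assembled_eq Let_def)
      then have "(ys, \<alpha>, \<sigma>) \<in> assemblies n (\<alpha>0, \<beta>s0, Us0)" using y \<alpha>(1) \<sigma> by (simp add: assemblies_def)
      then show "z \<in> (\<lambda>(ys, \<alpha>, \<sigma>). (\<sigma>, map (osize B) ys)) ` assemblies n (\<alpha>0, \<beta>s0, Us0)"
        unfolding z by (intro image_eqI[of _ _ "(ys, \<alpha>, \<sigma>)"]) (simp_all add: ol)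
    qed
  qed
qed

text \<open>By the bijection with cuts, there are \<open>k!\<close> times \<open>F\<close>
  assemblies, with \<open>F\<close> the product of the factorials of the block sizes. The component
  sizes of any assembly are these block sizes in some order, so the labeled Boltzmann factors
  contribute \<open>1 / F\<close> each time and \<open>F\<close> cancels.\<close>

lemma assemblies_count:
  assumes \<gamma>: "\<gamma> \<in> objs_of_size (composition Labeled A B) n"
  obtains F :: nat where "finite (assemblies n \<gamma>)" "card (assemblies n \<gamma>) = fact (core_size \<gamma>) * F" "F > 0"
    "\<And>ys \<alpha> \<sigma>. (ys, \<alpha>, \<sigma>) \<in> assemblies n \<gamma> \<Longrightarrow> length ys = core_size \<gamma> \<and> prod_list (map (\<lambda>\<beta>. fact (osize B \<beta>)) ys) = F"
proof -
  obtain \<alpha>0 \<beta>s0 Us0 where g: "\<gamma> = (\<alpha>0, \<beta>s0, Us0)" by (cases \<gamma>)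
  have \<gamma>': "(\<alpha>0, \<beta>s0, Us0) \<in> objs_of_size (composition Labeled A B) n" using \<gamma> unfolding g .
  have k: "length \<beta>s0 = length Us0" "\<And>i. i < length Us0 \<Longrightarrow> card (Us0 ! i) = osize B (\<beta>s0 ! i)" "set \<beta>s0 \<subseteq> objs B"
    "\<And>i j. j < length Us0 \<Longrightarrow> i < j \<Longrightarrow> Us0 ! i \<inter> Us0 ! j = {} \<and> Min (Us0 ! i) < Min (Us0 ! j)" "\<Union> (set Us0) = {1..n}"
    using \<gamma>' by (auto simp: objs_of_size_def composition_def labeled_composites_def)
  have dj: "Us0 ! i \<inter> Us0 ! j = {} \<and> Us0 ! i \<noteq> Us0 ! j" if "i < length Us0" "j < length Us0" "i \<noteq> j" for i j
  proof (cases "i < j")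
    case True
    then show ?thesis using k(4)[of j i] that by auto
  next
    case False
    then show ?thesis using k(4)[of i j] that by auto
  qed
  have dU: "distinct Us0" using dj by (simp add: distinct_conv_nth)
  have F: "finite (labeled_cuts n (set Us0)) \<and> card (labeled_cuts n (set Us0)) = fact (card (set Us0)) * (\<Prod>U\<in>set Us0. fact (card U))"
  proof (rule card_labeled_cuts)
    fix U V assume "U \<in> set Us0" "V \<in> set Us0" "U \<noteq> V"
    then show "U \<inter> V = {}" using dj by (metis in_set_conv_nth)
  qed (use k(5) in auto)
  note bij = assemblies_cuts[OF \<gamma>']
  show ?thesis
  proof (rule that[of "\<Prod>U\<in>set Us0. fact (card U)"])
    show "finite (assemblies n \<gamma>)" unfolding g using bij_betw_finite[OF bij] F by simp
    show "card (assemblies n \<gamma>) = fact (core_size \<gamma>) * (\<Prod>U\<in>set Us0. fact (card U))"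
      unfolding g using bij_betw_same_card[OF bij] F k(1) distinct_card[OF dU] by (simp add: core_size_def)
    show "(\<Prod>U\<in>set Us0. fact (card U)) > (0::nat)" by (simp add: prod_pos)
    fix ys \<alpha> \<sigma> assume t: "(ys, \<alpha>, \<sigma>) \<in> assemblies n \<gamma>"
    have y: "set ys \<subseteq> objs B" "total_size B ys = n" "\<sigma> permutes {1..n}" using t by (auto simp: assemblies_def)
    have "(\<sigma>, map (osize B) ys) \<in> labeled_cuts n (set Us0)"
      using bij_betw_apply[OF bij] t unfolding g by fastforce
    then have V: "set (moved \<sigma> ys) = set Us0" "distinct (moved \<sigma> ys)"
      by (auto simp: labeled_cuts_def permutations_of_set_def moved_def blocks_def)
    have "length ys = card (set (moved \<sigma> ys))" using distinct_card[OF V(2)] lengths(2)[OF y(3,1,2)] by simp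
    then have l: "length ys = core_size \<gamma>" unfolding V(1) g using k(1) distinct_card[OF dU] by (simp add: core_size_def)
    have "prod_list (map (\<lambda>V. fact (card V)) (moved \<sigma> ys)) = (\<Prod>U\<in>set Us0. fact (card U) :: nat)"
      using prod.distinct_set_conv_list[OF V(2), of "\<lambda>V. fact (card V) :: nat"] V(1) by simp
    moreover have "map (\<lambda>V. fact (card V) :: nat) (moved \<sigma> ys) = map (\<lambda>\<beta>. fact (osize B \<beta>)) ys"
      by (rule nth_equalityI) (use block_nth(6)[OF y(3,1,2)] lengths(2)[OF y(3,1,2)] in auto)
    ultimately show "length ys = core_size \<gamma> \<and> prod_list (map (\<lambda>\<beta>. fact (osize B \<beta>)) ys) = (\<Prod>U\<in>set Us0. fact (card U) :: nat)"
      using l by simp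
  qed
qed

end

section \<open>Law of the assembled object, given the components\<close>

definition draw :: "setting \<Rightarrow> 'a comb_class \<Rightarrow> 'b comb_class \<Rightarrow> 'b list \<Rightarrow> ('a, 'b) composite pmf" where
  "draw S A B ys = bind_pmf (pmf_of_set (objs_of_size A (length ys))) (\<lambda>\<alpha>. assemble S A B \<alpha> ys)"

definition lists_of_size :: "'b comb_class \<Rightarrow> nat \<Rightarrow> 'b list set" where
  "lists_of_size B n = {ys. set ys \<subseteq> objs B \<and> total_size B ys = n}"

locale composable =
  fixes S :: setting and A :: "'a comb_class" and B :: "'b comb_class"
  assumes A: "is_comb_class S A" and B: "is_comb_class S B" and B_0: "objs_of_size B 0 = {}"
    and A_nonempty: "k \<ge> 1 \<Longrightarrow> objs_of_size A k \<noteq> {}"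
begin

lemma finite_A: "finite (objs_of_size A k)" and finite_B: "finite (objs_of_size B k)"
  using A B by (auto simp: is_comb_class_def)

lemma osize_pos: "\<beta> \<in> objs B \<Longrightarrow> osize B \<beta> \<ge> 1"
  using B_0 by (cases "osize B \<beta>") (auto simp: objs_of_size_def)

lemma length_le_total_size: "set ys \<subseteq> objs B \<Longrightarrow> length ys \<le> total_size B ys"
proof (induction ys)
  case (Cons y ys)
  then show ?case using osize_pos[of y] by auto
qed simp

lemma finite_lists_of_size: "finite (lists_of_size B n)"
proof (rule finite_subset)
  show "lists_of_size B n \<subseteq> {ys. set ys \<subseteq> (\<Union>m\<le>n. objs_of_size B m) \<and> length ys \<le> n}"
  proof clarify
    fix ys assume ys: "ys \<in> lists_of_size B n"
    have "osize B y \<le> n" if "y \<in> set ys" for y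
      using ys that member_le_sum_list[of "osize B y" "map (osize B) ys"] by (auto simp: lists_of_size_def total_size_def)
    then show "set ys \<subseteq> (\<Union>m\<le>n. objs_of_size B m) \<and> length ys \<le> n"
      using ys length_le_total_size by (auto simp: lists_of_size_def objs_of_size_def)
  qed
  show "finite {ys. set ys \<subseteq> (\<Union>m\<le>n. objs_of_size B m) \<and> length ys \<le> n}"
    using finite_B by (intro finite_lists_length_le) auto
qed

lemma length_pos: "n \<ge> 1 \<Longrightarrow> ys \<in> lists_of_size B n \<Longrightarrow> length ys \<ge> 1"
  by (cases ys) (auto simp: lists_of_size_def)

lemma labeled_classesI: "S = Labeled \<Longrightarrow> labeled_classes A B"
  using A B B_0 by unfold_locales auto

lemma draw_unlabeled: "S = Unlabeled \<Longrightarrow> draw S A B ys = map_pmf (\<lambda>\<alpha>. (\<alpha>, ys, [])) (pmf_of_set (objs_of_size A (length ys)))"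
  by (simp add: draw_def assemble_def map_pmf_def)

lemma draw_labeled:
  assumes S: "S = Labeled" and ys: "ys \<in> lists_of_size B n"
  shows "draw S A B ys = bind_pmf (pmf_of_set (objs_of_size A (length ys)))
     (\<lambda>\<alpha>. map_pmf (\<lambda>\<sigma>. labeled_classes.assembled A B \<sigma> \<alpha> ys) (pmf_of_set {\<sigma>. \<sigma> permutes {1..n}}))"
proof -
  interpret labeled_classes A B by (rule labeled_classesI[OF S])
  show ?thesis using ys by (simp add: draw_def assemble_def S assembled_def blocks_def lists_of_size_def)
qed

lemma draw_support:
  assumes n: "n \<ge> 1" and ys: "ys \<in> lists_of_size B n" and \<gamma>: "\<gamma> \<in> set_pmf (draw S A B ys)"
  shows "\<gamma> \<in> objs_of_size (composition S A B) n \<and> core_size \<gamma> = length ys"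
proof (cases S)
  case Unlabeled
  have "set_pmf (pmf_of_set (objs_of_size A (length ys))) = objs_of_size A (length ys)"
    using A_nonempty[OF length_pos[OF n ys]] finite_A by (rule set_pmf_of_set)
  then obtain \<alpha> where "\<alpha> \<in> objs_of_size A (length ys)" "\<gamma> = (\<alpha>, ys, [])"
    using \<gamma> by (auto simp: draw_unlabeled[OF Unlabeled])
  then show ?thesis using ys
    by (auto simp: Unlabeled objs_of_size_def composition_def unlabeled_composites_def core_size_def lists_of_size_def)
next
  case Labeled
  interpret labeled_classes A B by (rule labeled_classesI[OF Labeled])
  have "set_pmf (pmf_of_set (objs_of_size A (length ys))) = objs_of_size A (length ys)"
    using A_nonempty[OF length_pos[OF n ys]] finite_A by (rule set_pmf_of_set)
  moreover have "set_pmf (pmf_of_set {\<sigma>. \<sigma> permutes {1..n}}) = {\<sigma>. \<sigma> permutes {1..n}}"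
    by (rule set_pmf_of_set) (auto simp: finite_permutations intro: permutes_id)
  ultimately obtain \<alpha> \<sigma> where "\<alpha> \<in> objs_of_size A (length ys)" "\<sigma> permutes {1..n}" "\<gamma> = assembled \<sigma> \<alpha> ys"
    using \<gamma> by (auto simp: draw_labeled[OF Labeled ys])
  then show ?thesis using assembled_in_composition[of \<sigma> n ys \<alpha>] ys by (simp add: Labeled lists_of_size_def)
qed

lemma prod_list_delta_labeled: "prod_list (map (\<lambda>\<beta>. delta Labeled (osize B \<beta>)) ys) = 1 / real (prod_list (map (\<lambda>\<beta>. fact (osize B \<beta>)) ys))"
  by (induction ys) (simp_all add: delta_def)

text \<open>Each of the \<open>k! * F\<close> assemblies carries \<open>1 / F\<close> from its
  components and \<open>1 / n!\<close> times \<open>1 / card\<close> from the permutation and the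
  core. The function \<open>v\<close> leaves room for the Boltzmann factors, which depend on the
  number of components only.\<close>

lemma draw_law_labeled:
  fixes v :: "nat \<Rightarrow> real"
  assumes S: "S = Labeled" and n: "n \<ge> 1" and \<gamma>: "\<gamma> \<in> objs_of_size (composition S A B) n"
  shows "(\<Sum>ys\<in>lists_of_size B n. prod_list (map (\<lambda>\<beta>. delta S (osize B \<beta>)) ys) * v (length ys) * pmf (draw S A B ys) \<gamma>)
    = delta S n * v (core_size \<gamma>) / (delta S (core_size \<gamma>) * real (card (objs_of_size A (core_size \<gamma>))))"
proof -
  interpret labeled_classes A B by (rule labeled_classesI[OF S])
  obtain F :: nat where F: "finite (assemblies n \<gamma>)" "card (assemblies n \<gamma>) = fact (core_size \<gamma>) * F" "F > 0"
    "\<And>ys \<alpha> \<sigma>. (ys, \<alpha>, \<sigma>) \<in> assemblies n \<gamma> \<Longrightarrow> length ys = core_size \<gamma> \<and> prod_list (map (\<lambda>\<beta>. fact (osize B \<beta>)) ys) = F"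
    using assemblies_count \<gamma> unfolding S by blast
  let ?P = "{\<sigma>. \<sigma> permutes {1..n}}"
  let ?Q = "\<lambda>ys \<alpha>. {\<sigma>. \<sigma> permutes {1..n} \<and> assembled \<sigma> \<alpha> ys = \<gamma>}"
  have finP: "finite ?P" by (rule finite_permutations) simp
  have neP: "?P \<noteq> {}" using permutes_id by blast
  have cP: "card ?P = fact n" by (rule card_permutations) simp_all
  define W where "W ys = prod_list (map (\<lambda>\<beta>. delta S (osize B \<beta>)) ys) * v (length ys) / (fact n * real (card (objs_of_size A (length ys))))" for ys
  have d: "prod_list (map (\<lambda>\<beta>. delta S (osize B \<beta>)) ys) * v (length ys) * pmf (draw S A B ys) \<gamma>
      = (\<Sum>\<alpha>\<in>objs_of_size A (length ys). \<Sum>\<sigma>\<in>?Q ys \<alpha>. W ys)" if ys: "ys \<in> lists_of_size B n" for ys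
  proof -
    have "pmf (map_pmf (\<lambda>\<sigma>. assembled \<sigma> \<alpha> ys) (pmf_of_set ?P)) \<gamma> = real (card (?Q ys \<alpha>)) / fact n" for \<alpha>
    proof -
      have "?P \<inter> (\<lambda>\<sigma>. assembled \<sigma> \<alpha> ys) -` {\<gamma>} = ?Q ys \<alpha>" by auto
      then show ?thesis by (simp only: pmf_map measure_pmf_of_set[OF neP finP] cP of_nat_fact)
    qed
    then have "pmf (draw S A B ys) \<gamma> = (\<Sum>\<alpha>\<in>objs_of_size A (length ys). real (card (?Q ys \<alpha>)) / fact n) / real (card (objs_of_size A (length ys)))"
      unfolding draw_labeled[OF S ys] using A_nonempty[OF length_pos[OF n ys]] finite_A
      by (simp add: pmf_bind_pmf_of_set)
    then show ?thesis by (simp add: W_def sum_distrib_left sum_divide_distrib field_simps)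
  qed
  have "(\<Sum>ys\<in>lists_of_size B n. prod_list (map (\<lambda>\<beta>. delta S (osize B \<beta>)) ys) * v (length ys) * pmf (draw S A B ys) \<gamma>)
      = (\<Sum>ys\<in>lists_of_size B n. \<Sum>\<alpha>\<in>objs_of_size A (length ys). \<Sum>\<sigma>\<in>?Q ys \<alpha>. W ys)"
    by (rule sum.cong) (simp_all only: d)
  also have "\<dots> = (\<Sum>ys\<in>lists_of_size B n. \<Sum>z\<in>Sigma (objs_of_size A (length ys)) (?Q ys). W ys)"
    using finite_A finP by (intro sum.cong refl) (simp add: sum.Sigma case_prod_unfold sum_distrib_right)
  also have "\<dots> = (\<Sum>z\<in>Sigma (lists_of_size B n) (\<lambda>ys. Sigma (objs_of_size A (length ys)) (?Q ys)). W (fst z))"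
    using finite_A finP finite_lists_of_size by (subst sum.Sigma) (simp_all add: case_prod_unfold)
  also have "Sigma (lists_of_size B n) (\<lambda>ys. Sigma (objs_of_size A (length ys)) (?Q ys)) = assemblies n \<gamma>"
    by (auto simp: assemblies_def lists_of_size_def)
  also have "(\<Sum>z\<in>assemblies n \<gamma>. W (fst z)) = (\<Sum>z\<in>assemblies n \<gamma>. v (core_size \<gamma>) / (real F * (fact n * real (card (objs_of_size A (core_size \<gamma>))))))"
  proof (rule sum.cong)
    fix z assume z: "z \<in> assemblies n \<gamma>"
    have "length (fst z) = core_size \<gamma> \<and> prod_list (map (\<lambda>\<beta>. fact (osize B \<beta>)) (fst z)) = F"
      using F(4) z by (cases z) auto
    then show "W (fst z) = v (core_size \<gamma>) / (real F * (fact n * real (card (objs_of_size A (core_size \<gamma>)))))"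
      unfolding W_def S prod_list_delta_labeled by simp
  qed simp
  also have "\<dots> = fact (core_size \<gamma>) * v (core_size \<gamma>) / (fact n * real (card (objs_of_size A (core_size \<gamma>))))"
    using F(2,3) by simp
  finally show ?thesis by (simp add: S delta_def)
qed

text \<open>In the unlabeled setting \<open>\<gamma>\<close> records its core and its list of
  components, so a single term of the sum survives.\<close>

lemma draw_law:
  fixes v :: "nat \<Rightarrow> real"
  assumes n: "n \<ge> 1" and \<gamma>: "\<gamma> \<in> objs_of_size (composition S A B) n"
  shows "(\<Sum>ys\<in>lists_of_size B n. prod_list (map (\<lambda>\<beta>. delta S (osize B \<beta>)) ys) * v (length ys) * pmf (draw S A B ys) \<gamma>)
    = delta S n * v (core_size \<gamma>) / (delta S (core_size \<gamma>) * real (card (objs_of_size A (core_size \<gamma>))))"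
proof (cases S)
  case Unlabeled
  obtain \<alpha> \<beta>s where g: "\<gamma> = (\<alpha>, \<beta>s, [])" "\<alpha> \<in> objs_of_size A (length \<beta>s)" "\<beta>s \<in> lists_of_size B n"
    using \<gamma> by (auto simp: Unlabeled composition_def unlabeled_composites_def objs_of_size_def lists_of_size_def)
  have p: "pmf (draw S A B ys) \<gamma> = (if ys = \<beta>s then 1 / real (card (objs_of_size A (length \<beta>s))) else 0)" if ys: "ys \<in> lists_of_size B n" for ys
  proof -
    have "objs_of_size A (length ys) \<inter> (\<lambda>\<alpha>. (\<alpha>, ys, [])) -` {\<gamma>} = (if ys = \<beta>s then {\<alpha>} else {})" using g(1,2) by auto
    then show ?thesis
      unfolding draw_unlabeled[OF Unlabeled] pmf_map measure_pmf_of_set[OF A_nonempty[OF length_pos[OF n ys]] finite_A] by auto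
  qed
  have d: "prod_list (map (\<lambda>\<beta>. delta S (osize B \<beta>)) ys) = 1" for ys
    by (induction ys) (simp_all add: Unlabeled delta_def)
  have "(\<Sum>ys\<in>lists_of_size B n. prod_list (map (\<lambda>\<beta>. delta S (osize B \<beta>)) ys) * v (length ys) * pmf (draw S A B ys) \<gamma>)
      = (\<Sum>ys\<in>lists_of_size B n. if ys = \<beta>s then v (length \<beta>s) / real (card (objs_of_size A (length \<beta>s))) else 0)"
    by (intro sum.cong refl) (simp add: p d)
  also have "\<dots> = v (length \<beta>s) / real (card (objs_of_size A (length \<beta>s)))"
    using g(3) finite_lists_of_size by simp
  finally show ?thesis by (simp add: Unlabeled delta_def g(1) core_size_def)
qed (rule draw_law_labeled[OF _ n \<gamma>])

end

section \<open>Laws of the generators\<close>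

lemma success_prob_map: "success_prob trial = measure (measure_spmf (map_spmf fst trial)) {x. x \<noteq> None}"
proof -
  have "fst -` {x :: 'a option. x \<noteq> None} = {(x :: 'a option, u :: nat). x \<noteq> None}" by auto
  then show ?thesis by (simp add: success_prob_def measure_map_spmf)
qed

lemma success_prob_pmf:
  assumes "map_spmf fst trial = spmf_of_pmf Q" "\<And>y. Some y \<in> set_pmf Q \<Longrightarrow> y \<in> Y" "finite Y"
  shows "success_prob trial = (\<Sum>y\<in>Y. pmf Q (Some y))"
proof -
  have "success_prob trial = measure (measure_pmf Q) {x. x \<noteq> None}"
    unfolding success_prob_map assms(1) by (simp only: measure_spmf_spmf_of_pmf)
  also have "\<dots> = measure (measure_pmf Q) (Some ` Y)"
    using assms(2) by (intro measure_pmf.finite_measure_eq_AE) (auto simp: AE_measure_pmf_iff not_None_eq)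
  also have "\<dots> = (\<Sum>y\<in>Some ` Y. pmf Q y)" using assms(3) by (intro measure_measure_pmf_finite) simp
  also have "\<dots> = (\<Sum>y\<in>Y. pmf Q (Some y))" by (simp add: sum.reindex)
  finally show ?thesis .
qed

lemma map_pmf_fst_timed: "map_pmf fst (timed p T) = p"
  by (simp add: timed_def map_bind_pmf map_pmf_comp bind_return_pmf')

text \<open>\<open>x\<close> plays the role of \<open>\<rho>\<close> and \<open>Bx\<close> that of
  \<open>B(\<rho>)\<close>; the locale ties the size law \<open>b\<close> of the renewal process to
  the Boltzmann sampler.\<close>

locale leap = composable S A B + renewal b R for S :: setting and A :: "'a comb_class" and B :: "'b comb_class" and b R +
  fixes x Bx :: real
  assumes x_pos: "x > 0" and Bx_pos: "Bx > 0"
    and b_eq: "b m = delta S m * real (card (objs_of_size B m)) * x ^ m / Bx"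
    and boltzmann_pmf: "pmf (boltzmann S B (rho S A B)) \<beta> = (if \<beta> \<in> objs B then delta S (osize B \<beta>) * x ^ osize B \<beta> / Bx else 0)"
begin

definition weight :: "'b list \<Rightarrow> real" where
  "weight ys = prod_list (map (pmf (boltzmann S B (rho S A B))) ys)"

lemma weight_eq:
  "ys \<in> lists_of_size B n \<Longrightarrow> weight ys = prod_list (map (\<lambda>\<beta>. delta S (osize B \<beta>)) ys) * (x ^ n / Bx ^ length ys)"
proof -
  have "set ys \<subseteq> objs B \<Longrightarrow> weight ys = prod_list (map (\<lambda>\<beta>. delta S (osize B \<beta>)) ys) * (x ^ total_size B ys / Bx ^ length ys)" for ys
    by (induction ys) (simp_all add: weight_def boltzmann_pmf power_add)
  then show "ys \<in> lists_of_size B n \<Longrightarrow> ?thesis" by (auto simp: lists_of_size_def)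
qed

lemma set_boltzmann: "set_pmf (boltzmann S B (rho S A B)) \<subseteq> objs B"
  by (auto simp: set_pmf_eq boltzmann_pmf split: if_splits)

lemma pmf_boltzmann_size: "pmf (map_pmf (osize B) (boltzmann S B (rho S A B))) m = b m"
proof -
  have "pmf (map_pmf (osize B) (boltzmann S B (rho S A B))) m = measure (measure_pmf (boltzmann S B (rho S A B))) (objs_of_size B m)"
    unfolding pmf_map using set_boltzmann
    by (intro measure_pmf.finite_measure_eq_AE) (auto simp: AE_measure_pmf_iff objs_of_size_def)
  also have "\<dots> = (\<Sum>\<beta>\<in>objs_of_size B m. pmf (boltzmann S B (rho S A B)) \<beta>)"
    by (rule measure_measure_pmf_finite[OF finite_B])
  also have "\<dots> = (\<Sum>\<beta>\<in>objs_of_size B m. delta S m * x ^ m / Bx)"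
    by (intro sum.cong refl) (auto simp: boltzmann_pmf objs_of_size_def)
  finally show ?thesis by (simp add: b_eq)
qed

text \<open>Applied to the size and to its squared deviation, it identifies \<open>\<mu>\<close> and
  \<open>\<sigma>\<close> with the moments of the renewal process.\<close>

lemma expectation_boltzmann_size:
  fixes f :: "nat \<Rightarrow> real"
  assumes "summable (\<lambda>m. b m * \<bar>f m\<bar>)"
  shows "measure_pmf.expectation (boltzmann S B (rho S A B)) (\<lambda>\<beta>. f (osize B \<beta>)) = (\<Sum>m. b m * f m)"
proof -
  let ?N = "map_pmf (osize B) (boltzmann S B (rho S A B))"
  have "measure_pmf.expectation (boltzmann S B (rho S A B)) (\<lambda>\<beta>. f (osize B \<beta>)) = (\<integral>m. f m \<partial>density (count_space UNIV) (\<lambda>m. ennreal (pmf ?N m)))"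
    by (simp only: measure_pmf_eq_density[symmetric] integral_map_pmf)
  also have "\<dots> = (\<integral>m. b m * f m \<partial>count_space UNIV)"
    by (subst integral_density) (auto simp: pmf_boltzmann_size AE_count_space b_nonneg)
  also have "\<dots> = (\<Sum>m. b m * f m)"
    using assms b_nonneg by (intro integral_count_space_nat) (simp add: integrable_count_space_nat_iff abs_mult)
  finally show ?thesis .
qed

lemma nn_integral_boltzmann_size: "(\<integral>\<^sup>+ \<beta>. of_nat (osize B \<beta>) \<partial>measure_pmf (boltzmann S B (rho S A B))) = ennreal mean"
proof -
  let ?N = "map_pmf (osize B) (boltzmann S B (rho S A B))"
  have s: "summable (\<lambda>m. real m * b m)" using summable_b_mom[of 1] by simp
  have "(\<integral>\<^sup>+ \<beta>. of_nat (osize B \<beta>) \<partial>measure_pmf (boltzmann S B (rho S A B))) = (\<integral>\<^sup>+ m. of_nat m \<partial>measure_pmf ?N)"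
    by simp
  also have "\<dots> = (\<integral>\<^sup>+ m. ennreal (real m * b m) \<partial>count_space UNIV)"
    unfolding nn_integral_measure_pmf pmf_boltzmann_size
    using b_nonneg by (intro nn_integral_cong) (simp add: ennreal_mult ennreal_of_nat_eq_real_of_nat mult.commute)
  also have "\<dots> = (\<Sum>m. ennreal (real m * b m))" by (rule nn_integral_count_space_nat)
  also have "\<dots> = ennreal mean" unfolding mean_def using b_nonneg s by (intro suminf_ennreal2) auto
  finally show ?thesis .
qed

text \<open>Splitting off the first component is the Cauchy product that defines the next
  power.\<close>

lemma sum_weight: "(\<Sum>ys\<in>{ys \<in> lists_of_size B n. length ys = k}. weight ys) = hit k n"
proof (induction k arbitrary: n)
  case 0
  have "{ys \<in> lists_of_size B n. length ys = 0} = (if n = 0 then {[]} else {})"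
    by (auto simp: lists_of_size_def)
  then show ?case by (simp add: hit_def weight_def)
next
  case (Suc k)
  let ?L = "\<lambda>k n. {ys \<in> lists_of_size B n. length ys = k}"
  let ?X = "Sigma {0..n} (\<lambda>m. objs_of_size B m \<times> ?L k (n - m))"
  have fin: "finite (?L k n)" for k n using finite_lists_of_size by (rule rev_finite_subset) auto
  have "(\<Sum>ys\<in>?L (Suc k) n. weight ys) = (\<Sum>(m, y, ys)\<in>?X. weight (y # ys))"
  proof (rule sum.reindex_bij_witness[where j = "\<lambda>ys. (osize B (hd ys), hd ys, tl ys)" and i = "\<lambda>(m, y, ys). y # ys"])
    fix ys assume ys: "ys \<in> ?L (Suc k) n"
    then obtain z zs where "ys = z # zs" by (cases ys) auto
    then show "(\<lambda>(m, y, ys). y # ys) (osize B (hd ys), hd ys, tl ys) = ys"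
      "(osize B (hd ys), hd ys, tl ys) \<in> ?X"
      "(\<lambda>(m, y, ys). weight (y # ys)) (osize B (hd ys), hd ys, tl ys) = weight ys"
      using ys by (auto simp: lists_of_size_def objs_of_size_def)
  qed (auto simp: lists_of_size_def objs_of_size_def)
  also have "\<dots> = (\<Sum>m=0..n. \<Sum>(y, ys)\<in>objs_of_size B m \<times> ?L k (n - m). weight (y # ys))"
    using fin finite_B by (subst sum.Sigma) auto
  also have "\<dots> = (\<Sum>m=0..n. b m * hit k (n - m))"
  proof (rule sum.cong[OF refl])
    fix m
    have "(\<Sum>(y, ys)\<in>objs_of_size B m \<times> ?L k (n - m). weight (y # ys))
        = (\<Sum>y\<in>objs_of_size B m. \<Sum>ys\<in>?L k (n - m). delta S m * x ^ m / Bx * weight ys)"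
      unfolding sum.cartesian_product[symmetric]
      by (intro sum.cong refl) (auto simp: weight_def boltzmann_pmf objs_of_size_def)
    also have "\<dots> = (\<Sum>y\<in>objs_of_size B m. delta S m * x ^ m / Bx * hit k (n - m))"
      by (simp only: sum_distrib_left[symmetric] Suc.IH)
    also have "\<dots> = b m * hit k (n - m)" by (simp add: b_eq)
    finally show "(\<Sum>(y, ys)\<in>objs_of_size B m \<times> ?L k (n - m). weight (y # ys)) = b m * hit k (n - m)" .
  qed
  also have "\<dots> = hit (Suc k) n" by (simp add: hit_def fps_mult_nth)
  finally show ?case .
qed

lemma sum_weight_length: "(\<Sum>ys\<in>lists_of_size B n. weight ys * G (length ys)) = (\<Sum>k\<le>n. hit k n * G k)"
proof -
  have "(\<Sum>ys\<in>lists_of_size B n. weight ys * G (length ys)) = (\<Sum>k\<le>n. \<Sum>ys\<in>{ys \<in> lists_of_size B n. length ys = k}. weight ys * G (length ys))"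
    using finite_lists_of_size length_le_total_size
    by (intro sum.group[symmetric]) (auto simp: lists_of_size_def)
  also have "\<dots> = (\<Sum>k\<le>n. (\<Sum>ys\<in>{ys \<in> lists_of_size B n. length ys = k}. weight ys) * G k)"
    by (intro sum.cong refl) (simp add: sum_distrib_right)
  finally show ?thesis by (simp only: sum_weight)
qed

definition a :: "nat \<Rightarrow> real" where "a k = delta S k * real (card (objs_of_size A k))"

text \<open>The weight \<open>a_k B(\<rho>)^k\<close>. The probability of an output is inversely
  proportional to its value at the core-size, so it measures the bias of the leap generator.\<close>

definition g :: "nat \<Rightarrow> real" where "g k = a k * Bx ^ k"

lemma delta_pos: "delta S k > 0" by (cases S) (simp_all add: delta_def)

lemma a_pos: "k \<ge> 1 \<Longrightarrow> a k > 0"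
  using A_nonempty[of k] finite_A[of k] delta_pos by (simp add: a_def card_gt_0_iff)

lemma g_pos: "k \<ge> 1 \<Longrightarrow> g k > 0"
  using a_pos Bx_pos by (simp add: g_def)

definition outcome :: "nat \<Rightarrow> ('a, 'b) composite \<Rightarrow> real" where
  "outcome n \<gamma> = (\<Sum>ys\<in>lists_of_size B n. weight ys * pmf (draw S A B ys) \<gamma>)"

abbreviation Cn :: "nat \<Rightarrow> ('a, 'b) composite set" where
  "Cn n \<equiv> objs_of_size (composition S A B) n"

lemma outcome_eq:
  assumes "n \<ge> 1" "\<gamma> \<in> Cn n"
  shows "outcome n \<gamma> = delta S n * x ^ n / g (core_size \<gamma>)"
proof -
  have "outcome n \<gamma> = (\<Sum>ys\<in>lists_of_size B n. prod_list (map (\<lambda>\<beta>. delta S (osize B \<beta>)) ys) * (x ^ n / Bx ^ length ys) * pmf (draw S A B ys) \<gamma>)"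
    unfolding outcome_def by (intro sum.cong refl) (simp add: weight_eq)
  also have "\<dots> = delta S n * (x ^ n / Bx ^ core_size \<gamma>) / (delta S (core_size \<gamma>) * real (card (objs_of_size A (core_size \<gamma>))))"
    by (rule draw_law[OF assms, of "\<lambda>k. x ^ n / Bx ^ k"])
  finally show ?thesis by (simp add: g_def a_def field_simps)
qed

text \<open>Every object of size \<open>n\<close> has positive \<open>outcome\<close>, hence lies in
  the support of the draw from one of finitely many lists, and each of these supports is
  finite.\<close>

lemma finite_Cn:
  assumes n: "n \<ge> 1"
  shows "finite (Cn n)"
proof (rule finite_subset)
  show "Cn n \<subseteq> (\<Union>ys\<in>lists_of_size B n. set_pmf (draw S A B ys))"
  proof
    fix \<gamma> assume \<gamma>: "\<gamma> \<in> Cn n"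
    have k: "core_size \<gamma> \<ge> 1"
    proof -
      obtain \<alpha> ys Us where g: "\<gamma> = (\<alpha>, ys, Us)" by (cases \<gamma>)
      have "ys \<noteq> []" using \<gamma> n unfolding g by (auto simp: objs_of_size_def composition_def)
      then show ?thesis by (simp add: g core_size_def Suc_le_eq)
    qed
    have "outcome n \<gamma> > 0" unfolding outcome_eq[OF n \<gamma>] using g_pos[OF k] delta_pos x_pos by simp
    then have "\<exists>ys\<in>lists_of_size B n. weight ys * pmf (draw S A B ys) \<gamma> \<noteq> 0"
    proof (rule contrapos_pp)
      assume "\<not> (\<exists>ys\<in>lists_of_size B n. weight ys * pmf (draw S A B ys) \<gamma> \<noteq> 0)"
      then have "outcome n \<gamma> = 0" unfolding outcome_def by (intro sum.neutral) blast
      then show "\<not> outcome n \<gamma> > 0" by simp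
    qed
    then show "\<gamma> \<in> (\<Union>ys\<in>lists_of_size B n. set_pmf (draw S A B ys))" by (auto simp: set_pmf_iff)
  qed
  show "finite (\<Union>ys\<in>lists_of_size B n. set_pmf (draw S A B ys))"
  proof (rule finite_UN_I[OF finite_lists_of_size])
    fix ys assume ys: "ys \<in> lists_of_size B n"
    have sA: "set_pmf (pmf_of_set (objs_of_size A (length ys))) = objs_of_size A (length ys)"
      using A_nonempty[OF length_pos[OF n ys]] finite_A by (rule set_pmf_of_set)
    have fP: "finite {\<sigma>. \<sigma> permutes {1..n}}" by (rule finite_permutations) simp
    have sP: "set_pmf (pmf_of_set {\<sigma>. \<sigma> permutes {1..n}}) = {\<sigma>. \<sigma> permutes {1..n}}"
      using permutes_id fP by (intro set_pmf_of_set) blast+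
    show "finite (set_pmf (draw S A B ys))"
    proof (cases S)
      case Unlabeled
      show ?thesis unfolding draw_unlabeled[OF Unlabeled] set_map_pmf sA using finite_A by (rule finite_imageI)
    next
      case Labeled
      show ?thesis unfolding draw_labeled[OF Labeled ys] set_bind_pmf set_map_pmf sA sP
        using finite_A fP by (intro finite_UN_I finite_imageI)
    qed
  qed
qed

lemma core_size_pos: "n \<ge> 1 \<Longrightarrow> \<gamma> \<in> Cn n \<Longrightarrow> core_size \<gamma> \<ge> 1"
  by (cases \<gamma>) (auto simp: objs_of_size_def composition_def core_size_def Suc_le_eq)

text \<open>Given a list, the draw puts total mass 1 on \<open>Cn n\<close>, with core-size the
  length of the list; so sums over objects become sums over core-sizes.\<close>

lemma sum_outcome:
  assumes n: "n \<ge> 1"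
  shows "(\<Sum>\<gamma>\<in>Cn n. outcome n \<gamma> * G (core_size \<gamma>)) = (\<Sum>k\<le>n. hit k n * G k)"
proof -
  have "(\<Sum>\<gamma>\<in>Cn n. outcome n \<gamma> * G (core_size \<gamma>)) = (\<Sum>ys\<in>lists_of_size B n. \<Sum>\<gamma>\<in>Cn n. weight ys * pmf (draw S A B ys) \<gamma> * G (core_size \<gamma>))"
    unfolding outcome_def sum_distrib_right by (rule sum.swap)
  also have "\<dots> = (\<Sum>ys\<in>lists_of_size B n. weight ys * G (length ys))"
  proof (rule sum.cong[OF refl])
    fix ys assume ys: "ys \<in> lists_of_size B n"
    have "(\<Sum>\<gamma>\<in>Cn n. weight ys * pmf (draw S A B ys) \<gamma> * G (core_size \<gamma>)) = (\<Sum>\<gamma>\<in>Cn n. (weight ys * G (length ys)) * pmf (draw S A B ys) \<gamma>)"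
    proof (rule sum.cong[OF refl])
      fix \<gamma>
      show "weight ys * pmf (draw S A B ys) \<gamma> * G (core_size \<gamma>) = (weight ys * G (length ys)) * pmf (draw S A B ys) \<gamma>"
        using draw_support[OF n ys, of \<gamma>] by (cases "\<gamma> \<in> set_pmf (draw S A B ys)") (simp_all add: set_pmf_iff)
    qed
    also have "\<dots> = weight ys * G (length ys) * (\<Sum>\<gamma>\<in>Cn n. pmf (draw S A B ys) \<gamma>)" by (simp only: sum_distrib_left)
    also have "(\<Sum>\<gamma>\<in>Cn n. pmf (draw S A B ys) \<gamma>) = 1"
      using draw_support[OF n ys] by (intro sum_pmf_eq_1 finite_Cn n) auto
    finally show "(\<Sum>\<gamma>\<in>Cn n. weight ys * pmf (draw S A B ys) \<gamma> * G (core_size \<gamma>)) = weight ys * G (length ys)" by simp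
  qed
  also have "\<dots> = (\<Sum>k\<le>n. hit k n * G k)" by (rule sum_weight_length)
  finally show ?thesis .
qed

text \<open>The coefficientwise form of \<open>C(z) = A(B(z))\<close> for \<open>n \<ge> 1\<close>,
  read off the sampler: \<open>outcome * g\<close> is constant on \<open>Cn n\<close>, and summing
  this constant counts the objects.\<close>

lemma card_Cn: "n \<ge> 1 \<Longrightarrow> delta S n * real (card (Cn n)) * x ^ n = (\<Sum>k\<le>n. hit k n * g k)"
proof -
  assume n: "n \<ge> 1"
  have "(\<Sum>\<gamma>\<in>Cn n. outcome n \<gamma> * g (core_size \<gamma>)) = (\<Sum>\<gamma>\<in>Cn n. delta S n * x ^ n)"
      proof (rule sum.cong[OF refl])
    fix \<gamma> assume \<gamma>: "\<gamma> \<in> Cn n"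
    show "outcome n \<gamma> * g (core_size \<gamma>) = delta S n * x ^ n"
      unfolding outcome_eq[OF n \<gamma>] using g_pos[OF core_size_pos[OF n \<gamma>]] by simp
  qed
  then show ?thesis using sum_outcome[OF n, of g] by simp
qed

section \<open>The generators at a fixed size\<close>

context
  fixes tA :: "'a \<Rightarrow> nat pmf" and tB :: "'b \<Rightarrow> nat pmf" and tasm :: "nat \<Rightarrow> nat" and n :: nat
  assumes n: "n \<ge> 1" and qn: "q n > 0"
begin

abbreviation "filled \<equiv> fill (timed (boltzmann S B (rho S A B)) tB) B n [] 0"

lemma filled: "lossless_spmf filled" "\<And>z. z \<in> set_spmf filled \<Longrightarrow> set (fst z) \<subseteq> objs B \<and> total_size B (fst z) \<le> n"
proof -
  have "fst z \<in> objs B \<and> osize B (fst z) \<ge> 1" if "z \<in> set_pmf (timed (boltzmann S B (rho S A B)) tB)" for z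
  proof -
    have "fst z \<in> set_pmf (map_pmf fst (timed (boltzmann S B (rho S A B)) tB))" using that by simp
    then show ?thesis using set_boltzmann osize_pos unfolding map_pmf_fst_timed by blast
  qed
  then have "lossless_spmf filled \<and> (\<forall>z\<in>set_spmf filled. set (fst z) \<subseteq> objs B \<and> total_size B (fst z) \<le> n)"
    by (rule fill_support) simp_all
  then show "lossless_spmf filled" "\<And>z. z \<in> set_spmf filled \<Longrightarrow> set (fst z) \<subseteq> objs B \<and> total_size B (fst z) \<le> n" by auto
qed

text \<open>Once running times are forgotten, the attempt is a draw from the filled list, with
  \<open>None\<close> for a list that falls short of \<open>n\<close>.\<close>

lemma attempt_law:
  obtains Q where "map_spmf fst (leap_attempt S A B tA tB tasm n) = spmf_of_pmf Q" "\<And>\<gamma>. pmf Q (Some \<gamma>) = outcome n \<gamma>"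
    "\<And>\<gamma>. Some \<gamma> \<in> set_pmf Q \<Longrightarrow> \<gamma> \<in> Cn n"
proof -
  have "lossless_spmf (map_spmf fst filled)" using filled(1) by simp
  then obtain F where F: "map_spmf fst filled = spmf_of_pmf F" by (auto simp: lossless_spmf_conv_spmf_of_pmf)
  have supp: "set ys \<subseteq> objs B \<and> total_size B ys \<le> n" if "ys \<in> set_pmf F" for ys
  proof -
    have "ys \<in> set_spmf (map_spmf fst filled)" using that by (simp add: F)
    then show ?thesis using filled(2) by auto
  qed
  define Q where "Q = bind_pmf F (\<lambda>ys. if total_size B ys < n then return_pmf None else map_pmf Some (draw S A B ys))"
  have "map_spmf fst (leap_attempt S A B tA tB tasm n) = bind_spmf (map_spmf fst filled)
     (\<lambda>ys. if total_size B ys < n then return_spmf None else spmf_of_pmf (map_pmf Some (draw S A B ys)))"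
  proof -
    have d: "map_pmf fst (bind_pmf (timed (pmf_of_set (objs_of_size A (length ys))) tA)
        (\<lambda>(\<alpha>, v). map_pmf (\<lambda>\<gamma>. (Some \<gamma>, u + v + tasm n)) (assemble S A B \<alpha> ys))) = map_pmf Some (draw S A B ys)" for ys u
    proof -
      have "map_pmf fst (bind_pmf (timed (pmf_of_set (objs_of_size A (length ys))) tA)
        (\<lambda>(\<alpha>, v). map_pmf (\<lambda>\<gamma>. (Some \<gamma>, u + v + tasm n)) (assemble S A B \<alpha> ys)))
        = bind_pmf (timed (pmf_of_set (objs_of_size A (length ys))) tA) (\<lambda>z. map_pmf Some (assemble S A B (fst z) ys))"
        by (simp add: map_bind_pmf case_prod_unfold map_pmf_comp)
      also have "\<dots> = bind_pmf (map_pmf fst (timed (pmf_of_set (objs_of_size A (length ys))) tA)) (\<lambda>\<alpha>. map_pmf Some (assemble S A B \<alpha> ys))"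
        by (simp add: bind_map_pmf)
      finally show ?thesis by (simp add: map_pmf_fst_timed draw_def map_bind_pmf)
    qed
    show ?thesis unfolding leap_attempt_def map_spmf_bind_spmf bind_map_spmf o_def
      by (intro bind_spmf_cong refl) (auto simp: d[unfolded case_prod_unfold] case_prod_unfold map_spmf_of_pmf)
  qed
  also have "\<dots> = spmf_of_pmf Q" unfolding F Q_def
    by (simp add: bind_spmf_of_pmf spmf_of_pmf_bind if_distrib cong: if_cong)
  finally have 1: "map_spmf fst (leap_attempt S A B tA tB tasm n) = spmf_of_pmf Q" .
  have pF: "pmf F ys = weight ys" if "ys \<in> lists_of_size B n" for ys
  proof -
    have "spmf (map_spmf fst filled) ([] @ ys) = weight ys"
      unfolding weight_def using that osize_pos set_boltzmann by (intro spmf_fill) (auto simp: lists_of_size_def)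
    then show ?thesis by (simp add: F)
  qed
  have 2: "pmf Q (Some \<gamma>) = outcome n \<gamma>" for \<gamma>
  proof -
    have "pmf Q (Some \<gamma>) = measure_pmf.expectation F (\<lambda>ys. pmf (if total_size B ys < n then return_pmf None else map_pmf Some (draw S A B ys)) (Some \<gamma>))"
      unfolding Q_def by (rule pmf_bind)
    also have "\<dots> = (\<Sum>ys\<in>lists_of_size B n. pmf (if total_size B ys < n then return_pmf None else map_pmf Some (draw S A B ys)) (Some \<gamma>) * pmf F ys)"
    proof (rule integral_measure_pmf_real[OF finite_lists_of_size])
      fix ys assume "ys \<in> set_pmf F" "pmf (if total_size B ys < n then return_pmf None else map_pmf Some (draw S A B ys)) (Some \<gamma>) \<noteq> 0"
      then show "ys \<in> lists_of_size B n" using supp[of ys] by (cases "total_size B ys < n") (auto simp: lists_of_size_def)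
    qed
    also have "\<dots> = outcome n \<gamma>" unfolding outcome_def
      by (intro sum.cong refl) (use pF in \<open>auto simp: pmf_map_inj' lists_of_size_def mult.commute\<close>)
    finally show ?thesis .
  qed
  have 3: "\<gamma> \<in> Cn n" if "Some \<gamma> \<in> set_pmf Q" for \<gamma>
  proof -
    obtain ys where "ys \<in> set_pmf F" "\<not> total_size B ys < n" "\<gamma> \<in> set_pmf (draw S A B ys)"
      using \<open>Some \<gamma> \<in> set_pmf Q\<close> by (auto simp: Q_def split: if_splits)
    then show ?thesis using supp[of ys] draw_support[OF n, of ys \<gamma>] by (auto simp: lists_of_size_def)
  qed
  show ?thesis using that[OF 1 2 3] .
qed

lemma attempt: "lossless_spmf (leap_attempt S A B tA tB tasm n)" "success_prob (leap_attempt S A B tA tB tasm n) = q n"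
proof -
  obtain Q where Q: "map_spmf fst (leap_attempt S A B tA tB tasm n) = spmf_of_pmf Q" "\<And>\<gamma>. pmf Q (Some \<gamma>) = outcome n \<gamma>"
    "\<And>\<gamma>. Some \<gamma> \<in> set_pmf Q \<Longrightarrow> \<gamma> \<in> Cn n" by (rule attempt_law) (rule that)
  have "lossless_spmf (map_spmf fst (leap_attempt S A B tA tB tasm n))" unfolding Q(1) by simp
  then show "lossless_spmf (leap_attempt S A B tA tB tasm n)" by simp
  have "success_prob (leap_attempt S A B tA tB tasm n) = (\<Sum>\<gamma>\<in>Cn n. outcome n \<gamma>)"
    using success_prob_pmf[OF Q(1,3) finite_Cn[OF n]] by (simp add: Q(2))
  also have "\<dots> = q n" using sum_outcome[OF n, of "\<lambda>_. 1"] by (simp add: q_def)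
  finally show "success_prob (leap_attempt S A B tA tB tasm n) = q n" .
qed

lemma leap_law:
  obtains L where "map_spmf fst (leap_generator S A B tA tB tasm n) = spmf_of_pmf L" "\<And>\<gamma>. pmf L \<gamma> = outcome n \<gamma> / q n"
    "set_pmf L \<subseteq> Cn n"
proof -
  obtain Q where Q: "map_spmf fst (leap_attempt S A B tA tB tasm n) = spmf_of_pmf Q" "\<And>\<gamma>. pmf Q (Some \<gamma>) = outcome n \<gamma>"
    "\<And>\<gamma>. Some \<gamma> \<in> set_pmf Q \<Longrightarrow> \<gamma> \<in> Cn n" by (rule attempt_law) (rule that)
  have sp: "success_prob (leap_attempt S A B tA tB tasm n) > 0" using attempt(2) qn by simp
  have "lossless_spmf (map_spmf fst (leap_generator S A B tA tB tasm n))"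
    unfolding leap_generator_def using lossless_retry[OF attempt(1) sp] by simp
  then obtain L where L: "map_spmf fst (leap_generator S A B tA tB tasm n) = spmf_of_pmf L" by (auto simp: lossless_spmf_conv_spmf_of_pmf)
  have p: "pmf L \<gamma> = outcome n \<gamma> / q n" for \<gamma>
  proof -
    have "pmf L \<gamma> = spmf (map_spmf fst (leap_generator S A B tA tB tasm n)) \<gamma>" unfolding L by simp
    then show ?thesis unfolding leap_generator_def spmf_retry[OF attempt(1) sp] Q(1) attempt(2) by (simp add: Q(2))
  qed
  have "set_pmf L \<subseteq> Cn n"
  proof
    fix \<gamma> assume "\<gamma> \<in> set_pmf L"
    then have "Some \<gamma> \<in> set_pmf Q" using p[of \<gamma>] Q(2)[of \<gamma>] by (auto simp: set_pmf_iff)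
    then show "\<gamma> \<in> Cn n" by (rule Q(3))
  qed
  then show ?thesis using that[OF L p] by blast
qed

context
  fixes w :: "nat \<Rightarrow> nat \<Rightarrow> real"
  assumes w: "\<And>k. 0 \<le> w n k" "\<And>k. w n k \<le> 1"
begin

lemma trial_law:
  obtains Q where "map_spmf fst (rejection_trial w S A B tA tB tasm n) = spmf_of_pmf Q"
    "\<And>\<gamma>. pmf Q (Some \<gamma>) = outcome n \<gamma> / q n * w n (core_size \<gamma>)" "\<And>\<gamma>. Some \<gamma> \<in> set_pmf Q \<Longrightarrow> \<gamma> \<in> Cn n"
proof -
  obtain L where L: "map_spmf fst (leap_generator S A B tA tB tasm n) = spmf_of_pmf L" "\<And>\<gamma>. pmf L \<gamma> = outcome n \<gamma> / q n"
    "set_pmf L \<subseteq> Cn n" by (rule leap_law) (rule that)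
  let ?d = "\<lambda>\<gamma>. map_pmf (\<lambda>success. if success then Some \<gamma> else None) (bernoulli_pmf (w n (core_size \<gamma>)))"
  define Q where "Q = bind_pmf L ?d"
  have "map_spmf fst (rejection_trial w S A B tA tB tasm n) = bind_spmf (map_spmf fst (leap_generator S A B tA tB tasm n)) (\<lambda>\<gamma>. spmf_of_pmf (?d \<gamma>))"
    unfolding rejection_trial_def map_spmf_bind_spmf bind_map_spmf o_def
    by (intro bind_spmf_cong refl) (simp add: case_prod_unfold map_spmf_of_pmf map_pmf_comp)
  also have "\<dots> = spmf_of_pmf Q" unfolding L(1) Q_def by (simp add: bind_spmf_of_pmf spmf_of_pmf_bind)
  finally have 1: "map_spmf fst (rejection_trial w S A B tA tB tasm n) = spmf_of_pmf Q" .
  have d: "pmf (?d \<gamma>') (Some \<gamma>) = (if \<gamma>' = \<gamma> then w n (core_size \<gamma>) else 0)" for \<gamma> \<gamma>'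
  proof -
    have "(\<lambda>success. if success then Some \<gamma>' else None) -` {Some \<gamma>} = (if \<gamma>' = \<gamma> then {True} else {})" by (auto split: if_splits)
    then show ?thesis using w by (simp add: pmf_map measure_pmf_single)
  qed
  have 2: "pmf Q (Some \<gamma>) = outcome n \<gamma> / q n * w n (core_size \<gamma>)" for \<gamma>
  proof -
    have "pmf Q (Some \<gamma>) = measure_pmf.expectation L (\<lambda>\<gamma>'. if \<gamma>' = \<gamma> then w n (core_size \<gamma>) else 0)"
      unfolding Q_def pmf_bind d ..
    also have "\<dots> = (\<Sum>\<gamma>'\<in>{\<gamma>}. (if \<gamma>' = \<gamma> then w n (core_size \<gamma>) else 0) * pmf L \<gamma>')"
      by (rule integral_measure_pmf_real) (auto split: if_splits)
    finally show ?thesis by (simp add: L(2))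
  qed
  have 3: "\<gamma> \<in> Cn n" if "Some \<gamma> \<in> set_pmf Q" for \<gamma>
    using that L(3) unfolding Q_def by (auto split: if_splits)
  show ?thesis using that[OF 1 2 3] .
qed

lemma trial: "lossless_spmf (rejection_trial w S A B tA tB tasm n)" "success_prob (rejection_trial w S A B tA tB tasm n) = E n (w n)"
proof -
  obtain Q where Q: "map_spmf fst (rejection_trial w S A B tA tB tasm n) = spmf_of_pmf Q"
    "\<And>\<gamma>. pmf Q (Some \<gamma>) = outcome n \<gamma> / q n * w n (core_size \<gamma>)" "\<And>\<gamma>. Some \<gamma> \<in> set_pmf Q \<Longrightarrow> \<gamma> \<in> Cn n" by (rule trial_law) (rule that)
  have "lossless_spmf (map_spmf fst (rejection_trial w S A B tA tB tasm n))" unfolding Q(1) by simp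
  then show "lossless_spmf (rejection_trial w S A B tA tB tasm n)" by simp
  have "success_prob (rejection_trial w S A B tA tB tasm n) = (\<Sum>\<gamma>\<in>Cn n. outcome n \<gamma> * w n (core_size \<gamma>)) / q n"
    using success_prob_pmf[OF Q(1,3) finite_Cn[OF n]] by (simp add: Q(2) sum_divide_distrib)
  also have "\<dots> = E n (w n)" using sum_outcome[OF n, of "w n"] by (simp add: E_def)
  finally show "success_prob (rejection_trial w S A B tA tB tasm n) = E n (w n)" .
qed

lemma rejection_law:
  assumes Z: "E n (w n) > 0"
  shows "spmf (map_spmf fst (rejection_generator w S A B tA tB tasm n)) \<gamma> = outcome n \<gamma> * w n (core_size \<gamma>) / (q n * E n (w n))"
proof -
  obtain Q where Q: "map_spmf fst (rejection_trial w S A B tA tB tasm n) = spmf_of_pmf Q"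
    "\<And>\<gamma>. pmf Q (Some \<gamma>) = outcome n \<gamma> / q n * w n (core_size \<gamma>)" "\<And>\<gamma>. Some \<gamma> \<in> set_pmf Q \<Longrightarrow> \<gamma> \<in> Cn n" by (rule trial_law) (rule that)
  have s: "success_prob (rejection_trial w S A B tA tB tasm n) > 0" using trial(2) Z by simp
  show ?thesis unfolding rejection_generator_def spmf_retry[OF trial(1) s] trial(2) Q(1) by (simp add: Q(2))
qed

text \<open>On \<open>Cn n\<close> the uniform law is \<open>outcome * g / (q n * E n g)\<close>,
  because \<open>outcome * g\<close> is constant, and the rejection law is
  \<open>outcome * w / (q n * E n w)\<close>. The factor \<open>outcome\<close> comes out of the
  absolute value, and \<open>sum_outcome\<close> applies.\<close>

lemma rejection_tv:
  assumes Z: "E n (w n) > 0" and G: "E n g > 0"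
  shows "tv_dist (Cn n) (pmf (pmf_of_set (Cn n))) (spmf (map_spmf fst (rejection_generator w S A B tA tB tasm n)))
    = E n (\<lambda>k. \<bar>g k / E n g - w n k / E n (w n)\<bar>) / 2"
proof -
  have cn: "delta S n * real (card (Cn n)) * x ^ n = q n * E n g" using card_Cn[OF n] qn by (simp add: E_def)
  have "q n * E n g > 0" using qn G by simp
  then have ne: "Cn n \<noteq> {}" unfolding cn[symmetric] by auto
  have t: "\<bar>pmf (pmf_of_set (Cn n)) \<gamma> - spmf (map_spmf fst (rejection_generator w S A B tA tB tasm n)) \<gamma>\<bar>
      = outcome n \<gamma> * (\<bar>g (core_size \<gamma>) / E n g - w n (core_size \<gamma>) / E n (w n)\<bar> / q n)" if \<gamma>: "\<gamma> \<in> Cn n" for \<gamma>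
  proof -
    have o: "outcome n \<gamma> * g (core_size \<gamma>) = delta S n * x ^ n"
      unfolding outcome_eq[OF n \<gamma>] using g_pos[OF core_size_pos[OF n \<gamma>]] by simp
    have o0: "outcome n \<gamma> \<ge> 0"
      unfolding outcome_eq[OF n \<gamma>] using g_pos[OF core_size_pos[OF n \<gamma>]] delta_pos[of n] x_pos by simp
    have "pmf (pmf_of_set (Cn n)) \<gamma> = 1 / real (card (Cn n))" using ne finite_Cn[OF n] \<gamma> by simp
    also have "\<dots> = delta S n * x ^ n / (q n * E n g)" unfolding cn[symmetric] using delta_pos[of n] x_pos by simp
    also have "\<dots> = outcome n \<gamma> * (g (core_size \<gamma>) / E n g / q n)" unfolding o[symmetric] by simp
    finally have "pmf (pmf_of_set (Cn n)) \<gamma> - spmf (map_spmf fst (rejection_generator w S A B tA tB tasm n)) \<gamma>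
      = outcome n \<gamma> * ((g (core_size \<gamma>) / E n g - w n (core_size \<gamma>) / E n (w n)) / q n)"
      unfolding rejection_law[OF Z] by (simp add: diff_divide_distrib right_diff_distrib)
    then show ?thesis using o0 qn by (simp add: abs_mult)
  qed
  have "tv_dist (Cn n) (pmf (pmf_of_set (Cn n))) (spmf (map_spmf fst (rejection_generator w S A B tA tB tasm n)))
    = 1 / 2 * (\<Sum>\<gamma>\<in>Cn n. outcome n \<gamma> * (\<bar>g (core_size \<gamma>) / E n g - w n (core_size \<gamma>) / E n (w n)\<bar> / q n))"
    unfolding tv_dist_def using t by (simp cong: sum.cong)
  also have "\<dots> = 1 / 2 * (\<Sum>k\<le>n. hit k n * (\<bar>g k / E n g - w n k / E n (w n)\<bar> / q n))"
    by (subst sum_outcome[OF n, of "\<lambda>k. \<bar>g k / E n g - w n k / E n (w n)\<bar> / q n"]) simp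
  finally show ?thesis by (simp add: E_def sum_divide_distrib)
qed

end

text \<open>Filling takes at most \<open>n + 1 \<le> 2 * n\<close> draws of mean cost at most
  \<open>KB * mean\<close>, the origin of the 2. The core has size at most \<open>n\<close> because
  components have size at least 1.\<close>

lemma mean_time_attempt:
  assumes KA: "\<And>k. k \<ge> 1 \<Longrightarrow> (\<integral>\<^sup>+ u. of_nat u \<partial>measure_pmf (bind_pmf (pmf_of_set (objs_of_size A k)) tA)) \<le> ennreal (KA * real k)" "KA \<ge> 0"
    and KB: "\<And>\<beta>. \<beta> \<in> objs B \<Longrightarrow> (\<integral>\<^sup>+ u. of_nat u \<partial>measure_pmf (tB \<beta>)) \<le> ennreal (KB * real (osize B \<beta>))" "KB \<ge> 0"
    and KT: "real (tasm n) \<le> KT * real n" "KT \<ge> 0"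
  shows "mean_time (leap_attempt S A B tA tB tasm n) \<le> ennreal ((2 * (KB * mean) + KA + KT) * real n)"
proof -
  let ?pb = "boltzmann S B (rho S A B)"
  have m0: "mean \<ge> 0" using mean_ge_1 by simp
  have "(\<integral>\<^sup>+ z. of_nat (snd z) \<partial>measure_pmf (timed ?pb tB)) = (\<integral>\<^sup>+ \<beta>. \<integral>\<^sup>+ u. of_nat u \<partial>measure_pmf (tB \<beta>) \<partial>measure_pmf ?pb)"
    by (simp add: timed_def nn_integral_bind_pmf nn_integral_map_pmf)
  also have "\<dots> \<le> (\<integral>\<^sup>+ \<beta>. ennreal KB * of_nat (osize B \<beta>) \<partial>measure_pmf ?pb)"
  proof (rule nn_integral_mono_AE, unfold AE_measure_pmf_iff, intro ballI)
    fix \<beta> assume "\<beta> \<in> set_pmf ?pb"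
    then have "\<beta> \<in> objs B" using set_boltzmann by blast
    then show "(\<integral>\<^sup>+ u. of_nat u \<partial>measure_pmf (tB \<beta>)) \<le> ennreal KB * of_nat (osize B \<beta>)"
      using KB(1)[of \<beta>] KB(2) by (simp add: ennreal_mult ennreal_of_nat_eq_real_of_nat)
  qed
  also have "\<dots> = ennreal KB * ennreal mean" by (simp add: nn_integral_cmult nn_integral_boltzmann_size)
  also have "\<dots> = ennreal (KB * mean)" using KB(2) m0 by (intro ennreal_mult[symmetric])
  finally have c: "(\<integral>\<^sup>+ z. of_nat (snd z) \<partial>measure_pmf (timed ?pb tB)) \<le> ennreal (KB * mean)" .
  have c0: "KB * mean \<ge> 0" using KB(2) m0 by simp
  have pos: "osize B (fst z) \<ge> 1" if "z \<in> set_pmf (timed ?pb tB)" for z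
  proof -
    have "fst z \<in> set_pmf (map_pmf fst (timed ?pb tB))" using that by simp
    then show ?thesis using set_boltzmann osize_pos unfolding map_pmf_fst_timed by blast
  qed
  have "mean_time filled \<le> ennreal (real 0 + KB * mean * (real (n - total_size B []) + 1))"
    by (rule fill_mean_time[OF pos c c0]) simp_all
  then have tf: "mean_time filled \<le> ennreal (KB * mean * (real n + 1))" by simp
  let ?C = "KA * real n + KT * real n"
  have C0: "?C \<ge> 0" using KA(2) KT(2) by simp
  let ?g = "\<lambda>z. if total_size B (fst z) < n then return_spmf (None, snd z)
       else spmf_of_pmf (bind_pmf (timed (pmf_of_set (objs_of_size A (length (fst z)))) tA) (\<lambda>(\<alpha>, v).
           map_pmf (\<lambda>\<gamma>. (Some \<gamma>, snd z + v + tasm n)) (assemble S A B \<alpha> (fst z))))"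
  have "mean_time (leap_attempt S A B tA tB tasm n) = (\<integral>\<^sup>+ z. mean_time (?g z) \<partial>measure_spmf filled)"
    unfolding leap_attempt_def mean_time_def nn_integral_bind_spmf by (simp only: case_prod_unfold)
  also have "\<dots> \<le> (\<integral>\<^sup>+ z. of_nat (snd z) + ennreal ?C \<partial>measure_spmf filled)"
  proof (rule nn_integral_mono_AE, unfold AE_measure_spmf_iff, intro ballI)
    fix z assume z: "z \<in> set_spmf filled"
    show "mean_time (?g z) \<le> of_nat (snd z) + ennreal ?C"
    proof (cases "total_size B (fst z) < n")
      case True
      then show ?thesis by (simp add: mean_time_def nn_integral_return measure_spmf_return_spmf)
    next
      case False
      then have l: "fst z \<in> lists_of_size B n" using filled(2)[OF z] by (simp add: lists_of_size_def)
      let ?k = "length (fst z)"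
      have k1: "?k \<ge> 1" by (rule length_pos[OF n l])
      have kn: "?k \<le> n" using length_le_total_size[of "fst z"] l by (simp add: lists_of_size_def)
      have "mean_time (?g z) = (\<integral>\<^sup>+ y. of_nat (snd z + snd y + tasm n) \<partial>measure_pmf (timed (pmf_of_set (objs_of_size A ?k)) tA))"
        using False by (simp add: mean_time_def measure_spmf_spmf_of_pmf nn_integral_bind_pmf case_prod_unfold)
      also have "\<dots> = of_nat (snd z + tasm n) + (\<integral>\<^sup>+ y. of_nat (snd y) \<partial>measure_pmf (timed (pmf_of_set (objs_of_size A ?k)) tA))"
        by (simp add: nn_integral_add add_ac)
      also have "(\<integral>\<^sup>+ y. of_nat (snd y) \<partial>measure_pmf (timed (pmf_of_set (objs_of_size A ?k)) tA))
          = (\<integral>\<^sup>+ u. of_nat u \<partial>measure_pmf (bind_pmf (pmf_of_set (objs_of_size A ?k)) tA))"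
        by (simp add: timed_def nn_integral_bind_pmf)
      also have "of_nat (snd z + tasm n) + \<dots> \<le> of_nat (snd z + tasm n) + ennreal (KA * real n)"
      proof (rule add_left_mono)
        have "(\<integral>\<^sup>+ u. of_nat u \<partial>measure_pmf (bind_pmf (pmf_of_set (objs_of_size A ?k)) tA)) \<le> ennreal (KA * real ?k)" by (rule KA(1)[OF k1])
        also have "\<dots> \<le> ennreal (KA * real n)" using kn KA(2) by (intro ennreal_leI mult_left_mono) auto
        finally show "(\<integral>\<^sup>+ u. of_nat u \<partial>measure_pmf (bind_pmf (pmf_of_set (objs_of_size A ?k)) tA)) \<le> ennreal (KA * real n)" .
      qed
      also have "\<dots> = of_nat (snd z) + ennreal (real (tasm n) + KA * real n)"
        using KA(2) by (simp add: ennreal_of_nat_eq_real_of_nat add.assoc)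
      also have "\<dots> \<le> of_nat (snd z) + ennreal ?C" using KT(1) by (intro add_left_mono ennreal_leI) simp
      finally show ?thesis .
    qed
  qed
  also have "\<dots> \<le> mean_time filled + ennreal ?C"
  proof -
    have "emeasure (measure_spmf filled) (space (measure_spmf filled)) \<le> 1" by (rule measure_spmf.subprob_emeasure_le_1)
    then have "ennreal ?C * emeasure (measure_spmf filled) (space (measure_spmf filled)) \<le> ennreal ?C * 1"
      by (rule mult_left_mono) simp
    then show ?thesis by (simp add: nn_integral_add mean_time_def)
  qed
  also have "\<dots> \<le> ennreal (KB * mean * (real n + 1)) + ennreal ?C" using tf by (rule add_right_mono)
  also have "\<dots> = ennreal (KB * mean * (real n + 1) + ?C)" using c0 C0 by (intro ennreal_plus[symmetric]) auto
  also have "\<dots> \<le> ennreal ((2 * (KB * mean) + KA + KT) * real n)"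
  proof (rule ennreal_leI)
    have "KB * mean * (real n + 1) \<le> KB * mean * (2 * real n)" using n c0 by (intro mult_left_mono) auto
    then show "KB * mean * (real n + 1) + ?C \<le> (2 * (KB * mean) + KA + KT) * real n" by (simp add: algebra_simps)
  qed
  finally show ?thesis .
qed

text \<open>Two nested repetitions, with success probabilities \<open>q n\<close> and
  \<open>E n (w n)\<close>; Wald's bound divides by each once.\<close>

lemma expected_time_rejection:
  assumes w: "\<And>k. 0 \<le> w n k" "\<And>k. w n k \<le> 1" and Z: "E n (w n) > 0"
    and K: "mean_time (leap_attempt S A B tA tB tasm n) \<le> ennreal K" "K \<ge> 0"
  shows "expected_time (rejection_generator w S A B tA tB tasm n) \<le> ennreal (K / q n / E n (w n))"
proof -
  have s: "success_prob (rejection_trial w S A B tA tB tasm n) > 0" using trial(2)[of w, OF w] Z by simp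
  have "success_prob (leap_attempt S A B tA tB tasm n) > 0" using attempt(2) qn by simp
  then have "mean_time (leap_generator S A B tA tB tasm n) \<le> ennreal (real 0 + K / success_prob (leap_attempt S A B tA tB tasm n))"
    unfolding leap_generator_def by (rule mean_time_retry[OF attempt(1) _ K])
  then have l: "mean_time (leap_generator S A B tA tB tasm n) \<le> ennreal (K / q n)" by (simp add: attempt(2))
  have "mean_time (rejection_trial w S A B tA tB tasm n) = mean_time (leap_generator S A B tA tB tasm n)"
    unfolding rejection_trial_def mean_time_def nn_integral_bind_spmf
    by (simp add: case_prod_unfold map_spmf_of_pmf measure_spmf_spmf_of_pmf nn_integral_map_pmf)
  then have t: "mean_time (rejection_trial w S A B tA tB tasm n) \<le> ennreal (K / q n)" using l by simp
  have "mean_time (rejection_generator w S A B tA tB tasm n) \<le> ennreal (real 0 + K / q n / success_prob (rejection_trial w S A B tA tB tasm n))"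
    unfolding rejection_generator_def using K(2) qn by (intro mean_time_retry trial(1)[of w, OF w] s t) simp
  then have "mean_time (rejection_generator w S A B tA tB tasm n) \<le> ennreal (K / q n / E n (w n))"
    by (simp add: trial(2)[of w, OF w])
  moreover have "lossless_spmf (rejection_generator w S A B tA tB tasm n)"
    unfolding rejection_generator_def by (rule lossless_retry[OF trial(1)[of w, OF w] s])
  ultimately show ?thesis by (simp add: expected_time_eq)
qed

end

end

section \<open>Admissible schemes\<close>

context renewal
begin

lemma hit_sums:
  assumes y: "0 \<le> y" "y < R"
  shows "(\<lambda>n. hit k n * y ^ n) sums beta y ^ k"
proof (induction k)
  case 0
  have "(\<lambda>n. hit 0 n * y ^ n) = (\<lambda>n. if n = 0 then 1 else 0)" by (auto simp: hit_def)
  then show ?case using sums_single[of 0 "\<lambda>_. 1 :: real"] by simp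
next
  case (Suc k)
  have b: "summable (\<lambda>m. b m * y ^ m)" by (rule summable_beta[OF y])
  have "(\<lambda>n. \<Sum>i\<le>n. (b i * y ^ i) * (hit k (n - i) * y ^ (n - i))) sums ((\<Sum>m. b m * y ^ m) * (\<Sum>n. hit k n * y ^ n))"
    using b Suc.IH y b_nonneg hit_nonneg by (intro Cauchy_product_sums) (auto simp: sums_iff)
  moreover have "(\<Sum>i\<le>n. (b i * y ^ i) * (hit k (n - i) * y ^ (n - i))) = hit (Suc k) n * y ^ n" for n
  proof -
    have "(\<Sum>i\<le>n. (b i * y ^ i) * (hit k (n - i) * y ^ (n - i))) = (\<Sum>i\<le>n. b i * hit k (n - i) * y ^ n)"
      by (intro sum.cong refl) (simp add: mult_ac flip: power_add)
    also have "\<dots> = hit (Suc k) n * y ^ n" by (simp add: hit_def fps_mult_nth atLeast0AtMost sum_distrib_right)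
    finally show ?thesis .
  qed
  ultimately show ?case using Suc.IH by (simp add: beta_def sums_iff)
qed

lemma hit_gt: "n < k \<Longrightarrow> hit k n = 0"
  using startsby_zero_power_prefix[of "Abs_fps b" k] b_0 by (simp add: hit_def)

lemma beta_1: "beta 1 = 1" using b_sums by (simp add: beta_def sums_iff)

lemma isCont_beta: "isCont beta 1"
  unfolding beta_def using b_radius R_gt_1 by (intro isCont_powser[of _ R]) auto

text \<open>Since \<open>beta\<close> is continuous at 1 with value 1, some \<open>y > 1\<close> has
  \<open>beta y < v\<close>; the composed series at \<open>y\<close> is then dominated by the outer
  one at \<open>v\<close>. All terms are nonnegative, so the exchange of sums is done on finite
  squares.\<close>

lemma composed_radius_gt:
  assumes u: "\<And>k. u k \<ge> 0" and v: "v > 1" "summable (\<lambda>k. u k * v ^ k)"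
  shows "\<exists>y>1. summable (\<lambda>n. (\<Sum>k\<le>n. hit k n * u k) * y ^ n)"
proof -
  have "eventually (\<lambda>y. beta y < v) (at 1)"
    using isCont_beta v(1) beta_1 by (intro order_tendstoD[of _ "beta 1"]) (auto simp: isCont_def)
  then obtain d where d: "d > 0" "\<And>y. y \<noteq> 1 \<Longrightarrow> dist y 1 < d \<Longrightarrow> beta y < v" by (auto simp: eventually_at)
  define y where "y = min (1 + d / 2) ((1 + R) / 2)"
  have y: "y > 1" "y < R" using d(1) R_gt_1 by (auto simp: y_def min_def)
  have "dist y 1 < d" using d(1) R_gt_1 by (auto simp: y_def min_def dist_real_def)
  then have bv: "beta y < v" using d(2)[of y] y by simp
  have b0: "beta y > 0" using y by (intro beta_pos) auto
  have "(\<Sum>n<N. (\<Sum>k\<le>n. hit k n * u k) * y ^ n) \<le> (\<Sum>k. u k * v ^ k)" for N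
  proof -
    have "(\<Sum>n<N. (\<Sum>k\<le>n. hit k n * u k) * y ^ n) \<le> (\<Sum>n<N. \<Sum>k<N. hit k n * u k * y ^ n)"
      unfolding sum_distrib_right using u hit_nonneg y by (intro sum_mono sum_mono2) auto
    also have "\<dots> = (\<Sum>k<N. u k * (\<Sum>n<N. hit k n * y ^ n))"
      by (subst sum.swap) (simp add: sum_distrib_left mult_ac)
    also have "\<dots> \<le> (\<Sum>k<N. u k * v ^ k)"
    proof (intro sum_mono mult_left_mono u)
      fix k
      have "(\<Sum>n<N. hit k n * y ^ n) \<le> beta y ^ k"
        using hit_sums[of y k] y hit_nonneg by (intro sum_le_suminf[THEN order_trans]) (auto simp: sums_iff)
      also have "\<dots> \<le> v ^ k" using bv b0 by (intro power_mono) auto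
      finally show "(\<Sum>n<N. hit k n * y ^ n) \<le> v ^ k" .
    qed
    also have "\<dots> \<le> (\<Sum>k. u k * v ^ k)" using v u by (intro sum_le_suminf) auto
    finally show ?thesis .
  qed
  then have "summable (\<lambda>n. (\<Sum>k\<le>n. hit k n * u k) * y ^ n)"
    using u hit_nonneg y by (intro summableI_nonneg_bounded) (auto intro!: sum_nonneg mult_nonneg_nonneg)
  then show ?thesis using y by blast
qed

text \<open>The reverse comparison: some \<open>y < 1\<close> has \<open>beta y > v\<close>, and the
  outer series at \<open>v\<close> is dominated by the composed one at \<open>y\<close>.\<close>

lemma outer_radius_ge:
  assumes u: "\<And>k. u k \<ge> 0" and v: "0 < v" "v < 1"
    and C: "\<And>y. 0 < y \<Longrightarrow> y < 1 \<Longrightarrow> summable (\<lambda>n. (\<Sum>k\<le>n. hit k n * u k) * y ^ n)"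
  shows "summable (\<lambda>k. u k * v ^ k)"
proof -
  have "eventually (\<lambda>y. beta y > v) (at 1)"
    using isCont_beta v(2) beta_1 by (intro order_tendstoD[of _ "beta 1"]) (auto simp: isCont_def)
  then obtain d where d: "d > 0" "\<And>y. y \<noteq> 1 \<Longrightarrow> dist y 1 < d \<Longrightarrow> beta y > v" by (auto simp: eventually_at)
  define y where "y = max (1 - d / 2) (1 / 2)"
  have y: "0 < y" "y < 1" using d(1) by (auto simp: y_def max_def)
  have yR: "y < R" using y R_gt_1 by simp
  have "dist y 1 < d" using d(1) by (auto simp: y_def max_def dist_real_def)
  then have bv: "beta y > v" using d(2)[of y] y by simp
  have s: "(\<lambda>n. \<Sum>k<K. hit k n * u k * y ^ n) sums (\<Sum>k<K. u k * beta y ^ k)" for K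
  proof (rule sums_sum)
    fix k
    have "(\<lambda>n. u k * (hit k n * y ^ n)) sums (u k * beta y ^ k)" using hit_sums[of y k] y yR by (intro sums_mult) auto
    then show "(\<lambda>n. hit k n * u k * y ^ n) sums (u k * beta y ^ k)" by (simp add: mult_ac)
  qed
  have "(\<Sum>k<K. u k * v ^ k) \<le> (\<Sum>n. (\<Sum>k\<le>n. hit k n * u k) * y ^ n)" for K
  proof -
    have "(\<Sum>k<K. u k * v ^ k) \<le> (\<Sum>k<K. u k * beta y ^ k)"
      using bv v by (intro sum_mono mult_left_mono power_mono u) auto
    also have "\<dots> = (\<Sum>n. \<Sum>k<K. hit k n * u k * y ^ n)" using s by (simp add: sums_iff)
    also have "\<dots> \<le> (\<Sum>n. (\<Sum>k\<le>n. hit k n * u k) * y ^ n)"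
    proof (rule suminf_le)
      fix n
      have "(\<Sum>k<K. hit k n * u k * y ^ n) = (\<Sum>k\<in>{..<K} \<inter> {..n}. hit k n * u k * y ^ n)"
        by (rule sum.mono_neutral_right) (auto simp: hit_gt)
      also have "\<dots> \<le> (\<Sum>k\<le>n. hit k n * u k * y ^ n)" using u hit_nonneg y by (intro sum_mono2) auto
      finally show "(\<Sum>k<K. hit k n * u k * y ^ n) \<le> (\<Sum>k\<le>n. hit k n * u k) * y ^ n" by (simp add: sum_distrib_right)
    qed (use s C y in \<open>auto simp: sums_iff\<close>)
    finally show ?thesis .
  qed
  then show ?thesis using u v by (intro summableI_nonneg_bounded) auto
qed

end

context leap
begin

text \<open>The identity \<open>B(\<rho>_C) = \<rho>_A\<close>. If \<open>B(\<rho>_C)\<close> were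
  larger, convergence of \<open>C\<close> inside its disk would carry \<open>A\<close> beyond its
  own radius; if it were smaller, convergence of \<open>A\<close> beyond \<open>B(\<rho>_C)\<close>
  would carry \<open>C\<close> beyond \<open>\<rho>_C\<close>.\<close>

lemma Bx_radius:
  assumes rA: "fps_conv_radius (gen_fun S A) = ereal rA" "rA > 0"
    and rC: "fps_conv_radius (gen_fun S (composition S A B)) = ereal x"
  shows "Bx = rA"
proof -
  \<comment> \<open>The constant term is dropped because the identity of coefficients holds for
    \<open>n \<ge> 1\<close>; convergence is not affected.\<close>
  define u where "u k = (if k = 0 then 0 else g k)" for k
  have u: "u k \<ge> 0" for k using g_pos[of k] by (cases k) (simp_all add: u_def)
  have au: "fps_nth (gen_fun S A) k * v ^ k = u k * (v / Bx) ^ k" if "k \<ge> 1" for k v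
    using that Bx_pos by (simp add: u_def gen_fun_def g_def a_def power_divide)
  have cu: "fps_nth (gen_fun S (composition S A B)) n * (x * y) ^ n = (\<Sum>k\<le>n. hit k n * u k) * y ^ n" if "n \<ge> 1" for n y
  proof -
    have "(\<Sum>k\<le>n. hit k n * u k) = (\<Sum>k\<le>n. hit k n * g k)"
      using that by (intro sum.cong refl) (auto simp: u_def hit_0)
    then show ?thesis using card_Cn[OF that] by (simp add: gen_fun_def power_mult_distrib)
  qed
  have sA: "summable (\<lambda>k. fps_nth (gen_fun S A) k * v ^ k) \<longleftrightarrow> summable (\<lambda>k. u k * (v / Bx) ^ k)" for v
    by (rule summable_cong) (use au in \<open>auto intro!: eventually_sequentiallyI[of 1]\<close>)
  have sC: "summable (\<lambda>n. fps_nth (gen_fun S (composition S A B)) n * (x * y) ^ n) \<longleftrightarrow> summable (\<lambda>n. (\<Sum>k\<le>n. hit k n * u k) * y ^ n)" for y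
    by (rule summable_cong) (use cu in \<open>auto intro!: eventually_sequentiallyI[of 1]\<close>)
  show ?thesis
  proof (rule antisym)
    show "Bx \<le> rA"
    proof (rule ccontr)
      assume "\<not> Bx \<le> rA"
      then have lt: "rA < Bx" by simp
      define m where "m = (rA + Bx) / 2"
      have m: "rA < m" "m < Bx" "m > 0" using lt rA(2) by (auto simp: m_def)
      have "summable (\<lambda>k. u k * (m / Bx) ^ k)"
      proof (rule outer_radius_ge[OF u])
        fix y :: real assume y: "0 < y" "y < 1"
        have "summable (\<lambda>n. fps_nth (gen_fun S (composition S A B)) n * (x * y) ^ n)"
          using y x_pos by (intro summable_fps) (simp add: rC)
        then show "summable (\<lambda>n. (\<Sum>k\<le>n. hit k n * u k) * y ^ n)" unfolding sC .
      qed (use m Bx_pos in auto)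
      then have "summable (\<lambda>k. fps_nth (gen_fun S A) k * m ^ k)" unfolding sA .
      then have "ereal (norm m) \<le> fps_conv_radius (gen_fun S A)" unfolding fps_conv_radius_def by (rule conv_radius_geI)
      then show False using m rA by simp
    qed
    show "rA \<le> Bx"
    proof (rule ccontr)
      assume "\<not> rA \<le> Bx"
      then have lt: "Bx < rA" by simp
      define m where "m = (rA + Bx) / 2"
      have m: "Bx < m" "m < rA" "m > 0" using lt Bx_pos by (auto simp: m_def)
      have "summable (\<lambda>k. fps_nth (gen_fun S A) k * m ^ k)" using m by (intro summable_fps) (simp add: rA)
      then have "summable (\<lambda>k. u k * (m / Bx) ^ k)" unfolding sA .
      then obtain y where y: "y > 1" "summable (\<lambda>n. (\<Sum>k\<le>n. hit k n * u k) * y ^ n)"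
        using composed_radius_gt[of u "m / Bx"] u m Bx_pos by auto
      have "summable (\<lambda>n. fps_nth (gen_fun S (composition S A B)) n * (x * y) ^ n)" unfolding sC by (rule y(2))
      then have "ereal (norm (x * y)) \<le> fps_conv_radius (gen_fun S (composition S A B))" unfolding fps_conv_radius_def by (rule conv_radius_geI)
      then show False using y(1) x_pos by (simp add: rC)
    qed
  qed
qed

lemma mu_eq: "mu S A B = mean"
proof -
  have "mu S A B = (\<Sum>m. b m * real m)" unfolding mu_def
    using summable_b_mom[of 1] by (intro expectation_boltzmann_size) (simp add: mult.commute)
  then show ?thesis by (simp add: mean_def mult.commute)
qed

lemma sigma_eq: "sigma S A B = sqrt var"
proof -
  have "measure_pmf.variance (boltzmann S B (rho S A B)) (\<lambda>\<beta>. real (osize B \<beta>)) = (\<Sum>m. b m * (real m - mean)\<^sup>2)"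
    unfolding mu_eq[unfolded mu_def]
    using summable_var by (intro expectation_boltzmann_size[of "\<lambda>m. (real m - mean)\<^sup>2"]) (simp add: mult.commute)
  then show ?thesis by (simp add: sigma_def var_def mult.commute)
qed

lemma scaled_eq: "scaled S A B n k = T n k"
  by (simp add: scaled_def T_def mu_eq sigma_eq)

lemma renewal_coeff_eq:
  assumes "x = rho S A B" "Bx = eval_fps (gen_fun S B) x"
  shows "renewal_coeff S A B n = q n"
proof -
  have "fps_const (1 / Bx) * (gen_fun S B oo (fps_const x * fps_X)) = Abs_fps b"
    by (rule fps_ext) (simp add: fps_compose_linear b_eq gen_fun_def)
  then show ?thesis unfolding renewal_coeff_def q_eq Let_def assms(1)[symmetric] assms(2)[symmetric] by simp
qed

lemma distortion_eq:
  assumes "x = rho S A B" "Bx = eval_fps (gen_fun S B) x" and n: "n \<ge> 1" "q n > 0"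
  shows "distortion S A B n k = E n g / g k"
proof -
  have "fps_nth (gen_fun S (composition S A B)) n * x ^ n = q n * E n g"
    using card_Cn[OF n(1)] n(2) by (simp add: gen_fun_def E_def)
  moreover have "fps_nth (gen_fun S A) k * Bx ^ k = g k" by (simp add: g_def a_def gen_fun_def)
  ultimately show ?thesis
    unfolding distortion_def renewal_coeff_eq[OF assms(1,2)] assms(1)[symmetric] assms(2)[symmetric] using n(2) by simp
qed

end

section \<open>From admissible schemes to the renewal setting\<close>

lemma not_periodic_imp:
  assumes "\<not> periodic F" "d \<ge> 2"
  shows "\<exists>m. fps_nth F m \<noteq> 0 \<and> \<not> d dvd m"
proof (rule ccontr)
  assume "\<not> (\<exists>m. fps_nth F m \<noteq> 0 \<and> \<not> d dvd m)"
  then have "{n. fps_nth F n \<noteq> 0} \<subseteq> {0 + d * j | j. True}" by (auto elim!: dvdE)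
  then show False using assms unfolding periodic_def by blast
qed

text \<open>A support with a single point \<open>m\<close> lies in \<open>m + 2 \<nat>\<close>, and
  an empty one in any progression.\<close>

lemma not_periodic_nondeg:
  assumes "\<not> periodic F"
  shows "\<exists>m m'. fps_nth F m \<noteq> 0 \<and> fps_nth F m' \<noteq> 0 \<and> m \<noteq> m'"
proof (rule ccontr)
  assume c: "\<not> ?thesis"
  obtain m where m: "fps_nth F m \<noteq> 0" using not_periodic_imp[OF assms, of 2] by auto
  have "{n. fps_nth F n \<noteq> 0} \<subseteq> {m + 2 * j | j. True}"
  proof
    fix n assume "n \<in> {n. fps_nth F n \<noteq> 0}"
    then have "n = m + 2 * 0" using c m by auto
    then show "n \<in> {m + 2 * j | j. True}" by blast
  qed
  then show False using assms unfolding periodic_def by (metis order_refl)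
qed

lemma gen_fun_nonneg: "fps_nth (gen_fun S C) n \<ge> 0"
  by (cases S) (simp_all add: gen_fun_def delta_def)

text \<open>The total mass is summed size by size; with finitely many objects of each size it
  becomes the series of \<open>B(z) / B(z)\<close>.\<close>

lemma pmf_boltzmann:
  assumes fin: "\<And>m. finite (objs_of_size B m)" and z: "z > 0" and Bz: "eval_fps (gen_fun S B) z > 0"
    and s: "summable (\<lambda>m. fps_nth (gen_fun S B) m * z ^ m)"
  shows "pmf (boltzmann S B z) \<beta> = (if \<beta> \<in> objs B then delta S (osize B \<beta>) * z ^ osize B \<beta> / eval_fps (gen_fun S B) z else 0)"
proof -
  let ?B = "eval_fps (gen_fun S B) z"
  define f where "f \<beta> = (if \<beta> \<in> objs B then delta S (osize B \<beta>) * z ^ osize B \<beta> / ?B else 0)" for \<beta>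
  have d: "delta S m > 0" for m by (cases S) (simp_all add: delta_def)
  have f0: "f \<beta> \<ge> 0" for \<beta> using d[of "osize B \<beta>"] z Bz by (simp add: f_def)
  let ?t = "\<lambda>m. fps_nth (gen_fun S B) m * z ^ m / ?B"
  have part: "ennreal (f \<beta>) = (\<Sum>m. ennreal (f \<beta>) * indicator (objs_of_size B m) \<beta>)" for \<beta>
  proof -
    have "(\<lambda>m. ennreal (f \<beta>) * indicator (objs_of_size B m) \<beta>) sums (\<Sum>m\<in>{osize B \<beta>}. ennreal (f \<beta>) * indicator (objs_of_size B m) \<beta>)"
      by (rule sums_finite) (auto simp: objs_of_size_def)
    moreover have "ennreal (f \<beta>) * indicator (objs_of_size B (osize B \<beta>)) \<beta> = ennreal (f \<beta>)"
      by (auto simp: objs_of_size_def f_def)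
    ultimately show ?thesis by (simp add: sums_iff)
  qed
  have "(\<integral>\<^sup>+ \<beta>. ennreal (f \<beta>) \<partial>count_space UNIV) = (\<integral>\<^sup>+ \<beta>. (\<Sum>m. ennreal (f \<beta>) * indicator (objs_of_size B m) \<beta>) \<partial>count_space UNIV)"
    by (rule nn_integral_cong) (rule part)
  also have "\<dots> = (\<Sum>m. \<integral>\<^sup>+ \<beta>. ennreal (f \<beta>) * indicator (objs_of_size B m) \<beta> \<partial>count_space UNIV)"
    by (rule nn_integral_suminf) simp
  also have "\<dots> = (\<Sum>m. ennreal (?t m))"
  proof (rule suminf_cong)
    fix m
    have "(\<integral>\<^sup>+ \<beta>. ennreal (f \<beta>) * indicator (objs_of_size B m) \<beta> \<partial>count_space UNIV) = (\<Sum>\<beta>\<in>objs_of_size B m. ennreal (f \<beta>) * indicator (objs_of_size B m) \<beta>)"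
      using fin by (intro nn_integral_count_space') auto
    also have "\<dots> = (\<Sum>\<beta>\<in>objs_of_size B m. ennreal (delta S m * z ^ m / ?B))"
      by (intro sum.cong refl) (auto simp: f_def objs_of_size_def)
    also have "\<dots> = ennreal (?t m)"
      using d[of m] z Bz by (subst sum_ennreal) (simp_all add: gen_fun_def)
    finally show "(\<integral>\<^sup>+ \<beta>. ennreal (f \<beta>) * indicator (objs_of_size B m) \<beta> \<partial>count_space UNIV) = ennreal (?t m)" .
  qed
  also have "\<dots> = ennreal (\<Sum>m. ?t m)"
    using gen_fun_nonneg[of S B] z Bz s by (intro suminf_ennreal2 summable_divide) auto
  also have "(\<Sum>m. ?t m) = 1" using suminf_divide[OF s, of ?B] Bz by (simp add: eval_fps_def)
  finally have "(\<integral>\<^sup>+ \<beta>. ennreal (f \<beta>) \<partial>count_space UNIV) = 1" by simp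
  then show ?thesis unfolding boltzmann_def f_def[symmetric] using f0 by (intro pmf_embed_pmf)
qed

lemma admissible_leap:
  assumes adm: "admissible S A B"
  defines "x \<equiv> rho S A B"
  defines "Bx \<equiv> eval_fps (gen_fun S B) x"
  defines "b \<equiv> \<lambda>m. delta S m * real (card (objs_of_size B m)) * x ^ m / Bx"
  shows "\<exists>R. leap S A B b R x Bx" and "fps_conv_radius (gen_fun S (composition S A B)) = ereal x"
proof -
  let ?gB = "gen_fun S B"
  have sch: "is_comb_class S A" "is_comb_class S B" "objs_of_size B 0 = {}"
      "0 < fps_conv_radius (gen_fun S (composition S A B))" "fps_conv_radius (gen_fun S (composition S A B)) < \<infinity>"
    and sup: "fps_conv_radius ?gB > fps_conv_radius (gen_fun S (composition S A B))" and ap: "\<not> periodic ?gB"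
    and Ak: "\<And>k. k \<ge> 1 \<Longrightarrow> fps_nth (gen_fun S A) k \<noteq> 0"
    using adm by (auto simp: admissible_def composition_scheme_def)
  show rC: "fps_conv_radius (gen_fun S (composition S A B)) = ereal x"
    unfolding x_def rho_def using sch(4,5) by (cases "fps_conv_radius (gen_fun S (composition S A B))") auto
  have x0: "x > 0" using sch(4) unfolding rC by simp
  \<comment> \<open>Supercriticality leaves room for a radius strictly between
    \<open>\<rho>_C\<close> and \<open>\<rho>_B\<close>; the quotient \<open>r / x\<close> is the
    \<open>R > 1\<close> of the renewal locale.\<close>
  obtain r where r: "ereal x < ereal r" "ereal r < fps_conv_radius ?gB" using ereal_dense2[OF sup] unfolding rC by auto
  have xr: "x < r" using r(1) by simp
  have sr: "summable (\<lambda>m. fps_nth ?gB m * r ^ m)" using r xr x0 by (intro summable_fps) simp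
  have sx: "summable (\<lambda>m. fps_nth ?gB m * x ^ m)" using sup x0 by (intro summable_fps) (simp add: rC)
  have d: "delta S m > 0" for m by (cases S) (simp_all add: delta_def)
  obtain m m' where mm: "fps_nth ?gB m \<noteq> 0" "fps_nth ?gB m' \<noteq> 0" "m \<noteq> m'" using not_periodic_nondeg[OF ap] by blast
  have Bx: "Bx > 0"
  proof -
    have "0 < fps_nth ?gB m * x ^ m" using mm(1) gen_fun_nonneg[of S B m] x0 by simp
    also have "\<dots> \<le> (\<Sum>m. fps_nth ?gB m * x ^ m)"
      using sum_le_suminf[OF sx, of "{m}"] gen_fun_nonneg[of S B] x0 by simp
    finally show ?thesis by (simp add: Bx_def eval_fps_def)
  qed
  have b: "b m = fps_nth ?gB m * x ^ m / Bx" for m by (simp add: b_def gen_fun_def)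
  have b0: "b m \<noteq> 0 \<longleftrightarrow> fps_nth ?gB m \<noteq> 0" for m using x0 Bx by (simp add: b)
  have "leap S A B b (r / x) x Bx"
  proof unfold_locales
    show "is_comb_class S A" "is_comb_class S B" "objs_of_size B 0 = {}" by fact+
    show "objs_of_size A k \<noteq> {}" if "1 \<le> k" for k using Ak[OF that] by (auto simp: gen_fun_def)
    show "b m \<ge> 0" for m using gen_fun_nonneg[of S B m] x0 Bx by (simp add: b)
    show "b 0 = 0" using sch(3) by (simp add: b_def)
    show "r / x > 1" using xr x0 by simp
    show "summable (\<lambda>m. b m * (r / x) ^ m)"
      using summable_divide[OF sr, of Bx] x0 by (simp add: b power_divide)
    have "(\<lambda>m. fps_nth ?gB m * x ^ m) sums Bx" using sx by (simp add: Bx_def eval_fps_def summable_sums)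
    then have "(\<lambda>m. fps_nth ?gB m * x ^ m / Bx) sums (Bx / Bx)" by (rule sums_divide)
    then show "b sums 1" using Bx by (simp add: b[abs_def])
    show "\<exists>m. b m \<noteq> 0 \<and> \<not> d dvd m" if "2 \<le> d" for d using not_periodic_imp[OF ap that] by (simp add: b0)
    show "\<exists>m m'. b m \<noteq> 0 \<and> b m' \<noteq> 0 \<and> m \<noteq> m'" using not_periodic_nondeg[OF ap] by (simp add: b0)
    show "x > 0" "Bx > 0" by fact+
    show "b m = delta S m * real (card (objs_of_size B m)) * x ^ m / Bx" for m by (simp add: b_def)
    show "pmf (boltzmann S B (rho S A B)) \<beta> = (if \<beta> \<in> objs B then delta S (osize B \<beta>) * x ^ osize B \<beta> / Bx else 0)" for \<beta>
      unfolding x_def[symmetric] Bx_def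
      using sch(2) x0 Bx sx by (intro pmf_boltzmann) (auto simp: is_comb_class_def Bx_def)
  qed
  then show "\<exists>R. leap S A B b R x Bx" by blast
qed

section \<open>Expansion of the distortion factor in real powers of n\<close>

context weighted_renewal
begin

lemma sn_powr: "n > 0 \<Longrightarrow> sn n ^ i = real n powr (- real i / 2)"
  by (simp add: sn_def powr_half_sqrt[symmetric] powr_minus_divide[symmetric] powr_power)

lemma eta_powr:
  assumes "n > 0"
  shows "eta n k ^ i = ((1 + (T n k)\<^sup>2) / real n) powr (real i / 2)"
proof -
  have p: "(1 + (T n k)\<^sup>2) / real n > 0" using assms by (simp add: add_pos_nonneg)
  have "eta n k = sqrt ((1 + (T n k)\<^sup>2) / real n)" by (simp add: eta_def sn_def real_sqrt_divide)
  also have "\<dots> = ((1 + (T n k)\<^sup>2) / real n) powr (1 / 2)" using p by (simp add: powr_half_sqrt)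
  finally have e: "eta n k = ((1 + (T n k)\<^sup>2) / real n) powr (1 / 2)" .
  have "z > 0 \<Longrightarrow> (z powr (1 / 2)) ^ i = z powr (real i / 2)" for z :: real by (simp add: powr_power)
  then show ?thesis unfolding e using p .
qed

text \<open>A range \<open>\<epsilon> n = o(sqrt n)\<close> is eventually below
  \<open>\<delta> * sqrt n\<close> for the \<open>\<delta>\<close> of the uniform expansion, so one
  expansion serves all such ranges.\<close>

lemma D_powr_expansion:
  "\<exists>P. (\<forall>i. parity_poly i (P i)) \<and> (\<forall>\<epsilon> r. \<epsilon> \<in> o(\<lambda>n. sqrt (real n)) \<longrightarrow>
     (\<exists>K. \<forall>\<^sub>F n in sequentially. \<forall>k. \<bar>T n k\<bar> \<le> \<epsilon> n \<longrightarrow>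
       \<bar>D n k - (1 + (\<Sum>i=1..r. poly (P i) (T n k) * real n powr (- real i / 2)))\<bar>
         \<le> K * ((1 + (T n k)\<^sup>2) / real n) powr ((real r + 1) / 2)))"
proof -
  obtain P where P: "\<And>i. parity_poly i (P i)" "P 0 = 1" "\<And>r. EXP r D P" using D_expansion by blast
  have "\<exists>K. \<forall>\<^sub>F n in sequentially. \<forall>k. \<bar>T n k\<bar> \<le> \<epsilon> n \<longrightarrow>
       \<bar>D n k - (1 + (\<Sum>i=1..r. poly (P i) (T n k) * real n powr (- real i / 2)))\<bar>
         \<le> K * ((1 + (T n k)\<^sup>2) / real n) powr ((real r + 1) / 2)"
    if e: "\<epsilon> \<in> o(\<lambda>n. sqrt (real n))" for \<epsilon> r
  proof -
    obtain K \<delta> where K: "\<delta> > 0" "\<forall>\<^sub>F n in sequentially. \<forall>k. \<bar>T n k\<bar> \<le> \<delta> * sqrt (real n) \<longrightarrow>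
       \<bar>D n k - (\<Sum>m\<le>r. poly (P m) (T n k) * sn n ^ m)\<bar> \<le> K * eta n k ^ Suc r"
      using EXP_E[OF P(3)[of r]] by blast
    have ev: "\<forall>\<^sub>F n in sequentially. norm (\<epsilon> n) \<le> \<delta> * norm (sqrt (real n))"
      using landau_o.smallD[OF e K(1)] .
    have "\<forall>\<^sub>F n in sequentially. \<forall>k. \<bar>T n k\<bar> \<le> \<epsilon> n \<longrightarrow>
       \<bar>D n k - (1 + (\<Sum>i=1..r. poly (P i) (T n k) * real n powr (- real i / 2)))\<bar>
         \<le> K * ((1 + (T n k)\<^sup>2) / real n) powr ((real r + 1) / 2)"
      using K(2) ev eventually_gt_at_top[of 0]
    proof eventually_elim
      case (elim n)
      show ?case
      proof (intro allI impI)
        fix k assume "\<bar>T n k\<bar> \<le> \<epsilon> n"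
        then have "\<bar>T n k\<bar> \<le> \<delta> * sqrt (real n)" using elim(2) by simp
        then have "\<bar>D n k - (\<Sum>m\<le>r. poly (P m) (T n k) * sn n ^ m)\<bar> \<le> K * eta n k ^ Suc r" using elim(1) by blast
        moreover have "(\<Sum>m\<le>r. poly (P m) (T n k) * sn n ^ m) = 1 + (\<Sum>i=1..r. poly (P i) (T n k) * real n powr (- real i / 2))"
        proof -
          have "{..r} = insert 0 {1..r}" by auto
          then have "(\<Sum>m\<le>r. poly (P m) (T n k) * sn n ^ m) = poly (P 0) (T n k) * sn n ^ 0 + (\<Sum>i=1..r. poly (P i) (T n k) * sn n ^ i)"
            by (simp only:) (rule sum.insert, auto)
          then show ?thesis using elim(3) by (simp only: sn_powr[OF elim(3)] P(2)) simp
        qed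
        moreover have "eta n k ^ Suc r = ((1 + (T n k)\<^sup>2) / real n) powr ((real r + 1) / 2)"
          unfolding eta_powr[OF elim(3)] by (simp add: add.commute)
        ultimately show "\<bar>D n k - (1 + (\<Sum>i=1..r. poly (P i) (T n k) * real n powr (- real i / 2)))\<bar>
         \<le> K * ((1 + (T n k)\<^sup>2) / real n) powr ((real r + 1) / 2)" by (simp only:)
      qed
    qed
    then show ?thesis by blast
  qed
  then show ?thesis using P(1) by blast
qed

end

text \<open>Here \<open>\<kappa>\<close> is the whole leading constant, including
  \<open>1 / Gamma s\<close>. Its sign is forced: \<open>g k\<close> is positive and its quotient by
  \<open>\<kappa> * k^(s-1)\<close> tends to 1. The update \<open>f(0 := 1)\<close> supplies the
  leading term that a sum starting at 1 leaves out.\<close>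

lemma (in leap) weighted_renewal_core:
  fixes f :: "nat \<Rightarrow> real"
  assumes ex: "\<And>r. (\<lambda>n. fps_nth (gen_fun S A) n / (\<kappa> * Bx powr (- real n) * real n powr (s - 1))
                  - (1 + (\<Sum>i=1..r. f i * real n powr (- real i)))) \<in> O(\<lambda>n. real n powr (- real r - 1))"
  shows "weighted_renewal b R (\<lambda>k. g k / \<kappa>) (s - 1) (f(0 := 1))" and "\<kappa> > 0"
proof -
  let ?h = "\<lambda>k. g k / \<kappa>"
  have h: "asymp_exp ?h (s - 1) (f(0 := 1))"
    unfolding asymp_exp_def
  proof
    fix N
    obtain c where c: "\<forall>\<^sub>F n in sequentially. norm (fps_nth (gen_fun S A) n / (\<kappa> * Bx powr (- real n) * real n powr (s - 1))
                  - (1 + (\<Sum>i=1..N. f i * real n powr (- real i)))) \<le> c * norm (real n powr (- real N - 1))"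
      using landau_o.bigE[OF ex[of N]] by blast
    have "\<forall>\<^sub>F k in sequentially. \<bar>?h k / real k powr (s - 1) - (\<Sum>l\<le>N. (f(0 := 1)) l * (1 / real k) ^ l)\<bar> \<le> c * (1 / real k) ^ Suc N"
      using c eventually_gt_at_top[of 0]
    proof eventually_elim
      case (elim k)
      have pw: "real k powr (- real i) = (1 / real k) ^ i" for i
        using elim(2) by (simp add: powr_minus_divide powr_realpow power_one_over)
      have "Bx powr (- real k) = 1 / Bx ^ k" using Bx_pos by (simp add: powr_minus_divide powr_realpow)
      then have 1: "fps_nth (gen_fun S A) k / (\<kappa> * Bx powr (- real k) * real k powr (s - 1)) = ?h k / real k powr (s - 1)"
        using Bx_pos by (simp add: g_def a_def gen_fun_def)
      have "{..N} = insert 0 {1..N}" by auto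
      then have "(\<Sum>l\<le>N. (f(0 := 1)) l * (1 / real k) ^ l) = (f(0 := 1)) 0 * (1 / real k) ^ 0 + (\<Sum>l=1..N. (f(0 := 1)) l * (1 / real k) ^ l)"
        by (simp only:) (rule sum.insert, auto)
      also have "(\<Sum>l=1..N. (f(0 := 1)) l * (1 / real k) ^ l) = (\<Sum>l=1..N. f l * (1 / real k) ^ l)" by (intro sum.cong) auto
      finally have 2: "(\<Sum>l\<le>N. (f(0 := 1)) l * (1 / real k) ^ l) = 1 + (\<Sum>l=1..N. f l * (1 / real k) ^ l)" by simp
      have 3: "norm (real k powr (- real N - 1)) = (1 / real k) ^ Suc N"
      proof -
        have "- real N - 1 = - real (Suc N)" by simp
        then show ?thesis by (simp only: pw) simp
      qed
      show ?case using elim(1) unfolding 1 2 3 pw by simp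
    qed
    then show "\<exists>C. \<forall>\<^sub>F k in sequentially. \<bar>?h k / real k powr (s - 1) - (\<Sum>l\<le>N. (f(0 := 1)) l * (1 / real k) ^ l)\<bar> \<le> C * (1 / real k) ^ Suc N"
      by blast
  qed
  have "(\<lambda>k. ?h k / real k powr (s - 1)) \<longlonglongrightarrow> 1" using asymp_exp_tendsto[OF h] by simp
  then have "\<forall>\<^sub>F k in sequentially. ?h k / real k powr (s - 1) > 0" by (rule order_tendstoD) simp
  then have "\<forall>\<^sub>F k in sequentially. ?h k / real k powr (s - 1) > 0 \<and> k \<ge> 1"
    using eventually_ge_at_top[of 1] by (rule eventually_conj)
  then obtain k where k: "?h k / real k powr (s - 1) > 0" "k \<ge> 1" using eventually_happens by force
  show \<kappa>: "\<kappa> > 0"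
  proof (rule ccontr)
    assume "\<not> \<kappa> > 0"
    then have "?h k / real k powr (s - 1) \<le> 0" using g_pos[OF k(2)] by (intro divide_nonpos_nonneg divide_nonneg_nonpos) auto
    then show False using k(1) by simp
  qed
  show "weighted_renewal b R ?h (s - 1) (f(0 := 1))"
    by unfold_locales (use h g_pos \<kappa> in auto)
qed

lemma integral_std_normal:
  fixes f :: "real \<Rightarrow> real"
  assumes "f \<in> borel_measurable borel"
  shows "1 / sqrt (2 * pi) * (LBINT t. exp (- t\<^sup>2 / 2) * f t) = integral\<^sup>L std_normal_distribution f"
proof -
  have "integral\<^sup>L std_normal_distribution f = (LBINT t. std_normal_density t *\<^sub>R f t)"
    using assms by (intro integral_density) auto
  also have "\<dots> = (LBINT t. 1 / sqrt (2 * pi) * (exp (- t\<^sup>2 / 2) * f t))"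
    by (intro Bochner_Integration.integral_cong) (simp_all add: std_normal_density_def)
  also have "\<dots> = 1 / sqrt (2 * pi) * (LBINT t. exp (- t\<^sup>2 / 2) * f t)" by (rule integral_mult_right_zero)
  finally show ?thesis ..
qed

lemma ennreal_linear_bound:
  assumes "\<exists>K. \<forall>i\<in>X. F i \<le> ennreal (K * real (m i))"
  obtains K where "K \<ge> 0" "\<And>i. i \<in> X \<Longrightarrow> F i \<le> ennreal (K * real (m i))"
proof -
  obtain K where K: "\<And>i. i \<in> X \<Longrightarrow> F i \<le> ennreal (K * real (m i))" using assms by blast
  have "F i \<le> ennreal (max K 0 * real (m i))" if "i \<in> X" for i
    using K[OF that] by (rule order_trans) (intro ennreal_leI mult_right_mono, auto)
  then show ?thesis using that[of "max K 0"] by simp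
qed

theorem proposition9:
  fixes S :: setting and A :: "'a comb_class" and B :: "'b comb_class"
    and s a I c :: real and r :: nat
    and p :: "nat \<Rightarrow> real poly" and y w :: "nat \<Rightarrow> nat \<Rightarrow> real"
    and tA :: "'a \<Rightarrow> nat pmf" and tB :: "'b \<Rightarrow> nat pmf" and tasm :: "nat \<Rightarrow> nat"
    and \<pi> \<pi>_rej :: "nat \<Rightarrow> ('a, 'b) composite \<Rightarrow> real"
  assumes "admissible S A B"
    and "has_singular_exponent (gen_fun S A) s"
    and "has_complete_expansion (gen_fun S A) s"
    and "0 < a" and "a < 1"
    and "p = distortion_poly S A B"
    and "y = (\<lambda>n k. 1 + (\<Sum>i=1..r. poly (p i) (scaled S A B n k) * real n powr (- real i / 2)))"
    and "w = (\<lambda>n k. if y n k \<ge> a then a / y n k else 1)"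
    and "\<pi> = (\<lambda>n. pmf (pmf_of_set (objs_of_size (composition S A B) n)))"
    and "\<pi>_rej = (\<lambda>n. spmf (map_spmf fst (rejection_generator w S A B tA tB tasm n)))"
    and "I = 1 / sqrt (2 * pi) * (LBINT t. exp (- t\<^sup>2 / 2) * poly (p (r + 1)) t)"
    and "c = 1 / sqrt (2 * pi) * (LBINT t. exp (- t\<^sup>2 / 2) * \<bar>poly (p (r + 1)) t - I\<bar>)"
  shows
    "(\<lambda>n. tv_dist (objs_of_size (composition S A B) n) (\<pi> n) (\<pi>_rej n)
            - c / 2 * real n powr (- (real r + 1) / 2))
       \<in> o(\<lambda>n. real n powr (- (real r + 1) / 2))
     \<and> (\<lambda>n. success_prob (rejection_trial w S A B tA tB tasm n)) \<longlonglongrightarrow> a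
     \<and> ((\<exists>K. \<forall>k\<ge>1. (\<integral>\<^sup>+ u. of_nat u
                \<partial>measure_pmf (bind_pmf (pmf_of_set (objs_of_size A k)) tA)) \<le> ennreal (K * real k)) \<and>
        (\<exists>K. \<forall>\<beta>\<in>objs B. (\<integral>\<^sup>+ u. of_nat u \<partial>measure_pmf (tB \<beta>)) \<le> ennreal (K * real (osize B \<beta>))) \<and>
        (\<exists>K. \<forall>n\<ge>1. real (tasm n) \<le> K * real n)
        \<longrightarrow> (\<exists>K. \<forall>\<^sub>F n in sequentially.
               expected_time (rejection_generator w S A B tA tB tasm n) \<le> ennreal (K * real n)))"
proof -
  define x where "x = rho S A B"
  define Bx where "Bx = eval_fps (gen_fun S B) x"
  define b where "b = (\<lambda>m. delta S m * real (card (objs_of_size B m)) * x ^ m / Bx)"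
  obtain R where leap: "leap S A B b R x Bx"
    using admissible_leap(1)[OF assms(1)] unfolding b_def Bx_def x_def by blast
  have rC: "fps_conv_radius (gen_fun S (composition S A B)) = ereal x"
    unfolding x_def by (rule admissible_leap(2)[OF assms(1)])
  interpret L: leap S A B b R x Bx by (rule leap)
  obtain \<kappa> f where sing: "singular_expansion (gen_fun S A) s \<kappa>" and
    ex: "\<And>r. (\<lambda>n. fps_nth (gen_fun S A) n / (\<kappa> / Gamma s * real_of_ereal (fps_conv_radius (gen_fun S A)) powr (- real n)
                                   * real n powr (s - 1))
                  - (1 + (\<Sum>i=1..r. f i * real n powr (- real i))))
              \<in> O(\<lambda>n. real n powr (- real r - 1))"
    using assms(3) unfolding has_complete_expansion_def by blast
  \<comment> \<open>The powers of \<open>\<rho>_A\<close> in the expansion of the coefficients of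
    \<open>A\<close> thereby become the powers of \<open>B(\<rho>)\<close> in the weights.\<close>
  have rA: "fps_conv_radius (gen_fun S A) = ereal Bx"
  proof -
    have "0 < fps_conv_radius (gen_fun S A)" "fps_conv_radius (gen_fun S A) < \<infinity>"
      using sing by (auto simp: singular_expansion_def)
    then obtain t where t: "fps_conv_radius (gen_fun S A) = ereal t" "t > 0"
      by (cases "fps_conv_radius (gen_fun S A)") auto
    then show ?thesis using L.Bx_radius[OF t rC] by simp
  qed
  define h where "h = (\<lambda>k. L.g k / (\<kappa> / Gamma s))"
  have ex': "\<And>r. (\<lambda>n. fps_nth (gen_fun S A) n / (\<kappa> / Gamma s * Bx powr (- real n) * real n powr (s - 1))
                  - (1 + (\<Sum>i=1..r. f i * real n powr (- real i)))) \<in> O(\<lambda>n. real n powr (- real r - 1))"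
    using ex unfolding rA real_of_ereal.simps .
  have \<kappa>: "\<kappa> / Gamma s > 0" by (rule L.weighted_renewal_core(2)[OF ex'])
  interpret W: weighted_renewal b R h "s - 1" "f(0 := 1)"
    unfolding h_def by (rule L.weighted_renewal_core(1)[OF ex'])
  have Eh: "W.Eh n = L.E n L.g / (\<kappa> / Gamma s)" for n
  proof -
    have "L.E n (\<lambda>k. L.g k / t) = L.E n L.g / t" for t by (simp add: L.E_def sum_divide_distrib mult_ac)
    then show ?thesis unfolding W.Eh_def unfolding h_def .
  qed
  \<comment> \<open>The leading constant cancels between the mean of the weights and the
    weight.\<close>
  have D: "W.D n k = L.E n L.g / L.g k" for n k
    unfolding W.D_def Eh unfolding h_def using less_imp_neq[OF \<kappa>] by auto
  have dist: "distortion S A B n k = W.D n k" if "n \<ge> 1" "L.q n > 0" for n k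
    unfolding D by (rule L.distortion_eq[OF x_def Bx_def that])
  have q_ev: "\<forall>\<^sub>F n in sequentially. n \<ge> 1 \<and> L.q n > 0"
    using eventually_ge_at_top[of 1] L.q_pos_ev by (rule eventually_conj)
  have "\<exists>P. distortion_expansion S A B P"
  proof -
    obtain P where P: "\<And>i. parity_poly i (P i)" "\<And>\<epsilon> r. \<epsilon> \<in> o(\<lambda>n. sqrt (real n)) \<Longrightarrow>
     (\<exists>K. \<forall>\<^sub>F n in sequentially. \<forall>k. \<bar>L.T n k\<bar> \<le> \<epsilon> n \<longrightarrow>
       \<bar>W.D n k - (1 + (\<Sum>i=1..r. poly (P i) (L.T n k) * real n powr (- real i / 2)))\<bar>
         \<le> K * ((1 + (L.T n k)\<^sup>2) / real n) powr ((real r + 1) / 2))"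
      using W.D_powr_expansion by blast
    have "distortion_expansion S A B P"
      unfolding distortion_expansion_def Let_def L.scaled_eq
    proof (intro conjI allI impI)
      fix \<epsilon> :: "nat \<Rightarrow> real" and r assume "\<epsilon> \<in> o(\<lambda>n. sqrt (real n))"
      then obtain K where "\<forall>\<^sub>F n in sequentially. \<forall>k. \<bar>L.T n k\<bar> \<le> \<epsilon> n \<longrightarrow>
       \<bar>W.D n k - (1 + (\<Sum>i=1..r. poly (P i) (L.T n k) * real n powr (- real i / 2)))\<bar>
         \<le> K * ((1 + (L.T n k)\<^sup>2) / real n) powr ((real r + 1) / 2)" using P(2) by blast
      then have "\<forall>\<^sub>F n in sequentially. \<forall>k. \<bar>L.T n k\<bar> \<le> \<epsilon> n \<longrightarrow>
       \<bar>distortion S A B n k - (1 + (\<Sum>i=1..r. poly (P i) (L.T n k) * real n powr (- real i / 2)))\<bar>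
         \<le> K * ((1 + (L.T n k)\<^sup>2) / real n) powr ((real r + 1) / 2)"
        using q_ev by eventually_elim (simp add: dist)
      then show "\<exists>K. \<forall>\<^sub>F n in sequentially. \<forall>k. \<bar>L.T n k\<bar> \<le> \<epsilon> n \<longrightarrow>
       \<bar>distortion S A B n k - (1 + (\<Sum>i=1..r. poly (P i) (L.T n k) * real n powr (- real i / 2)))\<bar>
         \<le> K * ((1 + (L.T n k)\<^sup>2) / real n) powr ((real r + 1) / 2)" by blast
    qed (use P(1) parity_poly_degree parity_poly_minus in blast)+
    then show ?thesis by blast
  qed
  \<comment> \<open>Existence passes the defining property on to the chosen polynomials; the degree
    bounds and the expansion are extracted from it.\<close>
  then have "distortion_expansion S A B p" unfolding assms(6) distortion_poly_def by (rule someI_ex)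
  then have deg: "\<And>i. i \<ge> 1 \<Longrightarrow> degree (p i) \<le> i" and
    pex: "\<And>\<epsilon> r. \<epsilon> \<in> o(\<lambda>n. sqrt (real n)) \<Longrightarrow>
        (\<exists>K. \<forall>\<^sub>F n in sequentially. \<forall>k. \<bar>L.T n k\<bar> \<le> \<epsilon> n \<longrightarrow>
           \<bar>distortion S A B n k - (1 + (\<Sum>i=1..r. poly (p i) (L.T n k) * real n powr (- real i / 2)))\<bar>
             \<le> K * ((1 + (L.T n k)\<^sup>2) / real n) powr ((real r + 1) / 2))"
    unfolding distortion_expansion_def Let_def L.scaled_eq by blast+
  have region: "\<exists>K. \<forall>\<^sub>F n in sequentially. \<forall>k. L.T n k ^ 4 \<le> real n \<longrightarrow>
        \<bar>W.D n k - (1 + (\<Sum>i=1..Suc r. poly (p i) (L.T n k) * L.sn n ^ i))\<bar> \<le> K * L.eta n k ^ Suc (Suc r)"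
  proof -
    \<comment> \<open>For \<open>\<epsilon> n = n^(1/4)\<close> the range in the definition is the
      region \<open>T^4 \<le> n\<close>. The expansion is taken up to index \<open>r + 1\<close>,
      one beyond the terms used in \<open>w\<close>.\<close>
    have "(\<lambda>n. sqrt (sqrt (real n))) \<in> o(\<lambda>n. sqrt (real n))" by real_asymp
    then obtain K where "\<forall>\<^sub>F n in sequentially. \<forall>k. \<bar>L.T n k\<bar> \<le> sqrt (sqrt (real n)) \<longrightarrow>
           \<bar>distortion S A B n k - (1 + (\<Sum>i=1..Suc r. poly (p i) (L.T n k) * real n powr (- real i / 2)))\<bar>
             \<le> K * ((1 + (L.T n k)\<^sup>2) / real n) powr ((real (Suc r) + 1) / 2)" using pex by blast
    then have "\<forall>\<^sub>F n in sequentially. \<forall>k. L.T n k ^ 4 \<le> real n \<longrightarrow>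
        \<bar>W.D n k - (1 + (\<Sum>i=1..Suc r. poly (p i) (L.T n k) * L.sn n ^ i))\<bar> \<le> K * L.eta n k ^ Suc (Suc r)"
      using q_ev
    proof eventually_elim
      case (elim n)
      have n: "n > 0" using elim(2) by simp
      show ?case
      proof (intro allI impI)
        fix k assume "L.T n k ^ 4 \<le> real n"
        then have "((L.T n k)\<^sup>2)\<^sup>2 \<le> real n" by (simp flip: power_mult)
        then have "\<bar>L.T n k\<bar> \<le> sqrt (sqrt (real n))" by (intro real_le_rsqrt) simp
        then have "\<bar>distortion S A B n k - (1 + (\<Sum>i=1..Suc r. poly (p i) (L.T n k) * real n powr (- real i / 2)))\<bar>
             \<le> K * ((1 + (L.T n k)\<^sup>2) / real n) powr ((real (Suc r) + 1) / 2)" using elim(1) by blast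
        moreover have "(real (Suc r) + 1) / 2 = real (Suc (Suc r)) / 2" by simp
        ultimately show "\<bar>W.D n k - (1 + (\<Sum>i=1..Suc r. poly (p i) (L.T n k) * L.sn n ^ i))\<bar> \<le> K * L.eta n k ^ Suc (Suc r)"
          using elim(2) by (simp only: W.sn_powr[OF n] W.eta_powr[OF n] dist)
      qed
    qed
    then show ?thesis by blast
  qed
  have mp: "poly q \<in> borel_measurable borel" for q :: "real poly"
    by (intro borel_measurable_continuous_onI continuous_intros)
  have I: "I = integral\<^sup>L std_normal_distribution (poly (p (Suc r)))"
    unfolding assms(11) using integral_std_normal[OF mp, of "p (r + 1)"] by simp
  have c: "c = integral\<^sup>L std_normal_distribution (\<lambda>t. \<bar>poly (p (Suc r)) t - I\<bar>)"
    unfolding assms(12) using integral_std_normal[of "\<lambda>t. \<bar>poly (p (r + 1)) t - I\<bar>"] mp by simp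
  note lim = W.rejection_limits[OF deg assms(4,5) region I]
  have yw: "w n k = W.wp p r a n k" if "n \<ge> 1" for n k
    using that by (simp add: assms(7,8) W.wp_def W.yp_def W.sn_powr L.scaled_eq)
  have w01: "0 \<le> w n k \<and> w n k \<le> 1" if "n \<ge> 1" for n k
    using W.wp_bounds[OF assms(4,5), of p r n k] unfolding yw[OF that] by simp
  have limZ: "(\<lambda>n. L.E n (w n)) \<longlonglongrightarrow> a"
  proof (rule Lim_transform_eventually[OF lim(1)])
    have "L.E n (W.wp p r a n) = L.E n (w n)" if "n \<ge> 1" for n
    proof -
      have "w n = W.wp p r a n" using yw[OF that] by blast
      then show ?thesis by simp
    qed
    then show "\<forall>\<^sub>F n in sequentially. L.E n (W.wp p r a n) = L.E n (w n)" by (rule eventually_sequentiallyI)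
  qed
  have Z_ev: "\<forall>\<^sub>F n in sequentially. L.E n (w n) > a / 2"
    using limZ by (rule order_tendstoD) (use assms(4) in simp)
  \<comment> \<open>Bounds the mean number of attempts per trial by \<open>2 * mean\<close>.\<close>
  have q2_ev: "\<forall>\<^sub>F n in sequentially. L.q n > 1 / (2 * L.mean)"
    using L.q_tendsto by (rule order_tendstoD) (use L.mean_ge_1 in \<open>simp add: divide_simps\<close>)
  have tv: "\<forall>\<^sub>F n in sequentially. tv_dist (objs_of_size (composition S A B) n) (\<pi> n) (\<pi>_rej n)
      = L.E n (\<lambda>k. \<bar>1 / W.D n k - W.wp p r a n k / L.E n (W.wp p r a n)\<bar>) / 2"
    using q_ev Z_ev
  proof eventually_elim
    case (elim n)
    have n: "n \<ge> 1" and qn: "L.q n > 0" using elim by auto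
    have Z: "L.E n (w n) > 0" using elim assms(4) by simp
    have wn: "w n = W.wp p r a n" using yw[OF n] by blast
    have G: "L.E n L.g > 0"
    proof (rule ccontr)
      assume "\<not> L.E n L.g > 0"
      then have "L.E n L.g / (\<kappa> / Gamma s) \<le> 0" using \<kappa> by (intro divide_nonpos_pos) auto
      then show False using W.Eh_pos[of n] n qn unfolding Eh by simp
    qed
    have "tv_dist (objs_of_size (composition S A B) n) (\<pi> n) (\<pi>_rej n) = L.E n (\<lambda>k. \<bar>L.g k / L.E n L.g - w n k / L.E n (w n)\<bar>) / 2"
      unfolding assms(9,10) using w01[OF n] by (intro L.rejection_tv n qn Z G) auto
    then show ?case unfolding D wn by simp
  qed
  have snr: "\<forall>\<^sub>F n in sequentially. L.sn n ^ Suc r = real n powr (- (real r + 1) / 2)"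
    using eventually_gt_at_top[of 0] by eventually_elim (simp only: W.sn_powr, simp add: algebra_simps)
  have 1: "(\<lambda>n. tv_dist (objs_of_size (composition S A B) n) (\<pi> n) (\<pi>_rej n)
            - c / 2 * real n powr (- (real r + 1) / 2)) \<in> o(\<lambda>n. real n powr (- (real r + 1) / 2))"
  proof (rule smalloI_tendsto)
    let ?F = "\<lambda>n. L.E n (\<lambda>k. \<bar>1 / W.D n k - W.wp p r a n k / L.E n (W.wp p r a n)\<bar>) / L.sn n ^ Suc r"
    have "(\<lambda>n. ?F n / 2 - c / 2) \<longlonglongrightarrow> c / 2 - c / 2" using lim(2) unfolding c[symmetric] by (intro tendsto_intros) auto
    then have l: "(\<lambda>n. ?F n / 2 - c / 2) \<longlonglongrightarrow> 0" by simp
    show "(\<lambda>n. (tv_dist (objs_of_size (composition S A B) n) (\<pi> n) (\<pi>_rej n)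
            - c / 2 * real n powr (- (real r + 1) / 2)) / real n powr (- (real r + 1) / 2)) \<longlonglongrightarrow> 0"
    proof (rule Lim_transform_eventually[OF l])
      show "\<forall>\<^sub>F n in sequentially. ?F n / 2 - c / 2 = (tv_dist (objs_of_size (composition S A B) n) (\<pi> n) (\<pi>_rej n)
            - c / 2 * real n powr (- (real r + 1) / 2)) / real n powr (- (real r + 1) / 2)"
        using tv snr eventually_gt_at_top[of 0]
      proof eventually_elim
        case (elim n)
        have "L.sn n ^ Suc r \<noteq> 0" using L.sn_bounds(1)[OF elim(3)] by simp
        then show ?case unfolding elim(1) elim(2)[symmetric] by (simp add: diff_divide_distrib del: power_Suc)
      qed
    qed
    show "\<forall>\<^sub>F n in sequentially. real n powr (- (real r + 1) / 2) \<noteq> 0"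
      using eventually_gt_at_top[of 0] by eventually_elim simp
  qed
  have 2: "(\<lambda>n. success_prob (rejection_trial w S A B tA tB tasm n)) \<longlonglongrightarrow> a"
  proof (rule Lim_transform_eventually[OF limZ])
    show "\<forall>\<^sub>F n in sequentially. L.E n (w n) = success_prob (rejection_trial w S A B tA tB tasm n)"
      using q_ev by eventually_elim (use w01 L.trial(2) in auto)
  qed
  have 3: "\<exists>K. \<forall>\<^sub>F n in sequentially. expected_time (rejection_generator w S A B tA tB tasm n) \<le> ennreal (K * real n)"
    if h: "\<exists>K. \<forall>k\<ge>1. (\<integral>\<^sup>+ u. of_nat u \<partial>measure_pmf (bind_pmf (pmf_of_set (objs_of_size A k)) tA)) \<le> ennreal (K * real k)"
        "\<exists>K. \<forall>\<beta>\<in>objs B. (\<integral>\<^sup>+ u. of_nat u \<partial>measure_pmf (tB \<beta>)) \<le> ennreal (K * real (osize B \<beta>))"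
        "\<exists>K. \<forall>n\<ge>1. real (tasm n) \<le> K * real n"
  proof -
    have "\<exists>K. \<forall>k\<in>{1..}. (\<integral>\<^sup>+ u. of_nat u \<partial>measure_pmf (bind_pmf (pmf_of_set (objs_of_size A k)) tA)) \<le> ennreal (K * real k)"
      using h(1) by auto
    then obtain KA where KA: "KA \<ge> 0" "\<And>k. k \<in> {1..} \<Longrightarrow> (\<integral>\<^sup>+ u. of_nat u \<partial>measure_pmf (bind_pmf (pmf_of_set (objs_of_size A k)) tA)) \<le> ennreal (KA * real k)"
      by (rule ennreal_linear_bound) (rule that)
    obtain KB where KB: "KB \<ge> 0" "\<And>\<beta>. \<beta> \<in> objs B \<Longrightarrow> (\<integral>\<^sup>+ u. of_nat u \<partial>measure_pmf (tB \<beta>)) \<le> ennreal (KB * real (osize B \<beta>))"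
      using h(2) by (rule ennreal_linear_bound) (rule that)
    obtain KT0 where KT0: "\<And>n. n \<ge> 1 \<Longrightarrow> real (tasm n) \<le> KT0 * real n" using h(3) by blast
    define KT where "KT = max KT0 0"
    have KT: "KT \<ge> 0" "\<And>n. n \<ge> 1 \<Longrightarrow> real (tasm n) \<le> KT * real n"
    proof -
      show "KT \<ge> 0" by (simp add: KT_def)
      fix n :: nat assume "n \<ge> 1"
      then have "real (tasm n) \<le> KT0 * real n" by (rule KT0)
      also have "\<dots> \<le> KT * real n" by (intro mult_right_mono) (auto simp: KT_def)
      finally show "real (tasm n) \<le> KT * real n" .
    qed
    \<comment> \<open>The mean cost of one attempt per unit of \<open>n\<close>. In the final bound
      the factors \<open>2 * mean\<close> and \<open>2 / a\<close> account for the repeated attempts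
      and trials.\<close>
    define K where "K = 2 * (KB * L.mean) + KA + KT"
    have K0: "K \<ge> 0" using KA(1) KB(1) KT(1) L.mean_ge_1 by (simp add: K_def)
    have "\<forall>\<^sub>F n in sequentially. expected_time (rejection_generator w S A B tA tB tasm n) \<le> ennreal ((K * (2 * L.mean) * (2 / a)) * real n)"
      using q_ev Z_ev q2_ev
    proof eventually_elim
      case (elim n)
      have n: "n \<ge> 1" and qn: "L.q n > 0" using elim by auto
      have Z: "L.E n (w n) > 0" using elim assms(4) by simp
      have m: "mean_time (leap_attempt S A B tA tB tasm n) \<le> ennreal (K * real n)"
        unfolding K_def using KA KB KT n by (intro L.mean_time_attempt n qn) auto
      have "expected_time (rejection_generator w S A B tA tB tasm n) \<le> ennreal (K * real n / L.q n / L.E n (w n))"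
        using w01[OF n] K0 by (intro L.expected_time_rejection n qn Z m) auto
      also have "\<dots> \<le> ennreal ((K * (2 * L.mean) * (2 / a)) * real n)"
      proof (rule ennreal_leI)
        have "1 / L.q n \<le> 2 * L.mean" using elim(3) qn L.mean_ge_1 by (simp add: field_simps)
        moreover have "1 / L.E n (w n) \<le> 2 / a" using elim(2) Z assms(4) by (simp add: field_simps)
        ultimately have "(1 / L.q n) * (1 / L.E n (w n)) \<le> (2 * L.mean) * (2 / a)"
          using qn Z L.mean_ge_1 by (intro mult_mono) auto
        then have "K * real n * ((1 / L.q n) * (1 / L.E n (w n))) \<le> K * real n * ((2 * L.mean) * (2 / a))"
          using K0 by (intro mult_left_mono) auto
        then show "K * real n / L.q n / L.E n (w n) \<le> (K * (2 * L.mean) * (2 / a)) * real n" by (simp add: mult_ac)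
      qed
      finally show ?case .
    qed
    then show ?thesis by blast
  qed
  show ?thesis using 1 2 3 by blast
qed

end
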